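(* Let $k$ be a field of characteristic $2$. Then for any integer $n\ge 1$ the group algebra $k(C_2\times C_{2^n})$ has representation dimension $3$.
   Context: $C_m$ denotes the cyclic group of order $m$, and $kG$ denotes the group algebra of a finite group $G$ over $k$. An algebra means a finite-dimensional (associative, unital) algebra over a fixed field $k$. For an algebra $A$, a finitely generated $A$-module $M$ is called a generator-cogenerator for $A$ if all projective indecomposable $A$-modules and all injective indecomposable $A$-modules occur (up to isomorphism) as direct summands of $M$. The representation dimension of $A$ is $$\operatorname{repdim}(A) := \inf\{\operatorname{gl.dim}(\operatorname{End}_A(M)) \mid M \text{ a generator-cogenerator for } A\} \in \mathbb{N}_0\cup\{\infty\},$$ where $\operatorname{gl.dim}$ denotes global dimension. *)

theory Defs
  imports "HOL-Algebra.Module" "HOL-Algebra.AbelCoset" "HOL-Algebra.Elementary_Groups"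
    "HOL-Library.Extended_Nat"
begin

section \<open>Left modules over noncommutative rings\<close>

text \<open>
  The locale \<open>module\<close> of HOL-Algebra requires a commutative ring of scalars, which excludes
  endomorphism rings. The following locale has the same axioms over an arbitrary ring; the
  \<open>mult\<close> and \<open>one\<close> fields of the record \<open>M\<close> are irrelevant, as in HOL-Algebra.
\<close>

locale left_module = R?: ring R + M?: abelian_group M
  for R :: "('a, 'x) ring_scheme" (structure) and M :: "('a, 'b, 'y) module_scheme" (structure) +
  assumes smult_closed [simp, intro]:
      "\<lbrakk>a \<in> carrier R; x \<in> carrier M\<rbrakk> \<Longrightarrow> a \<odot>\<^bsub>M\<^esub> x \<in> carrier M"
    and smult_l_distr:
      "\<lbrakk>a \<in> carrier R; b \<in> carrier R; x \<in> carrier M\<rbrakk> \<Longrightarrow>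
       (a \<oplus> b) \<odot>\<^bsub>M\<^esub> x = a \<odot>\<^bsub>M\<^esub> x \<oplus>\<^bsub>M\<^esub> b \<odot>\<^bsub>M\<^esub> x"
    and smult_r_distr:
      "\<lbrakk>a \<in> carrier R; x \<in> carrier M; y \<in> carrier M\<rbrakk> \<Longrightarrow>
       a \<odot>\<^bsub>M\<^esub> (x \<oplus>\<^bsub>M\<^esub> y) = a \<odot>\<^bsub>M\<^esub> x \<oplus>\<^bsub>M\<^esub> a \<odot>\<^bsub>M\<^esub> y"
    and smult_assoc1:
      "\<lbrakk>a \<in> carrier R; b \<in> carrier R; x \<in> carrier M\<rbrakk> \<Longrightarrow>
       (a \<otimes> b) \<odot>\<^bsub>M\<^esub> x = a \<odot>\<^bsub>M\<^esub> (b \<odot>\<^bsub>M\<^esub> x)"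
    and smult_one [simp]:
      "x \<in> carrier M \<Longrightarrow> \<one> \<odot>\<^bsub>M\<^esub> x = x"

definition module_homs ::
    "('a, 'x) ring_scheme \<Rightarrow> ('a, 'b, 'y) module_scheme \<Rightarrow> ('a, 'c, 'z) module_scheme \<Rightarrow> ('b \<Rightarrow> 'c) set"
  where "module_homs R M N = {f \<in> carrier M \<rightarrow> carrier N.
    (\<forall>x \<in> carrier M. \<forall>y \<in> carrier M. f (x \<oplus>\<^bsub>M\<^esub> y) = f x \<oplus>\<^bsub>N\<^esub> f y) \<and>
    (\<forall>r \<in> carrier R. \<forall>x \<in> carrier M. f (r \<odot>\<^bsub>M\<^esub> x) = r \<odot>\<^bsub>N\<^esub> f x)}"

definition module_iso ::
    "('a, 'x) ring_scheme \<Rightarrow> ('a, 'b, 'y) module_scheme \<Rightarrow> ('a, 'c, 'z) module_scheme \<Rightarrow> bool"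
  where "module_iso R M N \<longleftrightarrow> (\<exists>f \<in> module_homs R M N. bij_betw f (carrier M) (carrier N))"

text \<open>Homomorphisms are made extensional here so that equality in the ring is equality of maps
  on \<open>carrier M\<close>; the product is composition of maps.\<close>

definition End_ring :: "('a, 'x) ring_scheme \<Rightarrow> ('a, 'b, 'y) module_scheme \<Rightarrow> ('b \<Rightarrow> 'b) ring"
  where "End_ring R M =
    \<lparr>carrier = module_homs R M M \<inter> extensional (carrier M),
     monoid.mult = compose (carrier M),
     monoid.one = (\<lambda>x\<in>carrier M. x),
     ring.zero = (\<lambda>x\<in>carrier M. \<zero>\<^bsub>M\<^esub>),
     ring.add = (\<lambda>f g. \<lambda>x\<in>carrier M. f x \<oplus>\<^bsub>M\<^esub> g x)\<rparr>"

definition fin_gen :: "('a, 'x) ring_scheme \<Rightarrow> ('a, 'b, 'y) module_scheme \<Rightarrow> bool"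
  where "fin_gen R M \<longleftrightarrow> (\<exists>S. finite S \<and> S \<subseteq> carrier M \<and>
    (\<forall>H. submodule H R M \<and> S \<subseteq> H \<longrightarrow> H = carrier M))"

definition is_direct_sum ::
    "('a, 'x) ring_scheme \<Rightarrow> ('a, 'b, 'y) module_scheme \<Rightarrow> 'b set \<Rightarrow> 'b set \<Rightarrow> bool"
  where "is_direct_sum R M U V \<longleftrightarrow> submodule U R M \<and> submodule V R M \<and>
    U \<inter> V = {\<zero>\<^bsub>M\<^esub>} \<and> U <+>\<^bsub>M\<^esub> V = carrier M"

definition indecomposable :: "('a, 'x) ring_scheme \<Rightarrow> ('a, 'b, 'y) module_scheme \<Rightarrow> bool"
  where "indecomposable R M \<longleftrightarrow> carrier M \<noteq> {\<zero>\<^bsub>M\<^esub>} \<and>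
    (\<forall>U V. is_direct_sum R M U V \<longrightarrow> U = {\<zero>\<^bsub>M\<^esub>} \<or> V = {\<zero>\<^bsub>M\<^esub>})"

definition occurs_as_summand ::
    "('a, 'x) ring_scheme \<Rightarrow> ('a, 'b, 'y) module_scheme \<Rightarrow> ('a, 'c, 'z) module_scheme \<Rightarrow> bool"
  where "occurs_as_summand R X M \<longleftrightarrow>
    (\<exists>U V. is_direct_sum R M U V \<and> module_iso R X (M\<lparr>carrier := U\<rparr>))"


section \<open>Homological notions\<close>

text \<open>
  HOL cannot quantify over the elements of all types, so ``all modules'' means all modules whose
  carrier is a subset of some type \<open>'m\<close>, which plays the role of a universe. The notions below are
  the usual ones as soon as \<open>'m\<close> is infinite and at least as large as the ring (every module
  in \<open>'m\<close> is then a quotient of a free module in \<open>'m\<close>). For a finite-dimensional algebra over a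
  field \<open>'k\<close> it suffices that there is an injection from \<open>nat \<times> 'k\<close> to \<open>'m\<close>, and then every
  finitely generated module has an isomorphic copy in \<open>'m\<close>.
\<close>

definition projective :: "('a, 'x) ring_scheme \<Rightarrow> ('a, 'm) module \<Rightarrow> bool"
  where "projective R P \<longleftrightarrow> left_module R P \<and>
    (\<forall>(N :: ('a, 'm) module) (L :: ('a, 'm) module).
      left_module R N \<and> left_module R L \<longrightarrow>
      (\<forall>g \<in> module_homs R N L. \<forall>f \<in> module_homs R P L. g ` carrier N = carrier L \<longrightarrow>
        (\<exists>h \<in> module_homs R P N. \<forall>x \<in> carrier P. g (h x) = f x)))"

definition injective :: "('a, 'x) ring_scheme \<Rightarrow> ('a, 'm) module \<Rightarrow> bool"
  where "injective R I \<longleftrightarrow> left_module R I \<and>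
    (\<forall>(L :: ('a, 'm) module) (N :: ('a, 'm) module).
      left_module R L \<and> left_module R N \<longrightarrow>
      (\<forall>g \<in> module_homs R L N. \<forall>f \<in> module_homs R L I. inj_on g (carrier L) \<longrightarrow>
        (\<exists>h \<in> module_homs R N I. \<forall>x \<in> carrier L. h (g x) = f x)))"

text \<open>\<open>\<dots> \<rightarrow> P 2 \<rightarrow> P 1 \<rightarrow> P 0 \<rightarrow> X \<rightarrow> 0\<close> with differentials \<open>d i : P (i + 1) \<rightarrow> P i\<close> and
  augmentation \<open>e : P 0 \<rightarrow> X\<close>.\<close>

definition projective_resolution ::
    "('a, 'x) ring_scheme \<Rightarrow> ('a, 'm) module \<Rightarrow> (nat \<Rightarrow> ('a, 'm) module) \<Rightarrow>
     (nat \<Rightarrow> 'm \<Rightarrow> 'm) \<Rightarrow> ('m \<Rightarrow> 'm) \<Rightarrow> bool"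
  where "projective_resolution R X P d e \<longleftrightarrow>
    (\<forall>i. projective R (P i)) \<and>
    (\<forall>i. d i \<in> module_homs R (P (Suc i)) (P i)) \<and>
    e \<in> module_homs R (P 0) X \<and>
    e ` carrier (P 0) = carrier X \<and>
    {x \<in> carrier (P 0). e x = \<zero>\<^bsub>X\<^esub>} = d 0 ` carrier (P 1) \<and>
    (\<forall>i. {x \<in> carrier (P (Suc i)). d i x = \<zero>\<^bsub>P i\<^esub>} = d (Suc i) ` carrier (P (Suc (Suc i))))"

definition proj_dim :: "('a, 'x) ring_scheme \<Rightarrow> ('a, 'm) module \<Rightarrow> enat"
  where "proj_dim R X = Inf {enat n | n. \<exists>P d e. projective_resolution R X P d e \<and>
    (\<forall>i > n. carrier (P i) = {\<zero>\<^bsub>P i\<^esub>})}"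

definition gl_dim :: "'m itself \<Rightarrow> ('a, 'x) ring_scheme \<Rightarrow> enat"
  where "gl_dim _ R = Sup {proj_dim R X | X :: ('a, 'm) module. left_module R X}"


section \<open>Representation dimension\<close>

definition generator_cogenerator :: "('a, 'x) ring_scheme \<Rightarrow> ('a, 'm) module \<Rightarrow> bool"
  where "generator_cogenerator A M \<longleftrightarrow> left_module A M \<and> fin_gen A M \<and>
    (\<forall>P :: ('a, 'm) module. projective A P \<and> indecomposable A P \<longrightarrow> occurs_as_summand A P M) \<and>
    (\<forall>I :: ('a, 'm) module. injective A I \<and> indecomposable A I \<longrightarrow> occurs_as_summand A I M)"

text \<open>Only the ring structure of the algebra \<open>A\<close> enters: the action of the base field on
  \<open>A\<close>-modules and on their endomorphism rings is the one induced by scalar multiples of the unit.\<close>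

definition repdim :: "'m itself \<Rightarrow> ('a, 'x) ring_scheme \<Rightarrow> enat"
  where "repdim u A =
    Inf {gl_dim u (End_ring A M) | M :: ('a, 'm) module. generator_cogenerator A M}"


section \<open>Group algebras\<close>

text \<open>The group algebra of a finite group \<open>G\<close>: a function \<open>f\<close> stands for the formal sum of
  \<open>f g\<close> times \<open>g\<close> over \<open>g \<in> carrier G\<close>, and vanishes outside \<open>carrier G\<close>.\<close>

definition group_algebra :: "('g, 'x) monoid_scheme \<Rightarrow> ('g \<Rightarrow> 'k::field) ring"
  where "group_algebra G =
    \<lparr>carrier = {f. \<forall>g. g \<notin> carrier G \<longrightarrow> f g = 0},
     monoid.mult = (\<lambda>f f'. \<lambda>g. if g \<in> carrier G
       then \<Sum>h\<in>carrier G. f h * f' (inv\<^bsub>G\<^esub> h \<otimes>\<^bsub>G\<^esub> g) else 0),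
     monoid.one = (\<lambda>g. if g = \<one>\<^bsub>G\<^esub> then 1 else 0),
     ring.zero = (\<lambda>g. 0),
     ring.add = (\<lambda>f f'. \<lambda>g. f g + f' g)\<rparr>"

end

theory Submission
  imports Defs "HOL-Library.Function_Algebras"
begin

text \<open>
  Put \<open>q = 2^n\<close> and let \<open>A\<close> be the group algebra, which is \<open>k[x,y]/(x^2, y^q)\<close> for \<open>x = 1 + g\<close>, \<open>y = 1 + h\<close>
  with generators \<open>g\<close>, \<open>h\<close> of the two factors. A module on which the sum of all group elements acts
  nontrivially contains \<open>A\<close> as a summand; hence \<open>A\<close> is the only indecomposable projective and the
  only indecomposable injective.

  Lower bound: let \<open>M\<close> be a generator-cogenerator and \<open>E\<close> its endomorphism ring. As \<open>A\<close> is a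
  summand of \<open>M\<close>, the \<open>E\<close>-module \<open>M\<close> is projective. If the global dimension of \<open>E\<close> were at most 2, the
  kernel of the map \<open>M\<^sup>N \<rightarrow> M\<^sup>N\<^sup>-\<^sup>1\<close>, \<open>m \<mapsto> (x m\<^sub>l\<^sub>+\<^sub>1 - y m\<^sub>l)\<^sub>l\<close>, would be projective. For \<open>N\<close> larger than the
  dimension of \<open>M\<close>, a dual basis of this kernel would contradict the chain of elements \<open>f\<^sub>j\<close> with
  \<open>x f\<^sub>j = y f\<^sub>j\<^sub>+\<^sub>1\<close>, \<open>y f\<^sub>0 = 0\<close>, \<open>x f\<^sub>N = 0\<close>.

  Upper bound: let \<open>D\<close> be the sum of the ideals \<open>(y^i)\<close> of \<open>k[y]/(y^q)\<close> and \<open>(x, y^i)\<close> of \<open>A\<close>, and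
  \<open>M\<close> its dual. A second syzygy over the endomorphism ring has the form \<open>Hom(D, X)\<close> for a submodule
  \<open>X\<close> of a direct sum of copies of \<open>D\<close>. It is covered by a free module together with \<open>Hom(D, W)\<close>,
  where \<open>W\<close> is the part of \<open>X\<close> annihilated by \<open>x\<close>. Stacked bases over \<open>k[y]\<close> show that both \<open>W\<close> and the
  module \<open>D'\<close> for which \<open>Hom(D, D')\<close> is the kernel are retracts of sums of copies of \<open>D\<close>, so that this
  is a projective resolution of length 1.
\<close>

section \<open>Modules over a ring\<close>

text \<open>In the upper bound the summand Hom(D, W) serves the kernel, not surjectivity. A map
  \<psi> from a sum of copies of D to X has an arbitrary submodule as kernel, and nothing decomposes
  it. Once W is added, the kernel comes from D' = {d. x \<psi>(d) = 0}. This contains everything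
  annihilated by x, so only the coefficients at \<open>KU\<close> indices are constrained, and the
  constraint is membership in a lattice over k[y]. Stacked bases cut D' into ideals (x, y^i), copies
  of k[y]/(y^q) and the unconstrained \<open>KR\<close> part, which explains the choice of D.
  Modules over the endomorphism ring need not be finitely generated, so the sums may be infinite and
  stacked bases are needed in infinite rank; they come from linear algebra over k on constant terms.
  The dual of D is taken because its endomorphism ring acts on Hom(D, X) from the left, by
  precomposition. Projectivity is tested only on modules carried by subsets of \<open>'m\<close>, so
  every test module and every term of a resolution must be encoded in \<open>'m\<close>.\<close>

lemma left_moduleI:
  fixes R (structure) and M (structure)
  assumes "ring R"
    and "\<And>x y. x \<in> carrier M \<Longrightarrow> y \<in> carrier M \<Longrightarrow> x \<oplus>\<^bsub>M\<^esub> y \<in> carrier M"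
    and "\<zero>\<^bsub>M\<^esub> \<in> carrier M"
    and "\<And>x y z. \<lbrakk>x \<in> carrier M; y \<in> carrier M; z \<in> carrier M\<rbrakk> \<Longrightarrow>
      x \<oplus>\<^bsub>M\<^esub> y \<oplus>\<^bsub>M\<^esub> z = x \<oplus>\<^bsub>M\<^esub> (y \<oplus>\<^bsub>M\<^esub> z)"
    and "\<And>x y. x \<in> carrier M \<Longrightarrow> y \<in> carrier M \<Longrightarrow> x \<oplus>\<^bsub>M\<^esub> y = y \<oplus>\<^bsub>M\<^esub> x"
    and "\<And>x. x \<in> carrier M \<Longrightarrow> \<zero>\<^bsub>M\<^esub> \<oplus>\<^bsub>M\<^esub> x = x"
    and "\<And>x. x \<in> carrier M \<Longrightarrow> \<exists>y \<in> carrier M. y \<oplus>\<^bsub>M\<^esub> x = \<zero>\<^bsub>M\<^esub>"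
    and "\<And>a x. a \<in> carrier R \<Longrightarrow> x \<in> carrier M \<Longrightarrow> a \<odot>\<^bsub>M\<^esub> x \<in> carrier M"
    and "\<And>a b x. \<lbrakk>a \<in> carrier R; b \<in> carrier R; x \<in> carrier M\<rbrakk> \<Longrightarrow>
      (a \<oplus> b) \<odot>\<^bsub>M\<^esub> x = a \<odot>\<^bsub>M\<^esub> x \<oplus>\<^bsub>M\<^esub> b \<odot>\<^bsub>M\<^esub> x"
    and "\<And>a x y. \<lbrakk>a \<in> carrier R; x \<in> carrier M; y \<in> carrier M\<rbrakk> \<Longrightarrow>
      a \<odot>\<^bsub>M\<^esub> (x \<oplus>\<^bsub>M\<^esub> y) = a \<odot>\<^bsub>M\<^esub> x \<oplus>\<^bsub>M\<^esub> a \<odot>\<^bsub>M\<^esub> y"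
    and "\<And>a b x. \<lbrakk>a \<in> carrier R; b \<in> carrier R; x \<in> carrier M\<rbrakk> \<Longrightarrow>
      (a \<otimes> b) \<odot>\<^bsub>M\<^esub> x = a \<odot>\<^bsub>M\<^esub> (b \<odot>\<^bsub>M\<^esub> x)"
    and "\<And>x. x \<in> carrier M \<Longrightarrow> \<one> \<odot>\<^bsub>M\<^esub> x = x"
  shows "left_module R M"
  using assms by (intro left_module.intro left_module_axioms.intro abelian_groupI) auto

context left_module
begin

lemma lmod_l_null [simp]: "x \<in> carrier M \<Longrightarrow> \<zero>\<^bsub>R\<^esub> \<odot>\<^bsub>M\<^esub> x = \<zero>\<^bsub>M\<^esub>"
  by (metis M.add.r_cancel_one' R.add.r_cancel_one' R.zero_closed smult_closed smult_l_distr)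

lemma lmod_r_null [simp]: "a \<in> carrier R \<Longrightarrow> a \<odot>\<^bsub>M\<^esub> \<zero>\<^bsub>M\<^esub> = \<zero>\<^bsub>M\<^esub>"
  by (metis M.add.r_cancel_one' M.zero_closed smult_closed smult_r_distr)

lemma lmod_l_minus: "a \<in> carrier R \<Longrightarrow> x \<in> carrier M \<Longrightarrow> (\<ominus>\<^bsub>R\<^esub> a) \<odot>\<^bsub>M\<^esub> x = \<ominus>\<^bsub>M\<^esub> (a \<odot>\<^bsub>M\<^esub> x)"
  by (metis M.minus_equality R.add.inv_closed R.l_neg lmod_l_null smult_closed smult_l_distr)

lemma lmod_r_minus: "a \<in> carrier R \<Longrightarrow> x \<in> carrier M \<Longrightarrow> a \<odot>\<^bsub>M\<^esub> (\<ominus>\<^bsub>M\<^esub> x) = \<ominus>\<^bsub>M\<^esub> (a \<odot>\<^bsub>M\<^esub> x)"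
  by (metis M.add.inv_closed M.l_neg M.minus_equality lmod_r_null smult_closed smult_r_distr)

lemma lmod_finsum:
  "\<lbrakk>finite I; a \<in> carrier R; f \<in> I \<rightarrow> carrier M\<rbrakk> \<Longrightarrow>
    a \<odot>\<^bsub>M\<^esub> (\<Oplus>\<^bsub>M\<^esub>i\<in>I. f i) = (\<Oplus>\<^bsub>M\<^esub>i\<in>I. a \<odot>\<^bsub>M\<^esub> f i)"
  by (induct set: finite) (auto simp: smult_r_distr Pi_def)

lemma submoduleI_lmod:
  assumes "H \<subseteq> carrier M" "\<zero>\<^bsub>M\<^esub> \<in> H"
    and "\<And>a b. a \<in> H \<Longrightarrow> b \<in> H \<Longrightarrow> a \<oplus>\<^bsub>M\<^esub> b \<in> H"
    and sm: "\<And>a x. a \<in> carrier R \<Longrightarrow> x \<in> H \<Longrightarrow> a \<odot>\<^bsub>M\<^esub> x \<in> H"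
  shows "submodule H R M"
proof -
  have "\<ominus>\<^bsub>M\<^esub> x \<in> H" if "x \<in> H" for x
    using sm[OF R.add.inv_closed[OF R.one_closed] that] subsetD[OF assms(1) that]
    by (simp add: lmod_l_minus)
  then show ?thesis
    using assms by (intro submodule.intro subgroup.intro submodule_axioms.intro)
      (auto simp: a_inv_def)
qed

lemma submoduleD:
  assumes "submodule H R M"
  shows "H \<subseteq> carrier M" "\<zero>\<^bsub>M\<^esub> \<in> H"
    "\<And>a b. a \<in> H \<Longrightarrow> b \<in> H \<Longrightarrow> a \<oplus>\<^bsub>M\<^esub> b \<in> H"
    "\<And>a x. a \<in> carrier R \<Longrightarrow> x \<in> H \<Longrightarrow> a \<odot>\<^bsub>M\<^esub> x \<in> H"
    "\<And>a. a \<in> H \<Longrightarrow> \<ominus>\<^bsub>M\<^esub> a \<in> H"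
proof -
  interpret s: submodule H R M by fact
  show H: "H \<subseteq> carrier M" using s.subset by simp
  show "\<zero>\<^bsub>M\<^esub> \<in> H" using s.one_closed by simp
  show "\<And>a b. a \<in> H \<Longrightarrow> b \<in> H \<Longrightarrow> a \<oplus>\<^bsub>M\<^esub> b \<in> H" using s.m_closed by simp
  show sm: "\<And>a x. a \<in> carrier R \<Longrightarrow> x \<in> H \<Longrightarrow> a \<odot>\<^bsub>M\<^esub> x \<in> H" by simp
  show "\<ominus>\<^bsub>M\<^esub> x \<in> H" if "x \<in> H" for x
    using sm[OF R.add.inv_closed[OF R.one_closed] that] subsetD[OF H that]
    by (simp add: lmod_l_minus)
qed

lemma left_module_submodule:
  assumes "submodule H R M"
  shows "left_module R (M\<lparr>carrier := H\<rparr>)"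
proof (rule left_moduleI)
  note D = submoduleD[OF assms]
  have c: "x \<in> carrier M" if "x \<in> H" for x using D(1) that by auto
  show "\<exists>y\<in>carrier (M\<lparr>carrier := H\<rparr>). y \<oplus>\<^bsub>M\<lparr>carrier := H\<rparr>\<^esub> x = \<zero>\<^bsub>M\<lparr>carrier := H\<rparr>\<^esub>"
    if "x \<in> carrier (M\<lparr>carrier := H\<rparr>)" for x
    using that D(5)[of x] c[of x] by (auto intro!: bexI[of _ "\<ominus>\<^bsub>M\<^esub> x"] simp: M.l_neg)
qed (use submoduleD[OF assms] in \<open>auto simp: R.ring_axioms smult_l_distr smult_r_distr
      smult_assoc1 M.a_assoc subset_eq intro: M.a_comm\<close>)

end

section \<open>Homomorphisms, kernels and images\<close>

lemma module_homsI:
  assumes "\<And>x. x \<in> carrier M \<Longrightarrow> f x \<in> carrier N"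
    and "\<And>x y. x \<in> carrier M \<Longrightarrow> y \<in> carrier M \<Longrightarrow> f (x \<oplus>\<^bsub>M\<^esub> y) = f x \<oplus>\<^bsub>N\<^esub> f y"
    and "\<And>r x. r \<in> carrier R \<Longrightarrow> x \<in> carrier M \<Longrightarrow> f (r \<odot>\<^bsub>M\<^esub> x) = r \<odot>\<^bsub>N\<^esub> f x"
  shows "f \<in> module_homs R M N"
  using assms by (auto simp: module_homs_def)

lemma module_homsD:
  assumes "f \<in> module_homs R M N"
  shows hom_closed: "x \<in> carrier M \<Longrightarrow> f x \<in> carrier N"
    and hom_add: "x \<in> carrier M \<Longrightarrow> y \<in> carrier M \<Longrightarrow> f (x \<oplus>\<^bsub>M\<^esub> y) = f x \<oplus>\<^bsub>N\<^esub> f y"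
    and hom_smult: "r \<in> carrier R \<Longrightarrow> x \<in> carrier M \<Longrightarrow> f (r \<odot>\<^bsub>M\<^esub> x) = r \<odot>\<^bsub>N\<^esub> f x"
  using assms by (auto simp: module_homs_def)

lemma hom_zero:
  assumes "left_module R M" "left_module R N" "f \<in> module_homs R M N"
  shows "f \<zero>\<^bsub>M\<^esub> = \<zero>\<^bsub>N\<^esub>"
proof -
  interpret M: left_module R M by fact
  interpret N: left_module R N by fact
  show ?thesis
    using hom_smult[OF assms(3) M.R.zero_closed M.M.zero_closed] hom_closed[OF assms(3) M.M.zero_closed]
    by simp
qed

lemma hom_minus:
  assumes "left_module R M" "left_module R N" "f \<in> module_homs R M N" "x \<in> carrier M"
  shows "f (\<ominus>\<^bsub>M\<^esub> x) = \<ominus>\<^bsub>N\<^esub> (f x)"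
proof -
  interpret M: left_module R M by fact
  interpret N: left_module R N by fact
  show ?thesis
    using hom_smult[OF assms(3) M.R.add.inv_closed[OF M.R.one_closed] assms(4)]
      hom_closed[OF assms(3,4)] assms(4)
    by (simp add: M.lmod_l_minus N.lmod_l_minus)
qed

lemma hom_diff:
  assumes "left_module R M" "left_module R N" "f \<in> module_homs R M N" "x \<in> carrier M" "y \<in> carrier M"
  shows "f (x \<ominus>\<^bsub>M\<^esub> y) = f x \<ominus>\<^bsub>N\<^esub> f y"
proof -
  interpret M: left_module R M by fact
  interpret N: left_module R N by fact
  show ?thesis
    using assms(4,5) by (simp add: a_minus_def hom_add[OF assms(3)] hom_minus[OF assms(1-3)])
qed

lemma hom_finsum:
  assumes "left_module R M" "left_module R N" "f \<in> module_homs R M N" "finite I" "g \<in> I \<rightarrow> carrier M"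
  shows "f (\<Oplus>\<^bsub>M\<^esub>i\<in>I. g i) = (\<Oplus>\<^bsub>N\<^esub>i\<in>I. f (g i))"
proof -
  interpret M: left_module R M by fact
  interpret N: left_module R N by fact
  show ?thesis
    using assms(4,5)
    by (induct set: finite)
      (auto simp: hom_zero[OF assms(1-3)] hom_add[OF assms(3)] hom_closed[OF assms(3)] Pi_def)
qed

lemma hom_comp:
  "f \<in> module_homs R M N \<Longrightarrow> g \<in> module_homs R N L \<Longrightarrow> (\<lambda>x. g (f x)) \<in> module_homs R M L"
  by (auto simp: module_homs_def Pi_def)

lemma hom_plus:
  assumes "left_module R N" "f \<in> module_homs R M N" "g \<in> module_homs R M N"
  shows "(\<lambda>x. f x \<oplus>\<^bsub>N\<^esub> g x) \<in> module_homs R M N"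
proof -
  interpret N: left_module R N by fact
  show ?thesis
    using module_homsD[OF assms(2)] module_homsD[OF assms(3)]
    by (intro module_homsI)
      (auto simp: N.smult_r_distr N.M.a_ac)
qed

lemma hom_uminus:
  assumes "left_module R N" "f \<in> module_homs R M N"
  shows "(\<lambda>x. \<ominus>\<^bsub>N\<^esub> f x) \<in> module_homs R M N"
proof -
  interpret N: left_module R N by fact
  show ?thesis
    using module_homsD[OF assms(2)]
    by (intro module_homsI) (auto simp: N.lmod_r_minus N.M.minus_add)
qed

lemma hom_restrict_codomain:
  "f \<in> module_homs R M N \<Longrightarrow> f ` carrier M \<subseteq> H \<Longrightarrow> f \<in> module_homs R M (N\<lparr>carrier := H\<rparr>)"
  by (auto simp: module_homs_def Pi_def)

lemma hom_extend_codomain: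
  "f \<in> module_homs R M (N\<lparr>carrier := H\<rparr>) \<Longrightarrow> H \<subseteq> carrier N \<Longrightarrow> f \<in> module_homs R M N"
  by (auto simp: module_homs_def Pi_def)

lemma hom_restrict_domain:
  "f \<in> module_homs R M N \<Longrightarrow> H \<subseteq> carrier M \<Longrightarrow> f \<in> module_homs R (M\<lparr>carrier := H\<rparr>) N"
  by (auto simp: module_homs_def Pi_def subset_eq)

lemma submodule_kernel:
  assumes "left_module R M" "left_module R N" "f \<in> module_homs R M N"
  shows "submodule {x \<in> carrier M. f x = \<zero>\<^bsub>N\<^esub>} R M"
proof -
  interpret M: left_module R M by fact
  interpret N: left_module R N by fact
  show ?thesis
    by (rule M.submoduleI_lmod) (auto simp: hom_zero[OF assms] hom_add[OF assms(3)] hom_smult[OF assms(3)])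
qed

lemma submodule_image:
  assumes "left_module R M" "left_module R N" "f \<in> module_homs R M N"
  shows "submodule (f ` carrier M) R N"
proof -
  interpret M: left_module R M by fact
  interpret N: left_module R N by fact
  show ?thesis
  proof (rule N.submoduleI_lmod)
    show "f ` carrier M \<subseteq> carrier N" using hom_closed[OF assms(3)] by auto
    show "\<zero>\<^bsub>N\<^esub> \<in> f ` carrier M" using hom_zero[OF assms] by (metis M.M.zero_closed imageI)
    show "a \<oplus>\<^bsub>N\<^esub> b \<in> f ` carrier M" if "a \<in> f ` carrier M" "b \<in> f ` carrier M" for a b
      using that by (auto simp flip: hom_add[OF assms(3)])
    show "a \<odot>\<^bsub>N\<^esub> x \<in> f ` carrier M" if "a \<in> carrier R" "x \<in> f ` carrier M" for a x
      using that by (auto simp flip: hom_smult[OF assms(3)])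
  qed
qed

lemma hom_inj_iff:
  assumes "left_module R M" "left_module R N" "f \<in> module_homs R M N"
    and "\<And>x. x \<in> carrier M \<Longrightarrow> f x = \<zero>\<^bsub>N\<^esub> \<Longrightarrow> x = \<zero>\<^bsub>M\<^esub>"
  shows "inj_on f (carrier M)"
proof (rule inj_onI)
  interpret M: left_module R M by fact
  interpret N: left_module R N by fact
  fix x y assume xy: "x \<in> carrier M" "y \<in> carrier M" "f x = f y"
  then have "f (x \<ominus>\<^bsub>M\<^esub> y) = \<zero>\<^bsub>N\<^esub>"
    using hom_closed[OF assms(3)] by (simp only: hom_diff[OF assms(1-3)]) (simp add: a_minus_def N.M.r_neg)
  with assms(4)[of "x \<ominus>\<^bsub>M\<^esub> y"] xy have "x \<ominus>\<^bsub>M\<^esub> y = \<zero>\<^bsub>M\<^esub>"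
    by simp
  with xy show "x = y"
    unfolding a_minus_def by (metis M.M.add.inv_closed M.M.add.inv_inv M.M.minus_equality)
qed

lemma module_iso_inverse:
  assumes "left_module R M" "f \<in> module_homs R M N" "bij_betw f (carrier M) (carrier N)"
  shows "the_inv_into (carrier M) f \<in> module_homs R N M"
proof (rule module_homsI)
  interpret M: left_module R M by fact
  note inj = bij_betw_imp_inj_on[OF assms(3)] and img = bij_betw_imp_surj_on[OF assms(3)]
  have *: "\<exists>u\<in>carrier M. x = f u" if "x \<in> carrier N" for x using img that by blast
  show "the_inv_into (carrier M) f x \<in> carrier M" if "x \<in> carrier N" for x
    using *[OF that] by (auto simp: the_inv_into_f_f[OF inj])
  show "the_inv_into (carrier M) f (x \<oplus>\<^bsub>N\<^esub> y)
      = the_inv_into (carrier M) f x \<oplus>\<^bsub>M\<^esub> the_inv_into (carrier M) f y"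
    if "x \<in> carrier N" "y \<in> carrier N" for x y
    using *[OF that(1)] *[OF that(2)]
    by (auto simp: the_inv_into_f_f[OF inj] simp flip: hom_add[OF assms(2)])
  show "the_inv_into (carrier M) f (r \<odot>\<^bsub>N\<^esub> x) = r \<odot>\<^bsub>M\<^esub> the_inv_into (carrier M) f x"
    if "r \<in> carrier R" "x \<in> carrier N" for r x
    using *[OF that(2)] that(1)
    by (auto simp: the_inv_into_f_f[OF inj] simp flip: hom_smult[OF assms(2)])
qed

lemma module_iso_sym:
  "left_module R M \<Longrightarrow> module_iso R M N \<Longrightarrow> module_iso R N M"
  unfolding module_iso_def using module_iso_inverse bij_betw_the_inv_into by blast

lemma module_iso_trans:
  "module_iso R M N \<Longrightarrow> module_iso R N L \<Longrightarrow> module_iso R M L"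
  unfolding module_iso_def by (blast intro: hom_comp bij_betw_trans[unfolded comp_def])

text \<open>Modules built on function or product types enter the universe \<open>'m\<close> along an
  injection. The inverse of j is taken on the carrier of M only, so injectivity there
  suffices.\<close>

definition transport :: "('b \<Rightarrow> 'c) \<Rightarrow> ('a, 'b) module \<Rightarrow> ('a, 'c) module"
  where "transport j M =
    (let k = the_inv_into (carrier M) j in
    \<lparr>carrier = j ` carrier M, monoid.mult = (\<lambda>x y. j (k x \<otimes>\<^bsub>M\<^esub> k y)), one = j \<one>\<^bsub>M\<^esub>,
     zero = j \<zero>\<^bsub>M\<^esub>, add = (\<lambda>x y. j (k x \<oplus>\<^bsub>M\<^esub> k y)), smult = (\<lambda>a x. j (a \<odot>\<^bsub>M\<^esub> k x))\<rparr>)"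

lemma transport_simps:
  assumes "inj_on j (carrier M)"
  shows "carrier (transport j M) = j ` carrier M"
    and "\<zero>\<^bsub>transport j M\<^esub> = j \<zero>\<^bsub>M\<^esub>"
    and "x \<in> carrier M \<Longrightarrow> y \<in> carrier M \<Longrightarrow> j x \<oplus>\<^bsub>transport j M\<^esub> j y = j (x \<oplus>\<^bsub>M\<^esub> y)"
    and "x \<in> carrier M \<Longrightarrow> a \<odot>\<^bsub>transport j M\<^esub> j x = j (a \<odot>\<^bsub>M\<^esub> x)"
  by (simp_all add: transport_def Let_def the_inv_into_f_f[OF assms])

lemma left_module_transport:
  assumes "left_module R M" "inj_on j (carrier M)"
  shows "left_module R (transport j M)"
proof -
  interpret M: left_module R M by fact
  show ?thesis
  proof (rule left_moduleI)
    show "\<exists>y\<in>carrier (transport j M). y \<oplus>\<^bsub>transport j M\<^esub> x = \<zero>\<^bsub>transport j M\<^esub>"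
      if "x \<in> carrier (transport j M)" for x
    proof -
      from that obtain u where u: "u \<in> carrier M" "x = j u"
        by (auto simp: transport_simps[OF assms(2)])
      show ?thesis
        by (rule bexI[of _ "j (\<ominus>\<^bsub>M\<^esub> u)"])
          (use u in \<open>auto simp: transport_simps[OF assms(2)] M.M.l_neg\<close>)
    qed
  qed (auto simp: transport_simps[OF assms(2)] M.R.ring_axioms M.smult_l_distr M.smult_r_distr
      M.smult_assoc1 M.M.a_ac)
qed

lemma transport_hom:
  "inj_on j (carrier M) \<Longrightarrow> j \<in> module_homs R M (transport j M)"
  by (rule module_homsI) (auto simp: transport_simps)

lemma transport_bij: "inj_on j (carrier M) \<Longrightarrow> bij_betw j (carrier M) (carrier (transport j M))"
  by (simp add: transport_simps bij_betw_def)

lemma transport_inv_hom: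
  assumes "left_module R M" "inj_on j (carrier M)"
  shows "the_inv_into (carrier M) j \<in> module_homs R (transport j M) M"
  by (rule module_iso_inverse[OF assms(1) transport_hom transport_bij]) fact+

section \<open>Lifting and projective dimension\<close>

text \<open>The lifting property for P on an arbitrary type: \<open>projective\<close> can be stated
  only for modules on the type \<open>'m\<close> of the test modules, while most modules below live
  on function types.\<close>

definition lifting :: "'m itself \<Rightarrow> ('a, 'x) ring_scheme \<Rightarrow> ('a, 'b, 'y) module_scheme \<Rightarrow> bool"
  where "lifting _ R P \<longleftrightarrow>
    (\<forall>(N :: ('a, 'm) module) (L :: ('a, 'm) module). left_module R N \<and> left_module R L \<longrightarrow>
      (\<forall>g \<in> module_homs R N L. \<forall>f \<in> module_homs R P L. g ` carrier N = carrier L \<longrightarrow>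
        (\<exists>h \<in> module_homs R P N. \<forall>x \<in> carrier P. g (h x) = f x)))"

lemma projective_iff_lifting:
  "projective R (P :: ('a, 'm) module) \<longleftrightarrow> left_module R P \<and> lifting TYPE('m) R P"
  by (simp add: projective_def lifting_def)

lemma liftingD:
  fixes N L :: "('a, 'm) module"
  assumes "lifting TYPE('m) R P" "left_module R N" "left_module R L"
    "g \<in> module_homs R N L" "f \<in> module_homs R P L" "g ` carrier N = carrier L"
  shows "\<exists>h \<in> module_homs R P N. \<forall>x \<in> carrier P. g (h x) = f x"
  using assms(1)[unfolded lifting_def, rule_format, OF conjI, OF assms(2-6)] .

lemma liftingI:
  assumes "\<And>(N :: ('a, 'm) module) (L :: ('a, 'm) module) g f.
    \<lbrakk>left_module R N; left_module R L; g \<in> module_homs R N L; f \<in> module_homs R P L;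
     g ` carrier N = carrier L\<rbrakk> \<Longrightarrow> \<exists>h \<in> module_homs R P N. \<forall>x \<in> carrier P. g (h x) = f x"
  shows "lifting TYPE('m) R P"
  unfolding lifting_def by (intro allI impI ballI) (elim conjE, rule assms)

lemma lifting_retract:
  assumes "lifting TYPE('m) R Q" "i \<in> module_homs R P Q" "p \<in> module_homs R Q P"
    "\<And>x. x \<in> carrier P \<Longrightarrow> p (i x) = x"
  shows "lifting TYPE('m) R P"
proof (rule liftingI)
  fix N L :: "('a, 'm) module" and g f
  assume *: "left_module R N" "left_module R L" "g \<in> module_homs R N L"
    "f \<in> module_homs R P L" "g ` carrier N = carrier L"
  obtain h where h: "h \<in> module_homs R Q N" "\<forall>x\<in>carrier Q. g (h x) = f (p x)"
    by (rule bexE[OF liftingD[OF assms(1) *(1-3) hom_comp[OF assms(3) *(4)] *(5)]])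
  have "g (h (i x)) = f x" if "x \<in> carrier P" for x
    using bspec[OF h(2) hom_closed[OF assms(2) that]] assms(4)[OF that] by simp
  then show "\<exists>h\<in>module_homs R P N. \<forall>x\<in>carrier P. g (h x) = f x"
    by (intro bexI[OF _ hom_comp[OF assms(2) h(1)]] ballI)
qed

lemma lifting_transport:
  assumes "left_module R P" "lifting TYPE('m) R P" "inj_on j (carrier P)"
  shows "lifting TYPE('m) R (transport j P)"
  by (rule lifting_retract[OF assms(2) transport_inv_hom transport_hom])
    (use assms in \<open>auto simp: transport_simps the_inv_into_f_f\<close>)

lemma projective_transport:
  fixes j :: "'b \<Rightarrow> 'm"
  assumes "left_module R P" "lifting TYPE('m) R P" "inj_on j (carrier P)"
  shows "projective R (transport j P)"
  using assms by (simp add: projective_iff_lifting left_module_transport lifting_transport)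

section \<open>Binary products\<close>

definition module_prod :: "('a, 'b) module \<Rightarrow> ('a, 'c) module \<Rightarrow> ('a, 'b \<times> 'c) module"
  where "module_prod M N =
    \<lparr>carrier = carrier M \<times> carrier N, monoid.mult = (\<lambda>x y. (fst x \<otimes>\<^bsub>M\<^esub> fst y, snd x \<otimes>\<^bsub>N\<^esub> snd y)),
     one = (\<one>\<^bsub>M\<^esub>, \<one>\<^bsub>N\<^esub>), zero = (\<zero>\<^bsub>M\<^esub>, \<zero>\<^bsub>N\<^esub>),
     add = (\<lambda>x y. (fst x \<oplus>\<^bsub>M\<^esub> fst y, snd x \<oplus>\<^bsub>N\<^esub> snd y)),
     smult = (\<lambda>a x. (a \<odot>\<^bsub>M\<^esub> fst x, a \<odot>\<^bsub>N\<^esub> snd x))\<rparr>"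

lemma module_prod_simps [simp]:
  "carrier (module_prod M N) = carrier M \<times> carrier N"
  "\<zero>\<^bsub>module_prod M N\<^esub> = (\<zero>\<^bsub>M\<^esub>, \<zero>\<^bsub>N\<^esub>)"
  "x \<oplus>\<^bsub>module_prod M N\<^esub> y = (fst x \<oplus>\<^bsub>M\<^esub> fst y, snd x \<oplus>\<^bsub>N\<^esub> snd y)"
  "a \<odot>\<^bsub>module_prod M N\<^esub> x = (a \<odot>\<^bsub>M\<^esub> fst x, a \<odot>\<^bsub>N\<^esub> snd x)"
  by (simp_all add: module_prod_def)

lemma left_module_prod:
  assumes "left_module R M" "left_module R N"
  shows "left_module R (module_prod M N)"
proof -
  interpret M: left_module R M by fact
  interpret N: left_module R N by fact
  show ?thesis
  proof (rule left_moduleI)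
    show "\<exists>y\<in>carrier (module_prod M N). y \<oplus>\<^bsub>module_prod M N\<^esub> x = \<zero>\<^bsub>module_prod M N\<^esub>"
      if "x \<in> carrier (module_prod M N)" for x
      using that by (intro bexI[of _ "(\<ominus>\<^bsub>M\<^esub> fst x, \<ominus>\<^bsub>N\<^esub> snd x)"]) (auto simp: M.M.l_neg N.M.l_neg)
  qed (auto simp: M.R.ring_axioms M.smult_l_distr M.smult_r_distr M.smult_assoc1 M.M.a_ac
      N.smult_l_distr N.smult_r_distr N.smult_assoc1 N.M.a_ac)
qed

lemma lifting_prod:
  assumes "left_module R P" "left_module R Q" "lifting TYPE('m) R P" "lifting TYPE('m) R Q"
  shows "lifting TYPE('m) R (module_prod P Q)"
proof (rule liftingI)
  interpret P: left_module R P by fact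
  interpret Q: left_module R Q by fact
  fix N L :: "('a, 'm) module" and g f
  assume *: "left_module R N" "left_module R L" "g \<in> module_homs R N L"
    "f \<in> module_homs R (module_prod P Q) L" "g ` carrier N = carrier L"
  interpret N: left_module R N by fact
  have 1: "(\<lambda>x. (x, \<zero>\<^bsub>Q\<^esub>)) \<in> module_homs R P (module_prod P Q)"
    and 2: "(\<lambda>x. (\<zero>\<^bsub>P\<^esub>, x)) \<in> module_homs R Q (module_prod P Q)"
    by (auto intro!: module_homsI)
  have 3: "fst \<in> module_homs R (module_prod P Q) P" "snd \<in> module_homs R (module_prod P Q) Q"
    by (auto intro!: module_homsI)
  obtain h where h: "h \<in> module_homs R P N" "\<forall>x\<in>carrier P. g (h x) = f (x, \<zero>\<^bsub>Q\<^esub>)"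
    by (rule bexE[OF liftingD[OF assms(3) *(1-3) hom_comp[OF 1 *(4)] *(5)]])
  obtain k where k: "k \<in> module_homs R Q N" "\<forall>x\<in>carrier Q. g (k x) = f (\<zero>\<^bsub>P\<^esub>, x)"
    by (rule bexE[OF liftingD[OF assms(4) *(1-3) hom_comp[OF 2 *(4)] *(5)]])
  have "(\<lambda>x. h (fst x) \<oplus>\<^bsub>N\<^esub> k (snd x)) \<in> module_homs R (module_prod P Q) N"
    by (intro hom_plus *(1) hom_comp[OF 3(1) h(1)] hom_comp[OF 3(2) k(1)])
  moreover have "g (h (fst x) \<oplus>\<^bsub>N\<^esub> k (snd x)) = f x" if "x \<in> carrier (module_prod P Q)" for x
  proof -
    have x: "fst x \<in> carrier P" "snd x \<in> carrier Q" using that by auto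
    then have "g (h (fst x) \<oplus>\<^bsub>N\<^esub> k (snd x)) = f (fst x, \<zero>\<^bsub>Q\<^esub>) \<oplus>\<^bsub>L\<^esub> f (\<zero>\<^bsub>P\<^esub>, snd x)"
      by (simp add: hom_add[OF *(3)] hom_closed[OF h(1)] hom_closed[OF k(1)] h(2) k(2))
    also have "\<dots> = f x"
      using hom_add[OF *(4), of "(fst x, \<zero>\<^bsub>Q\<^esub>)" "(\<zero>\<^bsub>P\<^esub>, snd x)"] x by simp
    finally show ?thesis .
  qed
  ultimately show "\<exists>h\<in>module_homs R (module_prod P Q) N. \<forall>x\<in>carrier (module_prod P Q). g (h x) = f x"
    by (intro bexI[where x="\<lambda>x. h (fst x) \<oplus>\<^bsub>N\<^esub> k (snd x)"] ballI)
qed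

text \<open>L is replaced by the image of g, which is again a module on the type \<open>'m\<close>,
  so that g becomes onto.\<close>

lemma lifting_through:
  fixes N L :: "('a, 'm) module"
  assumes "lifting TYPE('m) R P" "left_module R N" "left_module R L"
    "g \<in> module_homs R N L" "f \<in> module_homs R P L" "f ` carrier P \<subseteq> g ` carrier N"
  shows "\<exists>h \<in> module_homs R P N. \<forall>x \<in> carrier P. g (h x) = f x"
proof -
  interpret L: left_module R L by fact
  let ?L = "L\<lparr>carrier := g ` carrier N\<rparr>"
  have "left_module R ?L"
    by (rule L.left_module_submodule[OF submodule_image[OF assms(2-4)]])
  from liftingD[OF assms(1,2) this, of g f] show ?thesis
    using hom_restrict_codomain[OF assms(4), of "g ` carrier N"] hom_restrict_codomain[OF assms(5,6)]
    by simp
qed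

section \<open>Projective dimension and second syzygies\<close>

lemma enat_Inf_mem: "S \<noteq> {} \<Longrightarrow> Inf S \<in> (S :: enat set)"
  unfolding Inf_enat_def by (auto intro: LeastI)

text \<open>An infimum in \<open>enat\<close> is attained unless the set is empty, and the infimum
  of the empty set is infinity. So a finite bound comes from an actual resolution.\<close>

lemma proj_dim_le_resolution:
  assumes "proj_dim R X \<le> enat n"
  obtains P d e where "projective_resolution R X P d e" "\<And>i. i > n \<Longrightarrow> carrier (P i) = {\<zero>\<^bsub>P i\<^esub>}"
proof -
  let ?S = "{enat n | n. \<exists>P d e. projective_resolution R X P d e \<and>
    (\<forall>i > n. carrier (P i) = {\<zero>\<^bsub>P i\<^esub>})}"
  have "?S \<noteq> {}"
    using assms unfolding proj_dim_def by (metis (no_types, lifting) Inf_empty enat_ord_simps(5) infinity_ileE top_enat_def)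
  then have "Inf ?S \<in> ?S" by (rule enat_Inf_mem)
  then obtain m P d e where "Inf ?S = enat m" "projective_resolution R X P d e"
    "\<forall>i > m. carrier (P i) = {\<zero>\<^bsub>P i\<^esub>}" by blast
  moreover have "m \<le> n"
    using assms \<open>Inf ?S = enat m\<close> unfolding proj_dim_def by simp
  ultimately show thesis
    by (intro that) auto
qed

text \<open>A form of Schanuel's lemma. The given start of a resolution is compared with a
  resolution Q of length 2: maps \<open>f0\<close>, \<open>f1\<close> and \<open>g0\<close>,
  \<open>g1\<close> in both directions and a homotopy \<open>h0\<close> in degree 0 exhibit the
  kernel of d as a retract of the product of P1 and Q 2.\<close>

lemma syzygy_lifting:
  fixes C P0 P1 :: "('a, 'm) module"
  assumes "proj_dim R C \<le> 2" and C: "left_module R C"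
    and P0: "projective R P0" and P1: "projective R P1"
    and d: "d \<in> module_homs R P1 P0" and e: "e \<in> module_homs R P0 C"
    and e_surj: "e ` carrier P0 = carrier C"
    and exact: "{x \<in> carrier P0. e x = \<zero>\<^bsub>C\<^esub>} = d ` carrier P1"
  shows "lifting TYPE('m) R (P1\<lparr>carrier := {x \<in> carrier P1. d x = \<zero>\<^bsub>P0\<^esub>}\<rparr>)"
proof -
  obtain Q \<delta> \<epsilon> where res: "projective_resolution R C Q \<delta> \<epsilon>"
    and Qz: "\<And>i. i > 2 \<Longrightarrow> carrier (Q i) = {\<zero>\<^bsub>Q i\<^esub>}"
    using proj_dim_le_resolution[of R C 2] assms(1) by (metis numeral_eq_enat)
  have Qp: "projective R (Q i)" for i using res by (simp add: projective_resolution_def)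
  then have Ql: "lifting TYPE('m) R (Q i)" and Qm: "left_module R (Q i)" for i
    by (simp_all add: projective_iff_lifting)
  have \<delta>: "\<delta> i \<in> module_homs R (Q (Suc i)) (Q i)" for i
    using res by (simp add: projective_resolution_def)
  have \<epsilon>: "\<epsilon> \<in> module_homs R (Q 0) C" "\<epsilon> ` carrier (Q 0) = carrier C"
    "{x \<in> carrier (Q 0). \<epsilon> x = \<zero>\<^bsub>C\<^esub>} = \<delta> 0 ` carrier (Q 1)"
    using res by (simp_all add: projective_resolution_def)
  have ex: "{x \<in> carrier (Q (Suc i)). \<delta> i x = \<zero>\<^bsub>Q i\<^esub>} = \<delta> (Suc i) ` carrier (Q (Suc (Suc i)))" for i
    using res by (simp add: projective_resolution_def)
  have lP0: "lifting TYPE('m) R P0" and mP0: "left_module R P0"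
    and lP1: "lifting TYPE('m) R P1" and mP1: "left_module R P1"
    using P0 P1 by (simp_all add: projective_iff_lifting)
  interpret P0: left_module R P0 by fact
  interpret P1: left_module R P1 by fact
  interpret Q0: left_module R "Q 0" by (rule Qm)
  interpret Q1: left_module R "Q 1" by (rule Qm)
  interpret Q2: left_module R "Q 2" by (rule Qm)
  have \<delta>0: "\<delta> 0 \<in> module_homs R (Q 1) (Q 0)" and \<delta>1: "\<delta> 1 \<in> module_homs R (Q 2) (Q 1)"
    using \<delta>[of 0] \<delta>[of 1] by (simp_all add: numeral_2_eq_2)
  have ed: "e (d x) = \<zero>\<^bsub>C\<^esub>" if "x \<in> carrier P1" for x
    using exact that by blast
  have \<epsilon>\<delta>: "\<epsilon> (\<delta> 0 x) = \<zero>\<^bsub>C\<^esub>" if "x \<in> carrier (Q 1)" for x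
    using \<epsilon>(3) that by blast
  obtain f0 where f0: "f0 \<in> module_homs R P0 (Q 0)" "\<forall>x\<in>carrier P0. \<epsilon> (f0 x) = e x"
    by (rule bexE[OF liftingD[OF lP0 Qm C \<epsilon>(1) e \<epsilon>(2)]])
  obtain g0 where g0: "g0 \<in> module_homs R (Q 0) P0" "\<forall>x\<in>carrier (Q 0). e (g0 x) = \<epsilon> x"
    by (rule bexE[OF liftingD[OF Ql mP0 C e \<epsilon>(1) e_surj]])
  have 1: "(\<lambda>x. f0 (d x)) ` carrier P1 \<subseteq> \<delta> 0 ` carrier (Q 1)"
    unfolding \<epsilon>(3)[symmetric] using ed f0(2) by (auto simp: hom_closed[OF d] hom_closed[OF f0(1)])
  obtain f1 where f1: "f1 \<in> module_homs R P1 (Q 1)" "\<forall>x\<in>carrier P1. \<delta> 0 (f1 x) = f0 (d x)"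
    by (rule bexE[OF lifting_through[OF lP1 Qm Qm \<delta>0 hom_comp[OF d f0(1)] 1]])
  have 2: "(\<lambda>x. g0 (\<delta> 0 x)) ` carrier (Q 1) \<subseteq> d ` carrier P1"
    unfolding exact[symmetric] using \<epsilon>\<delta> g0(2) by (auto simp: hom_closed[OF \<delta>0] hom_closed[OF g0(1)])
  obtain g1 where g1: "g1 \<in> module_homs R (Q 1) P1" "\<forall>x\<in>carrier (Q 1). d (g1 x) = g0 (\<delta> 0 x)"
    by (rule bexE[OF lifting_through[OF Ql mP1 mP0 d hom_comp[OF \<delta>0 g0(1)] 2]])
  let ?u = "\<lambda>x. x \<oplus>\<^bsub>P0\<^esub> \<ominus>\<^bsub>P0\<^esub> g0 (f0 x)"
  have id0: "(\<lambda>x. x) \<in> module_homs R P0 P0" and id1: "(\<lambda>x. x) \<in> module_homs R P1 P1"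
    by (auto intro: module_homsI)
  have u: "?u \<in> module_homs R P0 P0"
    by (intro hom_plus hom_uminus mP0 id0 hom_comp[OF f0(1) g0(1)])
  have eu: "e (?u x) = \<zero>\<^bsub>C\<^esub>" if "x \<in> carrier P0" for x
  proof -
    interpret C: left_module R C by fact
    have "f0 x \<in> carrier (Q 0)" "g0 (f0 x) \<in> carrier P0"
      using that by (simp_all add: hom_closed[OF f0(1)] hom_closed[OF g0(1)])
    then show ?thesis
      using that f0(2) g0(2) hom_closed[OF e] by (simp add: hom_add[OF e] hom_minus[OF mP0 C e] C.M.r_neg)
  qed
  have 3: "?u ` carrier P0 \<subseteq> d ` carrier P1"
    unfolding exact[symmetric] using eu hom_closed[OF u] by auto
  obtain h0 where h0: "h0 \<in> module_homs R P0 P1" "\<forall>x\<in>carrier P0. d (h0 x) = ?u x"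
    by (rule bexE[OF lifting_through[OF lP0 mP1 mP0 d u 3]])
  \<comment> \<open>The identity of P1 minus g1 f1 minus h0 d. As d h0 = 1 - g0 f0 on P0 and d g1 f1
    = g0 f0 d, its image lies in the kernel of d.\<close>
  define \<pi> where "\<pi> x = (x \<oplus>\<^bsub>P1\<^esub> \<ominus>\<^bsub>P1\<^esub> g1 (f1 x)) \<oplus>\<^bsub>P1\<^esub> \<ominus>\<^bsub>P1\<^esub> h0 (d x)" for x
  let ?K = "{x \<in> carrier P1. d x = \<zero>\<^bsub>P0\<^esub>}"
  let ?KM = "P1\<lparr>carrier := ?K\<rparr>"
  have \<pi>: "\<pi> \<in> module_homs R P1 P1"
    unfolding \<pi>_def by (intro hom_plus hom_uminus mP1 id1 hom_comp[OF f1(1) g1(1)] hom_comp[OF d h0(1)])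
  have c: "f1 x \<in> carrier (Q 1)" "g1 (f1 x) \<in> carrier P1" "d x \<in> carrier P0" "h0 (d x) \<in> carrier P1"
    "f0 (d x) \<in> carrier (Q 0)" "g0 (f0 (d x)) \<in> carrier P0" if "x \<in> carrier P1" for x
    by (blast intro: that hom_closed[OF f0(1)] hom_closed[OF g0(1)] hom_closed[OF f1(1)]
      hom_closed[OF g1(1)] hom_closed[OF h0(1)] hom_closed[OF d])+
  have d\<pi>: "d (\<pi> x) = \<zero>\<^bsub>P0\<^esub>" if x: "x \<in> carrier P1" for x
  proof -
    have "d (\<pi> x) = (d x \<oplus>\<^bsub>P0\<^esub> \<ominus>\<^bsub>P0\<^esub> g0 (f0 (d x))) \<oplus>\<^bsub>P0\<^esub> \<ominus>\<^bsub>P0\<^esub> (d x \<oplus>\<^bsub>P0\<^esub> \<ominus>\<^bsub>P0\<^esub> g0 (f0 (d x)))"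
      unfolding \<pi>_def using c[OF x] x f1(2) g1(2) h0(2)
      by (simp add: hom_add[OF d] hom_minus[OF mP1 mP0 d])
    also have "\<dots> = \<zero>\<^bsub>P0\<^esub>"
      using c[OF x] by (intro P0.M.r_neg) auto
    finally show ?thesis .
  qed
  let ?I = "Q 1\<lparr>carrier := \<delta> 1 ` carrier (Q 2)\<rparr>"
  \<comment> \<open>Exactness at Q 2, together with Q 3 = 0.\<close>
  have "inj_on (\<delta> 1) (carrier (Q 2))"
  proof (rule hom_inj_iff[OF Qm Qm \<delta>1])
    fix x assume "x \<in> carrier (Q 2)" "\<delta> 1 x = \<zero>\<^bsub>Q 1\<^esub>"
    then have "x \<in> \<delta> 2 ` carrier (Q 3)"
      using ex[of 1] by (auto simp: numeral_2_eq_2 numeral_3_eq_3)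
    then have "x = \<delta> 2 \<zero>\<^bsub>Q 3\<^esub>" using Qz[of 3] by simp
    also have "\<dots> = \<zero>\<^bsub>Q 2\<^esub>"
      using hom_zero[OF Qm Qm \<delta>, of 2] by (simp add: numeral_2_eq_2 numeral_3_eq_3)
    finally show "x = \<zero>\<^bsub>Q 2\<^esub>" .
  qed
  then have bij: "bij_betw (\<delta> 1) (carrier (Q 2)) (carrier ?I)"
    by (simp add: bij_betw_def)
  define k where "k = the_inv_into (carrier (Q 2)) (\<delta> 1)"
  have k: "k \<in> module_homs R ?I (Q 2)"
    unfolding k_def by (rule module_iso_inverse[OF Qm hom_restrict_codomain[OF \<delta>1] bij]) auto
  have \<delta>k: "\<delta> 1 (k x) = x" if "x \<in> \<delta> 1 ` carrier (Q 2)" for x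
    unfolding k_def using bij that by (intro f_the_inv_into_f) (auto simp: bij_betw_def)
  have mK: "left_module R ?KM"
    by (rule P1.left_module_submodule[OF submodule_kernel[OF mP1 mP0 d]])
  have KP: "f \<in> module_homs R ?KM N" if "f \<in> module_homs R P1 N" for f and N :: "('a, 'm) module"
    using that by (rule hom_restrict_domain) auto
  have f1K: "f1 ` ?K \<subseteq> \<delta> 1 ` carrier (Q 2)"
  proof -
    have "f1 x \<in> \<delta> 1 ` carrier (Q 2)" if "x \<in> ?K" for x
    proof -
      have "\<delta> 0 (f1 x) = \<zero>\<^bsub>Q 0\<^esub>"
        using that f1(2) hom_zero[OF mP0 Qm f0(1)] by simp
      then show ?thesis
        using ex[of 0] c(1)[of x] that by (auto simp: numeral_2_eq_2)
    qed
    then show ?thesis by blast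
  qed
  have f1I: "f1 \<in> module_homs R ?KM ?I"
    by (rule hom_restrict_codomain[OF KP[OF f1(1)]]) (use f1K in simp)
  \<comment> \<open>On the kernel of d the term with \<open>h0\<close> vanishes, so the identity is
    \<pi> plus g1 f1 there. Since f1 maps the kernel into the image of \<open>\<delta> 1\<close>, a
    copy of Q 2, the second summand factors through Q 2.\<close>
  let ?i = "\<lambda>x. (x, k (f1 x))"
  let ?p = "\<lambda>x. \<pi> (fst x) \<oplus>\<^bsub>P1\<^esub> g1 (\<delta> 1 (snd x))"
  let ?Z = "module_prod P1 (Q 2)"
  have i: "?i \<in> module_homs R ?KM ?Z"
    using hom_comp[OF f1I k] by (auto simp: module_homs_def Pi_def)
  have fs: "fst \<in> module_homs R ?Z P1" "snd \<in> module_homs R ?Z (Q 2)"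
    by (auto intro!: module_homsI)
  have p0: "?p \<in> module_homs R ?Z P1"
    by (intro hom_plus mP1 hom_comp[OF fs(1) \<pi>] hom_comp[OF hom_comp[OF fs(2) \<delta>1] g1(1)])
  have dg1\<delta>: "d (g1 (\<delta> 1 y)) = \<zero>\<^bsub>P0\<^esub>" if "y \<in> carrier (Q 2)" for y
  proof -
    have "\<delta> 1 y \<in> carrier (Q 1)" "\<delta> 0 (\<delta> 1 y) = \<zero>\<^bsub>Q 0\<^esub>"
      using ex[of 0] that by (auto simp: numeral_2_eq_2 set_eq_iff)
    then show ?thesis using g1(2) hom_zero[OF Qm mP0 g0(1)] by simp
  qed
  have cp: "\<pi> (fst y) \<in> carrier P1" "g1 (\<delta> 1 (snd y)) \<in> carrier P1" if "y \<in> carrier ?Z" for y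
    using hom_closed[OF hom_comp[OF fs(1) \<pi>] that]
      hom_closed[OF hom_comp[OF hom_comp[OF fs(2) \<delta>1] g1(1)] that] by auto
  have "?p ` carrier ?Z \<subseteq> ?K"
    using cp d\<pi> dg1\<delta> by (auto simp: hom_add[OF d])
  with p0 have p: "?p \<in> module_homs R ?Z ?KM"
    by (rule hom_restrict_codomain)
  have pi: "?p (?i x) = x" if "x \<in> carrier ?KM" for x
  proof -
    have x: "x \<in> carrier P1" "d x = \<zero>\<^bsub>P0\<^esub>" "f1 x \<in> \<delta> 1 ` carrier (Q 2)"
      using that f1K by auto
    have "?p (?i x) = \<pi> x \<oplus>\<^bsub>P1\<^esub> g1 (f1 x)"
      by (simp add: \<delta>k[OF x(3)] del: One_nat_def)
    also have "\<dots> = x"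
      unfolding \<pi>_def using x c[OF x(1)] hom_zero[OF mP0 mP1 h0(1)]
      by (simp add: P1.M.a_assoc P1.M.l_neg P1.M.minus_equality[of "\<zero>\<^bsub>P1\<^esub>" "\<zero>\<^bsub>P1\<^esub>"])
    finally show ?thesis .
  qed
  show ?thesis
    by (rule lifting_retract[OF lifting_prod[OF mP1 Qm lP1 Ql] i p pi])
qed

section \<open>Finite powers of a module\<close>

definition pi_module :: "'i set \<Rightarrow> ('a, 'b) module \<Rightarrow> ('a, 'i \<Rightarrow> 'b) module"
  where "pi_module I M =
    \<lparr>carrier = (\<Pi>\<^sub>E i\<in>I. carrier M), monoid.mult = (\<lambda>f g. \<lambda>i\<in>I. f i \<otimes>\<^bsub>M\<^esub> g i), one = (\<lambda>i\<in>I. \<one>\<^bsub>M\<^esub>),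
     zero = (\<lambda>i\<in>I. \<zero>\<^bsub>M\<^esub>), add = (\<lambda>f g. \<lambda>i\<in>I. f i \<oplus>\<^bsub>M\<^esub> g i), smult = (\<lambda>a f. \<lambda>i\<in>I. a \<odot>\<^bsub>M\<^esub> f i)\<rparr>"

lemma pi_module_simps [simp]:
  "carrier (pi_module I M) = (\<Pi>\<^sub>E i\<in>I. carrier M)"
  "\<zero>\<^bsub>pi_module I M\<^esub> = (\<lambda>i\<in>I. \<zero>\<^bsub>M\<^esub>)"
  "f \<oplus>\<^bsub>pi_module I M\<^esub> g = (\<lambda>i\<in>I. f i \<oplus>\<^bsub>M\<^esub> g i)"
  "a \<odot>\<^bsub>pi_module I M\<^esub> f = (\<lambda>i\<in>I. a \<odot>\<^bsub>M\<^esub> f i)"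
  by (simp_all add: pi_module_def)

lemma left_module_pi:
  assumes "left_module R M"
  shows "left_module R (pi_module I M)"
proof -
  interpret M: left_module R M by fact
  show ?thesis
  proof (rule left_moduleI)
    show "\<exists>y\<in>carrier (pi_module I M). y \<oplus>\<^bsub>pi_module I M\<^esub> x = \<zero>\<^bsub>pi_module I M\<^esub>"
      if "x \<in> carrier (pi_module I M)" for x
      using that by (intro bexI[of _ "\<lambda>i\<in>I. \<ominus>\<^bsub>M\<^esub> x i"]) (auto simp: M.M.l_neg dest: PiE_mem intro!: restrict_ext)
  qed (auto simp: M.R.ring_axioms M.smult_l_distr M.smult_r_distr M.smult_assoc1 M.M.a_assoc PiE_mem
      PiE_restrict extensional_restrict fun_eq_iff restrict_def PiE_def extensional_def Pi_def intro: M.M.a_comm)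
qed

lemma lifting_pi:
  assumes "left_module R M" "lifting TYPE('m) R M" "finite I"
  shows "lifting TYPE('m) R (pi_module I M)"
  using assms(3)
proof (induct I)
  case empty
  show ?case
  proof (rule liftingI)
    fix N L :: "('a, 'm) module" and g f
    assume *: "left_module R N" "left_module R L" "g \<in> module_homs R N L"
      "f \<in> module_homs R (pi_module {} M) L" "g ` carrier N = carrier L"
    interpret N: left_module R N by fact
    have "(\<lambda>x. \<zero>\<^bsub>N\<^esub>) \<in> module_homs R (pi_module {} M) N"
      by (auto intro!: module_homsI)
    moreover have "g \<zero>\<^bsub>N\<^esub> = f x" if "x \<in> carrier (pi_module {} M)" for x
      using hom_zero[OF *(1-3)] hom_zero[OF left_module_pi[OF assms(1)] *(2,4)] that
      by (simp add: restrict_def)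
    ultimately show "\<exists>h\<in>module_homs R (pi_module {} M) N. \<forall>x\<in>carrier (pi_module {} M). g (h x) = f x"
      by (intro bexI[where x="\<lambda>x. \<zero>\<^bsub>N\<^esub>"] ballI)
  qed
next
  case (insert i I)
  show ?case
  proof (rule lifting_retract[OF lifting_prod[OF assms(1) left_module_pi[OF assms(1)] assms(2) insert(3)]])
    show "(\<lambda>m. (m i, restrict m I)) \<in> module_homs R (pi_module (insert i I) M) (module_prod M (pi_module I M))"
      using insert(2) by (intro module_homsI) (auto simp: PiE_mem restrict_def fun_eq_iff)
    show "(\<lambda>p. (snd p)(i := fst p)) \<in> module_homs R (module_prod M (pi_module I M)) (pi_module (insert i I) M)"
      using insert(2) by (intro module_homsI) (auto simp: PiE_mem restrict_def fun_eq_iff PiE_def extensional_def)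
    show "(snd (m i, restrict m I))(i := fst (m i, restrict m I)) = m"
      if "m \<in> carrier (pi_module (insert i I) M)" for m
      using that by (auto simp: restrict_def fun_eq_iff PiE_def extensional_def)
  qed
qed

text \<open>The four terms may live on four different types. The injections move them into
  \<open>'m\<close>, and the zero submodule of X, a module on \<open>'m\<close>, continues the
  resolution.\<close>

lemma proj_dim_le_3:
  fixes X :: "('a, 'm) module" and P0 :: "('a, 'b0) module" and P1 :: "('a, 'b1) module"
    and P2 :: "('a, 'b2) module" and P3 :: "('a, 'b3) module"
  assumes X: "left_module R X" and mod: "left_module R P0" "left_module R P1" "left_module R P2" "left_module R P3"
    and lift: "lifting TYPE('m) R P0" "lifting TYPE('m) R P1" "lifting TYPE('m) R P2" "lifting TYPE('m) R P3"
    and e: "e \<in> module_homs R P0 X" and d0: "d0 \<in> module_homs R P1 P0"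
    and d1: "d1 \<in> module_homs R P2 P1" and d2: "d2 \<in> module_homs R P3 P2"
    and surj: "e ` carrier P0 = carrier X"
    and ex: "{x \<in> carrier P0. e x = \<zero>\<^bsub>X\<^esub>} = d0 ` carrier P1"
      "{x \<in> carrier P1. d0 x = \<zero>\<^bsub>P0\<^esub>} = d1 ` carrier P2"
      "{x \<in> carrier P2. d1 x = \<zero>\<^bsub>P1\<^esub>} = d2 ` carrier P3"
    and ker: "{x \<in> carrier P3. d2 x = \<zero>\<^bsub>P2\<^esub>} = {\<zero>\<^bsub>P3\<^esub>}"
    and j: "inj_on (j0 :: 'b0 \<Rightarrow> 'm) (carrier P0)" "inj_on (j1 :: 'b1 \<Rightarrow> 'm) (carrier P1)"
      "inj_on (j2 :: 'b2 \<Rightarrow> 'm) (carrier P2)" "inj_on (j3 :: 'b3 \<Rightarrow> 'm) (carrier P3)"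
  shows "proj_dim R X \<le> 3"
proof -
  interpret X: left_module R X by fact
  define Z where "Z = X\<lparr>carrier := {\<zero>\<^bsub>X\<^esub>}\<rparr>"
  define k0 where "k0 = the_inv_into (carrier P0) j0"
  define k1 where "k1 = the_inv_into (carrier P1) j1"
  define k2 where "k2 = the_inv_into (carrier P2) j2"
  define k3 where "k3 = the_inv_into (carrier P3) j3"
  have kj0: "k0 (j0 x) = x" if "x \<in> carrier P0" for x
    using the_inv_into_f_f[OF j(1) that] by (simp add: k0_def)
  have kj1: "k1 (j1 x) = x" if "x \<in> carrier P1" for x
    using the_inv_into_f_f[OF j(2) that] by (simp add: k1_def)
  have kj2: "k2 (j2 x) = x" if "x \<in> carrier P2" for x
    using the_inv_into_f_f[OF j(3) that] by (simp add: k2_def)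
  have kj3: "k3 (j3 x) = x" if "x \<in> carrier P3" for x
    using the_inv_into_f_f[OF j(4) that] by (simp add: k3_def)
  define P where "P i = (if i = 0 then transport j0 P0 else if i = 1 then transport j1 P1
    else if i = 2 then transport j2 P2 else if i = 3 then transport j3 P3 else Z)" for i :: nat
  define d where "d i = (if i = 0 then (\<lambda>x. j0 (d0 (k1 x))) else if i = 1 then (\<lambda>x. j1 (d1 (k2 x)))
    else if i = 2 then (\<lambda>x. j2 (d2 (k3 x))) else if i = 3 then (\<lambda>x. \<zero>\<^bsub>transport j3 P3\<^esub>) else (\<lambda>x. \<zero>\<^bsub>X\<^esub>))"
    for i :: nat
  have Pi: "P 0 = transport j0 P0" "P (Suc 0) = transport j1 P1" "P (Suc (Suc 0)) = transport j2 P2"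
    "P (Suc (Suc (Suc 0))) = transport j3 P3" "P (Suc (Suc (Suc (Suc i)))) = Z" for i
    by (simp_all add: P_def)
  have di: "d 0 = (\<lambda>x. j0 (d0 (k1 x)))" "d (Suc 0) = (\<lambda>x. j1 (d1 (k2 x)))"
    "d (Suc (Suc 0)) = (\<lambda>x. j2 (d2 (k3 x)))" "d (Suc (Suc (Suc 0))) = (\<lambda>x. \<zero>\<^bsub>transport j3 P3\<^esub>)"
    "d (Suc (Suc (Suc (Suc i)))) = (\<lambda>x. \<zero>\<^bsub>X\<^esub>)" for i
    by (simp_all add: d_def)
  have cases: "Q i" if "Q 0" "Q (Suc 0)" "Q (Suc (Suc 0))" "Q (Suc (Suc (Suc 0)))"
    "\<And>i. Q (Suc (Suc (Suc (Suc i))))" for Q :: "nat \<Rightarrow> bool" and i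
    using that by (metis not0_implies_Suc)
  have Zs: "submodule {\<zero>\<^bsub>X\<^esub>} R X"
    by (rule X.submoduleI_lmod) auto
  have Zm: "left_module R Z"
    unfolding Z_def by (rule X.left_module_submodule[OF Zs])
  have Zp: "projective R Z"
    unfolding projective_iff_lifting
  proof (intro conjI Zm liftingI)
    fix N L :: "('a, 'm) module" and g f
    assume *: "left_module R N" "left_module R L" "g \<in> module_homs R N L"
      "f \<in> module_homs R Z L"
    interpret N: left_module R N by fact
    have "(\<lambda>x. \<zero>\<^bsub>N\<^esub>) \<in> module_homs R Z N"
      by (auto intro!: module_homsI)
    moreover have "g \<zero>\<^bsub>N\<^esub> = f x" if "x \<in> carrier Z" for x
      using hom_zero[OF *(1-3)] hom_zero[OF Zm *(2,4)] that by (simp add: Z_def)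
    ultimately show "\<exists>h\<in>module_homs R Z N. \<forall>x\<in>carrier Z. g (h x) = f x"
      by (intro bexI[where x="\<lambda>x. \<zero>\<^bsub>N\<^esub>"] ballI)
  qed
  interpret P3: left_module R P3 by fact
  have Pp: "projective R (P i)" for i
    by (rule cases[of "\<lambda>i. projective R (P i)"])
      (simp_all add: Pi Zp projective_transport[OF mod(1) lift(1) j(1)] projective_transport[OF mod(2) lift(2) j(2)]
        projective_transport[OF mod(3) lift(3) j(3)] projective_transport[OF mod(4) lift(4) j(4)])
  have t3: "left_module R (transport j3 P3)"
    by (rule left_module_transport[OF mod(4) j(4)])
  interpret T3: left_module R "transport j3 P3" by (rule t3)
  have dh: "d i \<in> module_homs R (P (Suc i)) (P i)" for i
  proof (rule cases[of "\<lambda>i. d i \<in> module_homs R (P (Suc i)) (P i)"])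
    show "d 0 \<in> module_homs R (P (Suc 0)) (P 0)"
      unfolding Pi di k1_def
      by (rule hom_comp[OF hom_comp[OF transport_inv_hom[OF mod(2) j(2)] d0] transport_hom[OF j(1)]])
    show "d (Suc 0) \<in> module_homs R (P (Suc (Suc 0))) (P (Suc 0))"
      unfolding Pi di k2_def
      by (rule hom_comp[OF hom_comp[OF transport_inv_hom[OF mod(3) j(3)] d1] transport_hom[OF j(2)]])
    show "d (Suc (Suc 0)) \<in> module_homs R (P (Suc (Suc (Suc 0)))) (P (Suc (Suc 0)))"
      unfolding Pi di k3_def
      by (rule hom_comp[OF hom_comp[OF transport_inv_hom[OF mod(4) j(4)] d2] transport_hom[OF j(3)]])
    show "d (Suc (Suc (Suc 0))) \<in> module_homs R (P (Suc (Suc (Suc (Suc 0))))) (P (Suc (Suc (Suc 0))))"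
      unfolding Pi di by (rule module_homsI) auto
    show "d (Suc (Suc (Suc (Suc i)))) \<in> module_homs R (P (Suc (Suc (Suc (Suc (Suc i)))))) (P (Suc (Suc (Suc (Suc i)))))" for i
      unfolding Pi di by (rule module_homsI) (auto simp: Z_def)
  qed
  have zc: "\<zero>\<^bsub>P0\<^esub> \<in> carrier P0" "\<zero>\<^bsub>P1\<^esub> \<in> carrier P1" "\<zero>\<^bsub>P2\<^esub> \<in> carrier P2"
    using mod(1-3) by (auto intro!: abelian_monoid.zero_closed abelian_group.axioms(1) left_module.axioms(2))
  have z0: "j0 x = j0 \<zero>\<^bsub>P0\<^esub> \<longleftrightarrow> x = \<zero>\<^bsub>P0\<^esub>" if "x \<in> carrier P0" for x
    using inj_on_eq_iff[OF j(1) that zc(1)] .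
  have z1: "j1 x = j1 \<zero>\<^bsub>P1\<^esub> \<longleftrightarrow> x = \<zero>\<^bsub>P1\<^esub>" if "x \<in> carrier P1" for x
    using inj_on_eq_iff[OF j(2) that zc(2)] .
  have z2: "j2 x = j2 \<zero>\<^bsub>P2\<^esub> \<longleftrightarrow> x = \<zero>\<^bsub>P2\<^esub>" if "x \<in> carrier P2" for x
    using inj_on_eq_iff[OF j(3) that zc(3)] .
  have eh: "(\<lambda>x. e (k0 x)) \<in> module_homs R (P 0) X"
    unfolding Pi k0_def by (rule hom_comp[OF transport_inv_hom[OF mod(1) j(1)] e])
  have es: "(\<lambda>x. e (k0 x)) ` carrier (P 0) = carrier X"
    unfolding Pi transport_simps(1)[OF j(1)] surj[symmetric] image_image by (simp add: kj0)
  have e0: "{x \<in> carrier (P 0). e (k0 x) = \<zero>\<^bsub>X\<^esub>} = d 0 ` carrier (P 1)"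
  proof -
    have "{x \<in> carrier (P 0). e (k0 x) = \<zero>\<^bsub>X\<^esub>} = j0 ` {x \<in> carrier P0. e x = \<zero>\<^bsub>X\<^esub>}"
      by (auto simp: Pi transport_simps(1)[OF j(1)] kj0)
    also have "\<dots> = d 0 ` carrier (P 1)"
      unfolding ex(1) by (simp add: Pi di transport_simps(1)[OF j(2)] image_image kj1)
    finally show ?thesis .
  qed
  have ei: "{x \<in> carrier (P (Suc i)). d i x = \<zero>\<^bsub>P i\<^esub>} = d (Suc i) ` carrier (P (Suc (Suc i)))" for i
  proof (rule cases[of "\<lambda>i. {x \<in> carrier (P (Suc i)). d i x = \<zero>\<^bsub>P i\<^esub>} = d (Suc i) ` carrier (P (Suc (Suc i)))"])
    have "{x \<in> carrier (P (Suc 0)). d 0 x = \<zero>\<^bsub>P 0\<^esub>} = j1 ` {x \<in> carrier P1. d0 x = \<zero>\<^bsub>P0\<^esub>}"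
      by (auto simp: Pi di transport_simps(1,2)[OF j(1)] transport_simps(1)[OF j(2)] kj1 z0 hom_closed[OF d0])
    also have "\<dots> = d (Suc 0) ` carrier (P (Suc (Suc 0)))"
      unfolding ex(2) by (simp add: Pi di transport_simps(1)[OF j(3)] image_image kj2)
    finally show "{x \<in> carrier (P (Suc 0)). d 0 x = \<zero>\<^bsub>P 0\<^esub>} = d (Suc 0) ` carrier (P (Suc (Suc 0)))" .
    have "{x \<in> carrier (P (Suc (Suc 0))). d (Suc 0) x = \<zero>\<^bsub>P (Suc 0)\<^esub>} = j2 ` {x \<in> carrier P2. d1 x = \<zero>\<^bsub>P1\<^esub>}"
      by (auto simp: Pi di transport_simps(1,2)[OF j(2)] transport_simps(1)[OF j(3)] kj2 z1 hom_closed[OF d1])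
    also have "\<dots> = d (Suc (Suc 0)) ` carrier (P (Suc (Suc (Suc 0))))"
      unfolding ex(3) by (simp add: Pi di transport_simps(1)[OF j(4)] image_image kj3)
    finally show "{x \<in> carrier (P (Suc (Suc 0))). d (Suc 0) x = \<zero>\<^bsub>P (Suc 0)\<^esub>}
      = d (Suc (Suc 0)) ` carrier (P (Suc (Suc (Suc 0))))" .
    have "{x \<in> carrier (P (Suc (Suc (Suc 0)))). d (Suc (Suc 0)) x = \<zero>\<^bsub>P (Suc (Suc 0))\<^esub>}
        = j3 ` {x \<in> carrier P3. d2 x = \<zero>\<^bsub>P2\<^esub>}"
      by (auto simp: Pi di transport_simps(1,2)[OF j(3)] transport_simps(1)[OF j(4)] kj3 z2 hom_closed[OF d2])
    also have "\<dots> = d (Suc (Suc (Suc 0))) ` carrier (P (Suc (Suc (Suc (Suc 0)))))"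
      unfolding ker by (simp add: Pi di Z_def transport_simps(2)[OF j(4)])
    finally show "{x \<in> carrier (P (Suc (Suc (Suc 0)))). d (Suc (Suc 0)) x = \<zero>\<^bsub>P (Suc (Suc 0))\<^esub>}
      = d (Suc (Suc (Suc 0))) ` carrier (P (Suc (Suc (Suc (Suc 0)))))" .
    show "{x \<in> carrier (P (Suc (Suc (Suc (Suc 0))))). d (Suc (Suc (Suc 0))) x = \<zero>\<^bsub>P (Suc (Suc (Suc 0)))\<^esub>}
      = d (Suc (Suc (Suc (Suc 0)))) ` carrier (P (Suc (Suc (Suc (Suc (Suc 0))))))"
      by (auto simp: Pi di Z_def)
  qed (auto simp: Pi di Z_def)
  have "projective_resolution R X P d (\<lambda>x. e (k0 x))"
    unfolding projective_resolution_def by (intro conjI allI Pp dh eh es e0 ei)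
  moreover have "\<forall>i>3. carrier (P i) = {\<zero>\<^bsub>P i\<^esub>}"
    by (simp add: P_def Z_def)
  ultimately have "enat 3 \<in> {enat n | n. \<exists>P d e. projective_resolution R X P d e \<and>
    (\<forall>i > n. carrier (P i) = {\<zero>\<^bsub>P i\<^esub>})}"
    by blast
  then show ?thesis
    unfolding proj_dim_def by (metis (no_types, lifting) Inf_lower numeral_eq_enat)
qed

section \<open>Encoding into the universe\<close>

lemma ex_inj_prod:
  assumes "infinite (UNIV :: 'm set)"
  shows "\<exists>f :: 'm \<times> 'm \<Rightarrow> 'm. inj f"
proof -
  have "\<exists>f. bij_betw f (UNIV \<times> UNIV :: ('m \<times> 'm) set) (UNIV :: 'm set)"
    unfolding card_of_ordIso by (rule card_of_Times_same_infinite[OF assms])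
  then show ?thesis by (auto simp: bij_betw_def)
qed

text \<open>Folding with an injective pairing is injective only among lists of equal length, so the
  length is encoded as well.\<close>

lemma ex_inj_list:
  assumes "infinite (UNIV :: 'm set)"
  shows "\<exists>f :: 'm list \<Rightarrow> 'm. inj f"
proof -
  obtain p :: "'m \<times> 'm \<Rightarrow> 'm" where p: "inj p" using ex_inj_prod[OF assms] by blast
  obtain c :: "nat \<Rightarrow> 'm" where c: "inj c" using infinite_countable_subset[OF assms] by auto
  define h where "h xs = foldr (\<lambda>a b. p (a, b)) xs (c 0)" for xs
  have h: "length xs = length ys \<Longrightarrow> h xs = h ys \<Longrightarrow> xs = ys" for xs ys
    by (induct xs ys rule: list_induct2) (auto simp: h_def dest: injD[OF p])
  have "inj (\<lambda>xs. p (c (length xs), h xs))"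
    by (rule injI) (auto dest!: injD[OF p] injD[OF c] h)
  then show ?thesis by blast
qed

lemma ex_inj_pi:
  assumes "infinite (UNIV :: 'm set)" "finite I"
  shows "\<exists>f :: ('i \<Rightarrow> 'm) \<Rightarrow> 'm. inj_on f (\<Pi>\<^sub>E i\<in>I. A i)"
proof -
  obtain l :: "'m list \<Rightarrow> 'm" where l: "inj l" using ex_inj_list[OF assms(1)] by blast
  obtain xs where xs: "set xs = I" using finite_list[OF assms(2)] by blast
  have "inj_on (\<lambda>f. l (map f xs)) (\<Pi>\<^sub>E i\<in>I. A i)"
  proof (rule inj_onI)
    fix f g assume fg: "f \<in> (\<Pi>\<^sub>E i\<in>I. A i)" "g \<in> (\<Pi>\<^sub>E i\<in>I. A i)" "l (map f xs) = l (map g xs)"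
    have "map f xs = map g xs" using injD[OF l fg(3)] .
    then show "f = g" using xs by (intro PiE_ext[OF fg(1,2)]) auto
  qed
  then show ?thesis by blast
qed

text \<open>The function is recovered from the finite set of pairs (i, f i) with f i different from
  z, and a chosen enumeration of this set is a list.\<close>

lemma ex_inj_fin_supp:
  assumes "infinite (UNIV :: 'm set)" "inj (c :: 'i \<times> 'k \<Rightarrow> 'm)"
  shows "\<exists>f :: ('i \<Rightarrow> 'k) \<Rightarrow> 'm. inj_on f {f. finite {i. f i \<noteq> z}}"
proof -
  obtain l :: "'m list \<Rightarrow> 'm" where l: "inj l" using ex_inj_list[OF assms(1)] by blast
  let ?g = "\<lambda>f :: 'i \<Rightarrow> 'k. (\<lambda>i. (i, f i)) ` {i. f i \<noteq> z}"
  let ?L = "\<lambda>S. SOME xs. set xs = S"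
  have L: "set (?L S) = S" if "finite S" for S :: "('i \<times> 'k) set"
    using someI_ex[OF finite_list[OF that]] .
  have "inj_on (\<lambda>f. l (map c (?L (?g f)))) {f. finite {i. f i \<noteq> z}}"
  proof (rule inj_onI)
    fix f f' :: "'i \<Rightarrow> 'k"
    assume f: "f \<in> {f. finite {i. f i \<noteq> z}}" "f' \<in> {f. finite {i. f i \<noteq> z}}"
      and e: "l (map c (?L (?g f))) = l (map c (?L (?g f')))"
    have fin: "finite (?g f)" "finite (?g f')" using f by simp_all
    have "?L (?g f) = ?L (?g f')"
      using injD[OF l e] by (simp only: inj_map_eq_map[OF assms(2)])
    then have "set (?L (?g f)) = set (?L (?g f'))" by (rule arg_cong)
    then have eq: "?g f = ?g f'" by (simp only: L[OF fin(1)] L[OF fin(2)])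
    show "f = f'"
    proof
      fix i
      have "(i, f i) \<in> ?g f'" if "f i \<noteq> z" using eq[symmetric] that by auto
      moreover have "(i, f' i) \<in> ?g f" if "f' i \<noteq> z" using eq that by auto
      ultimately show "f i = f' i" by force
    qed
  qed
  then show ?thesis by blast
qed

section \<open>Stacked bases\<close>

definition fscale :: "'k::field \<Rightarrow> ('s \<Rightarrow> 'k) \<Rightarrow> ('s \<Rightarrow> 'k)"
  where "fscale c f = (\<lambda>s. c * f s)"

interpretation fv: vector_space fscale
  by unfold_locales (auto simp: fscale_def fun_eq_iff algebra_simps)

definition shift :: "('s \<Rightarrow> nat \<Rightarrow> 'k::zero) \<Rightarrow> ('s \<Rightarrow> nat \<Rightarrow> 'k)"
  where "shift f = (\<lambda>s l. case l of 0 \<Rightarrow> 0 | Suc m \<Rightarrow> f s m)"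

lemma shift_simps [simp]: "shift f s 0 = 0" "shift f s (Suc l) = f s l"
  by (simp_all add: shift_def)

lemma sum_fun_apply: "(\<Sum>x\<in>A. f x) s = (\<Sum>x\<in>A. f x s)"
  by (induct A rule: infinite_finite_induct) auto

lemma shift_pow: "(shift ^^ n) f s l = (if l < n then 0 else f s (l - n))"
proof (induct n arbitrary: l)
  case (Suc n) then show ?case by (cases l) auto
qed simp

text \<open>The functions \<open>'s \<Rightarrow> nat \<Rightarrow> 'k\<close> with finite support in the first argument form the free
  \<open>k[[y]]\<close>-module with basis \<open>'s\<close>, where \<open>y\<close> acts as \<open>shift\<close>.\<close>

definition fin_fun :: "'s set \<Rightarrow> ('s \<Rightarrow> nat \<Rightarrow> 'k::zero) set"
  where "fin_fun S = {f. finite {s. \<exists>l. f s l \<noteq> 0} \<and> {s. \<exists>l. f s l \<noteq> 0} \<subseteq> S}"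

lemma fin_funI:
  "finite U \<Longrightarrow> U \<subseteq> S \<Longrightarrow> (\<And>s l. f s l \<noteq> 0 \<Longrightarrow> s \<in> U) \<Longrightarrow> f \<in> fin_fun S"
  unfolding fin_fun_def by (blast intro: finite_subset)

lemma fin_fun_add: "f \<in> fin_fun S \<Longrightarrow> g \<in> fin_fun S \<Longrightarrow> f + g \<in> fin_fun S"
  for f g :: "'s \<Rightarrow> nat \<Rightarrow> 'k::comm_monoid_add"
  by (rule fin_funI[of "{s. \<exists>l. f s l \<noteq> 0} \<union> {s. \<exists>l. g s l \<noteq> 0}"])
    (auto simp: fin_fun_def plus_fun_def)

lemma fin_fun_scale: "f \<in> fin_fun S \<Longrightarrow> (\<lambda>s l. a * f s l) \<in> fin_fun S"
  for f :: "'s \<Rightarrow> nat \<Rightarrow> 'k::field"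
  by (rule fin_funI[of "{s. \<exists>l. f s l \<noteq> 0}"]) (auto simp: fin_fun_def)

lemma fin_fun_shift: "f \<in> fin_fun S \<Longrightarrow> shift f \<in> fin_fun S"
  by (rule fin_funI[of "{s. \<exists>l. f s l \<noteq> 0}"]) (auto simp: fin_fun_def shift_def split: nat.splits)

lemma fin_fun_zero: "0 \<in> fin_fun S"
  by (rule fin_funI[of "{}"]) auto

text \<open>A k[y]-submodule G of the free k[[y]]-module F = \<open>fin_fun S\<close> that contains
  y^q F. The rank may be infinite.\<close>

locale shift_lattice =
  fixes S :: "'s set" and G :: "('s \<Rightarrow> nat \<Rightarrow> 'k::field) set" and q :: nat
  assumes G_sub: "G \<subseteq> fin_fun S"
    and G_zero: "0 \<in> G"
    and G_add: "f \<in> G \<Longrightarrow> g \<in> G \<Longrightarrow> f + g \<in> G"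
    and G_scale: "f \<in> G \<Longrightarrow> (\<lambda>s l. a * f s l) \<in> G"
    and G_shift: "f \<in> G \<Longrightarrow> shift f \<in> G"
    and G_pow: "f \<in> fin_fun S \<Longrightarrow> (shift ^^ q) f \<in> G"
begin

text \<open>Increasing bases of \<open>lead 0 \<subseteq> lead 1 \<subseteq> \<dots>\<close> lift to elements \<open>gen b\<close> of the free module such that
  the \<open>y^(ht b) gen b\<close> generate \<open>G\<close>.\<close>

definition lead :: "nat \<Rightarrow> ('s \<Rightarrow> 'k) set"
  where "lead i = {(\<lambda>s. f s 0) |f. f \<in> fin_fun S \<and> (shift ^^ i) f \<in> G}"

lemma shift_pow_add: "(shift ^^ i) (f + g) = (shift ^^ i) f + (shift ^^ i) (g :: 's \<Rightarrow> nat \<Rightarrow> 'k)"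
  by (auto simp: fun_eq_iff shift_pow)

lemma lead_Suc: "lead i \<subseteq> lead (Suc i)"
  unfolding lead_def using G_shift by auto

lemma lead_q: "f \<in> fin_fun S \<Longrightarrow> (\<lambda>s. f s 0) \<in> lead q"
  unfolding lead_def using G_pow by blast

text \<open>Each basis contains the previous one, so that a basis vector b has a well-defined first
  level \<open>ht b\<close>.\<close>

lemma ex_chain:
  "\<exists>Bs. \<forall>i. (fv.independent (Bs i) \<and> Bs i \<subseteq> lead i \<and> lead i \<subseteq> fv.span (Bs i)) \<and> Bs i \<subseteq> Bs (Suc i)"
proof (rule dependent_nat_choice[where Q = "\<lambda>i B B'. B \<subseteq> B'"])
  obtain B where "B \<subseteq> lead 0" "fv.independent B" "lead 0 \<subseteq> fv.span B"
    by (rule fv.maximal_independent_subset)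
  then show "\<exists>B. fv.independent B \<and> B \<subseteq> lead 0 \<and> lead 0 \<subseteq> fv.span B" by blast
  fix B i assume B: "fv.independent B \<and> B \<subseteq> lead i \<and> lead i \<subseteq> fv.span B"
  have "B \<subseteq> lead (Suc i)" using B lead_Suc by blast
  with B obtain B' where "B \<subseteq> B'" "B' \<subseteq> lead (Suc i)" "fv.independent B'" "lead (Suc i) \<subseteq> fv.span B'"
    by (metis fv.maximal_independent_subset_extend)
  then show "\<exists>B'. (fv.independent B' \<and> B' \<subseteq> lead (Suc i) \<and> lead (Suc i) \<subseteq> fv.span B') \<and> B \<subseteq> B'"
    by blast
qed

definition chain :: "nat \<Rightarrow> ('s \<Rightarrow> 'k) set"
  where "chain = (SOME Bs. \<forall>i. (fv.independent (Bs i) \<and> Bs i \<subseteq> lead i \<and> lead i \<subseteq> fv.span (Bs i))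
    \<and> Bs i \<subseteq> Bs (Suc i))"

lemma chain: "fv.independent (chain i)" "chain i \<subseteq> lead i" "lead i \<subseteq> fv.span (chain i)"
  and chain_Suc: "chain i \<subseteq> chain (Suc i)"
  using someI_ex[OF ex_chain] unfolding chain_def by blast+

lemma chain_mono: "i \<le> j \<Longrightarrow> chain i \<subseteq> chain j"
  using lift_Suc_mono_le[of chain] chain_Suc by blast

text \<open>By \<open>lead_q\<close> this is a basis over k of the space of all constant terms; its
  lifts \<open>gen b\<close> are a basis of F over k[[y]].\<close>

definition base :: "('s \<Rightarrow> 'k) set" where "base = chain q"

definition ht :: "('s \<Rightarrow> 'k) \<Rightarrow> nat" where "ht b = (LEAST i. b \<in> chain i)"

lemma ht_le: "b \<in> chain i \<Longrightarrow> ht b \<le> i"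
  unfolding ht_def by (rule Least_le)

lemma ht_chain: "b \<in> base \<Longrightarrow> b \<in> chain (ht b)"
  unfolding ht_def base_def by (rule LeastI)

lemma ht_le_q: "b \<in> base \<Longrightarrow> ht b \<le> q"
  by (simp add: base_def ht_le)

definition gen :: "('s \<Rightarrow> 'k) \<Rightarrow> ('s \<Rightarrow> nat \<Rightarrow> 'k)"
  where "gen b = (SOME f. f \<in> fin_fun S \<and> (shift ^^ ht b) f \<in> G \<and> b = (\<lambda>s. f s 0))"

lemma gen:
  assumes "b \<in> base"
  shows "gen b \<in> fin_fun S" "(shift ^^ ht b) (gen b) \<in> G" "gen b s 0 = b s"
proof -
  have "b \<in> lead (ht b)" using ht_chain[OF assms] chain(2) by blast
  then have "\<exists>f. f \<in> fin_fun S \<and> (shift ^^ ht b) f \<in> G \<and> b = (\<lambda>s. f s 0)"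
    unfolding lead_def by blast
  from someI_ex[OF this] have *: "gen b \<in> fin_fun S \<and> (shift ^^ ht b) (gen b) \<in> G \<and> b = (\<lambda>s. gen b s 0)"
    unfolding gen_def .
  then show "gen b \<in> fin_fun S" "(shift ^^ ht b) (gen b) \<in> G" by blast+
  show "gen b s 0 = b s" using * by metis
qed

lemma G_shift_pow: "f \<in> G \<Longrightarrow> (shift ^^ n) f \<in> G"
  by (induct n) (auto intro: G_shift)

lemma gen_pow_G: "b \<in> base \<Longrightarrow> ht b \<le> i \<Longrightarrow> (shift ^^ i) (gen b) \<in> G"
  using G_shift_pow[OF gen(2), of b "i - ht b"] by (simp flip: funpow_add comp_apply[of "shift ^^ (i - ht b)"])

definition rep :: "('s \<Rightarrow> nat \<Rightarrow> 'k) \<Rightarrow> ('s \<Rightarrow> 'k) \<Rightarrow> 'k"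
  where "rep f = fv.representation base (\<lambda>s. f s 0)"

lemma lead_span: "f \<in> fin_fun S \<Longrightarrow> (\<lambda>s. f s 0) \<in> fv.span base"
  using lead_q chain(3) unfolding base_def by blast

lemma indep: "fv.independent base" unfolding base_def by (rule chain)

lemma rep_add: "f \<in> fin_fun S \<Longrightarrow> g \<in> fin_fun S \<Longrightarrow> rep (f + g) b = rep f b + rep g b"
  using fv.representation_add[OF indep lead_span lead_span, of g f]
  by (simp add: rep_def plus_fun_def add.commute)

lemma rep_scale: "f \<in> fin_fun S \<Longrightarrow> rep (\<lambda>s l. a * f s l) b = a * rep f b"
  using fv.representation_scale[OF indep lead_span, of f a]
  by (simp add: rep_def fscale_def)

lemma rep_base: "rep f b \<noteq> 0 \<Longrightarrow> b \<in> base"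
  unfolding rep_def by (rule fv.representation_ne_zero)

lemma rep_finite: "finite {b. rep f b \<noteq> 0}"
  unfolding rep_def by (rule fv.finite_representation)

lemma rep_sum: "f \<in> fin_fun S \<Longrightarrow> (\<Sum>b | rep f b \<noteq> 0. rep f b * b s) = f s 0"
  using fv.sum_nonzero_representation_eq[OF indep lead_span, of f]
  unfolding rep_def fscale_def fun_eq_iff by (auto simp: sum_fun_apply)

text \<open>The constant term of f lies in \<open>lead i\<close>, hence in the span of
  \<open>chain i\<close>, and coefficients in this part of the basis agree with those in
  \<open>base\<close>. Beyond q the bound on heights takes over.\<close>

lemma rep_ht:
  assumes "f \<in> fin_fun S" "(shift ^^ i) f \<in> G" "rep f b \<noteq> 0"
  shows "ht b \<le> i"
proof (cases "i \<le> q")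
  case True
  have "(\<lambda>s. f s 0) \<in> fv.span (chain i)"
    using assms(1,2) chain(3) unfolding lead_def by blast
  then have "fv.representation base (\<lambda>s. f s 0) = fv.representation (chain i) (\<lambda>s. f s 0)"
    by (rule fv.representation_extend[OF indep]) (simp add: base_def chain_mono True)
  with assms(3) have "b \<in> chain i"
    unfolding rep_def by (auto intro: fv.representation_ne_zero)
  then show ?thesis by (rule ht_le)
next
  case False
  then show ?thesis using ht_le_q[OF rep_base[OF assms(3)]] by simp
qed

definition comb :: "('s \<Rightarrow> nat \<Rightarrow> 'k) \<Rightarrow> ('s \<Rightarrow> nat \<Rightarrow> 'k)"
  where "comb f = (\<lambda>s l. \<Sum>b | rep f b \<noteq> 0. rep f b * gen b s l)"

lemma comb_superset:
  "finite U \<Longrightarrow> {b. rep f b \<noteq> 0} \<subseteq> U \<Longrightarrow> comb f s l = (\<Sum>b\<in>U. rep f b * gen b s l)"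
  unfolding comb_def by (rule sum.mono_neutral_left) auto

lemma comb_add:
  assumes "f \<in> fin_fun S" "g \<in> fin_fun S"
  shows "comb (f + g) s l = comb f s l + comb g s l"
proof -
  let ?U = "{b. rep f b \<noteq> 0} \<union> {b. rep g b \<noteq> 0}"
  have U: "finite ?U" by (simp add: rep_finite)
  have "comb (f + g) s l = (\<Sum>b\<in>?U. rep (f + g) b * gen b s l)"
    by (rule comb_superset[OF U]) (auto simp: rep_add[OF assms])
  also have "\<dots> = (\<Sum>b\<in>?U. rep f b * gen b s l) + (\<Sum>b\<in>?U. rep g b * gen b s l)"
    by (simp add: rep_add[OF assms] algebra_simps sum.distrib)
  also have "\<dots> = comb f s l + comb g s l"
    using comb_superset[OF U, of f s l] comb_superset[OF U, of g s l] by auto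
  finally show ?thesis .
qed

lemma comb_scale:
  assumes "f \<in> fin_fun S"
  shows "comb (\<lambda>s l. a * f s l) s l = a * comb f s l"
proof -
  have "comb (\<lambda>s l. a * f s l) s l = (\<Sum>b | rep f b \<noteq> 0. rep (\<lambda>s l. a * f s l) b * gen b s l)"
    by (rule comb_superset[OF rep_finite]) (auto simp: rep_scale[OF assms])
  then show ?thesis
    by (simp add: rep_scale[OF assms] comb_def sum_distrib_left mult.assoc)
qed

lemma comb_fin_fun: "comb f \<in> fin_fun S"
proof (rule fin_funI)
  let ?U = "\<Union>b\<in>{b. rep f b \<noteq> 0}. {s. \<exists>l. gen b s l \<noteq> 0}"
  have *: "finite {s. \<exists>l. gen b s l \<noteq> 0} \<and> {s. \<exists>l. gen b s l \<noteq> 0} \<subseteq> S" if "rep f b \<noteq> 0" for b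
    using gen(1)[OF rep_base[OF that]] unfolding fin_fun_def by blast
  show "finite ?U" using * rep_finite by blast
  show "?U \<subseteq> S" using * by blast
  show "s \<in> ?U" if "comb f s l \<noteq> 0" for s l
  proof -
    from that obtain b where "b \<in> {b. rep f b \<noteq> 0}" "rep f b * gen b s l \<noteq> 0"
      unfolding comb_def by (meson sum.neutral)
    then show ?thesis by auto
  qed
qed

text \<open>\<open>red\<close> divides by \<open>y\<close> what is left of \<open>f\<close> after subtracting the combination of
  generators with the same constant term.\<close>

definition red :: "('s \<Rightarrow> nat \<Rightarrow> 'k) \<Rightarrow> ('s \<Rightarrow> nat \<Rightarrow> 'k)"
  where "red f = (\<lambda>s l. f s (Suc l) - comb f s (Suc l))"

lemma red_fin_fun:
  assumes "f \<in> fin_fun S"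
  shows "red f \<in> fin_fun S"
  by (rule fin_funI[of "{s. \<exists>l. f s l \<noteq> 0} \<union> {s. \<exists>l. comb f s l \<noteq> 0}"])
    (use assms comb_fin_fun[of f] in \<open>auto simp: fin_fun_def red_def\<close>)

lemma red_pow_fin_fun: "f \<in> fin_fun S \<Longrightarrow> (red ^^ n) f \<in> fin_fun S"
  by (induct n) (auto intro: red_fin_fun)

lemma red_add: "f \<in> fin_fun S \<Longrightarrow> g \<in> fin_fun S \<Longrightarrow> red (f + g) = red f + red g"
  by (auto simp: red_def comb_add fun_eq_iff)

lemma red_scale: "f \<in> fin_fun S \<Longrightarrow> red (\<lambda>s l. a * f s l) = (\<lambda>s l. a * red f s l)"
  by (auto simp: red_def comb_scale fun_eq_iff algebra_simps)

lemma rep_shift: "rep (shift f) b = 0"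
proof -
  have "(\<lambda>s. shift f s 0) = 0" by auto
  then show ?thesis by (simp add: rep_def fv.representation_zero)
qed

lemma red_shift: "red (shift f) = f"
  by (auto simp: red_def comb_def rep_shift fun_eq_iff)

lemma red_decomp: "f \<in> fin_fun S \<Longrightarrow> f s l = comb f s l + shift (red f) s l"
proof (cases l)
  case 0
  assume f: "f \<in> fin_fun S"
  have "comb f s 0 = (\<Sum>b | rep f b \<noteq> 0. rep f b * b s)"
    unfolding comb_def using gen(3) rep_base by (intro sum.cong) auto
  with rep_sum[OF f] 0 show ?thesis by simp
next
  case (Suc m)
  then show ?thesis by (simp add: red_def)
qed

text \<open>\<open>red\<close> peels off one power of y, so this is the coefficient of y^l
  \<open>gen b\<close> in the expansion of f in the basis \<open>gen\<close>; compare
  \<open>coord_expansion\<close>.\<close>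

definition coord :: "nat \<Rightarrow> ('s \<Rightarrow> nat \<Rightarrow> 'k) \<Rightarrow> ('s \<Rightarrow> 'k) \<Rightarrow> 'k"
  where "coord l f = rep ((red ^^ l) f)"

lemma coord_finite: "finite {b. coord l f b \<noteq> 0}"
  unfolding coord_def by (rule rep_finite)

lemma coord_base: "coord l f b \<noteq> 0 \<Longrightarrow> b \<in> base"
  unfolding coord_def by (rule rep_base)

lemma red_pow_add: "f \<in> fin_fun S \<Longrightarrow> g \<in> fin_fun S \<Longrightarrow> (red ^^ n) (f + g) = (red ^^ n) f + (red ^^ n) g"
  by (induct n) (auto simp: red_add red_pow_fin_fun)

lemma red_pow_scale: "f \<in> fin_fun S \<Longrightarrow> (red ^^ n) (\<lambda>s l. a * f s l) = (\<lambda>s l. a * (red ^^ n) f s l)"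
  by (induct n) (auto simp: red_scale red_pow_fin_fun)

lemma coord_add: "f \<in> fin_fun S \<Longrightarrow> g \<in> fin_fun S \<Longrightarrow> coord l (f + g) b = coord l f b + coord l g b"
  by (simp add: coord_def red_pow_add rep_add red_pow_fin_fun)

lemma coord_scale: "f \<in> fin_fun S \<Longrightarrow> coord l (\<lambda>s l. a * f s l) b = a * coord l f b"
  by (simp add: coord_def red_pow_scale rep_scale red_pow_fin_fun)

lemma coord_shift_0: "coord 0 (shift f) b = 0"
  by (simp add: coord_def rep_shift)

lemma coord_shift_Suc: "coord (Suc l) (shift f) b = coord l f b"
  by (simp add: coord_def red_shift funpow_Suc_right del: funpow.simps)

lemma coord_shift_pow: "l < n \<Longrightarrow> coord l ((shift ^^ n) f) b = 0"
proof (induct n arbitrary: l)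
  case (Suc n)
  then show ?case by (cases l) (auto simp: coord_shift_0 coord_shift_Suc)
qed simp

lemma G_diff: "f \<in> G \<Longrightarrow> g \<in> G \<Longrightarrow> f - g \<in> G"
proof -
  assume *: "f \<in> G" "g \<in> G"
  have eq: "f - g = f + (\<lambda>s l. (-1) * g s l)" by (auto simp: fun_eq_iff)
  show ?thesis unfolding eq by (intro G_add G_scale *)
qed

lemma G_sum: "finite U \<Longrightarrow> (\<And>b. b \<in> U \<Longrightarrow> h b \<in> G) \<Longrightarrow> (\<lambda>s l. \<Sum>b\<in>U. a b * h b s l) \<in> G"
proof (induct set: finite)
  case empty then show ?case using G_zero by (simp add: zero_fun_def)
next
  case (insert x U)
  then have "(\<lambda>s l. a x * h x s l) + (\<lambda>s l. \<Sum>b\<in>U. a b * h b s l) \<in> G"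
    by (intro G_add G_scale) auto
  with insert show ?case by (simp add: plus_fun_def)
qed

text \<open>If y^i f is in G, then so is y^i \<open>comb f\<close>, because the generators occurring
  in it have height at most i. The difference is y^(i+1) \<open>red f\<close>, so the induction
  continues with \<open>red f\<close> and i + 1.\<close>

lemma coord_G_aux:
  "f \<in> fin_fun S \<Longrightarrow> (shift ^^ i) f \<in> G \<Longrightarrow> coord l f b \<noteq> 0 \<Longrightarrow> ht b \<le> i + l"
proof (induct l arbitrary: f i)
  case 0
  then show ?case using rep_ht by (auto simp: coord_def)
next
  case (Suc l)
  have "(shift ^^ i) (comb f) = (\<lambda>s l. \<Sum>b | rep f b \<noteq> 0. rep f b * (shift ^^ i) (gen b) s l)"
    by (auto simp: fun_eq_iff shift_pow comb_def)
  moreover have "\<dots> \<in> G"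
    using rep_base rep_ht[OF Suc.prems(1,2)] by (intro G_sum rep_finite gen_pow_G) auto
  ultimately have "(shift ^^ i) f - (shift ^^ i) (comb f) \<in> G"
    using G_diff Suc.prems(2) by simp
  also have "(shift ^^ i) f - (shift ^^ i) (comb f) = (shift ^^ Suc i) (red f)"
  proof -
    have "f = comb f + shift (red f)"
      by (intro ext) (simp only: plus_fun_apply red_decomp[OF Suc.prems(1), symmetric])
    then have "(shift ^^ i) f = (shift ^^ i) (comb f + shift (red f))"
      by (rule arg_cong)
    then have "(shift ^^ i) f = (shift ^^ i) (comb f) + (shift ^^ i) (shift (red f))"
      by (simp only: shift_pow_add)
    then show ?thesis by (simp add: funpow_Suc_right del: funpow.simps)
  qed
  finally have "(shift ^^ Suc i) (red f) \<in> G" .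
  from Suc.hyps[OF red_fin_fun[OF Suc.prems(1)] this] Suc.prems(3)
  show ?case by (simp add: coord_def funpow_Suc_right del: funpow.simps)
qed

lemma coord_G: "f \<in> G \<Longrightarrow> coord l f b \<noteq> 0 \<Longrightarrow> ht b \<le> l"
  using coord_G_aux[of f 0 l b] G_sub by auto

text \<open>An exact expansion with a remainder divisible by y^n, which avoids infinite sums: the
  modules to which it is applied are annihilated by y^q.\<close>

lemma coord_expansion:
  assumes "f \<in> fin_fun S"
  shows "f = (\<lambda>s m. (\<Sum>l<n. \<Sum>b | coord l f b \<noteq> 0. coord l f b * (shift ^^ l) (gen b) s m)
    + (shift ^^ n) ((red ^^ n) f) s m)"
proof (induct n)
  case (Suc n)
  let ?g = "(red ^^ n) f"
  have "?g = comb ?g + shift (red ?g)"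
    by (intro ext) (simp only: plus_fun_apply red_decomp[OF red_pow_fin_fun[OF assms], symmetric])
  then have "(shift ^^ n) ?g = (shift ^^ n) (comb ?g + shift (red ?g))"
    by (rule arg_cong)
  also have "\<dots> = (shift ^^ n) (comb ?g) + (shift ^^ n) (shift (red ?g))"
    by (rule shift_pow_add)
  also have "(shift ^^ n) (comb ?g) = (\<lambda>s m. \<Sum>b | coord n f b \<noteq> 0. coord n f b * (shift ^^ n) (gen b) s m)"
    by (auto simp: fun_eq_iff shift_pow comb_def coord_def)
  finally have "(shift ^^ n) ?g s m = (\<Sum>b | coord n f b \<noteq> 0. coord n f b * (shift ^^ n) (gen b) s m)
    + (shift ^^ Suc n) ((red ^^ Suc n) f) s m" for s m
    by (simp add: funpow_swap1 plus_fun_def)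
  then show ?case
    using Suc by (simp add: add.assoc del: funpow.simps)
qed simp

end

section \<open>The functor of string-type generators\<close>

datatype knd = KR | KU | KV

declare split_paired_All [simp del] split_paired_Ex [simp del]

type_synonym idx = "knd \<times> nat \<times> nat"

locale strings =
  fixes q :: nat
  assumes q_pos: "0 < q"
begin

text \<open>\<open>(KR, i, j)\<close> with \<open>i \<le> j < q\<close> is a basis of the ideal \<open>(y^i)\<close> of \<open>k[y]/(y^q)\<close>, and the
  \<open>(KU, i, j)\<close> with \<open>i \<le> j < q\<close> together with the \<open>(KV, i, j)\<close> with \<open>j < q\<close> are the basis
  \<open>y^j\<close> and \<open>x y^j\<close> of the ideal \<open>(x, y^i)\<close> of \<open>k[x,y]/(x^2, y^q)\<close>.\<close>

definition T :: "idx set"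
  where "T = {(c, i, j). i < q \<and> j < q \<and> (c \<noteq> KV \<longrightarrow> i \<le> j)}"

definition eta :: "idx \<Rightarrow> idx" where "eta = (\<lambda>(c, i, j). (c, i, Suc j))"

text \<open>Indices \<open>t\<close> with \<open>x t = 0\<close> are sent outside of \<open>T\<close>.\<close>

definition xi :: "idx \<Rightarrow> idx" where "xi = (\<lambda>(c, i, j). (KV, if c = KU then i else q, j))"

text \<open>\<open>rowY\<close> and \<open>rowX\<close> are multiplication by y and x on coefficient
  vectors in the basis T: the coefficient at y t is the old coefficient at t. The test against q
  expresses y^q = 0.\<close>

definition rowY :: "(idx \<Rightarrow> 'k::zero) \<Rightarrow> idx \<Rightarrow> 'k"
  where "rowY f = (\<lambda>(c, i, j). case j of 0 \<Rightarrow> 0 | Suc l \<Rightarrow> if j < q then f (c, i, l) else 0)"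

definition rowX :: "(idx \<Rightarrow> 'k::zero) \<Rightarrow> idx \<Rightarrow> 'k"
  where "rowX f = (\<lambda>(c, i, j). if c = KV then f (KU, i, j) else 0)"

lemma T_iff [simp]: "(c, i, j) \<in> T \<longleftrightarrow> i < q \<and> j < q \<and> (c \<noteq> KV \<longrightarrow> i \<le> j)"
  by (simp add: T_def)

lemma eta_simp [simp]: "eta (c, i, j) = (c, i, Suc j)" by (simp add: eta_def)

lemma xi_simp [simp]: "xi (c, i, j) = (KV, if c = KU then i else q, j)" by (simp add: xi_def)

lemma rowY_simp [simp]: "rowY f (c, i, 0) = 0" "rowY f (c, i, Suc l) = (if Suc l < q then f (c, i, l) else 0)"
  by (simp_all add: rowY_def)

lemma rowX_simp [simp]: "rowX f (c, i, j) = (if c = KV then f (KU, i, j) else 0)"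
  by (simp add: rowX_def)

lemma T_subset: "T \<subseteq> {KR, KU, KV} \<times> {..<q} \<times> {..<q}"
  using knd.exhaust by (auto simp: T_def)

lemma finite_T [simp]: "finite T"
  by (rule finite_subset[OF T_subset]) simp

definition Yv :: "('j \<Rightarrow> idx \<Rightarrow> 'k::zero) \<Rightarrow> 'j \<Rightarrow> idx \<Rightarrow> 'k" where "Yv f = (\<lambda>j. rowY (f j))"

definition Xv :: "('j \<Rightarrow> idx \<Rightarrow> 'k::zero) \<Rightarrow> 'j \<Rightarrow> idx \<Rightarrow> 'k" where "Xv f = (\<lambda>j. rowX (f j))"

definition vs :: "'k::times \<Rightarrow> ('j \<Rightarrow> idx \<Rightarrow> 'k) \<Rightarrow> 'j \<Rightarrow> idx \<Rightarrow> 'k" where "vs c f = (\<lambda>j t. c * f j t)"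

lemma Yv_simp [simp]: "Yv f j (c, i, 0) = 0" "Yv f j (c, i, Suc l) = (if Suc l < q then f j (c, i, l) else 0)"
  by (simp_all add: Yv_def)

lemma Xv_simp [simp]: "Xv f j (c, i, l) = (if c = KV then f j (KU, i, l) else 0)"
  by (simp add: Xv_def)

lemma vs_simp [simp]: "vs c f j t = c * f j t" by (simp add: vs_def)

text \<open>The direct sum D^(J) of copies of the module D with basis T, one for each element of
  J.\<close>

definition fs :: "'j set \<Rightarrow> ('j \<Rightarrow> idx \<Rightarrow> 'k::zero) set"
  where "fs J = {f. finite {j. f j \<noteq> 0} \<and> {j. f j \<noteq> 0} \<subseteq> J \<and> (\<forall>j t. t \<notin> T \<longrightarrow> f j t = 0)}"

lemma fsI:
  assumes "finite U" "U \<subseteq> J" "\<And>j t. f j t \<noteq> 0 \<Longrightarrow> j \<in> U \<and> t \<in> T"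
  shows "f \<in> fs J"
proof -
  have "{j. f j \<noteq> 0} \<subseteq> U" using assms(3) by (fastforce simp: fun_eq_iff)
  moreover have "f j t = 0" if "t \<notin> T" for j t using assms(3) that by blast
  ultimately show ?thesis unfolding fs_def using assms(1,2) finite_subset by blast
qed

lemma fsD:
  assumes "f \<in> fs J"
  shows "finite {j. f j \<noteq> 0}" "{j. f j \<noteq> 0} \<subseteq> J" "t \<notin> T \<Longrightarrow> f j t = 0" "f j t \<noteq> 0 \<Longrightarrow> j \<in> J"
    "f j t \<noteq> 0 \<Longrightarrow> f j \<noteq> 0" "f j t \<noteq> 0 \<Longrightarrow> t \<in> T"
proof -
  show "finite {j. f j \<noteq> 0}" and *: "{j. f j \<noteq> 0} \<subseteq> J" and "t \<notin> T \<Longrightarrow> f j t = 0" "f j t \<noteq> 0 \<Longrightarrow> t \<in> T"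
    using assms unfolding fs_def by blast+
  show "f j \<noteq> 0" if "f j t \<noteq> 0" using that by auto
  then show "j \<in> J" if "f j t \<noteq> 0" using * that by blast
qed

section \<open>Subspaces, the actions of x and y, and linear maps on sums of copies of D\<close>

definition lin_sub :: "('j \<Rightarrow> idx \<Rightarrow> 'k::field) set \<Rightarrow> bool"
  where "lin_sub X \<longleftrightarrow> 0 \<in> X \<and> (\<forall>v\<in>X. \<forall>w\<in>X. v + w \<in> X) \<and> (\<forall>c. \<forall>v\<in>X. vs c v \<in> X)"

lemma lin_subD:
  assumes "lin_sub X"
  shows "0 \<in> X" "v \<in> X \<Longrightarrow> w \<in> X \<Longrightarrow> v + w \<in> X" "v \<in> X \<Longrightarrow> vs c v \<in> X"
  using assms by (auto simp: lin_sub_def)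

lemma lin_sub_sum:
  assumes "lin_sub X" "\<And>i. i \<in> I \<Longrightarrow> v i \<in> X"
  shows "(\<lambda>j s. \<Sum>i\<in>I. c i * v i j s) \<in> X"
  using assms(2)
proof (induct I rule: infinite_finite_induct)
  case (insert i I)
  then have "vs (c i) (v i) + (\<lambda>j s. \<Sum>i\<in>I. c i * v i j s) \<in> X"
    by (intro lin_subD[OF assms(1)]) auto
  also have "vs (c i) (v i) + (\<lambda>j s. \<Sum>i\<in>I. c i * v i j s) = (\<lambda>j s. \<Sum>i\<in>insert i I. c i * v i j s)"
    using insert by (auto simp: fun_eq_iff)
  finally show ?case .
qed (use lin_subD(1)[OF assms(1)] in \<open>auto simp: zero_fun_def\<close>)

lemma lin_sub_sum1:
  assumes "lin_sub X" "\<And>i. i \<in> I \<Longrightarrow> v i \<in> X"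
  shows "(\<lambda>j s. \<Sum>i\<in>I. v i j s) \<in> X"
  using lin_sub_sum[OF assms, where c = "\<lambda>_. 1"] by simp

lemma lin_sub_fs: "lin_sub (fs J :: ('j \<Rightarrow> idx \<Rightarrow> 'k::field) set)"
  unfolding lin_sub_def
proof (intro conjI ballI allI)
  show "(0 :: 'j \<Rightarrow> idx \<Rightarrow> 'k) \<in> fs J" by (rule fsI[of "{}"]) auto
  fix v :: "'j \<Rightarrow> idx \<Rightarrow> 'k" assume v: "v \<in> fs J"
  show "v + w \<in> fs J" if w: "w \<in> fs J" for w
  proof (rule fsI)
    show "finite ({j. v j \<noteq> 0} \<union> {j. w j \<noteq> 0})" "{j. v j \<noteq> 0} \<union> {j. w j \<noteq> 0} \<subseteq> J"
      using fsD(1,2)[OF v] fsD(1,2)[OF w] by auto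
    show "j \<in> {j. v j \<noteq> 0} \<union> {j. w j \<noteq> 0} \<and> t \<in> T" if "(v + w) j t \<noteq> 0" for j t
    proof -
      from that have "v j t \<noteq> 0 \<or> w j t \<noteq> 0" by auto
      then show ?thesis
      proof
        assume "v j t \<noteq> 0" then show ?thesis using fsD(5,6)[OF v, of j t] by simp
      next
        assume "w j t \<noteq> 0" then show ?thesis using fsD(5,6)[OF w, of j t] by simp
      qed
    qed
  qed
  show "vs c v \<in> fs J" for c
  proof (rule fsI)
    show "finite {j. v j \<noteq> 0}" "{j. v j \<noteq> 0} \<subseteq> J" by (rule fsD[OF v])+
    show "j \<in> {j. v j \<noteq> 0} \<and> t \<in> T" if "vs c v j t \<noteq> 0" for j t
      using fsD(5,6)[OF v, of j t] that by auto
  qed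
qed

lemma fs_Yv: "f \<in> fs J \<Longrightarrow> Yv f \<in> fs J"
proof (rule fsI)
  assume f: "f \<in> fs J"
  show "finite {j. f j \<noteq> 0}" "{j. f j \<noteq> 0} \<subseteq> J" using fsD(1,2)[OF f] by auto
  show "j \<in> {j. f j \<noteq> 0} \<and> t \<in> T" if "Yv f j t \<noteq> 0" for j t
  proof -
    obtain c i l where t: "t = (c, i, l)" by (cases t)
    have "l \<noteq> 0" using that t by (cases l) auto
    then obtain m where m: "l = Suc m" using not0_implies_Suc by blast
    with t that have "Suc m < q" "f j (c, i, m) \<noteq> 0" by (auto split: if_splits)
    then show ?thesis using fsD(5,6)[OF f, of j "(c, i, m)"] t m by auto
  qed
qed

lemma fs_Xv: "f \<in> fs J \<Longrightarrow> Xv f \<in> fs J"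
proof (rule fsI)
  assume f: "f \<in> fs J"
  show "finite {j. f j \<noteq> 0}" "{j. f j \<noteq> 0} \<subseteq> J" using fsD(1,2)[OF f] by auto
  show "j \<in> {j. f j \<noteq> 0} \<and> t \<in> T" if "Xv f j t \<noteq> 0" for j t
  proof -
    obtain c i l where t: "t = (c, i, l)" by (cases t)
    with that have "c = KV" "f j (KU, i, l) \<noteq> 0" by (auto split: if_splits)
    then show ?thesis using fsD(5,6)[OF f, of j "(KU, i, l)"] t by auto
  qed
qed

lemma Yv_add: "Yv (f + g) = Yv f + Yv (g :: 'j \<Rightarrow> idx \<Rightarrow> 'k::comm_monoid_add)"
proof (intro ext)
  fix j t show "Yv (f + g) j t = (Yv f + Yv g) j t"
    by (cases t; cases "snd (snd t)") auto
qed

lemma Xv_add: "Xv (f + g) = Xv f + Xv (g :: 'j \<Rightarrow> idx \<Rightarrow> 'k::comm_monoid_add)"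
  by (intro ext) (auto simp: Xv_def rowX_def split: prod.splits)

lemma Yv_zero: "Yv (0 :: 'j \<Rightarrow> idx \<Rightarrow> 'k::comm_monoid_add) = 0"
proof (intro ext)
  fix j t show "Yv 0 j t = (0 :: 'j \<Rightarrow> idx \<Rightarrow> 'k) j t"
    by (cases t; cases "snd (snd t)") auto
qed

lemma Xv_zero: "Xv (0 :: 'j \<Rightarrow> idx \<Rightarrow> 'k::comm_monoid_add) = 0"
  by (intro ext) (auto simp: Xv_def rowX_def split: prod.splits)

lemma Yv_sum: "Yv (\<lambda>j s. \<Sum>i\<in>I. c i * v i j s) = (\<lambda>j s. \<Sum>i\<in>I. c i * Yv (v i) j s)"
  for c :: "'i \<Rightarrow> 'k::field"
proof (intro ext)
  fix j t show "Yv (\<lambda>j s. \<Sum>i\<in>I. c i * v i j s) j t = (\<Sum>i\<in>I. c i * Yv (v i) j t)"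
    by (cases t; cases "snd (snd t)") auto
qed

lemma Xv_sum: "Xv (\<lambda>j s. \<Sum>i\<in>I. c i * v i j s) = (\<lambda>j s. \<Sum>i\<in>I. c i * Xv (v i) j s)"
  for c :: "'i \<Rightarrow> 'k::field"
  by (intro ext) (auto simp: Xv_def rowX_def split: prod.splits)

lemma Yv_vs: "Yv (vs c f) = vs c (Yv f)" for c :: "'k::field"
  using Yv_sum[where I = "{()}" and c = "\<lambda>_. c" and v = "\<lambda>_. f"] by (simp add: vs_def)

lemma Xv_vs: "Xv (vs c f) = vs c (Xv f)" for c :: "'k::field"
  using Xv_sum[where I = "{()}" and c = "\<lambda>_. c" and v = "\<lambda>_. f"] by (simp add: vs_def)

lemma Yv_pow: "(Yv ^^ n) f j (c, i, l) = (if l < n \<or> (n > 0 \<and> q \<le> l) then 0 else f j (c, i, l - n))"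
proof (induct n arbitrary: l)
  case (Suc n)
  then show ?case by (cases l) auto
qed simp

lemma Yv_pow_q: "(Yv ^^ q) f = 0"
  using q_pos by (auto simp: fun_eq_iff Yv_pow)

lemma Xv_Xv: "Xv (Xv f) = 0"
  by (auto simp: fun_eq_iff)

lemma Xv_Yv: "Xv (Yv f) = Yv (Xv f)"
proof (intro ext)
  fix j t show "Xv (Yv f) j t = Yv (Xv f) j t"
    by (cases t; cases "snd (snd t)") auto
qed

text \<open>Multiplication by y on coefficients is adjoint to the shift \<open>eta\<close> of
  indices. Indices that \<open>eta\<close> moves out of T contribute zero, as m vanishes
  there.\<close>

lemma sum_rowY:
  fixes d m :: "idx \<Rightarrow> 'k::field"
  assumes "\<And>t. t \<notin> T \<Longrightarrow> d t = 0" "\<And>t. t \<notin> T \<Longrightarrow> m t = 0"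
  shows "(\<Sum>t\<in>T. rowY d t * m t) = (\<Sum>t\<in>T. d t * m (eta t))"
proof -
  let ?T = "{t \<in> T. eta t \<in> T}"
  have inj: "inj_on eta ?T" by (rule inj_onI) auto
  have "(\<Sum>t\<in>T. d t * m (eta t)) = (\<Sum>t\<in>?T. d t * m (eta t))"
    using assms by (intro sum.mono_neutral_right) auto
  also have "\<dots> = (\<Sum>t\<in>?T. rowY d (eta t) * m (eta t))"
    by (rule sum.cong) (auto simp: T_def)
  also have "\<dots> = (\<Sum>t\<in>eta ` ?T. rowY d t * m t)"
    by (simp add: sum.reindex[OF inj])
  also have "\<dots> = (\<Sum>t\<in>T. rowY d t * m t)"
  proof (rule sum.mono_neutral_left)
    show "\<forall>t\<in>T - eta ` ?T. rowY d t * m t = 0"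
    proof
      fix t assume t: "t \<in> T - eta ` ?T"
      obtain c i j where cij: "t = (c, i, j)" by (cases t)
      show "rowY d t * m t = 0"
      proof (cases j)
        case (Suc l)
        have "(c, i, l) \<notin> T"
        proof
          assume "(c, i, l) \<in> T"
          then have "(c, i, l) \<in> ?T" using t cij Suc by auto
          from imageI[OF this, of eta] have "t \<in> eta ` ?T" using cij Suc by simp
          then show False using t by blast
        qed
        then show ?thesis using assms(1) cij Suc by simp
      qed (simp add: cij)
    qed
  qed auto
  finally show ?thesis by simp
qed

text \<open>As for y; only \<open>KU\<close> indices contribute, since \<open>xi\<close> sends all
  others outside of T, where m vanishes.\<close>

lemma sum_rowX:
  fixes d m :: "idx \<Rightarrow> 'k::field"
  assumes "\<And>t. t \<notin> T \<Longrightarrow> d t = 0" "\<And>t. t \<notin> T \<Longrightarrow> m t = 0"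
  shows "(\<Sum>t\<in>T. rowX d t * m t) = (\<Sum>t\<in>T. d t * m (xi t))"
proof -
  let ?T = "{t \<in> T. fst t = KU}"
  have inj: "inj_on xi ?T" by (rule inj_onI) auto
  have "(\<Sum>t\<in>T. d t * m (xi t)) = (\<Sum>t\<in>?T. d t * m (xi t))"
  proof (rule sum.mono_neutral_right)
    have "m (xi t) = 0" if "t \<in> T" "fst t \<noteq> KU" for t
      using that by (intro assms(2)) (cases t, auto)
    then show "\<forall>t\<in>T - ?T. d t * m (xi t) = 0" by auto
  qed auto
  also have "\<dots> = (\<Sum>t\<in>?T. rowX d (xi t) * m (xi t))"
    by (rule sum.cong) auto
  also have "\<dots> = (\<Sum>t\<in>xi ` ?T. rowX d t * m t)"
    by (simp add: sum.reindex[OF inj])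
  also have "\<dots> = (\<Sum>t\<in>T. rowX d t * m t)"
  proof (rule sum.mono_neutral_left)
    show "\<forall>t\<in>T - xi ` ?T. rowX d t * m t = 0"
    proof
      fix t assume t: "t \<in> T - xi ` ?T"
      obtain c i j where cij: "t = (c, i, j)" by (cases t)
      have "(KU, i, j) \<notin> T" if "c = KV"
      proof
        assume "(KU, i, j) \<in> T"
        then have "(KU, i, j) \<in> ?T" by simp
        then have "xi (KU, i, j) \<in> xi ` ?T" by (rule imageI)
        then show False using t cij that by simp
      qed
      then show "rowX d t * m t = 0" using assms(1) cij by auto
    qed
  qed auto
  finally show ?thesis by simp
qed

text \<open>Homomorphisms of k[x,y]-modules, so homomorphisms over A.\<close>

definition lin_map :: "('j \<Rightarrow> idx \<Rightarrow> 'k::field) set \<Rightarrow> ('i \<Rightarrow> idx \<Rightarrow> 'k) set \<Rightarrow>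
    (('j \<Rightarrow> idx \<Rightarrow> 'k) \<Rightarrow> ('i \<Rightarrow> idx \<Rightarrow> 'k)) \<Rightarrow> bool"
  where "lin_map X X' f \<longleftrightarrow> (\<forall>v\<in>X. f v \<in> X' \<and> f (Yv v) = Yv (f v) \<and> f (Xv v) = Xv (f v)
    \<and> (\<forall>c. f (vs c v) = vs c (f v)) \<and> (\<forall>w\<in>X. f (v + w) = f v + f w))"

lemma lin_mapD:
  assumes "lin_map X X' f" "v \<in> X"
  shows "f v \<in> X'" "f (Yv v) = Yv (f v)" "f (Xv v) = Xv (f v)" "f (vs c v) = vs c (f v)"
    "w \<in> X \<Longrightarrow> f (v + w) = f v + f w"
  using assms by (auto simp: lin_map_def)

lemma lin_map_zero: "lin_sub X \<Longrightarrow> lin_map X X' f \<Longrightarrow> f 0 = 0"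
  using lin_mapD(4)[of X X' f 0 0] lin_subD(1)[of X] by (auto simp: vs_def zero_fun_def)

lemma sum_insert_vs:
  fixes c :: "'i \<Rightarrow> 'k::field"
  assumes "finite I" "i \<notin> I"
  shows "(\<lambda>j s. \<Sum>i\<in>insert i I. c i * u i j s) = vs (c i) (u i) + (\<lambda>j s. \<Sum>i\<in>I. c i * u i j s)"
  using assms by (auto simp: fun_eq_iff)

lemma lin_map_sum:
  assumes "lin_sub X" "lin_map X X' f" "\<And>i. i \<in> I \<Longrightarrow> v i \<in> X"
  shows "f (\<lambda>j s. \<Sum>i\<in>I. c i * v i j s) = (\<lambda>j s. \<Sum>i\<in>I. c i * f (v i) j s)"
  using assms(3)
proof (induct I rule: infinite_finite_induct)
  case (insert i I)
  have "f (\<lambda>j s. \<Sum>i\<in>insert i I. c i * v i j s) = f (vs (c i) (v i) + (\<lambda>j s. \<Sum>i\<in>I. c i * v i j s))"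
    by (simp only: sum_insert_vs[OF insert(1,2)])
  also have "\<dots> = f (vs (c i) (v i)) + f (\<lambda>j s. \<Sum>i\<in>I. c i * v i j s)"
    by (intro lin_mapD(5)[OF assms(2)] lin_subD(3)[OF assms(1)] lin_sub_sum[OF assms(1)] insert.prems) auto
  also have "\<dots> = vs (c i) (f (v i)) + (\<lambda>j s. \<Sum>i\<in>I. c i * f (v i) j s)"
    using insert by (simp add: lin_mapD(4)[OF assms(2)])
  also have "\<dots> = (\<lambda>j s. \<Sum>i\<in>insert i I. c i * f (v i) j s)"
    using insert(1,2) by (auto simp: fun_eq_iff)
  finally show ?case .
qed (use lin_map_zero[OF assms(1,2)] in \<open>auto simp: zero_fun_def\<close>)

definition H :: "('j \<Rightarrow> idx \<Rightarrow> 'k::field) set \<Rightarrow> (idx \<Rightarrow> 'j \<Rightarrow> idx \<Rightarrow> 'k) set"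
  where "H X = {r. (\<forall>t\<in>T. r t \<in> X \<and> Yv (r t) = r (eta t) \<and> Xv (r t) = r (xi t)) \<and> (\<forall>t. t \<notin> T \<longrightarrow> r t = 0)}"

lemma HI:
  "(\<And>t. t \<in> T \<Longrightarrow> r t \<in> X) \<Longrightarrow> (\<And>t. t \<in> T \<Longrightarrow> Yv (r t) = r (eta t)) \<Longrightarrow>
   (\<And>t. t \<in> T \<Longrightarrow> Xv (r t) = r (xi t)) \<Longrightarrow> (\<And>t. t \<notin> T \<Longrightarrow> r t = 0) \<Longrightarrow> r \<in> H X"
  by (simp add: H_def)

lemma HD:
  assumes "r \<in> H X"
  shows "t \<in> T \<Longrightarrow> r t \<in> X" "t \<in> T \<Longrightarrow> Yv (r t) = r (eta t)" "t \<in> T \<Longrightarrow> Xv (r t) = r (xi t)"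
    "t \<notin> T \<Longrightarrow> r t = 0"
  using assms by (auto simp: H_def)

text \<open>Elements of \<open>H X\<close> are the homomorphisms to \<open>X\<close> from the module with basis \<open>T\<close>, so a family of
  them defines a homomorphism from a direct sum of copies of this module.\<close>

definition pair :: "('b \<Rightarrow> idx \<Rightarrow> 'j \<Rightarrow> idx \<Rightarrow> 'k::field) \<Rightarrow> ('b \<Rightarrow> idx \<Rightarrow> 'k) \<Rightarrow> ('j \<Rightarrow> idx \<Rightarrow> 'k)"
  where "pair M d = (\<lambda>j s. \<Sum>b | d b \<noteq> 0. \<Sum>t\<in>T. d b t * M b t j s)"

lemma pair_superset:
  "finite U \<Longrightarrow> {b. d b \<noteq> 0} \<subseteq> U \<Longrightarrow> pair M d j s = (\<Sum>b\<in>U. \<Sum>t\<in>T. d b t * M b t j s)"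
  unfolding pair_def
proof (rule sum.mono_neutral_left)
  assume "finite U" "{b. d b \<noteq> 0} \<subseteq> U"
  show "\<forall>b\<in>U - {b. d b \<noteq> 0}. (\<Sum>t\<in>T. d b t * M b t j s) = 0"
    by simp
qed

text \<open>By the adjointness in \<open>sum_rowY\<close> and \<open>sum_rowX\<close> the action on
  the coefficients d moves to the indices of M, where it is the action on values because each M b is
  a homomorphism.\<close>

lemma pair_lin_map:
  fixes M :: "'b \<Rightarrow> idx \<Rightarrow> 'j \<Rightarrow> idx \<Rightarrow> 'k::field"
  assumes "lin_sub X" "\<And>b. b \<in> B \<Longrightarrow> M b \<in> H X"
  shows "lin_map (fs B) X (pair M)"
  unfolding lin_map_def
proof (intro ballI conjI allI)
  fix v :: "'b \<Rightarrow> idx \<Rightarrow> 'k" assume v: "v \<in> fs B"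
  note vD = fsD[OF v]
  have vb: "b \<in> B" if "v b \<noteq> 0" for b using vD(2) that by auto
  show "pair M v \<in> X"
    unfolding pair_def using HD(1)[OF assms(2)] vb
    by (intro lin_sub_sum1[OF assms(1)] lin_sub_sum[OF assms(1)]) auto
  have M0: "M b t j s = 0" if "b \<in> B" "t \<notin> T" for b t j s
    using HD(4)[OF assms(2)] that by simp
  show "pair M (Yv v) = Yv (pair M v)"
  proof -
    have "pair M (Yv v) j s = (\<Sum>b | v b \<noteq> 0. \<Sum>t\<in>T. rowY (v b) t * M b t j s)" for j s
    proof -
      have "{b. Yv v b \<noteq> 0} \<subseteq> {b. v b \<noteq> 0}"
        by (auto simp: Yv_def rowY_def fun_eq_iff split: nat.splits if_splits)
      then show ?thesis
        using pair_superset[OF vD(1)] by (simp add: Yv_def)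
    qed
    moreover have "(\<Sum>t\<in>T. rowY (v b) t * M b t j s) = (\<Sum>t\<in>T. v b t * Yv (M b t) j s)" if "v b \<noteq> 0" for b j s
      using HD(2)[OF assms(2)[OF vb[OF that]]] M0[OF vb[OF that]]
      by (subst sum_rowY) (auto intro: vD(3))
    ultimately have "pair M (Yv v) = (\<lambda>j s. \<Sum>b | v b \<noteq> 0. 1 * (\<Sum>t\<in>T. v b t * Yv (M b t) j s))"
      by (auto simp: fun_eq_iff)
    also have "\<dots> = (\<lambda>j s. \<Sum>b | v b \<noteq> 0. 1 * Yv (\<lambda>j s. \<Sum>t\<in>T. v b t * M b t j s) j s)"
      unfolding Yv_sum ..
    also have "\<dots> = Yv (pair M v)"
      unfolding pair_def Yv_sum[symmetric] by simp
    finally show ?thesis .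
  qed
  show "pair M (Xv v) = Xv (pair M v)"
  proof -
    have "pair M (Xv v) j s = (\<Sum>b | v b \<noteq> 0. \<Sum>t\<in>T. rowX (v b) t * M b t j s)" for j s
    proof -
      have "{b. Xv v b \<noteq> 0} \<subseteq> {b. v b \<noteq> 0}"
        by (auto simp: Xv_def rowX_def fun_eq_iff split: if_splits)
      then show ?thesis
        using pair_superset[OF vD(1)] by (simp add: Xv_def)
    qed
    moreover have "(\<Sum>t\<in>T. rowX (v b) t * M b t j s) = (\<Sum>t\<in>T. v b t * Xv (M b t) j s)" if "v b \<noteq> 0" for b j s
      using HD(3)[OF assms(2)[OF vb[OF that]]] M0[OF vb[OF that]]
      by (subst sum_rowX) (auto intro: vD(3))
    ultimately have "pair M (Xv v) = (\<lambda>j s. \<Sum>b | v b \<noteq> 0. 1 * (\<Sum>t\<in>T. v b t * Xv (M b t) j s))"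
      by (auto simp: fun_eq_iff)
    also have "\<dots> = (\<lambda>j s. \<Sum>b | v b \<noteq> 0. 1 * Xv (\<lambda>j s. \<Sum>t\<in>T. v b t * M b t j s) j s)"
      unfolding Xv_sum ..
    also have "\<dots> = Xv (pair M v)"
      unfolding pair_def Xv_sum[symmetric] by simp
    finally show ?thesis .
  qed
  show "pair M (vs c v) = vs c (pair M v)" for c
  proof (intro ext)
    fix j s
    have *: "{b. vs c v b \<noteq> 0} \<subseteq> {b. v b \<noteq> 0}" by (auto simp: fun_eq_iff)
    show "pair M (vs c v) j s = vs c (pair M v) j s"
      using pair_superset[OF vD(1) *, of M j s] pair_superset[OF vD(1) order_refl, of M j s]
      by (simp add: sum_distrib_left mult.assoc)
  qed
  show "pair M (v + w) = pair M v + pair M w" if w: "w \<in> fs B" for w :: "'b \<Rightarrow> idx \<Rightarrow> 'k"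
  proof (intro ext)
    fix j s
    let ?U = "{b. v b \<noteq> 0} \<union> {b. w b \<noteq> 0}"
    have U: "finite ?U" using vD(1) fsD(1)[OF w] by simp
    have "{b. (v + w) b \<noteq> 0} \<subseteq> ?U" "{b. v b \<noteq> 0} \<subseteq> ?U" "{b. w b \<noteq> 0} \<subseteq> ?U"
      by auto
    note * = pair_superset[where d = "v + w", OF U this(1), of M j s]
      pair_superset[where d = v, OF U this(2), of M j s] pair_superset[where d = w, OF U this(3), of M j s]
    show "pair M (v + w) j s = (pair M v + pair M w) j s"
      unfolding plus_fun_apply[of "pair M v"] plus_fun_apply[of "pair M v j"] *
      by (simp add: algebra_simps sum.distrib)
  qed
qed

end

section \<open>Modules over the endomorphism ring\<close>

text \<open>\<open>\<mu> e\<close> is the matrix of \<open>e\<close> acting on columns indexed by \<open>T\<close>; the condition on its rows says that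
  \<open>e\<close> commutes with \<open>x\<close> and \<open>y\<close>.\<close>

locale mat_ring = strings q + E: ring E
  for q and E :: "('e, 'x) ring_scheme" +
  fixes \<mu> :: "'e \<Rightarrow> idx \<Rightarrow> idx \<Rightarrow> 'k::field"
  assumes \<mu>_bij: "bij_betw \<mu> (carrier E) {a. (\<forall>t. t \<notin> T \<longrightarrow> a t = 0) \<and> (\<forall>t t'. t' \<notin> T \<longrightarrow> a t t' = 0) \<and>
      (\<forall>t\<in>T. rowY (a t) = a (eta t) \<and> rowX (a t) = a (xi t))}"
    and \<mu>_add: "e \<in> carrier E \<Longrightarrow> f \<in> carrier E \<Longrightarrow> \<mu> (e \<oplus>\<^bsub>E\<^esub> f) t t' = \<mu> e t t' + \<mu> f t t'"
    and \<mu>_mult: "e \<in> carrier E \<Longrightarrow> f \<in> carrier E \<Longrightarrow> \<mu> (e \<otimes>\<^bsub>E\<^esub> f) t t' = (\<Sum>s\<in>T. \<mu> e t s * \<mu> f s t')"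
    and \<mu>_one: "\<mu> \<one>\<^bsub>E\<^esub> t t' = (if t = t' \<and> t \<in> T then 1 else 0)"
begin

lemma \<mu>D:
  assumes "e \<in> carrier E"
  shows "t \<notin> T \<Longrightarrow> \<mu> e t = 0" "t' \<notin> T \<Longrightarrow> \<mu> e t t' = 0"
    "t \<in> T \<Longrightarrow> rowY (\<mu> e t) = \<mu> e (eta t)" "t \<in> T \<Longrightarrow> rowX (\<mu> e t) = \<mu> e (xi t)"
  using bij_betwE[OF \<mu>_bij] assms by auto

definition \<nu> :: "(idx \<Rightarrow> idx \<Rightarrow> 'k) \<Rightarrow> 'e" where "\<nu> = the_inv_into (carrier E) \<mu>"

lemma \<nu>:
  assumes "\<And>t. t \<notin> T \<Longrightarrow> a t = 0" "\<And>t t'. t' \<notin> T \<Longrightarrow> a t t' = 0"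
    "\<And>t. t \<in> T \<Longrightarrow> rowY (a t) = a (eta t)" "\<And>t. t \<in> T \<Longrightarrow> rowX (a t) = a (xi t)"
  shows "\<nu> a \<in> carrier E" "\<mu> (\<nu> a) = a"
proof -
  have a: "a \<in> \<mu> ` carrier E"
    using assms unfolding bij_betw_imp_surj_on[OF \<mu>_bij] by simp
  then show "\<nu> a \<in> carrier E" "\<mu> (\<nu> a) = a"
    unfolding \<nu>_def using bij_betw_imp_inj_on[OF \<mu>_bij]
    by (auto intro!: the_inv_into_into f_the_inv_into_f)
qed

lemma \<mu>_eqI: "e \<in> carrier E \<Longrightarrow> f \<in> carrier E \<Longrightarrow> (\<And>t t'. \<mu> e t t' = \<mu> f t t') \<Longrightarrow> e = f"
  using bij_betw_imp_inj_on[OF \<mu>_bij] by (auto simp: inj_on_def fun_eq_iff)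

text \<open>Hom(D, X), with e acting by precomposition with the endomorphism of D that sends t to
  row t of \<open>\<mu> e\<close>. Matrix products correspond to composition in the reversed order,
  which makes this a left module.\<close>

definition HM :: "('j \<Rightarrow> idx \<Rightarrow> 'k) set \<Rightarrow> ('e, idx \<Rightarrow> 'j \<Rightarrow> idx \<Rightarrow> 'k) module"
  where "HM X = \<lparr>carrier = H X, monoid.mult = (+), one = 0, zero = 0, add = (+),
    smult = (\<lambda>e r t j s. \<Sum>t'\<in>T. \<mu> e t t' * r t' j s)\<rparr>"

lemma HM_simps [simp]:
  "carrier (HM X) = H X" "\<zero>\<^bsub>HM X\<^esub> = 0" "r \<oplus>\<^bsub>HM X\<^esub> r' = r + r'"
  "e \<odot>\<^bsub>HM X\<^esub> r = (\<lambda>t j s. \<Sum>t'\<in>T. \<mu> e t t' * r t' j s)"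
  by (simp_all add: HM_def)

lemma H_zero: "lin_sub X \<Longrightarrow> 0 \<in> H X"
  by (rule HI) (auto simp: lin_subD Yv_zero Xv_zero)

lemma H_add:
  assumes "lin_sub X" "r \<in> H X" "r' \<in> H X"
  shows "r + r' \<in> H X"
proof (rule HI)
  fix t
  show "(r + r') t = 0" if "t \<notin> T"
    by (simp only: plus_fun_apply HD(4)[OF assms(2) that] HD(4)[OF assms(3) that] add_0_right)
qed (use assms in \<open>auto simp: lin_subD HD Yv_add Xv_add\<close>)

lemma H_smult:
  assumes X: "lin_sub X" and e: "e \<in> carrier E" and r: "r \<in> H X"
  shows "(\<lambda>t j s. \<Sum>t'\<in>T. \<mu> e t t' * r t' j s) \<in> H X"
proof (rule HI)
  note e' = \<mu>D[OF e]
  show "(\<lambda>j s. \<Sum>t'\<in>T. \<mu> e t t' * r t' j s) \<in> X" for t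
    using HD(1)[OF r] by (intro lin_sub_sum[OF X]) auto
  show "(\<lambda>j s. \<Sum>t'\<in>T. \<mu> e t t' * r t' j s) = 0" if "t \<notin> T" for t
    using e'(1)[OF that] by (simp add: zero_fun_def)
  have r0: "r t j s = 0" if "t \<notin> T" for t j s using HD(4)[OF r that] by simp
  show "Yv (\<lambda>j s. \<Sum>t'\<in>T. \<mu> e t t' * r t' j s) = (\<lambda>j s. \<Sum>t'\<in>T. \<mu> e (eta t) t' * r t' j s)" if t: "t \<in> T" for t
  proof -
    have "(\<Sum>t'\<in>T. \<mu> e t t' * Yv (r t') j s) = (\<Sum>t'\<in>T. rowY (\<mu> e t) t' * r t' j s)" for j s
      using e'(2) r0 by (subst sum_rowY) (auto simp: HD(2)[OF r])
    then show ?thesis unfolding Yv_sum e'(3)[OF t] by simp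
  qed
  show "Xv (\<lambda>j s. \<Sum>t'\<in>T. \<mu> e t t' * r t' j s) = (\<lambda>j s. \<Sum>t'\<in>T. \<mu> e (xi t) t' * r t' j s)" if t: "t \<in> T" for t
  proof -
    have "(\<Sum>t'\<in>T. \<mu> e t t' * Xv (r t') j s) = (\<Sum>t'\<in>T. rowX (\<mu> e t) t' * r t' j s)" for j s
      using e'(2) r0 by (subst sum_rowX) (auto simp: HD(3)[OF r])
    then show ?thesis unfolding Xv_sum e'(4)[OF t] by simp
  qed
qed

lemma left_module_HM:
  assumes X: "lin_sub X"
  shows "left_module E (HM X)"
proof (rule left_moduleI)
  show "\<exists>y\<in>carrier (HM X). y \<oplus>\<^bsub>HM X\<^esub> r = \<zero>\<^bsub>HM X\<^esub>" if "r \<in> carrier (HM X)" for r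
  proof -
    have r: "r \<in> H X" using that by simp
    have "(\<lambda>t. vs (-1) (r t)) \<in> H X"
    proof (rule HI)
      show "vs (-1) (r t) \<in> X" if "t \<in> T" for t using HD(1)[OF r that] lin_subD(3)[OF X] by blast
      show "Yv (vs (-1) (r t)) = vs (-1) (r (eta t))" if "t \<in> T" for t
        by (simp add: Yv_vs HD(2)[OF r that])
      show "Xv (vs (-1) (r t)) = vs (-1) (r (xi t))" if "t \<in> T" for t
        by (simp add: Xv_vs HD(3)[OF r that])
      show "vs (-1) (r t) = 0" if "t \<notin> T" for t
        by (simp add: HD(4)[OF r that] fun_eq_iff)
    qed
    moreover have "(\<lambda>t. vs (-1) (r t)) + r = 0" by (simp add: fun_eq_iff)
    ultimately show ?thesis by (intro bexI[of _ "\<lambda>t. vs (-1) (r t)"]) auto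
  qed
  show "e \<otimes>\<^bsub>E\<^esub> f \<odot>\<^bsub>HM X\<^esub> r = e \<odot>\<^bsub>HM X\<^esub> (f \<odot>\<^bsub>HM X\<^esub> r)"
    if ef: "e \<in> carrier E" "f \<in> carrier E" and "r \<in> carrier (HM X)" for e f r
  proof (intro ext)
    fix t j s
    have "(\<Sum>t'\<in>T. (\<Sum>u\<in>T. \<mu> e t u * \<mu> f u t') * r t' j s) = (\<Sum>u\<in>T. \<mu> e t u * (\<Sum>t'\<in>T. \<mu> f u t' * r t' j s))"
      unfolding sum_distrib_left sum_distrib_right mult.assoc by (rule sum.swap)
    then show "(e \<otimes>\<^bsub>E\<^esub> f \<odot>\<^bsub>HM X\<^esub> r) t j s = (e \<odot>\<^bsub>HM X\<^esub> (f \<odot>\<^bsub>HM X\<^esub> r)) t j s"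
      by (simp add: \<mu>_mult[OF ef])
  qed
  show "\<one>\<^bsub>E\<^esub> \<odot>\<^bsub>HM X\<^esub> r = r" if "r \<in> carrier (HM X)" for r
  proof (intro ext)
    fix t j s
    have r: "r \<in> H X" using that by simp
    have "(\<Sum>t'\<in>T. \<mu> \<one>\<^bsub>E\<^esub> t t' * r t' j s) = (\<Sum>t'\<in>T. if t = t' then r t j s else 0)"
      by (rule sum.cong) (auto simp: \<mu>_one)
    also have "\<dots> = r t j s" using HD(4)[OF r, of t] by (cases "t \<in> T") auto
    finally show "(\<one>\<^bsub>E\<^esub> \<odot>\<^bsub>HM X\<^esub> r) t j s = r t j s" by simp
  qed
  show "e \<odot>\<^bsub>HM X\<^esub> r \<in> carrier (HM X)" if "e \<in> carrier E" "r \<in> carrier (HM X)" for e r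
    using H_smult[OF X] that by simp
qed (use H_zero[OF X] H_add[OF X] in \<open>auto simp: E.ring_axioms add_ac \<mu>_add distrib_right distrib_left
    sum.distrib fun_eq_iff\<close>)

lemma post_hom:
  assumes "lin_sub X" "lin_sub X'" "lin_map X X' f"
  shows "(\<lambda>r t. f (r t)) \<in> module_homs E (HM X) (HM X')"
proof (rule module_homsI)
  have r0: "r t \<in> X" if "r \<in> H X" for r t
    using HD(1,4)[OF that, of t] lin_subD(1)[OF assms(1)] by (cases "t \<in> T") auto
  show "(\<lambda>t. f (r t)) \<in> carrier (HM X')" if "r \<in> carrier (HM X)" for r
  proof -
    have r: "r \<in> H X" using that by simp
    have "(\<lambda>t. f (r t)) \<in> H X'"
    proof (rule HI)
      fix t
      show "f (r t) \<in> X'" using lin_mapD(1)[OF assms(3) r0[OF r]] .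
      show "f (r t) = 0" if "t \<notin> T" using HD(4)[OF r that] lin_map_zero[OF assms(1,3)] by simp
      assume "t \<in> T"
      show "Yv (f (r t)) = f (r (eta t))"
        using lin_mapD(2)[OF assms(3) r0[OF r]] HD(2)[OF r \<open>t \<in> T\<close>] by metis
      show "Xv (f (r t)) = f (r (xi t))"
        using lin_mapD(3)[OF assms(3) r0[OF r]] HD(3)[OF r \<open>t \<in> T\<close>] by metis
    qed
    then show ?thesis by simp
  qed
  show "(\<lambda>t. f ((r \<oplus>\<^bsub>HM X\<^esub> r') t)) = (\<lambda>t. f (r t)) \<oplus>\<^bsub>HM X'\<^esub> (\<lambda>t. f (r' t))"
    if "r \<in> carrier (HM X)" "r' \<in> carrier (HM X)" for r r'
    using lin_mapD(5)[OF assms(3) r0 r0, of r r'] that by (simp add: plus_fun_def)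
  show "(\<lambda>t. f ((e \<odot>\<^bsub>HM X\<^esub> r) t)) = e \<odot>\<^bsub>HM X'\<^esub> (\<lambda>t. f (r t))"
    if "e \<in> carrier E" "r \<in> carrier (HM X)" for e r
    using lin_map_sum[OF assms(1,3), of T r] r0[of r] that by simp
qed

lemma lifting_HM_retract:
  fixes X :: "('j \<Rightarrow> idx \<Rightarrow> 'k) set" and B :: "'b set"
  assumes "lin_sub X" "lin_map X (fs B) \<sigma>" "lin_map (fs B) X \<pi>" "\<And>v. v \<in> X \<Longrightarrow> \<pi> (\<sigma> v) = v"
    and "lifting TYPE('m) E (HM (fs B))"
  shows "lifting TYPE('m) E (HM X)"
proof (rule lifting_retract[OF assms(5) post_hom[OF assms(1) lin_sub_fs assms(2)] post_hom[OF lin_sub_fs assms(1,3)]])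
  fix r assume "r \<in> carrier (HM X)"
  then have r: "r \<in> H X" by simp
  have "r t \<in> X" for t
    using HD(1,4)[OF r, of t] lin_subD(1)[OF assms(1)] by (cases "t \<in> T") auto
  then show "(\<lambda>t. \<pi> (\<sigma> (r t))) = r" using assms(4) by auto
qed

subsection \<open>Free modules\<close>

abbreviation FE :: "'j set \<Rightarrow> ('e, idx \<Rightarrow> 'j \<Rightarrow> idx \<Rightarrow> 'k) module"
  where "FE J \<equiv> HM (fs J)"

lemmas FE_module = left_module_HM[OF lin_sub_fs]

text \<open>The inclusion of the j-th copy of D into D^(J), that is, the j-th basis element of
  Hom(D, D^(J)) as a free module over E = Hom(D, D).\<close>

definition unit :: "'j \<Rightarrow> idx \<Rightarrow> 'j \<Rightarrow> idx \<Rightarrow> 'k"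
  where "unit j = (\<lambda>t j' t'. if j' = j \<and> t' = t \<and> t \<in> T then 1 else 0)"

lemma unit_H: "j \<in> J \<Longrightarrow> unit j \<in> H (fs J)"
proof (rule HI)
  fix t
  show "unit j t \<in> fs J" if "j \<in> J"
    by (rule fsI[of "{j}"]) (use that in \<open>auto simp: unit_def split: if_splits\<close>)
  show "unit j t = 0" if "t \<notin> T" using that by (auto simp: unit_def fun_eq_iff)
  assume t: "t \<in> T"
  show "Yv (unit j t) = unit j (eta t)"
  proof (intro ext)
    fix j' t' show "Yv (unit j t) j' t' = unit j (eta t) j' t'"
      using t by (cases t; cases t'; cases "snd (snd t')") (auto simp: unit_def)
  qed
  show "Xv (unit j t) = unit j (xi t)"
  proof (intro ext)
    fix j' t' show "Xv (unit j t) j' t' = unit j (xi t) j' t'"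
      using t by (cases t; cases t') (auto simp: unit_def)
  qed
qed

definition coef :: "(idx \<Rightarrow> 'j \<Rightarrow> idx \<Rightarrow> 'k) \<Rightarrow> 'j \<Rightarrow> 'e"
  where "coef r j = \<nu> (\<lambda>t t'. r t j t')"

lemma coef:
  assumes r: "r \<in> H (fs J)"
  shows "coef r j \<in> carrier E" "\<mu> (coef r j) t t' = r t j t'"
proof -
  have rf: "r t \<in> fs J" for t
    using HD(1,4)[OF r, of t] lin_subD(1)[OF lin_sub_fs[of J]] by (cases "t \<in> T") auto
  have 1: "(\<lambda>t'. r t j t') = 0" if "t \<notin> T" for t
    using HD(4)[OF r that] by (simp add: fun_eq_iff)
  have 2: "r t j t' = 0" if "t' \<notin> T" for t t'
    using fsD(3)[OF rf that] .
  have 3: "rowY (\<lambda>t'. r t j t') = (\<lambda>t'. r (eta t) j t')" if "t \<in> T" for t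
    using HD(2)[OF r that] by (auto simp: Yv_def fun_eq_iff)
  have 4: "rowX (\<lambda>t'. r t j t') = (\<lambda>t'. r (xi t) j t')" if "t \<in> T" for t
    using HD(3)[OF r that] by (auto simp: Xv_def fun_eq_iff)
  note * = \<nu>[of "\<lambda>t t'. r t j t'", OF 1 2 3 4]
  show "coef r j \<in> carrier E" unfolding coef_def by (rule *)
  show "\<mu> (coef r j) t t' = r t j t'" unfolding coef_def by (simp add: *)
qed

definition supp :: "(idx \<Rightarrow> 'j \<Rightarrow> idx \<Rightarrow> 'k) \<Rightarrow> 'j set"
  where "supp r = {j. \<exists>t t'. r t j t' \<noteq> 0}"

text \<open>T is finite and each value r t has finite support in J. Therefore Hom(D, D^(J)) is the
  direct sum of copies of E even for infinite J.\<close>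

lemma supp:
  assumes r: "r \<in> H (fs J)"
  shows "finite (supp r)" "supp r \<subseteq> J"
proof -
  have *: "\<exists>t\<in>T. r t j \<noteq> 0" if "j \<in> supp r" for j
  proof -
    have "\<exists>t t'. r t j t' \<noteq> 0" using that by (simp add: supp_def)
    then obtain t t' where t: "r t j t' \<noteq> 0" by blast
    then have "t \<in> T" "r t j \<noteq> 0" using HD(4)[OF r, of t] by (cases "t \<in> T", auto)+
    then show ?thesis by blast
  qed
  then have sub: "supp r \<subseteq> (\<Union>t\<in>T. {j. r t j \<noteq> 0})" by blast
  moreover have "finite (\<Union>t\<in>T. {j. r t j \<noteq> 0})"
    using fsD(1)[OF HD(1)[OF r]] by simp
  ultimately show "finite (supp r)" by (rule finite_subset)
  show "supp r \<subseteq> J" using sub fsD(2)[OF HD(1)[OF r]] by blast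
qed

text \<open>The homomorphism from the free module that takes the basis element \<open>unit j\<close>
  to n j.\<close>

definition ev :: "('e, 'b) module \<Rightarrow> ('j \<Rightarrow> 'b) \<Rightarrow> (idx \<Rightarrow> 'j \<Rightarrow> idx \<Rightarrow> 'k) \<Rightarrow> 'b"
  where "ev N n r = (\<Oplus>\<^bsub>N\<^esub>j\<in>supp r. coef r j \<odot>\<^bsub>N\<^esub> n j)"

lemma ev_superset:
  assumes N: "left_module E N" and n: "n \<in> J \<rightarrow> carrier N" and r: "r \<in> H (fs J)"
    and U: "finite U" "supp r \<subseteq> U" "U \<subseteq> J"
  shows "ev N n r = (\<Oplus>\<^bsub>N\<^esub>j\<in>U. coef r j \<odot>\<^bsub>N\<^esub> n j)"
proof -
  interpret N: left_module E N by fact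
  have nj: "n j \<in> carrier N" if "j \<in> U" for j using n U that by auto
  have "coef r j = \<zero>\<^bsub>E\<^esub>" if "j \<notin> supp r" for j
  proof (rule \<mu>_eqI)
    show "coef r j \<in> carrier E" using coef(1)[OF r] .
    have "\<mu> \<zero>\<^bsub>E\<^esub> t t' = 0" for t t'
      using \<mu>_add[of "\<zero>\<^bsub>E\<^esub>" "\<zero>\<^bsub>E\<^esub>" t t'] by (metis E.l_zero E.zero_closed add_cancel_left_right)
    then show "\<mu> (coef r j) t t' = \<mu> \<zero>\<^bsub>E\<^esub> t t'" for t t'
      using that by (simp add: coef(2)[OF r] supp_def)
  qed simp
  then show ?thesis
    unfolding ev_def using U nj coef(1)[OF r]
    by (intro N.M.add.finprod_mono_neutral_cong_left) auto
qed

lemma ev_hom: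
  assumes N: "left_module E N" and n: "n \<in> J \<rightarrow> carrier N"
  shows "ev N n \<in> module_homs E (FE J) N"
proof (rule module_homsI)
  interpret N: left_module E N by fact
  show "ev N n r \<in> carrier N" if "r \<in> carrier (FE J)" for r
    unfolding ev_def using that coef(1)[of r J] supp(2)[of r J] n by (intro N.M.finsum_closed) auto
  show "ev N n (r \<oplus>\<^bsub>FE J\<^esub> r') = ev N n r \<oplus>\<^bsub>N\<^esub> ev N n r'"
    if "r \<in> carrier (FE J)" "r' \<in> carrier (FE J)" for r r'
  proof -
    have r: "r \<in> H (fs J)" "r' \<in> H (fs J)" using that by auto
    have rr: "r + r' \<in> H (fs J)" using H_add[OF lin_sub_fs r] .
    let ?U = "supp r \<union> supp r'"
    have "supp (r + r') \<subseteq> ?U"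
    proof
      fix j assume "j \<in> supp (r + r')"
      then obtain t s where "(r + r') t j s \<noteq> 0" unfolding supp_def by blast
      then have "r t j s \<noteq> 0 \<or> r' t j s \<noteq> 0" by auto
      then show "j \<in> ?U" unfolding supp_def by blast
    qed
    then have U: "finite ?U" "?U \<subseteq> J" "supp r \<subseteq> ?U" "supp r' \<subseteq> ?U" "supp (r + r') \<subseteq> ?U"
      using supp[OF r(1)] supp[OF r(2)] by auto
    have c: "coef (r + r') j = coef r j \<oplus>\<^bsub>E\<^esub> coef r' j" for j
      by (rule \<mu>_eqI) (auto simp: coef[OF r(1)] coef[OF r(2)] coef[OF rr] \<mu>_add)
    have nj: "n j \<in> carrier N" if "j \<in> ?U" for j using n U that by auto
    have "ev N n (r + r') = (\<Oplus>\<^bsub>N\<^esub>j\<in>?U. coef r j \<odot>\<^bsub>N\<^esub> n j \<oplus>\<^bsub>N\<^esub> coef r' j \<odot>\<^bsub>N\<^esub> n j)"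
      unfolding ev_superset[OF N n rr U(1,5,2)] using nj coef(1)[OF r(1)] coef(1)[OF r(2)]
      by (intro N.M.finsum_cong') (auto simp: c N.smult_l_distr)
    also have "\<dots> = ev N n r \<oplus>\<^bsub>N\<^esub> ev N n r'"
      unfolding ev_superset[OF N n r(1) U(1,3,2)] ev_superset[OF N n r(2) U(1,4,2)]
      using nj coef(1)[OF r(1)] coef(1)[OF r(2)] by (intro N.M.finsum_addf) auto
    finally show ?thesis by simp
  qed
  show "ev N n (e \<odot>\<^bsub>FE J\<^esub> r) = e \<odot>\<^bsub>N\<^esub> ev N n r"
    if e: "e \<in> carrier E" and "r \<in> carrier (FE J)" for e r
  proof -
    have r: "r \<in> H (fs J)" using that by auto
    let ?er = "\<lambda>t j s. \<Sum>t'\<in>T. \<mu> e t t' * r t' j s"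
    have er: "?er \<in> H (fs J)" by (rule H_smult[OF lin_sub_fs e r])
    have s: "supp ?er \<subseteq> supp r"
    proof
      fix j assume "j \<in> supp ?er"
      then obtain t s where "?er t j s \<noteq> 0" unfolding supp_def by blast
      then obtain t' where "\<mu> e t t' * r t' j s \<noteq> 0" by (meson sum.neutral)
      then have "r t' j s \<noteq> 0" by auto
      then show "j \<in> supp r" unfolding supp_def by blast
    qed
    have c: "coef ?er j = e \<otimes>\<^bsub>E\<^esub> coef r j" for j
      by (rule \<mu>_eqI) (auto simp: coef[OF r] coef[OF er] e \<mu>_mult)
    have nj: "n j \<in> carrier N" if "j \<in> supp r" for j using n supp(2)[OF r] that by auto
    have "ev N n ?er = (\<Oplus>\<^bsub>N\<^esub>j\<in>supp r. e \<odot>\<^bsub>N\<^esub> (coef r j \<odot>\<^bsub>N\<^esub> n j))"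
      unfolding ev_superset[OF N n er supp(1)[OF r] s supp(2)[OF r]] using nj coef(1)[OF r] e
      by (intro N.M.finsum_cong') (auto simp: c N.smult_assoc1)
    also have "\<dots> = e \<odot>\<^bsub>N\<^esub> ev N n r"
      unfolding ev_def using nj coef(1)[OF r] e
      by (intro N.lmod_finsum[symmetric] supp(1)[OF r]) auto
    finally show ?thesis by simp
  qed
qed

lemma ev_unit:
  assumes N: "left_module E N" and n: "n \<in> J \<rightarrow> carrier N" and j: "j \<in> J"
  shows "ev N n (unit j) = n j"
proof -
  interpret N: left_module E N by fact
  have "supp (unit j) \<subseteq> {j}" by (auto simp: supp_def unit_def split: if_splits)
  then have "ev N n (unit j) = (\<Oplus>\<^bsub>N\<^esub>j'\<in>{j}. coef (unit j) j' \<odot>\<^bsub>N\<^esub> n j')"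
    using j by (intro ev_superset[OF N n unit_H[OF j]]) auto
  moreover have "coef (unit j) j = \<one>\<^bsub>E\<^esub>"
  proof (rule \<mu>_eqI)
    show "coef (unit j) j \<in> carrier E" by (rule coef(1)[OF unit_H[OF j]])
    show "\<mu> (coef (unit j) j) t t' = \<mu> \<one>\<^bsub>E\<^esub> t t'" for t t'
      unfolding coef(2)[OF unit_H[OF j]] \<mu>_one by (simp add: unit_def eq_commute)
  qed simp
  ultimately show ?thesis using n j by (auto simp: Pi_def)
qed

lemma HM_finsum:
  assumes X: "lin_sub X" and "finite U" "\<And>j. j \<in> U \<Longrightarrow> g j \<in> H X"
  shows "(\<Oplus>\<^bsub>HM X\<^esub>j\<in>U. g j) = (\<Sum>j\<in>U. g j)"
proof -
  interpret N: left_module E "HM X" by (rule left_module_HM[OF X])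
  show ?thesis
    using assms(2,3)
  proof (induct U)
    case (insert j U)
    have "(\<Oplus>\<^bsub>HM X\<^esub>j\<in>insert j U. g j) = g j \<oplus>\<^bsub>HM X\<^esub> (\<Oplus>\<^bsub>HM X\<^esub>j\<in>U. g j)"
      using insert by (intro N.M.finsum_insert) auto
    with insert show ?case by simp
  qed simp
qed

lemma FE_decomp:
  assumes r: "r \<in> H (fs J)"
  shows "r = ev (FE J) unit r"
proof (intro ext)
  fix t j s
  have u: "unit j \<in> H (fs J)" if "j \<in> supp r" for j using unit_H[of j J] supp(2)[OF r] that by auto
  have m: "coef r i \<odot>\<^bsub>FE J\<^esub> unit i \<in> H (fs J)" if "i \<in> supp r" for i
    using H_smult[OF lin_sub_fs coef(1)[OF r] u[OF that]] by simp
  have *: "(coef r i \<odot>\<^bsub>FE J\<^esub> unit i) t j s = (if i = j then r t j s else 0)" for i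
  proof -
    have "(coef r i \<odot>\<^bsub>FE J\<^esub> unit i) t j s = (\<Sum>t'\<in>T. r t i t' * unit i t' j s)"
      by (simp add: coef(2)[OF r])
    also have "\<dots> = (\<Sum>t'\<in>T. if t' = s then (if i = j then r t i s else 0) else 0)"
      by (rule sum.cong) (auto simp: unit_def)
    also have "\<dots> = (if i = j then r t j s else 0)"
      using \<mu>D(2)[OF coef(1)[OF r], of s j t] coef(2)[OF r, of j t s] by auto
    finally show ?thesis .
  qed
  have "ev (FE J) unit r = (\<Sum>i\<in>supp r. coef r i \<odot>\<^bsub>FE J\<^esub> unit i)"
    unfolding ev_def by (rule HM_finsum[OF lin_sub_fs supp(1)[OF r] m])
  then have "ev (FE J) unit r t j s = (\<Sum>i\<in>supp r. if i = j then r t j s else 0)"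
    by (simp only: sum_fun_apply *)
  also have "\<dots> = r t j s"
    using supp(1)[OF r] by (auto simp: supp_def)
  finally show "r t j s = ev (FE J) unit r t j s" by simp
qed

lemma hom_ev:
  assumes N: "left_module E N" and f: "f \<in> module_homs E (FE J) N" and r: "r \<in> H (fs J)"
  shows "f r = ev N (\<lambda>j. f (unit j)) r"
proof -
  interpret N: left_module E N by fact
  interpret F: left_module E "FE J" by (rule FE_module)
  have u: "unit j \<in> carrier (FE J)" if "j \<in> supp r" for j using unit_H[of j J] supp(2)[OF r] that by auto
  have "f r = f (ev (FE J) unit r)" using FE_decomp[OF r] by simp
  also have "\<dots> = (\<Oplus>\<^bsub>N\<^esub>j\<in>supp r. f (coef r j \<odot>\<^bsub>FE J\<^esub> unit j))"
    unfolding ev_def using u coef(1)[OF r]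
    by (intro hom_finsum[OF FE_module N f supp(1)[OF r]] Pi_I F.smult_closed) auto
  also have "\<dots> = ev N (\<lambda>j. f (unit j)) r"
    unfolding ev_def using u coef(1)[OF r] hom_closed[OF f]
    by (intro N.M.finsum_cong' refl) (auto simp: hom_smult[OF f] simp del: HM_simps)
  finally show ?thesis .
qed

lemma lifting_FE: "lifting TYPE('m) E (FE J)"
proof (rule liftingI)
  fix N L :: "('e, 'm) module" and g f
  assume N: "left_module E N" and L: "left_module E L" and g: "g \<in> module_homs E N L"
    and f: "f \<in> module_homs E (FE J) L" and s: "g ` carrier N = carrier L"
  interpret N: left_module E N by fact
  have "\<forall>j\<in>J. \<exists>n\<in>carrier N. g n = f (unit j)"
  proof
    fix j assume "j \<in> J"
    then have "f (unit j) \<in> carrier L" using unit_H by (intro hom_closed[OF f]) auto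
    then show "\<exists>n\<in>carrier N. g n = f (unit j)" using s by (metis imageE)
  qed
  then obtain n where n: "\<forall>j\<in>J. n j \<in> carrier N \<and> g (n j) = f (unit j)" by metis
  then have nN: "n \<in> J \<rightarrow> carrier N" by auto
  have h: "ev N n \<in> module_homs E (FE J) N" by (rule ev_hom[OF N nN])
  have gh: "(\<lambda>r. g (ev N n r)) \<in> module_homs E (FE J) L" by (rule hom_comp[OF h g])
  have "g (ev N n r) = f r" if "r \<in> carrier (FE J)" for r
  proof -
    have r: "r \<in> H (fs J)" using that by simp
    interpret L: left_module E L by fact
    have "ev L (\<lambda>j. g (ev N n (unit j))) r = ev L (\<lambda>j. f (unit j)) r"
      unfolding ev_def[of L]
    proof (rule L.M.finsum_cong'[OF refl])
      show "(\<lambda>j. coef r j \<odot>\<^bsub>L\<^esub> f (unit j)) \<in> supp r \<rightarrow> carrier L"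
      proof (rule Pi_I)
        fix j assume "j \<in> supp r"
        then have "unit j \<in> carrier (FE J)" using supp(2)[OF r] unit_H[of j J] by auto
        then show "coef r j \<odot>\<^bsub>L\<^esub> f (unit j) \<in> carrier L"
          by (intro L.smult_closed coef(1)[OF r] hom_closed[OF f])
      qed
      show "coef r j \<odot>\<^bsub>L\<^esub> g (ev N n (unit j)) = coef r j \<odot>\<^bsub>L\<^esub> f (unit j)" if "j \<in> supp r" for j
        using ev_unit[OF N nN, of j] n supp(2)[OF r] that by auto
    qed
    then show ?thesis using hom_ev[OF L gh r] hom_ev[OF L f r] by simp
  qed
  then show "\<exists>h\<in>module_homs E (FE J) N. \<forall>r\<in>carrier (FE J). g (h r) = f r"
    by (intro bexI[OF _ h] ballI)
qed

text \<open>Yoneda: a homomorphism from Hom(D, D^(J)) to Hom(D, X) is induced by a map D^(J) -> X,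
  namely the one given by the images of the units. This turns kernels over E into kernels over
  A.\<close>

lemma hom_pair:
  assumes X: "lin_sub X" and f: "f \<in> module_homs E (FE J) (HM X)" and r: "r \<in> H (fs J)"
  shows "f r t = pair (\<lambda>j. f (unit j)) (r t)"
proof (intro ext)
  fix i s
  have u: "f (unit j) \<in> H X" if "j \<in> supp r" for j
    using hom_closed[OF f, of "unit j"] unit_H[of j J] supp(2)[OF r] that by auto
  have m: "coef r j \<odot>\<^bsub>HM X\<^esub> f (unit j) \<in> H X" if "j \<in> supp r" for j
    using H_smult[OF X coef(1)[OF r] u[OF that]] by simp
  have "f r = (\<Oplus>\<^bsub>HM X\<^esub>j\<in>supp r. coef r j \<odot>\<^bsub>HM X\<^esub> f (unit j))"
    using hom_ev[OF left_module_HM[OF X] f r] unfolding ev_def .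
  also have "\<dots> = (\<Sum>j\<in>supp r. coef r j \<odot>\<^bsub>HM X\<^esub> f (unit j))"
    by (rule HM_finsum[OF X supp(1)[OF r] m])
  finally have "f r t i s = (\<Sum>j\<in>supp r. (coef r j \<odot>\<^bsub>HM X\<^esub> f (unit j)) t i s)"
    by (simp only: sum_fun_apply)
  also have "\<dots> = (\<Sum>j\<in>supp r. \<Sum>t'\<in>T. r t j t' * f (unit j) t' i s)"
    by (simp add: coef(2)[OF r])
  also have "\<dots> = pair (\<lambda>j. f (unit j)) (r t) i s"
    by (rule pair_superset[OF supp(1)[OF r], symmetric]) (auto simp: supp_def fun_eq_iff)
  finally show "f r t i s = pair (\<lambda>j. f (unit j)) (r t) i s" .
qed

end

section \<open>Decomposition into string-type generators\<close>

context strings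
begin

definition line :: "knd \<Rightarrow> nat \<Rightarrow> idx set" where "line c i = (\<lambda>l. (c, i, l)) ` {..<q}"

lemma sum_line:
  fixes g :: "idx \<Rightarrow> 'a::comm_monoid_add"
  assumes "\<And>t. t \<notin> T \<Longrightarrow> g t = 0" "\<And>t. t \<in> T \<Longrightarrow> t \<notin> line c i \<Longrightarrow> g t = 0"
  shows "(\<Sum>t\<in>T. g t) = (\<Sum>l<q. g (c, i, l))"
proof -
  have "(\<Sum>t\<in>T. g t) = (\<Sum>t\<in>T \<inter> line c i. g t)"
    using assms(2) by (intro sum.mono_neutral_right) auto
  also have "\<dots> = (\<Sum>t\<in>line c i. g t)"
    using assms(1) by (intro sum.mono_neutral_left) (auto simp: line_def)
  also have "\<dots> = (\<Sum>l<q. g (c, i, l))"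
    unfolding line_def by (subst sum.reindex) (auto simp: inj_on_def)
  finally show ?thesis .
qed

subsection \<open>Modules annihilated by \<open>x\<close>\<close>

text \<open>The k[[y]]-linear map from the free module on a set of vectors that sends each basis
  element w to the vector w itself. The sum stops at q because y^q acts as zero.\<close>

definition eps :: "(('j \<Rightarrow> idx \<Rightarrow> 'k::field) \<Rightarrow> nat \<Rightarrow> 'k) \<Rightarrow> 'j \<Rightarrow> idx \<Rightarrow> 'k"
  where "eps a = (\<lambda>j s. \<Sum>w | a w \<noteq> 0. \<Sum>l<q. a w l * (Yv ^^ l) w j s)"

lemma eps_superset:
  "finite U \<Longrightarrow> {w. \<exists>l. a w l \<noteq> 0} \<subseteq> U \<Longrightarrow> eps a j s = (\<Sum>w\<in>U. \<Sum>l<q. a w l * (Yv ^^ l) w j s)"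
  unfolding eps_def by (rule sum.mono_neutral_left) (auto simp: fun_eq_iff)

lemma eps_add:
  fixes a a' :: "('j \<Rightarrow> idx \<Rightarrow> 'k::field) \<Rightarrow> nat \<Rightarrow> 'k"
  assumes "a \<in> fin_fun W" "a' \<in> fin_fun W"
  shows "eps (a + a') = eps a + eps a'"
proof (intro ext)
  fix j s
  let ?U = "{w. \<exists>l. a w l \<noteq> 0} \<union> {w. \<exists>l. a' w l \<noteq> 0}"
  have U: "finite ?U" using assms by (auto simp: fin_fun_def)
  have 1: "{w. \<exists>l. (a + a') w l \<noteq> 0} \<subseteq> ?U" "{w. \<exists>l. a w l \<noteq> 0} \<subseteq> ?U" "{w. \<exists>l. a' w l \<noteq> 0} \<subseteq> ?U" by auto
  show "eps (a + a') j s = (eps a + eps a') j s"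
    unfolding plus_fun_apply[of "eps a"] plus_fun_apply[of "eps a j"]
      eps_superset[OF U 1(1)] eps_superset[OF U 1(2)] eps_superset[OF U 1(3)]
    by (simp add: algebra_simps sum.distrib)
qed

lemma eps_scale:
  fixes a :: "('j \<Rightarrow> idx \<Rightarrow> 'k::field) \<Rightarrow> nat \<Rightarrow> 'k"
  assumes "a \<in> fin_fun W"
  shows "eps (\<lambda>w l. c * a w l) = vs c (eps a)"
proof (intro ext)
  fix j s
  let ?U = "{w. \<exists>l. a w l \<noteq> 0}"
  have U: "finite ?U" using assms by (auto simp: fin_fun_def)
  have 1: "{w. \<exists>l. c * a w l \<noteq> 0} \<subseteq> ?U" by auto
  show "eps (\<lambda>w l. c * a w l) j s = vs c (eps a) j s"
    unfolding vs_simp eps_superset[OF U 1] eps_superset[OF U order_refl]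
    by (simp add: sum_distrib_left mult.assoc)
qed

lemma eps_shift:
  fixes a :: "('j \<Rightarrow> idx \<Rightarrow> 'k::field) \<Rightarrow> nat \<Rightarrow> 'k"
  assumes "a \<in> fin_fun W"
  shows "eps (shift a) = Yv (eps a)"
proof (intro ext)
  fix j s
  let ?U = "{w. \<exists>l. a w l \<noteq> 0}"
  have U: "finite ?U" using assms by (auto simp: fin_fun_def)
  have 1: "{w. \<exists>l. shift a w l \<noteq> 0} \<subseteq> ?U"
  proof safe
    fix w l assume "shift a w l \<noteq> 0" then show "\<exists>l. a w l \<noteq> 0" by (cases l) auto
  qed
  obtain p where p: "q = Suc p" using q_pos by (cases q) auto
  have *: "(\<Sum>l<q. shift a w l * (Yv ^^ l) w j s) = (\<Sum>l<q. a w l * Yv ((Yv ^^ l) w) j s)" for w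
  proof -
    have "(\<Sum>l<q. shift a w l * (Yv ^^ l) w j s) = (\<Sum>l<p. a w l * Yv ((Yv ^^ l) w) j s)"
      unfolding p sum.lessThan_Suc_shift by simp
    moreover have "Yv ((Yv ^^ p) w) = 0" using Yv_pow_q[of w] unfolding p by simp
    ultimately show ?thesis unfolding p by simp
  qed
  have "eps a = (\<lambda>j s. \<Sum>w\<in>?U. 1 * (\<lambda>j s. \<Sum>l<q. a w l * (Yv ^^ l) w j s) j s)"
    by (intro ext) (simp add: eps_superset[OF U order_refl])
  then have "Yv (eps a) = (\<lambda>j s. \<Sum>w\<in>?U. 1 * (\<lambda>j s. \<Sum>l<q. a w l * Yv ((Yv ^^ l) w) j s) j s)"
    by (simp only: Yv_sum)
  then show "eps (shift a) j s = Yv (eps a) j s"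
    by (simp add: eps_superset[OF U 1] *)
qed

lemma eps_shift_pow: "a \<in> fin_fun W \<Longrightarrow> eps ((shift ^^ n) a) = (Yv ^^ n) (eps a)"
  for a :: "('j \<Rightarrow> idx \<Rightarrow> 'k::field) \<Rightarrow> nat \<Rightarrow> 'k"
proof (induct n)
  case (Suc n)
  have "(shift ^^ n) a \<in> fin_fun W" using Suc.prems by (induct n) (auto intro: fin_fun_shift)
  then show ?case using Suc by (simp add: eps_shift)
qed simp

lemma fin_fun_sum:
  fixes h :: "'i \<Rightarrow> 's \<Rightarrow> nat \<Rightarrow> 'k::field"
  assumes "\<And>i. i \<in> I \<Longrightarrow> h i \<in> fin_fun W"
  shows "(\<lambda>w l. \<Sum>i\<in>I. c i * h i w l) \<in> fin_fun W"
  using assms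
proof (induct I rule: infinite_finite_induct)
  case (insert i I)
  have "(\<lambda>w l. c i * h i w l) + (\<lambda>w l. \<Sum>i\<in>I. c i * h i w l) \<in> fin_fun W"
    using insert by (intro fin_fun_add fin_fun_scale) auto
  then show ?case using insert by (simp add: plus_fun_def)
qed (use fin_fun_zero in \<open>auto simp: zero_fun_def\<close>)

lemma eps_in: 
  assumes "lin_sub W" "\<And>w. w \<in> W \<Longrightarrow> Yv w \<in> W" "a \<in> fin_fun W"
  shows "eps a \<in> W"
proof -
  have 1: "(Yv ^^ l) w \<in> W" if "w \<in> W" for l w using that assms(2) by (induct l) auto
  have 2: "w \<in> W" if "a w \<noteq> 0" for w
    using that assms(3) by (auto simp: fin_fun_def fun_eq_iff)
  show ?thesis
    unfolding eps_def using 1 2 by (intro lin_sub_sum1[OF assms(1)] lin_sub_sum[OF assms(1)]) auto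
qed

definition single :: "'w \<Rightarrow> 'w \<Rightarrow> nat \<Rightarrow> 'k::field"
  where "single w = (\<lambda>w' l. if w' = w \<and> l = 0 then 1 else 0)"

lemma single_fin_fun: "w \<in> W \<Longrightarrow> single w \<in> fin_fun W"
  by (rule fin_funI[of "{w}"]) (auto simp: single_def split: if_splits)

lemma eps_single: "eps (single w) = w"
proof (intro ext)
  fix j s
  have 1: "{w'. \<exists>l. single w w' l \<noteq> (0::'b)} \<subseteq> {w}" by (auto simp: single_def split: if_splits)
  have "eps (single w) j s = (\<Sum>l<q. single w w l * (Yv ^^ l) w j s)"
    by (subst eps_superset[OF _ 1]) auto
  also have "\<dots> = (\<Sum>l<q. if l = 0 then w j s else 0)"
    by (rule sum.cong) (auto simp: single_def)
  finally have "eps (single w) j s = (\<Sum>l<q. if l = 0 then w j s else 0)" .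
  then show "eps (single w) j s = w j s" using q_pos by simp
qed

end

section \<open>Expansions along a stacked basis in modules annihilated by y^q\<close>

locale string_lattice = strings q + shift_lattice S G q
  for q and S :: "'s set" and G :: "('s \<Rightarrow> nat \<Rightarrow> 'k::field) set"
begin

lemma fin_fun_shift_pow: "f \<in> fin_fun S \<Longrightarrow> (shift ^^ n) f \<in> fin_fun S"
  by (induct n) (auto intro: fin_fun_shift)

text \<open>f and g differ by a multiple of y^n, and such multiples have no coordinates below
  n.\<close>

lemma coord_cong:
  assumes f: "f \<in> fin_fun S" and g: "g \<in> fin_fun S"
    and eq: "\<And>s l. l < n \<Longrightarrow> f s l = g s l" and "l < n"
  shows "coord l f b = coord l g b"
proof -
  define h where "h = (\<lambda>s m. g s (m + n) - f s (m + n))"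
  have h: "h \<in> fin_fun S"
    by (rule fin_funI[of "{s. \<exists>l. f s l \<noteq> 0} \<union> {s. \<exists>l. g s l \<noteq> 0}"])
      (use f g in \<open>auto simp: fin_fun_def h_def\<close>)
  have "g = f + (shift ^^ n) h"
    using eq by (auto simp: fun_eq_iff shift_pow h_def)
  then show ?thesis
    using coord_add[OF f fin_fun_shift_pow[OF h], of l n b] coord_shift_pow[OF \<open>l < n\<close>, of h b] by simp
qed

text \<open>\<Theta> is k[y]-linear into a module on which y^q acts as zero, so it kills the
  remainder of \<open>coord_expansion\<close> at n = q. The uniform index set U makes the sums
  comparable.\<close>

lemma coord_expansion_map:
  fixes \<Theta> :: "('s \<Rightarrow> nat \<Rightarrow> 'k) \<Rightarrow> 'j \<Rightarrow> idx \<Rightarrow> 'k"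
  assumes add: "\<And>f g. f \<in> fin_fun S \<Longrightarrow> g \<in> fin_fun S \<Longrightarrow> \<Theta> (f + g) = \<Theta> f + \<Theta> g"
    and scale: "\<And>c f. f \<in> fin_fun S \<Longrightarrow> \<Theta> (\<lambda>s l. c * f s l) = vs c (\<Theta> f)"
    and sh: "\<And>f. f \<in> fin_fun S \<Longrightarrow> \<Theta> (shift f) = Yv (\<Theta> f)"
    and f: "f \<in> fin_fun S" and U: "finite U" "(\<Union>l<q. {b. coord l f b \<noteq> 0}) \<subseteq> U"
  shows "\<Theta> f j s = (\<Sum>b\<in>U. \<Sum>l<q. coord l f b * (Yv ^^ l) (\<Theta> (gen b)) j s)"
proof -
  have sum: "\<Theta> (\<lambda>s l. \<Sum>i\<in>I. c i * h i s l) = (\<lambda>j s. \<Sum>i\<in>I. c i * \<Theta> (h i) j s)"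
    if "\<And>i. i \<in> I \<Longrightarrow> h i \<in> fin_fun S" for I :: "'i set" and c h
    using that
  proof (induct I rule: infinite_finite_induct)
    case (insert i I)
    have "(\<lambda>w l. \<Sum>i\<in>insert i I. c i * h i w l) = (\<lambda>w l. c i * h i w l) + (\<lambda>w l. \<Sum>i\<in>I. c i * h i w l)"
      using insert by (auto simp: fun_eq_iff)
    then have "\<Theta> (\<lambda>w l. \<Sum>i\<in>insert i I. c i * h i w l)
        = \<Theta> (\<lambda>w l. c i * h i w l) + \<Theta> (\<lambda>w l. \<Sum>i\<in>I. c i * h i w l)"
      using insert add[OF fin_fun_scale fin_fun_sum, of "h i" I h "c i" c] by simp
    then show ?case
      using insert by (auto simp: scale[of "h i"] fun_eq_iff)
  qed (use scale[OF fin_fun_zero, of 0] in \<open>auto simp: zero_fun_def vs_def\<close>)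
  have sh_pow: "\<Theta> ((shift ^^ n) h) = (Yv ^^ n) (\<Theta> h)" if "h \<in> fin_fun S" for n h
    using that by (induct n) (auto simp: sh fin_fun_shift_pow)
  let ?inner = "\<lambda>l w m. \<Sum>b | coord l f b \<noteq> 0. coord l f b * (shift ^^ l) (gen b) w m"
  have exp: "f = (\<lambda>w m. \<Sum>l<q. ?inner l w m) + (shift ^^ q) ((red ^^ q) f)" (is "_ = ?A + ?R")
    using coord_expansion[OF f, of q] by (simp add: plus_fun_def)
  have If: "?inner l \<in> fin_fun S" for l
    using coord_base by (intro fin_fun_sum fin_fun_shift_pow gen) auto
  have Af: "?A \<in> fin_fun S"
    using fin_fun_sum[of "{..<q}" ?inner S "\<lambda>_. 1"] If by simp
  have Rf: "?R \<in> fin_fun S" by (intro fin_fun_shift_pow red_pow_fin_fun f)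
  have R0: "\<Theta> ?R = 0"
    using sh_pow[OF red_pow_fin_fun[OF f], of q q] by (simp add: Yv_pow_q)
  have "\<Theta> f = \<Theta> (?A + ?R)" using exp by simp
  also have "\<dots> = \<Theta> ?A" unfolding add[OF Af Rf] R0 by simp
  also have "\<dots> = (\<lambda>j s. \<Sum>l<q. 1 * \<Theta> (?inner l) j s)"
    using sum[of "{..<q}" ?inner "\<lambda>_. 1"] If by simp
  also have "\<dots> = (\<lambda>j s. \<Sum>l<q. \<Sum>b | coord l f b \<noteq> 0. coord l f b * (Yv ^^ l) (\<Theta> (gen b)) j s)"
  proof -
    have "\<Theta> (?inner l) = (\<lambda>j s. \<Sum>b | coord l f b \<noteq> 0. coord l f b * (Yv ^^ l) (\<Theta> (gen b)) j s)" for l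
    proof -
      have "(shift ^^ l) (gen b) \<in> fin_fun S" if "b \<in> {b. coord l f b \<noteq> 0}" for b
        using that coord_base by (intro fin_fun_shift_pow gen) auto
      from sum[OF this, of "{b. coord l f b \<noteq> 0}" "\<lambda>b. b" "coord l f"] show ?thesis
        using sh_pow[OF gen(1)[OF coord_base]] by (auto intro!: ext sum.cong)
    qed
    then show ?thesis by simp
  qed
  also have "\<dots> = (\<lambda>j s. \<Sum>b\<in>U. \<Sum>l<q. coord l f b * (Yv ^^ l) (\<Theta> (gen b)) j s)"
  proof (intro ext)
    fix j s
    have "(\<Sum>b | coord l f b \<noteq> 0. coord l f b * (Yv ^^ l) (\<Theta> (gen b)) j s)
      = (\<Sum>b\<in>U. coord l f b * (Yv ^^ l) (\<Theta> (gen b)) j s)" if "l < q" for l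
      using U that by (intro sum.mono_neutral_left) auto
    then have "(\<Sum>l<q. \<Sum>b | coord l f b \<noteq> 0. coord l f b * (Yv ^^ l) (\<Theta> (gen b)) j s)
      = (\<Sum>l<q. \<Sum>b\<in>U. coord l f b * (Yv ^^ l) (\<Theta> (gen b)) j s)"
      by (intro sum.cong[OF refl]) (simp only: lessThan_iff)
    also have "\<dots> = (\<Sum>b\<in>U. \<Sum>l<q. coord l f b * (Yv ^^ l) (\<Theta> (gen b)) j s)"
      by (rule sum.swap)
    finally show "(\<Sum>l<q. \<Sum>b | coord l f b \<noteq> 0. coord l f b * (Yv ^^ l) (\<Theta> (gen b)) j s)
      = (\<Sum>b\<in>U. \<Sum>l<q. coord l f b * (Yv ^^ l) (\<Theta> (gen b)) j s)" .
  qed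
  finally show ?thesis by meson
qed

end

context strings
begin

text \<open>W is a module over k[y]/(y^q), the quotient of the free k[[y]]-module on the set W by
  the kernel G of \<open>eps\<close>. A stacked basis splits it into modules k[y]/(y^h) with h =
  \<open>ht b\<close>, and k[y]/(y^h) is isomorphic to the ideal (y^(q - h)) of k[y]/(y^q), the row
  \<open>KR\<close> with i = q - h.\<close>

theorem decompose_ker_X:
  fixes W :: "('j \<Rightarrow> idx \<Rightarrow> 'k::field) set"
  assumes W: "lin_sub W" and Y: "\<And>w. w \<in> W \<Longrightarrow> Yv w \<in> W" and X: "\<And>w. w \<in> W \<Longrightarrow> Xv w = 0"
  shows "\<exists>(B :: (('j \<Rightarrow> idx \<Rightarrow> 'k) \<Rightarrow> 'k) set) \<sigma> \<pi>. lin_map W (fs B) \<sigma> \<and> lin_map (fs B) W \<pi> \<and> (\<forall>v\<in>W. \<pi> (\<sigma> v) = v)"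
proof -
  define G where "G = {a \<in> fin_fun W. eps a = 0}"
  have e0: "eps (0 :: ('j \<Rightarrow> idx \<Rightarrow> 'k) \<Rightarrow> nat \<Rightarrow> 'k) = 0" by (auto simp: eps_def fun_eq_iff)
  have shf: "(shift ^^ n) a \<in> fin_fun W" if "a \<in> fin_fun W" for n and a :: "('j \<Rightarrow> idx \<Rightarrow> 'k) \<Rightarrow> nat \<Rightarrow> 'k"
    using that by (induct n) (auto intro: fin_fun_shift)
  interpret L: string_lattice q W G
  proof unfold_locales
    show "f + g \<in> G" if "f \<in> G" "g \<in> G" for f g
      using that fin_fun_add[of f W g] by (auto simp: G_def eps_add[of f W g])
    show "(\<lambda>s l. a * f s l) \<in> G" if "f \<in> G" for f a
      using that fin_fun_scale[of f W a] by (auto simp: G_def eps_scale[of f W] fun_eq_iff)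
    show "shift f \<in> G" if "f \<in> G" for f
      using that fin_fun_shift[of f W] by (auto simp: G_def eps_shift[of f W] Yv_zero)
    show "(shift ^^ q) f \<in> G" if "f \<in> fin_fun W" for f
      using shf[OF that] eps_shift_pow[OF that, of q] by (simp add: G_def Yv_pow_q)
  qed (auto simp: G_def fin_fun_zero e0)
  let ?B = "L.base"
  \<comment> \<open>Two preimages of the same element of W differ by an element of G, whose
    coordinates at b vanish below the height of b.\<close>
  have coord_eq: "L.coord l a b = L.coord l a' b"
    if "a \<in> fin_fun W" "a' \<in> fin_fun W" "eps a = eps a'" "l < L.ht b" for a a' l b
  proof -
    have m: "(\<lambda>s l. (-1) * a' s l) \<in> fin_fun W" using fin_fun_scale[OF that(2)] .
    have "a + (\<lambda>s l. (-1) * a' s l) \<in> G"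
      unfolding G_def using that fin_fun_add[OF that(1) m]
      by (simp only: mem_Collect_eq eps_add[OF that(1) m] eps_scale[OF that(2)]) (auto simp: fun_eq_iff)
    then have "L.coord l (a + (\<lambda>s l. (-1) * a' s l)) b = 0"
      using L.coord_G that(4) by (meson not_le)
    then show ?thesis
      unfolding L.coord_add[OF that(1) m] L.coord_scale[OF that(2)] by simp
  qed
  \<comment> \<open>The generator of the ideal (y^i) sits at l = i, so index l carries the
    coordinate of y^(l - i). Height 0 gives i = q, an empty row.\<close>
  define \<sigma> where "\<sigma> w = (\<lambda>b (c, i, l). if b \<in> ?B \<and> c = KR \<and> i = q - L.ht b \<and> i \<le> l \<and> l < q
      then L.coord (l - i) (single w) b else 0)" for w
  define M where "M b = (\<lambda>(c, i, l). if b \<in> ?B \<and> c = KR \<and> i = q - L.ht b \<and> i \<le> l \<and> l < q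
      then (Yv ^^ (l - i)) (eps (L.gen b)) else 0)" for b
  have \<sigma>_simp: "\<sigma> w b (c, i, l) = (if b \<in> ?B \<and> c = KR \<and> i = q - L.ht b \<and> i \<le> l \<and> l < q
      then L.coord (l - i) (single w) b else 0)" for w b c i l
    by (simp add: \<sigma>_def)
  have M_simp: "M b (c, i, l) = (if b \<in> ?B \<and> c = KR \<and> i = q - L.ht b \<and> i \<le> l \<and> l < q
      then (Yv ^^ (l - i)) (eps (L.gen b)) else 0)" for b c i l
    by (simp add: M_def)
  have genW: "eps (L.gen b) \<in> W" if "b \<in> ?B" for b
    by (rule eps_in[OF W Y L.gen(1)[OF that]])
  have powW: "(Yv ^^ l) w \<in> W" if "w \<in> W" for l w using that Y by (induct l) auto
  have gen0: "(Yv ^^ l) (eps (L.gen b)) = 0" if "b \<in> ?B" "L.ht b \<le> l" for b l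
    using L.gen_pow_G[OF that] eps_shift_pow[OF L.gen(1)[OF that(1)], of l] by (simp add: G_def)
  \<comment> \<open>Any preimage under \<open>eps\<close> may replace \<open>single w\<close>.
    Linearity of \<sigma> follows, since preimages can be added, scaled and shifted.\<close>
  have \<sigma>_any: "\<sigma> (eps a) b (c, i, l) = (if b \<in> ?B \<and> c = KR \<and> i = q - L.ht b \<and> i \<le> l \<and> l < q
      then L.coord (l - i) a b else 0)" if a: "a \<in> fin_fun W" for a b c i l
  proof (cases "b \<in> ?B \<and> c = KR \<and> i = q - L.ht b \<and> i \<le> l \<and> l < q")
    case True
    have "l - i < L.ht b" using True L.ht_le_q[of b] by linarith
    then have "L.coord (l - i) (single (eps a)) b = L.coord (l - i) a b"
      using a eps_in[OF W Y a] by (intro coord_eq single_fin_fun) (auto simp: eps_single)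
    then show ?thesis using True by (simp add: \<sigma>_simp)
  qed (auto simp: \<sigma>_simp)
  have \<sigma>fs: "\<sigma> w \<in> fs ?B" if "w \<in> W" for w
  proof (rule fsI)
    let ?U = "\<Union>l<q. {b. L.coord l (single w) b \<noteq> 0}"
    show "finite ?U" by (simp add: L.coord_finite)
    show "?U \<subseteq> ?B" using L.coord_base by blast
    show "b \<in> ?U \<and> t \<in> T" if "\<sigma> w b t \<noteq> 0" for b and t :: idx
    proof -
      obtain c i l where t: "t = (c, i, l)" by (cases t)
      then have *: "i \<le> l" "l < q" "L.coord (l - i) (single w) b \<noteq> 0"
        using that by (auto simp: \<sigma>_simp split: if_splits)
      then have "l - i < q" by simp
      then show ?thesis using * t by auto
    qed
  qed
  have lin: "lin_map W (fs ?B) \<sigma>"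
    unfolding lin_map_def
  proof (intro ballI conjI allI)
    fix v assume v: "v \<in> W"
    have sv: "(single v :: _ \<Rightarrow> nat \<Rightarrow> 'k) \<in> fin_fun W" by (rule single_fin_fun[OF v])
    show "\<sigma> v \<in> fs ?B" by (rule \<sigma>fs[OF v])
    show "\<sigma> (Yv v) = Yv (\<sigma> v)"
    proof (intro ext)
      fix b and t :: idx
      obtain c i l where t: "t = (c, i, l)" by (cases t)
      have "eps (shift (single v)) = Yv v" by (simp add: eps_shift[OF sv] eps_single)
      then have *: "\<sigma> (Yv v) b t = (if b \<in> ?B \<and> c = KR \<and> i = q - L.ht b \<and> i \<le> l \<and> l < q
          then L.coord (l - i) (shift (single v)) b else 0)"
        using \<sigma>_any[OF fin_fun_shift[OF sv], of b c i l] t by simp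
      show "\<sigma> (Yv v) b t = Yv (\<sigma> v) b t"
      proof (cases l)
        case 0
        then show ?thesis unfolding * by (simp add: t L.coord_shift_0)
      next
        case (Suc m)
        show ?thesis
        proof (cases "i \<le> m")
          case True
          then have "l - i = Suc (m - i)" using Suc by simp
          then show ?thesis unfolding * using Suc True by (auto simp: t L.coord_shift_Suc \<sigma>_simp)
        next
          case False
          then have "l - i = 0" using Suc by simp
          then show ?thesis unfolding * using Suc False by (auto simp: t L.coord_shift_0 \<sigma>_simp)
        qed
      qed
    qed
    have zero: "\<sigma> 0 = 0"
    proof (intro ext)
      fix b and t :: idx
      obtain c i l where t: "t = (c, i, l)" by (cases t)
      have "L.coord m 0 b = 0" for m
        using L.coord_scale[OF fin_fun_zero, of m 0 b] by (simp add: zero_fun_def)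
      then show "\<sigma> 0 b t = (0 :: _ \<Rightarrow> idx \<Rightarrow> 'k) b t"
        using \<sigma>_any[OF fin_fun_zero, of b c i l] by (simp add: e0 t)
    qed
    show "\<sigma> (Xv v) = Xv (\<sigma> v)"
      unfolding X[OF v] zero by (auto simp: fun_eq_iff \<sigma>_simp)
    show "\<sigma> (vs c v) = vs c (\<sigma> v)" for c
    proof (intro ext)
      fix b and t :: idx
      obtain c' i l where t: "t = (c', i, l)" by (cases t)
      have "eps (\<lambda>w l. c * single v w l) = vs c v" by (simp add: eps_scale[OF sv] eps_single)
      then show "\<sigma> (vs c v) b t = vs c (\<sigma> v) b t"
        using \<sigma>_any[OF fin_fun_scale[OF sv, of c], of b c' i l]
        by (simp add: t L.coord_scale[OF sv] \<sigma>_simp)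
    qed
    show "\<sigma> (v + w) = \<sigma> v + \<sigma> w" if w: "w \<in> W" for w
    proof (intro ext)
      have sw: "(single w :: _ \<Rightarrow> nat \<Rightarrow> 'k) \<in> fin_fun W" by (rule single_fin_fun[OF w])
      fix b and t :: idx
      obtain c' i l where t: "t = (c', i, l)" by (cases t)
      have "eps (single v + single w) = v + w" by (simp add: eps_add[OF sv sw] eps_single)
      then show "\<sigma> (v + w) b t = (\<sigma> v + \<sigma> w) b t"
        using \<sigma>_any[OF fin_fun_add[OF sv sw], of b c' i l]
        by (simp add: t L.coord_add[OF sv sw] \<sigma>_simp)
    qed
  qed
  have MH: "M b \<in> H W" if b: "b \<in> ?B" for b
  proof (rule HI)
    fix t :: idx
    obtain c i l where t: "t = (c, i, l)" by (cases t)
    show "M b t \<in> W" using powW[OF genW[OF b]] lin_subD(1)[OF W] by (simp add: t M_simp)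
    show "M b t = 0" if "t \<notin> T" using that by (auto simp: t M_simp)
    assume tT: "t \<in> T"
    show "Yv (M b t) = M b (eta t)"
    proof (cases "c = KR \<and> i = q - L.ht b \<and> i \<le> l \<and> l < q")
      case True
      have *: "Yv ((Yv ^^ (l - i)) (eps (L.gen b))) = (Yv ^^ (Suc l - i)) (eps (L.gen b))"
        using True by (simp add: Suc_diff_le)
      show ?thesis
      proof (cases "Suc l < q")
        case False
        \<comment> \<open>Beyond the last index of the row the power of y has reached the height of
          b, where it annihilates the image of the generator in W.\<close>
        then have "L.ht b \<le> Suc l - i" using True L.ht_le_q[OF b] by linarith
        then show ?thesis using True False gen0[OF b] b * by (simp add: t M_simp)
      qed (use True b * in \<open>simp add: t M_simp\<close>)
    qed (use tT in \<open>auto simp: t M_simp Yv_zero\<close>)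
    show "Xv (M b t) = M b (xi t)"
      using X[OF powW[OF genW[OF b]]] by (auto simp: t M_simp Xv_zero)
  qed
  have \<pi>: "lin_map (fs ?B) W (pair M)" by (rule pair_lin_map[OF W MH])
  have "pair M (\<sigma> v) = v" if v: "v \<in> W" for v
  proof (intro ext)
    fix j s
    have sv: "(single v :: _ \<Rightarrow> nat \<Rightarrow> 'k) \<in> fin_fun W" by (rule single_fin_fun[OF v])
    let ?U = "\<Union>l<q. {b. L.coord l (single v) b \<noteq> 0}"
    have U: "finite ?U" by (simp add: L.coord_finite)
    have UB: "?U \<subseteq> ?B" using L.coord_base by blast
    have sub: "{b. \<sigma> v b \<noteq> 0} \<subseteq> ?U"
    proof
      fix b assume "b \<in> {b. \<sigma> v b \<noteq> 0}"
      then obtain t where "\<sigma> v b t \<noteq> 0" by (auto simp: fun_eq_iff)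
      moreover obtain c i l where t: "t = (c, i, l)" by (cases t)
      ultimately have *: "l < q" "L.coord (l - i) (single v) b \<noteq> 0"
        by (auto simp: \<sigma>_simp split: if_splits)
      then have "l - i < q" by simp
      with *(2) show "b \<in> ?U" by blast
    qed
    have inner: "(\<Sum>t\<in>T. \<sigma> v b t * M b t j s)
        = (\<Sum>l<q. L.coord l (single v) b * (Yv ^^ l) (eps (L.gen b)) j s)" if "b \<in> ?U" for b
    proof -
      have b: "b \<in> ?B" using UB that by blast
      let ?i = "q - L.ht b"
      have "(\<Sum>t\<in>T. \<sigma> v b t * M b t j s) = (\<Sum>l<q. \<sigma> v b (KR, ?i, l) * M b (KR, ?i, l) j s)"
      proof (rule sum_line)
        fix t :: idx
        obtain c i l where t: "t = (c, i, l)" by (cases t)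
        show "\<sigma> v b t * M b t j s = 0" if "t \<notin> T" using that by (auto simp: t \<sigma>_simp)
        show "\<sigma> v b t * M b t j s = 0" if "t \<in> T" "t \<notin> line KR ?i" using that by (auto simp: t \<sigma>_simp line_def)
      qed
      also have "\<dots> = (\<Sum>l\<in>{?i..<q}. L.coord (l - ?i) (single v) b * (Yv ^^ (l - ?i)) (eps (L.gen b)) j s)"
        using b by (intro sum.mono_neutral_cong_right) (auto simp: \<sigma>_simp M_simp)
      also have "\<dots> = (\<Sum>l<L.ht b. L.coord l (single v) b * (Yv ^^ l) (eps (L.gen b)) j s)"
        using L.ht_le_q[OF b]
        by (intro sum.reindex_bij_witness[of _ "\<lambda>l. l + ?i" "\<lambda>l. l - ?i"]) auto
      also have "\<dots> = (\<Sum>l<q. L.coord l (single v) b * (Yv ^^ l) (eps (L.gen b)) j s)"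
        using L.ht_le_q[OF b] gen0[OF b] by (intro sum.mono_neutral_left) auto
      finally show ?thesis .
    qed
    have "eps (single v) j s = (\<Sum>b\<in>?U. \<Sum>l<q. L.coord l (single v) b * (Yv ^^ l) (eps (L.gen b)) j s)"
      by (rule L.coord_expansion_map[where \<Theta> = eps])
        (use U sv in \<open>auto simp: eps_add[of _ W] eps_scale[of _ W] eps_shift[of _ W]\<close>)
    then show "pair M (\<sigma> v) j s = v j s"
      using inner by (simp add: pair_superset[OF U sub] eps_single)
  qed
  with lin \<pi> show ?thesis by blast
qed

end

context strings
begin

subsection \<open>Preimages under multiplication by \<open>x\<close>\<close>

text \<open>Vectors over k[[y]] indexed by J times {..<q} become the coefficients of kind c in
  D^(J), cut off at y^q; \<open>part\<close> reads them back.\<close>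

definition emb :: "knd \<Rightarrow> ('j \<times> nat \<Rightarrow> nat \<Rightarrow> 'k::field) \<Rightarrow> 'j \<Rightarrow> idx \<Rightarrow> 'k"
  where "emb c f = (\<lambda>j (c', i, l). if c' = c \<and> i < q \<and> l < q then f (j, i) l else 0)"

definition part :: "knd \<Rightarrow> ('j \<Rightarrow> idx \<Rightarrow> 'k::field) \<Rightarrow> 'j \<times> nat \<Rightarrow> nat \<Rightarrow> 'k"
  where "part c d = (\<lambda>(j, i) l. d j (c, i, l))"

lemma emb_simp [simp]: "emb c f j (c', i, l) = (if c' = c \<and> i < q \<and> l < q then f (j, i) l else 0)"
  by (simp add: emb_def)

lemma part_simp [simp]: "part c d (j, i) l = d j (c, i, l)"
  by (simp add: part_def)

lemma emb_add: "emb c (f + g) = emb c f + emb c g"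
  by (auto simp: fun_eq_iff)

lemma emb_scale: "emb c (\<lambda>s l. a * f s l) = vs a (emb c f)"
  by (auto simp: fun_eq_iff)

lemma emb_shift: "emb c (shift f) = Yv (emb c f)"
proof (intro ext)
  fix j and t :: idx
  obtain c' i l where t: "t = (c', i, l)" by (cases t)
  show "emb c (shift f) j t = Yv (emb c f) j t" by (cases l) (auto simp: t)
qed

lemma emb_shift_pow: "emb c ((shift ^^ n) f) = (Yv ^^ n) (emb c f)"
  by (induct n) (auto simp: emb_shift)

lemma Xv_emb: "Xv (emb KU f) = emb KV f" "Xv (emb KV f) = 0"
  by (auto simp: fun_eq_iff)

lemma emb_fs:
  assumes f: "f \<in> fin_fun (J \<times> {..<q})" and "\<And>j i l. c \<noteq> KV \<Longrightarrow> l < i \<Longrightarrow> f (j, i) l = 0"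
  shows "emb c f \<in> fs J"
proof (rule fsI)
  let ?S = "{s. \<exists>l. f s l \<noteq> 0}"
  have S: "finite ?S" "?S \<subseteq> J \<times> {..<q}" using f by (auto simp: fin_fun_def)
  show "finite (fst ` ?S)" "fst ` ?S \<subseteq> J" using S by auto
  show "j \<in> fst ` ?S \<and> t \<in> T" if "emb c f j t \<noteq> 0" for j t
  proof -
    obtain c' i l where t: "t = (c', i, l)" by (cases t)
    with that have *: "c' = c" "i < q" "l < q" "f (j, i) l \<noteq> 0" by (auto split: if_splits)
    then have "(j, i) \<in> ?S" by blast
    then have "j \<in> fst ` ?S" by (rule image_eqI[rotated]) simp
    moreover have "c \<noteq> KV \<longrightarrow> i \<le> l" using assms(2)[of l i j] *(4) by fastforce
    ultimately show ?thesis using * t by simp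
  qed
qed

lemma part_fin_fun: "d \<in> fs J \<Longrightarrow> part c d \<in> fin_fun (J \<times> {..<q})"
proof (rule fin_funI)
  assume d: "d \<in> fs J"
  show "finite ({j. d j \<noteq> 0} \<times> {..<q})" "{j. d j \<noteq> 0} \<times> {..<q} \<subseteq> J \<times> {..<q}"
    using fsD(1,2)[OF d] by auto
  show "s \<in> {j. d j \<noteq> 0} \<times> {..<q}" if "part c d s l \<noteq> 0" for s l
  proof -
    obtain j i where s: "s = (j, i)" by (cases s)
    with that have "d j (c, i, l) \<noteq> 0" by simp
    from fsD(5,6)[OF d this] show ?thesis by (simp add: s)
  qed
qed

lemma emb_part: "d \<in> fs J \<Longrightarrow> emb c (part c d) j t = (if fst t = c then d j t else 0)"
proof -
  assume d: "d \<in> fs J"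
  obtain c' i l where t: "t = (c', i, l)" by (cases t)
  show ?thesis using fsD(6)[OF d, of j t] by (auto simp: t)
qed

lemma part_add: "part c (d + d') = part c d + part c d'" by (auto simp: fun_eq_iff)

lemma part_vs: "part c (vs a d) = (\<lambda>s l. a * part c d s l)" by (auto simp: fun_eq_iff)

lemma part_Xv: "part KV (Xv d) = part KU d" "part KU (Xv d) = 0" by (auto simp: fun_eq_iff)

lemma part_Yv: "l < q \<Longrightarrow> part c (Yv d) s l = shift (part c d) s l"
  by (cases s; cases l) auto

lemma lin_sub_ker:
  assumes "lin_sub X" "lin_map X X' f"
  shows "lin_sub {d \<in> X. f d = 0}"
  unfolding lin_sub_def
proof (intro conjI ballI allI)
  show "0 \<in> {d \<in> X. f d = 0}" using lin_subD(1)[OF assms(1)] lin_map_zero[OF assms] by simp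
  show "v + w \<in> {d \<in> X. f d = 0}" if "v \<in> {d \<in> X. f d = 0}" "w \<in> {d \<in> X. f d = 0}" for v w
    using that lin_subD(2)[OF assms(1), of v w] lin_mapD(5)[OF assms(2), of v w] by simp
  show "vs c v \<in> {d \<in> X. f d = 0}" if "v \<in> {d \<in> X. f d = 0}" for c v
    using that lin_subD(3)[OF assms(1), of v c] lin_mapD(4)[OF assms(2), of v c] by (auto simp: fun_eq_iff)
qed

lemma lin_map_Xv:
  assumes "lin_map (fs J) X' f"
  shows "lin_map (fs J) X' (\<lambda>d. f (Xv d))"
  unfolding lin_map_def
proof (intro ballI conjI allI)
  note D = lin_mapD[OF assms fs_Xv]
  fix v :: "'a \<Rightarrow> idx \<Rightarrow> 'b" assume v: "v \<in> fs J"
  show "f (Xv v) \<in> X'" by (rule D(1)[OF v])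
  show "f (Xv (Yv v)) = Yv (f (Xv v))" unfolding Xv_Yv by (rule D(2)[OF v])
  show "f (Xv (Xv v)) = Xv (f (Xv v))" by (rule D(3)[OF v])
  show "f (Xv (vs c v)) = vs c (f (Xv v))" for c unfolding Xv_vs by (rule D(4)[OF v])
  show "f (Xv (v + w)) = f (Xv v) + f (Xv w)" if "w \<in> fs J" for w
    unfolding Xv_add by (rule D(5)[OF v fs_Xv[OF that]])
qed

text \<open>An element lies in D iff its \<open>KU\<close> coefficients lie in the lattice G; its
  \<open>KR\<close> and \<open>KV\<close> coefficients are arbitrary because x kills them. With F
  the free k[[y]]-module on J times {..<q}, the \<open>KV\<close> part is F/y^q F, the
  \<open>KU\<close> part is G/y^q F, and x is the inclusion of the second into the first. For a
  stacked basis, \<open>gen b\<close> of F and y^(ht b) \<open>gen b\<close> of G, each b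
  contributes the ideal (x, y^(ht b)). At height q this is (x), isomorphic to k[y]/(y^q).\<close>

theorem decompose_preimage_X:
  fixes J :: "'j set" and X' :: "('i \<Rightarrow> idx \<Rightarrow> 'k::field) set"
  assumes X': "lin_sub X'" and \<psi>: "lin_map (fs J) X' \<psi>"
  defines "D \<equiv> {d \<in> fs J. \<psi> (Xv d) = 0}"
  shows "\<exists>(B :: ('j + ('j \<times> nat \<Rightarrow> 'k)) set) \<sigma> \<pi>. lin_map D (fs B) \<sigma> \<and> lin_map (fs B) D \<pi> \<and> (\<forall>v\<in>D. \<pi> (\<sigma> v) = v)"
proof -
  let ?S = "J \<times> {..<q}"
  define G where "G = {f \<in> fin_fun ?S. (\<forall>j i l. l < i \<longrightarrow> f (j, i) l = 0) \<and> \<psi> (emb KV f) = 0}"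
  have \<psi>0: "\<psi> 0 = 0" by (rule lin_map_zero[OF lin_sub_fs \<psi>])
  have eV: "emb KV f \<in> fs J" if "f \<in> fin_fun ?S" for f :: "'j \<times> nat \<Rightarrow> nat \<Rightarrow> 'k"
    using that by (rule emb_fs) simp
  have emb0: "emb c 0 = (0 :: 'j \<Rightarrow> idx \<Rightarrow> 'k)" for c by (auto simp: fun_eq_iff)
  have shf: "(shift ^^ n) f \<in> fin_fun ?S" if "f \<in> fin_fun ?S" for n and f :: "'j \<times> nat \<Rightarrow> nat \<Rightarrow> 'k"
    using that by (induct n) (auto intro: fin_fun_shift)
  interpret L: string_lattice q ?S G
  proof unfold_locales
    show "0 \<in> G" by (simp add: G_def fin_fun_zero emb0 \<psi>0)
    show "f + g \<in> G" if "f \<in> G" "g \<in> G" for f g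
      using that fin_fun_add[of f ?S g] lin_mapD(5)[OF \<psi> eV eV, of f g] by (auto simp: G_def emb_add)
    show "(\<lambda>s l. a * f s l) \<in> G" if "f \<in> G" for f a
      using that fin_fun_scale[of f ?S a] lin_mapD(4)[OF \<psi> eV, of f a] by (auto simp: G_def emb_scale fun_eq_iff)
    show "shift f \<in> G" if "f \<in> G" for f
    proof -
      have "shift f (j, i) l = 0" if "l < i" for j i l
        using that \<open>f \<in> G\<close> by (cases l) (auto simp: G_def)
      then show ?thesis
        using that fin_fun_shift[of f ?S] lin_mapD(2)[OF \<psi> eV, of f] by (auto simp: G_def emb_shift Yv_zero)
    qed
    show "(shift ^^ q) f \<in> G" if f: "f \<in> fin_fun ?S" for f
    proof -
      have "(shift ^^ q) f (j, i) l = 0" if "l < i" for j i l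
      proof (cases "i < q")
        case False
        then have "f (j, i) m = 0" for m using f by (auto simp: fin_fun_def)
        then show ?thesis by (simp add: shift_pow)
      qed (use that in \<open>simp add: shift_pow\<close>)
      then show ?thesis using shf[OF f] by (simp add: G_def emb_shift_pow Yv_pow_q \<psi>0)
    qed
  qed (auto simp: G_def)
  \<comment> \<open>\<open>Inl j\<close> carries the \<open>KR\<close> part of the j-th copy,
    \<open>Inr b\<close> the ideal that belongs to the generator b.\<close>
  let ?B = "Inl ` J \<union> Inr ` L.base"
  have Dsub: "D \<subseteq> fs J" by (auto simp: D_def)
  have Dlin: "lin_sub D"
    unfolding D_def by (rule lin_sub_ker[OF lin_sub_fs lin_map_Xv[OF \<psi>]])
  have GU: "part KU d \<in> G" if d: "d \<in> D" for d
  proof -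
    have d': "d \<in> fs J" using d Dsub by blast
    have "emb KV (part KU d) = Xv d"
    proof (intro ext)
      fix j and t :: idx
      obtain c i l where t: "t = (c, i, l)" by (cases t)
      show "emb KV (part KU d) j t = Xv d j t"
        using fsD(6)[OF d', of j "(KU, i, l)"] by (auto simp: t)
    qed
    moreover have "d j (KU, i, l) = 0" if "l < i" for j i l
      using fsD(3)[OF d', of "(KU, i, l)" j] that by auto
    ultimately show ?thesis using d part_fin_fun[OF d'] by (auto simp: G_def D_def)
  qed
  \<comment> \<open>A generator of height q would need i = q, which is outside of T. Its summand (x)
    is placed in the row \<open>KR\<close> with i = 0, the copy of k[y]/(y^q).\<close>
  define \<sigma> where "\<sigma> d = (\<lambda>b (c, i, l). case b of
      Inl j \<Rightarrow> if c = KR then d j (KR, i, l) else 0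
    | Inr b \<Rightarrow> if b \<in> L.base \<and> l < q then
        (if L.ht b < q then (if i = L.ht b \<and> c \<noteq> KR then L.coord l (part c d) b else 0)
         else (if c = KR \<and> i = 0 then L.coord l (part KV d) b else 0)) else 0)" for d
  have \<sigma>L: "\<sigma> d (Inl j) (c, i, l) = (if c = KR then d j (KR, i, l) else 0)" for d j c i l
    by (simp add: \<sigma>_def)
  have \<sigma>R: "\<sigma> d (Inr b) (c, i, l) = (if b \<in> L.base \<and> l < q then
        (if L.ht b < q then (if i = L.ht b \<and> c \<noteq> KR then L.coord l (part c d) b else 0)
         else (if c = KR \<and> i = 0 then L.coord l (part KV d) b else 0)) else 0)" for d b c i l
    by (simp add: \<sigma>_def)
  define \<delta> :: "'j \<Rightarrow> idx \<Rightarrow> 'j \<Rightarrow> idx \<Rightarrow> 'k" where "\<delta> j t = (\<lambda>j' t'. if j' = j \<and> t' = t then 1 else 0)" for j t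
  define M where "M b = (\<lambda>(c, i, l). case b of
      Inl j \<Rightarrow> if c = KR \<and> i \<le> l \<and> l < q then \<delta> j (KR, i, l) else 0
    | Inr b \<Rightarrow> if b \<in> L.base \<and> l < q then
        (if L.ht b < q then (if i = L.ht b \<and> (c = KV \<or> c = KU \<and> i \<le> l) then (Yv ^^ l) (emb c (L.gen b)) else 0)
         else (if c = KR \<and> i = 0 then (Yv ^^ l) (emb KV (L.gen b)) else 0)) else 0)" for b :: "'j + ('j \<times> nat \<Rightarrow> 'k)"
  have M_Inl: "M (Inl j) (c, i, l) = (if c = KR \<and> i \<le> l \<and> l < q then \<delta> j (KR, i, l) else 0)" for j c i l
    by (simp add: M_def)
  have M_Inr: "M (Inr b) (c, i, l) = (if b \<in> L.base \<and> l < q then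
        (if L.ht b < q then (if i = L.ht b \<and> (c = KV \<or> c = KU \<and> i \<le> l) then (Yv ^^ l) (emb c (L.gen b)) else 0)
         else (if c = KR \<and> i = 0 then (Yv ^^ l) (emb KV (L.gen b)) else 0)) else 0)" for b c i l
    by (simp add: M_def)
  \<comment> \<open>This keeps the \<open>KU\<close> coordinates inside the row of (x, y^i), which
    starts at y^i.\<close>
  have pKU0: "L.coord l (part KU d) b = 0" if "d \<in> D" "l < L.ht b" for d l b
    using L.coord_G[OF GU[OF that(1)], of l b] that(2) by linarith
  have \<sigma>fs: "\<sigma> d \<in> fs ?B" if d: "d \<in> D" for d
  proof (rule fsI)
    have d': "d \<in> fs J" using d Dsub by blast
    let ?U = "Inl ` {j. d j \<noteq> 0} \<union> Inr ` (\<Union>c\<in>{KR, KU, KV}. \<Union>l<q. {b. L.coord l (part c d) b \<noteq> 0})"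
    show "finite ?U" using fsD(1)[OF d'] L.coord_finite by auto
    show "?U \<subseteq> ?B"
    proof (rule Un_mono)
      show "Inl ` {j. d j \<noteq> 0} \<subseteq> Inl ` J" using fsD(2)[OF d'] by (rule image_mono)
      have "(\<Union>c\<in>{KR, KU, KV}. \<Union>l<q. {b. L.coord l (part c d) b \<noteq> 0}) \<subseteq> L.base"
        by (intro UN_least subsetI) (use L.coord_base in blast)
      then show "Inr ` (\<Union>c\<in>{KR, KU, KV}. \<Union>l<q. {b. L.coord l (part c d) b \<noteq> 0}) \<subseteq> Inr ` L.base"
        by (rule image_mono)
    qed
    show "b \<in> ?U \<and> t \<in> T" if nz: "\<sigma> d b t \<noteq> 0" for b and t :: idx
    proof -
      obtain c i l where t: "t = (c, i, l)" by (cases t)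
      show ?thesis
      proof (cases b)
        case (Inl j)
        then have "c = KR" "d j (KR, i, l) \<noteq> 0" using nz by (auto simp: t \<sigma>L split: if_splits)
        then show ?thesis using fsD(5,6)[OF d', of j "(KR, i, l)"] Inl t by auto
      next
        case (Inr b')
        have lq: "l < q" and iq: "i < q" and ci: "c \<noteq> KR \<longrightarrow> i = L.ht b'" "c = KR \<longrightarrow> i = 0"
          using nz q_pos by (auto simp: t \<sigma>R Inr split: if_splits)
        have co: "L.coord l (part (if c = KR then KV else c) d) b' \<noteq> 0"
          using nz by (auto simp: t \<sigma>R Inr split: if_splits)
        moreover have "(if c = KR then KV else c) \<in> {KR, KU, KV}" by (cases c) auto
        ultimately have "b' \<in> (\<Union>c\<in>{KR, KU, KV}. \<Union>l<q. {b. L.coord l (part c d) b \<noteq> 0})"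
          using lq by blast
        moreover have "c \<noteq> KV \<longrightarrow> i \<le> l"
        proof (cases c)
          case KU
          then have "\<not> l < L.ht b'" using co pKU0[OF d, of l b'] by auto
          then show ?thesis using KU ci by simp
        qed (use ci in auto)
        ultimately show ?thesis using Inr t lq iq by auto
      qed
    qed
  qed
  \<comment> \<open>The two vectors differ only from y^q on, where coefficient vectors are cut off;
    coordinates below q do not see the difference.\<close>
  have coordY: "L.coord l (part c (Yv d)) b = L.coord l (shift (part c d)) b" if "d \<in> fs J" "l < q" for d l c b
    using that by (intro L.coord_cong[of _ _ q] part_fin_fun fs_Yv fin_fun_shift part_Yv)
  have coord0: "L.coord l 0 b = 0" for l b
    using L.coord_scale[OF fin_fun_zero, of l 0 b] by (simp add: zero_fun_def)
  have lin: "lin_map D (fs ?B) \<sigma>"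
    unfolding lin_map_def
  proof (intro ballI conjI allI)
    fix v assume v: "v \<in> D"
    then have v': "v \<in> fs J" using Dsub by blast
    note pv = part_fin_fun[OF v']
    show "\<sigma> v \<in> fs ?B" by (rule \<sigma>fs[OF v])
    show "\<sigma> (Yv v) = Yv (\<sigma> v)"
    proof (intro ext)
      fix b and t :: idx
      obtain c i l where t: "t = (c, i, l)" by (cases t)
      show "\<sigma> (Yv v) b t = Yv (\<sigma> v) b t"
      proof (cases b)
        case (Inl j)
        then show ?thesis by (cases l) (auto simp: t \<sigma>L)
      next
        case (Inr b')
        have *: "L.coord m (part c (Yv v)) b' = (case m of 0 \<Rightarrow> 0 | Suc m' \<Rightarrow> L.coord m' (part c v) b')"
          if "m < q" for m c
          using coordY[OF v' that] by (cases m) (auto simp: L.coord_shift_0 L.coord_shift_Suc)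
        show ?thesis by (cases l) (auto simp: t Inr \<sigma>R *)
      qed
    qed
    show "\<sigma> (Xv v) = Xv (\<sigma> v)"
    proof (intro ext)
      fix b and t :: idx
      obtain c i l where t: "t = (c, i, l)" by (cases t)
      show "\<sigma> (Xv v) b t = Xv (\<sigma> v) b t"
      proof (cases b)
        case (Inl j)
        then show ?thesis by (auto simp: t \<sigma>L)
      next
        case (Inr b')
        \<comment> \<open>For a generator of height q the \<open>KR\<close> row receives coordinates
          of the \<open>KU\<close> part of v, and these vanish below the height.\<close>
        show ?thesis
          using pKU0[OF v, of l b'] by (cases c) (auto simp: t Inr \<sigma>R part_Xv coord0)
      qed
    qed
    show "\<sigma> (vs a v) = vs a (\<sigma> v)" for a
    proof (intro ext)
      fix b and t :: idx
      obtain c i l where t: "t = (c, i, l)" by (cases t)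
      show "\<sigma> (vs a v) b t = vs a (\<sigma> v) b t"
        by (cases b) (auto simp: t \<sigma>L \<sigma>R part_vs L.coord_scale[OF pv])
    qed
    show "\<sigma> (v + w) = \<sigma> v + \<sigma> w" if w: "w \<in> D" for w
    proof (intro ext)
      have w': "w \<in> fs J" using w Dsub by blast
      note pw = part_fin_fun[OF w']
      fix b and t :: idx
      obtain c i l where t: "t = (c, i, l)" by (cases t)
      show "\<sigma> (v + w) b t = (\<sigma> v + \<sigma> w) b t"
        by (cases b) (auto simp: t \<sigma>L \<sigma>R part_add L.coord_add[OF pv pw])
    qed
  qed
  have \<delta>fs: "\<delta> j (KR, i, l) \<in> fs J" if "j \<in> J" "i \<le> l" "l < q" for j i l
    by (rule fsI[of "{j}"]) (use that in \<open>auto simp: \<delta>_def split: if_splits\<close>)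
  have X\<delta>: "Xv (\<delta> j (KR, i, l)) = 0" for j i l
    by (auto simp: \<delta>_def fun_eq_iff)
  have Y\<delta>: "Yv (\<delta> j (KR, i, l)) = (if Suc l < q then \<delta> j (KR, i, Suc l) else 0)" for j i l
  proof (intro ext)
    fix j' and t :: idx
    obtain c' i' l' where t: "t = (c', i', l')" by (cases t)
    show "Yv (\<delta> j (KR, i, l)) j' t = (if Suc l < q then \<delta> j (KR, i, Suc l) else 0) j' t"
      by (cases l') (auto simp: t \<delta>_def)
  qed
  have eVD: "emb KV f \<in> D" if "f \<in> fin_fun ?S" for f
    using eV[OF that] by (simp add: D_def Xv_emb \<psi>0)
  have eUD: "emb KU f \<in> D" if "f \<in> G" for f
  proof -
    have "emb KU f \<in> fs J" using that by (intro emb_fs) (auto simp: G_def)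
    then show ?thesis using that by (simp add: D_def Xv_emb G_def)
  qed
  have genY: "(Yv ^^ l) (emb c (L.gen b)) = emb c ((shift ^^ l) (L.gen b))" for l c b
    by (simp add: emb_shift_pow)
  have MH: "M b \<in> H D" if b: "b \<in> ?B" for b
  proof (rule HI)
    fix t :: idx
    obtain c i l where t: "t = (c, i, l)" by (cases t)
    have D0: "0 \<in> D" by (rule lin_subD(1)[OF Dlin])
    show "M b t \<in> D"
    proof (cases b)
      case (Inl j)
      then have "j \<in> J" using b by auto
      then show ?thesis using \<delta>fs[of j i l] D0 by (auto simp: t Inl M_Inl D_def X\<delta> \<psi>0)
    next
      case (Inr b')
      then have b': "b' \<in> L.base" using b by auto
      note L.gen(1)[OF b']
      then show ?thesis
        using D0 eVD[OF shf[OF L.gen(1)[OF b']], of l] eUD[OF L.gen_pow_G[OF b'], of l]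
        by (auto simp: t Inr M_Inr genY)
    qed
    show "M b t = 0" if "t \<notin> T"
      using that L.ht_le_q by (cases b) (auto simp: t M_Inl M_Inr)
    assume tT: "t \<in> T"
    show "Yv (M b t) = M b (eta t)"
    proof (cases b)
      case (Inl j)
      then show ?thesis using tT by (auto simp: t M_Inl Y\<delta> Yv_zero)
    next
      case (Inr b')
      have z: "Yv ((Yv ^^ l) w) = 0" if "\<not> Suc l < q" for w :: "'j \<Rightarrow> idx \<Rightarrow> 'k"
      proof -
        have "Suc l = q" using that tT t by simp
        then show ?thesis using Yv_pow_q[of w] by auto
      qed
      show ?thesis using tT by (auto simp: t Inr M_Inr Yv_zero z)
    qed
    show "Xv (M b t) = M b (xi t)"
    proof (cases b)
      case (Inl j)
      then show ?thesis by (auto simp: t M_Inl X\<delta> Xv_zero)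
    next
      case (Inr b')
      show ?thesis using tT by (cases c) (auto simp: t Inr M_Inr Xv_zero genY Xv_emb)
    qed
  qed
  have \<pi>: "lin_map (fs ?B) D (pair M)" by (rule pair_lin_map[OF Dlin MH])
  have "pair M (\<sigma> d) = d" if d: "d \<in> D" for d
  proof (intro ext)
    fix j and s :: idx
    have d': "d \<in> fs J" using d Dsub by blast
    let ?J = "{j. d j \<noteq> 0}"
    let ?V = "\<lambda>c. \<Union>l<q. {b. L.coord l (part c d) b \<noteq> 0}"
    let ?W = "?V KU \<union> ?V KV"
    have J: "finite ?J" by (rule fsD(1)[OF d'])
    have W: "finite ?W" "?W \<subseteq> L.base" using L.coord_finite L.coord_base by auto
    have sub: "{b. \<sigma> d b \<noteq> 0} \<subseteq> Inl ` ?J \<union> Inr ` ?W"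
    proof
      fix b assume "b \<in> {b. \<sigma> d b \<noteq> 0}"
      then obtain t where nz: "\<sigma> d b t \<noteq> 0" by (auto simp: fun_eq_iff)
      obtain c i l where t: "t = (c, i, l)" by (cases t)
      show "b \<in> Inl ` ?J \<union> Inr ` ?W"
      proof (cases b)
        case (Inl j)
        then have "d j \<noteq> 0" using nz by (auto simp: t \<sigma>L fun_eq_iff split: if_splits)
        then show ?thesis using Inl by blast
      next
        case (Inr b')
        then have "b' \<in> ?W" using nz by (cases c) (auto simp: t \<sigma>R split: if_splits)
        then show ?thesis using Inr by blast
      qed
    qed
    have ex: "emb c (part c d) j s = (\<Sum>b\<in>?W. \<Sum>l<q. L.coord l (part c d) b * (Yv ^^ l) (emb c (L.gen b)) j s)"
      if "c \<in> {KU, KV}" for c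
      by (rule L.coord_expansion_map[where \<Theta> = "emb c"])
        (use W that part_fin_fun[OF d'] in \<open>auto simp: emb_add emb_scale emb_shift\<close>)
    have "pair M (\<sigma> d) j s = (\<Sum>b\<in>Inl ` ?J \<union> Inr ` ?W. \<Sum>t\<in>T. \<sigma> d b t * M b t j s)"
      using J W by (intro pair_superset[OF _ sub]) auto
    also have "\<dots> = (\<Sum>b\<in>Inl ` ?J. \<Sum>t\<in>T. \<sigma> d b t * M b t j s) + (\<Sum>b\<in>Inr ` ?W. \<Sum>t\<in>T. \<sigma> d b t * M b t j s)"
      using J W by (intro sum.union_disjoint) auto
    also have "(\<Sum>b\<in>Inl ` ?J. \<Sum>t\<in>T. \<sigma> d b t * M b t j s) = (\<Sum>j'\<in>?J. \<Sum>t\<in>T. \<sigma> d (Inl j') t * M (Inl j') t j s)"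
      by (subst sum.reindex) auto
    also have "\<dots> = (\<Sum>j'\<in>?J. if j' = j then (if fst s = KR then d j s else 0) else 0)"
    proof (rule sum.cong[OF refl])
      fix j'
      have "(\<Sum>t\<in>T. \<sigma> d (Inl j') t * M (Inl j') t j s) = (\<Sum>t\<in>T. if t = s then (if j' = j \<and> fst s = KR then d j s else 0) else 0)"
      proof (rule sum.cong[OF refl])
        fix t assume "t \<in> T"
        obtain c i l where t: "t = (c, i, l)" by (cases t)
        show "\<sigma> d (Inl j') t * M (Inl j') t j s = (if t = s then (if j' = j \<and> fst s = KR then d j s else 0) else 0)"
          using \<open>t \<in> T\<close> by (auto simp: t \<sigma>L M_Inl \<delta>_def)
      qed
      also have "\<dots> = (if j' = j then (if fst s = KR then d j s else 0) else 0)"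
        using fsD(3)[OF d', of s j] by simp
      finally show "(\<Sum>t\<in>T. \<sigma> d (Inl j') t * M (Inl j') t j s) = (if j' = j then (if fst s = KR then d j s else 0) else 0)" .
    qed
    also have "\<dots> = (if fst s = KR then d j s else 0)"
      using J by (auto simp: fun_eq_iff)
    also have "(\<Sum>b\<in>Inr ` ?W. \<Sum>t\<in>T. \<sigma> d b t * M b t j s) = (\<Sum>b\<in>?W. \<Sum>t\<in>T. \<sigma> d (Inr b) t * M (Inr b) t j s)"
      by (subst sum.reindex) auto
    also have "\<dots> = (\<Sum>b\<in>?W. (\<Sum>l<q. L.coord l (part KV d) b * (Yv ^^ l) (emb KV (L.gen b)) j s)
        + (\<Sum>l<q. L.coord l (part KU d) b * (Yv ^^ l) (emb KU (L.gen b)) j s))"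
    proof (rule sum.cong[OF refl])
      fix b assume "b \<in> ?W"
      then have b: "b \<in> L.base" using W(2) by blast
      let ?g = "\<lambda>t. \<sigma> d (Inr b) t * M (Inr b) t j s"
      have g0: "?g t = 0" if "t \<notin> T" for t
      proof -
        obtain c i l where t: "t = (c, i, l)" by (cases t)
        show ?thesis using that by (auto simp: t \<sigma>R M_Inr)
      qed
      have KUz: "(\<Sum>l<q. L.coord l (part KU d) b * (Yv ^^ l) (emb KU (L.gen b)) j s)
        = (\<Sum>l<q. if L.ht b \<le> l then L.coord l (part KU d) b * (Yv ^^ l) (emb KU (L.gen b)) j s else 0)"
        using pKU0[OF d] by (intro sum.cong) auto
      show "(\<Sum>t\<in>T. ?g t) = (\<Sum>l<q. L.coord l (part KV d) b * (Yv ^^ l) (emb KV (L.gen b)) j s)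
        + (\<Sum>l<q. L.coord l (part KU d) b * (Yv ^^ l) (emb KU (L.gen b)) j s)"
      proof (cases "L.ht b < q")
        case True
        let ?gV = "\<lambda>t. if fst t = KV then ?g t else 0" and ?gU = "\<lambda>t. if fst t = KU then ?g t else 0"
        have "(\<Sum>t\<in>T. ?g t) = (\<Sum>t\<in>T. ?gV t + ?gU t)"
        proof (rule sum.cong[OF refl])
          fix t :: idx
          obtain c i l where t: "t = (c, i, l)" by (cases t)
          show "?g t = ?gV t + ?gU t" using True by (cases c) (auto simp: t \<sigma>R)
        qed
        also have "\<dots> = (\<Sum>t\<in>T. ?gV t) + (\<Sum>t\<in>T. ?gU t)" by (rule sum.distrib)
        also have "(\<Sum>t\<in>T. ?gV t) = (\<Sum>l<q. ?gV (KV, L.ht b, l))"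
        proof (rule sum_line)
          fix t :: idx
          obtain c i l where t: "t = (c, i, l)" by (cases t)
          show "?gV t = 0" if "t \<notin> T" using g0[OF that] by simp
          show "?gV t = 0" if "t \<in> T" "t \<notin> line KV (L.ht b)" using that True by (auto simp: t \<sigma>R line_def)
        qed
        also have "(\<Sum>t\<in>T. ?gU t) = (\<Sum>l<q. ?gU (KU, L.ht b, l))"
        proof (rule sum_line)
          fix t :: idx
          obtain c i l where t: "t = (c, i, l)" by (cases t)
          show "?gU t = 0" if "t \<notin> T" using g0[OF that] by simp
          show "?gU t = 0" if "t \<in> T" "t \<notin> line KU (L.ht b)" using that True by (auto simp: t \<sigma>R line_def)
        qed
        also have "(\<Sum>l<q. ?gV (KV, L.ht b, l)) = (\<Sum>l<q. L.coord l (part KV d) b * (Yv ^^ l) (emb KV (L.gen b)) j s)"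
          using b True by (intro sum.cong) (auto simp: \<sigma>R M_Inr)
        also have "(\<Sum>l<q. ?gU (KU, L.ht b, l)) = (\<Sum>l<q. L.coord l (part KU d) b * (Yv ^^ l) (emb KU (L.gen b)) j s)"
          unfolding KUz using b True by (intro sum.cong) (auto simp: \<sigma>R M_Inr)
        finally show ?thesis .
      next
        case False
        have "(\<Sum>t\<in>T. ?g t) = (\<Sum>l<q. ?g (KR, 0, l))"
        proof (rule sum_line)
          fix t :: idx
          obtain c i l where t: "t = (c, i, l)" by (cases t)
          show "?g t = 0" if "t \<notin> T" using g0[OF that] .
          show "?g t = 0" if "t \<in> T" "t \<notin> line KR 0" using that False by (auto simp: t \<sigma>R line_def)
        qed
        also have "\<dots> = (\<Sum>l<q. L.coord l (part KV d) b * (Yv ^^ l) (emb KV (L.gen b)) j s)"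
          using b False by (intro sum.cong) (auto simp: \<sigma>R M_Inr)
        moreover have "(\<Sum>l<q. L.coord l (part KU d) b * (Yv ^^ l) (emb KU (L.gen b)) j s) = 0"
          unfolding KUz using False by (intro sum.neutral) auto
        ultimately show ?thesis by simp
      qed
    qed
    also have "\<dots> = emb KV (part KV d) j s + emb KU (part KU d) j s"
      unfolding sum.distrib
      using ex[of KV] ex[of KU] by simp
    also have "(if fst s = KR then d j s else 0) + (emb KV (part KV d) j s + emb KU (part KU d) j s) = d j s"
      unfolding emb_part[OF d'] by (cases "fst s") auto
    finally show "pair M (\<sigma> d) j s = d j s" .
  qed
  with lin \<pi> show ?thesis by blast
qed

end

section \<open>Global dimension at most 3\<close>

context mat_ring
begin

lemma H_mono: "X \<subseteq> X' \<Longrightarrow> H X \<subseteq> H X'"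
  unfolding H_def by blast

lemma HM_hom_mono: "f \<in> module_homs E N (HM X) \<Longrightarrow> X \<subseteq> X' \<Longrightarrow> f \<in> module_homs E N (HM X')"
  using H_mono[of X X'] by (auto simp: module_homs_def Pi_def)

lemma free_cover:
  fixes N :: "('e, 'b) module"
  assumes N: "left_module E N" and j: "inj_on j (carrier N)"
  shows "\<exists>\<phi>\<in>module_homs E (FE (j ` carrier N)) N. \<phi> ` carrier (FE (j ` carrier N)) = carrier N"
proof -
  let ?n = "the_inv_into (carrier N) j"
  have n: "?n \<in> j ` carrier N \<rightarrow> carrier N"
    using the_inv_into_into[OF j] by auto
  have h: "ev N ?n \<in> module_homs E (FE (j ` carrier N)) N" by (rule ev_hom[OF N n])
  have "x \<in> ev N ?n ` carrier (FE (j ` carrier N))" if "x \<in> carrier N" for x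
  proof (rule image_eqI)
    show "x = ev N ?n (unit (j x))"
      using ev_unit[OF N n, of "j x"] that by (simp add: the_inv_into_f_f[OF j])
    show "unit (j x) \<in> carrier (FE (j ` carrier N))" using that by (simp add: unit_H)
  qed
  then show ?thesis using h hom_closed[OF h] by blast
qed

text \<open>The first two terms are free covers of X and of its first syzygy. All index sets are
  subsets of \<open>'m\<close>, so a single encoding serves for every term.\<close>

theorem gl_dim_le_3:
  fixes c :: "(idx \<times> 'm \<times> idx) \<times> 'k \<Rightarrow> 'm"
  assumes inf: "infinite (UNIV :: 'm set)" and c: "inj c"
  shows "gl_dim TYPE('m) E \<le> 3"
  unfolding gl_dim_def
proof (rule Sup_least, safe)
  fix X :: "('e, 'm) module" assume X: "left_module E X"
  obtain f :: "((idx \<times> 'm \<times> idx) \<Rightarrow> 'k) \<Rightarrow> 'm" where f: "inj_on f {g. finite {i. g i \<noteq> 0}}"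
    using ex_inj_fin_supp[OF inf c, of 0] by blast
  obtain pr :: "'m \<times> 'm \<Rightarrow> 'm" where pr: "inj pr" using ex_inj_prod[OF inf] by blast
  define enc :: "(idx \<Rightarrow> 'm \<Rightarrow> idx \<Rightarrow> 'k) \<Rightarrow> 'm" where "enc r = f (\<lambda>(t, j, s). r t j s)" for r
  have enc: "inj_on enc (H (fs J))" for J :: "'m set"
  proof (rule inj_onI)
    fix r r' :: "idx \<Rightarrow> 'm \<Rightarrow> idx \<Rightarrow> 'k" assume r: "r \<in> H (fs J)" "r' \<in> H (fs J)" and e: "enc r = enc r'"
    have fin: "(\<lambda>(t, j, s). r t j s) \<in> {g. finite {i. g i \<noteq> 0}}" if r: "r \<in> H (fs J)" for r :: "idx \<Rightarrow> 'm \<Rightarrow> idx \<Rightarrow> 'k"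
    proof -
      have "r t j s \<noteq> 0 \<Longrightarrow> t \<in> T \<and> j \<in> supp r \<and> s \<in> T" for t j s
        using coef(2)[OF r, of j t s] \<mu>D(1,2)[OF coef(1)[OF r, of j], of t] \<mu>D(2)[OF coef(1)[OF r, of j], of s t]
        unfolding supp_def by force
      then have "{i. (\<lambda>(t, j, s). r t j s) i \<noteq> 0} \<subseteq> T \<times> supp r \<times> T" by auto
      moreover have "finite (T \<times> supp r \<times> T)" using supp(1)[OF r] by simp
      ultimately show ?thesis using finite_subset by blast
    qed
    from inj_onD[OF f e[unfolded enc_def] fin[OF r(1)] fin[OF r(2)]]
    have eq: "(\<lambda>(t, j, s). r t j s) = (\<lambda>(t, j, s). r' t j s)" .
    show "r = r'"
    proof (intro ext)
      fix t j s show "r t j s = r' t j s" using fun_cong[OF eq, of "(t, j, s)"] by simp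
    qed
  qed
  obtain e where e: "e \<in> module_homs E (FE (carrier X)) X" "e ` carrier (FE (carrier X)) = carrier X"
    using free_cover[OF X, of "\<lambda>x. x"] by auto
  let ?P0 = "FE (carrier X)"
  let ?K1 = "?P0\<lparr>carrier := {r \<in> carrier ?P0. e r = \<zero>\<^bsub>X\<^esub>}\<rparr>"
  have K1: "left_module E ?K1"
    by (rule left_module.left_module_submodule[OF FE_module submodule_kernel[OF FE_module X e(1)]])
  have "inj_on enc (carrier ?K1)" using enc[of "carrier X"] by (rule inj_on_subset) auto
  then obtain \<phi>1 where \<phi>1': "\<phi>1 \<in> module_homs E (FE (enc ` carrier ?K1)) ?K1"
    "\<phi>1 ` carrier (FE (enc ` carrier ?K1)) = carrier ?K1"
    using free_cover[OF K1, of enc] by blast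
  define J1 where "J1 = enc ` carrier ?K1"
  have \<phi>1: "\<phi>1 \<in> module_homs E (FE J1) ?P0"
    unfolding J1_def by (rule hom_extend_codomain[OF \<phi>1'(1)]) auto
  have \<phi>1i: "{r \<in> carrier ?P0. e r = \<zero>\<^bsub>X\<^esub>} = \<phi>1 ` carrier (FE J1)"
    using \<phi>1'(2) unfolding J1_def by simp
  let ?\<psi>1 = "pair (\<lambda>j. \<phi>1 (unit j))"
  have \<psi>1: "lin_map (fs J1) (fs (carrier X)) ?\<psi>1"
    using hom_closed[OF \<phi>1] unit_H[of _ J1] by (intro pair_lin_map[OF lin_sub_fs]) auto
  \<comment> \<open>Hom(D, -) is left exact: the kernel of \<open>\<phi>1\<close> is Hom(D, X2),
    with X2 the kernel of the map that induces \<open>\<phi>1\<close>.\<close>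
  define X2 where "X2 = {d \<in> fs J1. ?\<psi>1 d = 0}"
  have X2: "lin_sub X2" unfolding X2_def by (rule lin_sub_ker[OF lin_sub_fs \<psi>1])
  have X2s: "X2 \<subseteq> fs J1" by (auto simp: X2_def)
  have K2: "{r \<in> carrier (FE J1). \<phi>1 r = \<zero>\<^bsub>?P0\<^esub>} = H X2"
  proof -
    have "\<phi>1 r = 0 \<longleftrightarrow> r \<in> H X2" if r: "r \<in> H (fs J1)" for r
    proof -
      have "\<phi>1 r = 0 \<longleftrightarrow> (\<forall>t. ?\<psi>1 (r t) = 0)"
        using hom_pair[OF lin_sub_fs \<phi>1 r] by (auto simp: fun_eq_iff[of "\<phi>1 r"])
      also have "\<dots> \<longleftrightarrow> (\<forall>t\<in>T. r t \<in> X2)"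
        using HD(1,4)[OF r] lin_map_zero[OF lin_sub_fs \<psi>1] unfolding X2_def by (metis (mono_tags, lifting) mem_Collect_eq)
      also have "\<dots> \<longleftrightarrow> r \<in> H X2" using r by (auto simp: H_def)
      finally show ?thesis .
    qed
    then show ?thesis using H_mono[OF X2s] by auto
  qed
  have m2: "left_module E (HM X2)" by (rule left_module_HM[OF X2])
  have "inj_on enc (carrier (HM X2))" using enc[of J1] by (rule inj_on_subset) (use H_mono[OF X2s] in simp)
  then obtain \<phi>2 where \<phi>2': "\<phi>2 \<in> module_homs E (FE (enc ` H X2)) (HM X2)" "\<phi>2 ` carrier (FE (enc ` H X2)) = H X2"
    using free_cover[OF m2, of enc] by auto
  define J2 where "J2 = enc ` H X2"
  have \<phi>2: "\<phi>2 \<in> module_homs E (FE J2) (HM X2)" "\<phi>2 ` H (fs J2) = H X2"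
    using \<phi>2' unfolding J2_def by auto
  let ?\<psi>2 = "pair (\<lambda>j. \<phi>2 (unit j))"
  have \<psi>2: "lin_map (fs J2) X2 ?\<psi>2"
    using hom_closed[OF \<phi>2(1)] unit_H[of _ J2] by (intro pair_lin_map[OF X2]) auto
  define W where "W = {d \<in> X2. Xv d = 0}"
  have XvX2: "lin_map X2 (fs J1) Xv"
    using X2s fs_Xv unfolding lin_map_def by (auto simp: Xv_Yv Xv_Xv Xv_zero Xv_vs Xv_add)
  have W: "lin_sub W" unfolding W_def by (rule lin_sub_ker[OF X2 XvX2])
  have Ws: "W \<subseteq> X2" by (auto simp: W_def)
  have WY: "Yv w \<in> W" if "w \<in> W" for w
    using that lin_mapD(2)[OF \<psi>1, of w] fs_Yv[of w J1] by (auto simp: W_def X2_def Xv_Yv Yv_zero)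
  have WX: "Xv w = 0" if "w \<in> W" for w using that by (simp add: W_def)
  have liftW: "lifting TYPE('m) E (HM W)"
    using decompose_ker_X[OF W WY WX] lifting_HM_retract[OF W _ _ _ lifting_FE] by blast
  have mW: "left_module E (HM W)" by (rule left_module_HM[OF W])
  interpret HW: left_module E "HM W" by (rule mW)
  \<comment> \<open>The preimage of W under \<open>?\<psi>2\<close>, written as in
    \<open>decompose_preimage_X\<close>; this is D' of the overview, not the module with basis
    T.\<close>
  define D where "D = {d \<in> fs J2. ?\<psi>2 (Xv d) = 0}"
  have D: "lin_sub D" unfolding D_def by (rule lin_sub_ker[OF lin_sub_fs lin_map_Xv[OF \<psi>2]])
  have Ds: "D \<subseteq> fs J2" by (auto simp: D_def)
  have liftD: "lifting TYPE('m) E (HM D)"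
    using decompose_preimage_X[OF X2 \<psi>2] lifting_HM_retract[OF D _ _ _ lifting_FE] unfolding D_def[symmetric] by blast
  have mD: "left_module E (HM D)" by (rule left_module_HM[OF D])
  have HD_iff: "\<phi>2 r \<in> H W \<longleftrightarrow> r \<in> H D" if r: "r \<in> H (fs J2)" for r
  proof -
    have p: "\<phi>2 r \<in> H X2" using hom_closed[OF \<phi>2(1), of r] r by simp
    have "\<phi>2 r \<in> H W \<longleftrightarrow> (\<forall>t\<in>T. Xv (\<phi>2 r t) = 0)"
      using p by (auto simp: H_def W_def)
    also have "\<dots> \<longleftrightarrow> (\<forall>t\<in>T. ?\<psi>2 (Xv (r t)) = 0)"
      using HD(1)[OF r] lin_mapD(3)[OF \<psi>2] by (simp add: hom_pair[OF X2 \<phi>2(1) r])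
    also have "\<dots> \<longleftrightarrow> r \<in> H D" using r by (auto simp: H_def D_def)
    finally show ?thesis .
  qed
  let ?P2 = "module_prod (FE J2) (HM W)"
  \<comment> \<open>In an element of the kernel of \<open>?d1\<close> the component in
    \<open>HM W\<close> is the negative of the image of the other one. So the kernel is the set of r
    whose image lies in \<open>HM W\<close>, which is \<open>HM D\<close>, embedded by
    \<open>?d2\<close>.\<close>
  let ?d1 = "\<lambda>p. \<phi>2 (fst p) + snd p"
  let ?d2 = "\<lambda>r. (r, \<ominus>\<^bsub>HM W\<^esub> \<phi>2 r)"
  have fs: "fst \<in> module_homs E ?P2 (FE J2)" "snd \<in> module_homs E ?P2 (HM W)"
    by (auto intro!: module_homsI)
  have d1X: "?d1 \<in> module_homs E ?P2 (HM X2)"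
    using hom_plus[OF m2 hom_comp[OF fs(1) \<phi>2(1)] HM_hom_mono[OF fs(2) Ws]] by simp
  have d1: "?d1 \<in> module_homs E ?P2 (FE J1)"
    by (rule HM_hom_mono[OF d1X X2s])
  have \<phi>2D: "\<phi>2 \<in> module_homs E (HM D) (HM W)"
  proof (rule module_homsI)
    fix r s assume r: "r \<in> carrier (HM D)" 
    then have r': "r \<in> H (fs J2)" using H_mono[OF Ds] by auto
    show "\<phi>2 r \<in> carrier (HM W)" using HD_iff[OF r'] r by simp
    show "\<phi>2 (r \<oplus>\<^bsub>HM D\<^esub> s) = \<phi>2 r \<oplus>\<^bsub>HM W\<^esub> \<phi>2 s" if "s \<in> carrier (HM D)"
      using hom_add[OF \<phi>2(1), of r s] r' that H_mono[OF Ds] by auto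
    show "\<phi>2 (a \<odot>\<^bsub>HM D\<^esub> r) = a \<odot>\<^bsub>HM W\<^esub> \<phi>2 r" if "a \<in> carrier E" for a
      using hom_smult[OF \<phi>2(1) that, of r] r' by simp
  qed
  have d2: "?d2 \<in> module_homs E (HM D) ?P2"
    using hom_uminus[OF mW \<phi>2D] H_mono[OF Ds] by (auto simp: module_homs_def Pi_def)
  have neg: "\<ominus>\<^bsub>HM W\<^esub> w = v" if "v \<in> H W" "w \<in> H W" "v + w = 0" for v w
    using HW.M.minus_equality[of v w] that by simp
  have rneg: "w + \<ominus>\<^bsub>HM W\<^esub> w = 0" if "w \<in> H W" for w
    using HW.M.r_neg[of w] that by simp
  have ex2: "{r \<in> carrier (FE J1). \<phi>1 r = \<zero>\<^bsub>?P0\<^esub>} = ?d1 ` carrier ?P2"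
    unfolding K2
  proof
    show "?d1 ` carrier ?P2 \<subseteq> H X2" using hom_closed[OF d1X] by (simp add: image_subset_iff)
    show "H X2 \<subseteq> ?d1 ` carrier ?P2"
    proof
      fix r assume "r \<in> H X2"
      then obtain s where "s \<in> H (fs J2)" "r = \<phi>2 s" using \<phi>2(2) by blast
      then show "r \<in> ?d1 ` carrier ?P2"
        using H_zero[OF W] by (intro image_eqI[of _ _ "(s, 0)"]) auto
    qed
  qed
  have ex3: "{p \<in> carrier ?P2. ?d1 p = \<zero>\<^bsub>FE J1\<^esub>} = ?d2 ` carrier (HM D)"
  proof
    show "?d2 ` carrier (HM D) \<subseteq> {p \<in> carrier ?P2. ?d1 p = \<zero>\<^bsub>FE J1\<^esub>}"
      using hom_closed[OF d2] rneg hom_closed[OF \<phi>2D] by (auto simp: image_subset_iff)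
    show "{p \<in> carrier ?P2. ?d1 p = \<zero>\<^bsub>FE J1\<^esub>} \<subseteq> ?d2 ` carrier (HM D)"
    proof
      fix p assume "p \<in> {p \<in> carrier ?P2. ?d1 p = \<zero>\<^bsub>FE J1\<^esub>}"
      then obtain r w where p: "p = (r, w)" "r \<in> H (fs J2)" "w \<in> H W" "\<phi>2 r + w = 0" by auto
      have "\<phi>2 r = \<ominus>\<^bsub>HM W\<^esub> w"
      proof -
        have "\<phi>2 r + w = \<ominus>\<^bsub>HM W\<^esub> w + w" using p rneg[OF p(3)] by (simp add: add.commute)
        then show ?thesis by (rule add_right_imp_eq)
      qed
      then have 1: "\<phi>2 r \<in> H W" using HW.M.a_inv_closed[of w] p(3) by simp
      then have "r \<in> H D" using HD_iff[OF p(2)] by simp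
      moreover have "w = \<ominus>\<^bsub>HM W\<^esub> \<phi>2 r" using neg[OF p(3) 1] p(4) by (simp add: add.commute)
      ultimately show "p \<in> ?d2 ` carrier (HM D)" using p(1) by simp
    qed
  qed
  have inj2: "inj_on (\<lambda>p. pr (enc (fst p), enc (snd p))) (carrier ?P2)"
  proof (rule inj_onI)
    fix p p' assume p: "p \<in> carrier ?P2" "p' \<in> carrier ?P2"
      and "pr (enc (fst p), enc (snd p)) = pr (enc (fst p'), enc (snd p'))"
    then have e': "enc (fst p) = enc (fst p')" "enc (snd p) = enc (snd p')" using injD[OF pr] by blast+
    have "W \<subseteq> fs J1" using Ws X2s by blast
    then have "H W \<subseteq> H (fs J1)" by (rule H_mono)
    then have "inj_on enc (H W)" using enc[of J1] by (rule inj_on_subset[rotated])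
    from inj_onD[OF this, OF e'(2)] inj_onD[OF enc[of J2], OF e'(1)] show "p = p'"
      using p by (auto intro: prod_eqI)
  qed
  show "proj_dim E X \<le> 3"
  proof (rule proj_dim_le_3[of E X ?P0 "FE J1" ?P2 "HM D" e \<phi>1 ?d1 ?d2 enc enc "\<lambda>p. pr (enc (fst p), enc (snd p))" enc])
    show "lifting TYPE('m) E ?P2"
      by (rule lifting_prod[OF FE_module mW lifting_FE liftW])
    show "left_module E ?P2" by (rule left_module_prod[OF FE_module mW])
    show "{x \<in> carrier (HM D). ?d2 x = \<zero>\<^bsub>?P2\<^esub>} = {\<zero>\<^bsub>HM D\<^esub>}"
    proof -
      have "\<phi>2 0 = 0" using hom_zero[OF mD mW \<phi>2D] by simp
      then have "\<ominus>\<^bsub>HM W\<^esub> \<phi>2 0 = 0" using neg[of 0 0] H_zero[OF W] by simp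
      then show ?thesis using H_zero[OF D] by auto
    qed
    show "inj_on enc (carrier (HM D))"
      using enc[of J2] by (rule inj_on_subset) (use H_mono[OF Ds] in simp)
    show "inj_on enc (carrier ?P0)" "inj_on enc (carrier (FE J1))" using enc by simp_all
  qed (fact X FE_module mD lifting_FE liftD e \<phi>1 d1 d2 \<phi>1i ex2 ex3 inj2)+
qed

end

section \<open>Group algebras of abelian 2-groups in characteristic 2\<close>

locale two_group_algebra = G: comm_group G
  for G :: "('g, 'x) monoid_scheme" (structure) +
  fixes n :: nat and A :: "('g \<Rightarrow> 'k::field) ring"
  assumes fin: "finite (carrier G)"
    and exponent: "g \<in> carrier G \<Longrightarrow> g [^] (2 ^ n :: nat) = \<one>"
    and char2: "CHAR('k) = 2"
    and A_def: "A = group_algebra G"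
begin

lemma two_zero: "x + x = (0 :: 'k)"
proof -
  have "of_nat 2 = (0 :: 'k)" using of_nat_CHAR[where 'a = 'k] by (simp add: char2)
  then have "(1 + 1 :: 'k) = 0" by simp
  then have "(1 + 1) * x = 0" by simp
  then show ?thesis by (simp add: distrib_right)
qed

lemma A_carrier: "f \<in> carrier A \<longleftrightarrow> (\<forall>g. g \<notin> carrier G \<longrightarrow> f g = 0)"
  by (simp add: A_def group_algebra_def)

lemma A_ops:
  "(f \<oplus>\<^bsub>A\<^esub> f') g = f g + f' g" "\<zero>\<^bsub>A\<^esub> = (\<lambda>g. 0)" "\<one>\<^bsub>A\<^esub> = (\<lambda>g. if g = \<one> then 1 else 0)"
  "(f \<otimes>\<^bsub>A\<^esub> f') g = (if g \<in> carrier G then \<Sum>h\<in>carrier G. f h * f' (inv h \<otimes> g) else 0)"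
  by (simp_all add: A_def group_algebra_def)

lemma sum_translate:
  assumes "u \<in> carrier G"
  shows "(\<Sum>h\<in>carrier G. F (u \<otimes> h)) = (\<Sum>h\<in>carrier G. F h)"
  by (rule sum.reindex_bij_witness[of _ "\<lambda>h. inv u \<otimes> h" "\<lambda>h. u \<otimes> h"])
    (use assms in \<open>auto simp: G.m_assoc[symmetric]\<close>)

lemma sum_inv: "(\<Sum>h\<in>carrier G. F (inv h)) = (\<Sum>h\<in>carrier G. F h)"
  by (rule sum.reindex_bij_witness[of _ "\<lambda>h. inv h" "\<lambda>h. inv h"]) auto

lemma A_mult_comm: "f \<otimes>\<^bsub>A\<^esub> f' = f' \<otimes>\<^bsub>A\<^esub> f"
proof
  fix g
  show "(f \<otimes>\<^bsub>A\<^esub> f') g = (f' \<otimes>\<^bsub>A\<^esub> f) g"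
  proof (cases "g \<in> carrier G")
    case True
    have e: "inv (inv h \<otimes> g) \<otimes> g = h" if "h \<in> carrier G" for h
    proof -
      have "inv (inv h \<otimes> g) \<otimes> g = inv g \<otimes> (h \<otimes> g)"
        using that True by (simp add: G.inv_mult_group G.m_assoc)
      also have "\<dots> = inv g \<otimes> (g \<otimes> h)" using that True by (simp only: G.m_comm)
      also have "\<dots> = h" using that True by (simp add: G.m_assoc[symmetric])
      finally show ?thesis .
    qed
    have "(\<Sum>h\<in>carrier G. f h * f' (inv h \<otimes> g)) = (\<Sum>h\<in>carrier G. f' h * f (inv h \<otimes> g))"
      by (rule sum.reindex_bij_witness[of _ "\<lambda>h. inv h \<otimes> g" "\<lambda>h. inv h \<otimes> g"])
        (use True e in \<open>auto simp: mult.commute\<close>)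
    then show ?thesis by (simp add: A_ops)
  qed (simp add: A_ops)
qed

lemma A_cring: "cring A"
proof (rule cringI)
  show "abelian_group A"
  proof (rule abelian_groupI)
    show "\<exists>y\<in>carrier A. y \<oplus>\<^bsub>A\<^esub> f = \<zero>\<^bsub>A\<^esub>" if "f \<in> carrier A" for f
      using that by (intro bexI[of _ f]) (auto simp: A_ops fun_eq_iff two_zero)
  qed (auto simp: A_carrier A_ops fun_eq_iff)
  show "comm_monoid A"
  proof (rule comm_monoidI)
    show "f \<otimes>\<^bsub>A\<^esub> f' \<in> carrier A" for f f' by (simp add: A_carrier A_ops)
    show "\<one>\<^bsub>A\<^esub> \<in> carrier A" by (auto simp: A_carrier A_ops)
    show "f \<otimes>\<^bsub>A\<^esub> f' = f' \<otimes>\<^bsub>A\<^esub> f" for f f' by (rule A_mult_comm)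
    show "\<one>\<^bsub>A\<^esub> \<otimes>\<^bsub>A\<^esub> f = f" if "f \<in> carrier A" for f
    proof
      fix g
      have "(\<Sum>h\<in>carrier G. (if h = \<one> then 1 else 0) * f (inv h \<otimes> g)) = (\<Sum>h\<in>carrier G. if h = \<one> then f g else 0)"
        if "g \<in> carrier G" using that by (intro sum.cong) auto
      then show "(\<one>\<^bsub>A\<^esub> \<otimes>\<^bsub>A\<^esub> f) g = f g" using that fin by (auto simp: A_ops A_carrier)
    qed
    show "f \<otimes>\<^bsub>A\<^esub> f' \<otimes>\<^bsub>A\<^esub> f'' = f \<otimes>\<^bsub>A\<^esub> (f' \<otimes>\<^bsub>A\<^esub> f'')" for f f' f''
    proof
      fix g
      show "(f \<otimes>\<^bsub>A\<^esub> f' \<otimes>\<^bsub>A\<^esub> f'') g = (f \<otimes>\<^bsub>A\<^esub> (f' \<otimes>\<^bsub>A\<^esub> f'')) g"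
      proof (cases "g \<in> carrier G")
        case True
        have "(\<Sum>h\<in>carrier G. (\<Sum>u\<in>carrier G. f u * f' (inv u \<otimes> h)) * f'' (inv h \<otimes> g))
          = (\<Sum>u\<in>carrier G. f u * (\<Sum>h\<in>carrier G. f' (inv u \<otimes> h) * f'' (inv h \<otimes> g)))"
          unfolding sum_distrib_left sum_distrib_right mult.assoc by (rule sum.swap)
        also have "\<dots> = (\<Sum>u\<in>carrier G. f u * (\<Sum>h\<in>carrier G. f' h * f'' (inv h \<otimes> (inv u \<otimes> g))))"
        proof (rule sum.cong[OF refl])
          fix u assume u: "u \<in> carrier G"
          have "(\<Sum>h\<in>carrier G. f' (inv u \<otimes> h) * f'' (inv h \<otimes> g))
            = (\<Sum>h\<in>carrier G. f' (inv u \<otimes> (u \<otimes> h)) * f'' (inv (u \<otimes> h) \<otimes> g))"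
            by (rule sum_translate[OF u, symmetric])
          also have "\<dots> = (\<Sum>h\<in>carrier G. f' h * f'' (inv h \<otimes> (inv u \<otimes> g)))"
          proof (rule sum.cong[OF refl])
            fix h assume h: "h \<in> carrier G"
            have "inv u \<otimes> (u \<otimes> h) = h" using u h by (simp add: G.m_assoc[symmetric])
            moreover have "inv (u \<otimes> h) \<otimes> g = inv h \<otimes> (inv u \<otimes> g)"
              using u h True by (simp add: G.inv_mult_group G.m_assoc)
            ultimately show "f' (inv u \<otimes> (u \<otimes> h)) * f'' (inv (u \<otimes> h) \<otimes> g) = f' h * f'' (inv h \<otimes> (inv u \<otimes> g))"
              by simp
          qed
          finally show "f u * (\<Sum>h\<in>carrier G. f' (inv u \<otimes> h) * f'' (inv h \<otimes> g))
            = f u * (\<Sum>h\<in>carrier G. f' h * f'' (inv h \<otimes> (inv u \<otimes> g)))" by simp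
        qed
        finally show ?thesis using True by (simp add: A_ops)
      qed (simp add: A_ops)
    qed
  qed
  show "(f \<oplus>\<^bsub>A\<^esub> f') \<otimes>\<^bsub>A\<^esub> f'' = f \<otimes>\<^bsub>A\<^esub> f'' \<oplus>\<^bsub>A\<^esub> f' \<otimes>\<^bsub>A\<^esub> f''" for f f' f''
    by (auto simp: A_ops fun_eq_iff distrib_right sum.distrib)
qed

sublocale A: cring A by (rule A_cring)

definition sgl :: "'g \<Rightarrow> 'k \<Rightarrow> 'g \<Rightarrow> 'k" where "sgl g c = (\<lambda>h. if h = g then c else 0)"

lemma sgl_closed [simp]: "g \<in> carrier G \<Longrightarrow> sgl g c \<in> carrier A"
  by (auto simp: sgl_def A_carrier)

lemma sgl_mult_apply:
  assumes "g \<in> carrier G" "u \<in> carrier G"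
  shows "(sgl g c \<otimes>\<^bsub>A\<^esub> f) u = c * f (inv g \<otimes> u)"
proof -
  have "(\<Sum>h\<in>carrier G. sgl g c h * f (inv h \<otimes> u)) = (\<Sum>h\<in>carrier G. if h = g then c * f (inv g \<otimes> u) else 0)"
    by (rule sum.cong) (auto simp: sgl_def)
  then show ?thesis using assms fin by (simp add: A_ops)
qed

lemma sgl_mult:
  assumes "g \<in> carrier G" "h \<in> carrier G"
  shows "sgl g c \<otimes>\<^bsub>A\<^esub> sgl h d = sgl (g \<otimes> h) (c * d)"
proof
  fix u
  show "(sgl g c \<otimes>\<^bsub>A\<^esub> sgl h d) u = sgl (g \<otimes> h) (c * d) u"
  proof (cases "u \<in> carrier G")
    case True
    have "inv g \<otimes> u = h \<longleftrightarrow> u = g \<otimes> h"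
      using assms True by (metis G.inv_closed G.inv_solve_left)
    then show ?thesis using sgl_mult_apply[OF assms(1) True] by (simp add: sgl_def)
  next
    case False
    then show ?thesis using assms by (auto simp: A_ops sgl_def)
  qed
qed

lemma sgl_one: "\<one>\<^bsub>A\<^esub> = sgl \<one> 1" by (simp add: A_ops sgl_def)

lemma sgl_add: "sgl g (c + d) = sgl g c \<oplus>\<^bsub>A\<^esub> sgl g d"
  by (auto simp: A_ops sgl_def fun_eq_iff)

lemma sgl_zero: "sgl g 0 = \<zero>\<^bsub>A\<^esub>"
  by (auto simp: A_ops sgl_def fun_eq_iff)

lemma A_induct [consumes 1, case_names zero add]:
  assumes f: "f \<in> carrier A" and z: "P \<zero>\<^bsub>A\<^esub>"
    and a: "\<And>f g c. f \<in> carrier A \<Longrightarrow> g \<in> carrier G \<Longrightarrow> P f \<Longrightarrow> P (f \<oplus>\<^bsub>A\<^esub> sgl g c)"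
  shows "P f"
proof -
  have "\<forall>f\<in>carrier A. {g. f g \<noteq> 0} \<subseteq> S \<longrightarrow> P f" if "finite S" "S \<subseteq> carrier G" for S
    using that
  proof (induct S)
    case empty
    show ?case
    proof (intro ballI impI)
      fix f :: "'g \<Rightarrow> 'k" assume "{g. f g \<noteq> 0} \<subseteq> {}"
      then have "f = \<zero>\<^bsub>A\<^esub>" by (auto simp: A_ops)
      then show "P f" using z by simp
    qed
  next
    case (insert g S)
    show ?case
    proof (intro ballI impI)
      fix f :: "'g \<Rightarrow> 'k" assume f: "f \<in> carrier A" "{g. f g \<noteq> 0} \<subseteq> insert g S"
      let ?f = "f(g := 0)"
      have "?f \<in> carrier A" "{g. ?f g \<noteq> 0} \<subseteq> S" using f by (auto simp: A_carrier)
      then have "P ?f" using insert by blast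
      then have "P (?f \<oplus>\<^bsub>A\<^esub> sgl g (f g))" using a insert \<open>?f \<in> carrier A\<close> by blast
      moreover have "?f \<oplus>\<^bsub>A\<^esub> sgl g (f g) = f" by (auto simp: A_ops sgl_def fun_eq_iff)
      ultimately show "P f" by simp
    qed
  qed
  from this[OF fin order_refl] show ?thesis using f by (auto simp: A_carrier)
qed

section \<open>Augmentation, Frobenius map and units\<close>

definition aug :: "('g \<Rightarrow> 'k) \<Rightarrow> 'k" where "aug f = (\<Sum>g\<in>carrier G. f g)"

lemma aug_add: "aug (f \<oplus>\<^bsub>A\<^esub> f') = aug f + aug f'"
  by (simp add: aug_def A_ops sum.distrib)

lemma aug_sgl: "g \<in> carrier G \<Longrightarrow> aug (sgl g c) = c"
  using fin by (simp add: aug_def sgl_def)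

lemma aug_zero: "aug \<zero>\<^bsub>A\<^esub> = 0" by (simp add: aug_def A_ops)

lemma A_two_zero: "f \<oplus>\<^bsub>A\<^esub> f = \<zero>\<^bsub>A\<^esub>"
  by (simp add: A_ops fun_eq_iff two_zero)

lemma frobenius_A:
  assumes "f \<in> carrier A" "f' \<in> carrier A"
  shows "(f \<oplus>\<^bsub>A\<^esub> f') [^]\<^bsub>A\<^esub> (2 ^ m :: nat) = f [^]\<^bsub>A\<^esub> (2 ^ m :: nat) \<oplus>\<^bsub>A\<^esub> f' [^]\<^bsub>A\<^esub> (2 ^ m :: nat)"
proof (induct m)
  case (Suc m)
  have sq: "(a \<oplus>\<^bsub>A\<^esub> b) [^]\<^bsub>A\<^esub> (2 :: nat) = a [^]\<^bsub>A\<^esub> (2 :: nat) \<oplus>\<^bsub>A\<^esub> b [^]\<^bsub>A\<^esub> (2 :: nat)"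
    if ab: "a \<in> carrier A" "b \<in> carrier A" for a b
  proof -
    have "(a \<oplus>\<^bsub>A\<^esub> b) [^]\<^bsub>A\<^esub> (2 :: nat) = (a \<oplus>\<^bsub>A\<^esub> b) \<otimes>\<^bsub>A\<^esub> (a \<oplus>\<^bsub>A\<^esub> b)"
      using ab by (simp add: numeral_2_eq_2)
    also have "\<dots> = a \<otimes>\<^bsub>A\<^esub> a \<oplus>\<^bsub>A\<^esub> ((a \<otimes>\<^bsub>A\<^esub> b \<oplus>\<^bsub>A\<^esub> a \<otimes>\<^bsub>A\<^esub> b) \<oplus>\<^bsub>A\<^esub> b \<otimes>\<^bsub>A\<^esub> b)"
      using ab by (simp add: A.l_distr A.r_distr A.a_assoc A.m_comm[of b a])
    also have "\<dots> = a \<otimes>\<^bsub>A\<^esub> a \<oplus>\<^bsub>A\<^esub> b \<otimes>\<^bsub>A\<^esub> b"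
      using ab by (simp add: A_two_zero)
    finally show ?thesis using ab by (simp add: numeral_2_eq_2)
  qed
  have "(f \<oplus>\<^bsub>A\<^esub> f') [^]\<^bsub>A\<^esub> (2 ^ Suc m :: nat) = ((f \<oplus>\<^bsub>A\<^esub> f') [^]\<^bsub>A\<^esub> (2 ^ m :: nat)) [^]\<^bsub>A\<^esub> (2 :: nat)"
    using assms by (simp add: A.nat_pow_pow mult.commute)
  then show ?case
    using assms Suc by (simp add: sq A.nat_pow_pow mult.commute)
qed (use assms in simp)

lemma frobenius_k: "((a :: 'k) + b) ^ 2 ^ m = a ^ 2 ^ m + b ^ 2 ^ m"
proof (induct m)
  case (Suc m)
  have sq: "(x + y) ^ 2 = x ^ 2 + y ^ 2" for x y :: 'k
    using two_zero[of "x * y"] by (simp add: power2_eq_square algebra_simps)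
  then show ?case using Suc by (simp add: power_mult power_mult mult.commute[of 2])
qed simp

lemma sgl_pow: "g \<in> carrier G \<Longrightarrow> sgl g c [^]\<^bsub>A\<^esub> (m :: nat) = sgl (g [^] m) (c ^ m)"
  by (induct m) (auto simp: sgl_one sgl_mult mult.commute)

text \<open>Raising to the power 2^n is additive in characteristic 2 and takes every group element
  to the unit. Hence A is local: an element of nonzero augmentation is invertible.\<close>

lemma A_pow_aug: "f \<in> carrier A \<Longrightarrow> f [^]\<^bsub>A\<^esub> (2 ^ n :: nat) = sgl \<one> (aug f ^ 2 ^ n)"
proof (induct f rule: A_induct)
  case zero
  have "\<zero>\<^bsub>A\<^esub> [^]\<^bsub>A\<^esub> (2 ^ n :: nat) = \<zero>\<^bsub>A\<^esub>" by (rule A.nat_pow_zero) simp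
  then show ?case by (simp add: aug_zero sgl_zero power_0_left)
next
  case (add f g c)
  then show ?case
    by (simp add: frobenius_A sgl_pow exponent aug_add aug_sgl frobenius_k sgl_add)
qed

lemma aug_unit:
  assumes f: "f \<in> carrier A" and "aug f \<noteq> 0"
  obtains u where "u \<in> carrier A" "u \<otimes>\<^bsub>A\<^esub> f = \<one>\<^bsub>A\<^esub>"
proof
  let ?c = "aug f ^ 2 ^ n"
  let ?u = "sgl \<one> (inverse ?c) \<otimes>\<^bsub>A\<^esub> f [^]\<^bsub>A\<^esub> (2 ^ n - 1 :: nat)"
  show "?u \<in> carrier A" using f by simp
  have "Suc (2 ^ n - 1) = (2 ^ n :: nat)" by simp
  then have "f [^]\<^bsub>A\<^esub> (2 ^ n - 1 :: nat) \<otimes>\<^bsub>A\<^esub> f = f [^]\<^bsub>A\<^esub> (2 ^ n :: nat)"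
    using A.nat_pow_Suc[of f "2 ^ n - 1"] by simp
  then have "?u \<otimes>\<^bsub>A\<^esub> f = sgl \<one> (inverse ?c) \<otimes>\<^bsub>A\<^esub> f [^]\<^bsub>A\<^esub> (2 ^ n :: nat)"
    using f A.m_assoc[of "sgl \<one> (inverse ?c)" "f [^]\<^bsub>A\<^esub> (2 ^ n - 1 :: nat)" f] by simp
  also have "sgl \<one> (inverse ?c) \<otimes>\<^bsub>A\<^esub> f [^]\<^bsub>A\<^esub> (2 ^ n :: nat) = \<one>\<^bsub>A\<^esub>"
    using assms(2) by (simp add: A_pow_aug[OF f] sgl_mult sgl_one)
  finally show "?u \<otimes>\<^bsub>A\<^esub> f = \<one>\<^bsub>A\<^esub>" .
qed

definition norm_elt :: "'g \<Rightarrow> 'k" where "norm_elt = (\<lambda>g. if g \<in> carrier G then 1 else 0)"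

lemma norm_closed [simp]: "norm_elt \<in> carrier A" by (simp add: norm_elt_def A_carrier)

lemma norm_mult: "f \<otimes>\<^bsub>A\<^esub> norm_elt = sgl \<one> (aug f) \<otimes>\<^bsub>A\<^esub> norm_elt"
proof
  fix g
  show "(f \<otimes>\<^bsub>A\<^esub> norm_elt) g = (sgl \<one> (aug f) \<otimes>\<^bsub>A\<^esub> norm_elt) g"
  proof (cases "g \<in> carrier G")
    case True
    then show ?thesis using sgl_mult_apply[of \<one> g "aug f" norm_elt]
      by (simp add: A_ops norm_elt_def aug_def)
  qed (simp add: A_ops)
qed

lemma fixed_by_sgl:
  assumes M: "left_module A M" and p: "p \<in> carrier M"
    and fx: "\<And>g. g \<in> carrier G \<Longrightarrow> sgl g 1 \<odot>\<^bsub>M\<^esub> p = p" and a: "a \<in> carrier A"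
  shows "a \<odot>\<^bsub>M\<^esub> p = sgl \<one> (aug a) \<odot>\<^bsub>M\<^esub> p"
proof -
  interpret M: left_module A M by fact
  show ?thesis using a
  proof (induct a rule: A_induct)
    case zero then show ?case using p by (simp add: aug_zero sgl_zero)
  next
    case (add f g c)
    have "sgl g c \<odot>\<^bsub>M\<^esub> p = (sgl \<one> c \<otimes>\<^bsub>A\<^esub> sgl g 1) \<odot>\<^bsub>M\<^esub> p" using add by (simp add: sgl_mult)
    also have "\<dots> = sgl \<one> c \<odot>\<^bsub>M\<^esub> p" using add p fx by (simp add: M.smult_assoc1)
    finally show ?case using add p by (simp add: M.smult_l_distr aug_add aug_sgl sgl_add)
  qed
qed

lemma mod_two_zero: "left_module A M \<Longrightarrow> x \<in> carrier M \<Longrightarrow> x \<oplus>\<^bsub>M\<^esub> x = \<zero>\<^bsub>M\<^esub>"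
proof -
  assume M: "left_module A M" and x: "x \<in> carrier M"
  interpret M: left_module A M by fact
  have "x \<oplus>\<^bsub>M\<^esub> x = (\<one>\<^bsub>A\<^esub> \<oplus>\<^bsub>A\<^esub> \<one>\<^bsub>A\<^esub>) \<odot>\<^bsub>M\<^esub> x"
    using x by (subst M.smult_l_distr) auto
  then show ?thesis using x by (simp add: A_two_zero)
qed

text \<open>The group elements are treated one at a time. For each g the element 1 + g is nilpotent,
  and commutativity of A keeps the vector fixed by the elements treated before.\<close>

lemma ex_fixed:
  assumes M: "left_module A M" and nz: "carrier M \<noteq> {\<zero>\<^bsub>M\<^esub>}"
  obtains p where "p \<in> carrier M" "p \<noteq> \<zero>\<^bsub>M\<^esub>" "\<And>g. g \<in> carrier G \<Longrightarrow> sgl g 1 \<odot>\<^bsub>M\<^esub> p = p"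
proof -
  interpret M: left_module A M by fact
  have "\<exists>p\<in>carrier M. p \<noteq> \<zero>\<^bsub>M\<^esub> \<and> (\<forall>g\<in>S. sgl g 1 \<odot>\<^bsub>M\<^esub> p = p)" if "finite S" "S \<subseteq> carrier G" for S
    using that
  proof (induct S)
    case empty
    then show ?case using nz by blast
  next
    case (insert g S)
    then obtain p where p: "p \<in> carrier M" "p \<noteq> \<zero>\<^bsub>M\<^esub>" "\<forall>g\<in>S. sgl g 1 \<odot>\<^bsub>M\<^esub> p = p" by auto
    define a where "a = \<one>\<^bsub>A\<^esub> \<oplus>\<^bsub>A\<^esub> sgl g 1"
    have g: "g \<in> carrier G" and a: "a \<in> carrier A" using insert by (auto simp: a_def)
    have "aug a = 0" using g by (simp add: a_def aug_add sgl_one aug_sgl two_zero)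
    then have "a [^]\<^bsub>A\<^esub> (2 ^ n :: nat) = \<zero>\<^bsub>A\<^esub>"
      using a by (simp add: A_pow_aug power_0_left sgl_zero)
    then have ex: "a [^]\<^bsub>A\<^esub> (2 ^ n :: nat) \<odot>\<^bsub>M\<^esub> p = \<zero>\<^bsub>M\<^esub>" using p by simp
    \<comment> \<open>The last nonzero vector among p, a p, a^2 p, ... is annihilated by a = 1 + g,
      hence fixed by g.\<close>
    define i where "i = (LEAST i :: nat. a [^]\<^bsub>A\<^esub> i \<odot>\<^bsub>M\<^esub> p = \<zero>\<^bsub>M\<^esub>)"
    have i: "a [^]\<^bsub>A\<^esub> i \<odot>\<^bsub>M\<^esub> p = \<zero>\<^bsub>M\<^esub>"
      unfolding i_def by (rule LeastI[where P = "\<lambda>i. a [^]\<^bsub>A\<^esub> i \<odot>\<^bsub>M\<^esub> p = \<zero>\<^bsub>M\<^esub>", OF ex])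
    have "i \<noteq> 0"
    proof
      assume "i = 0"
      with i p show False by simp
    qed
    then obtain j where j: "i = Suc j" using not0_implies_Suc by blast
    define p' where "p' = a [^]\<^bsub>A\<^esub> j \<odot>\<^bsub>M\<^esub> p"
    have p': "p' \<in> carrier M" using a p by (simp add: p'_def)
    have "p' \<noteq> \<zero>\<^bsub>M\<^esub>"
      unfolding p'_def using not_less_Least[of j "\<lambda>i. a [^]\<^bsub>A\<^esub> i \<odot>\<^bsub>M\<^esub> p = \<zero>\<^bsub>M\<^esub>"] j unfolding i_def by simp
    moreover have "sgl g 1 \<odot>\<^bsub>M\<^esub> p' = p'"
    proof -
      have "a \<odot>\<^bsub>M\<^esub> p' = (a [^]\<^bsub>A\<^esub> j \<otimes>\<^bsub>A\<^esub> a) \<odot>\<^bsub>M\<^esub> p"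
        using a p by (simp add: p'_def M.smult_assoc1[symmetric] A.m_comm)
      then have 0: "a \<odot>\<^bsub>M\<^esub> p' = \<zero>\<^bsub>M\<^esub>" using i j by simp
      have "a \<odot>\<^bsub>M\<^esub> p' = p' \<oplus>\<^bsub>M\<^esub> sgl g 1 \<odot>\<^bsub>M\<^esub> p'"
        using g p' by (simp add: a_def M.smult_l_distr)
      with 0 have e: "p' \<oplus>\<^bsub>M\<^esub> sgl g 1 \<odot>\<^bsub>M\<^esub> p' = p' \<oplus>\<^bsub>M\<^esub> p'" using mod_two_zero[OF M p'] by simp
      have "sgl g 1 \<odot>\<^bsub>M\<^esub> p' = (p' \<oplus>\<^bsub>M\<^esub> p') \<oplus>\<^bsub>M\<^esub> sgl g 1 \<odot>\<^bsub>M\<^esub> p'"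
        using p' g by (simp add: mod_two_zero[OF M p'])
      also have "\<dots> = p' \<oplus>\<^bsub>M\<^esub> (p' \<oplus>\<^bsub>M\<^esub> p')" using p' g e by (simp add: M.M.a_assoc)
      also have "\<dots> = p'" using p' by (simp add: mod_two_zero[OF M p'])
      finally show ?thesis .
    qed
    moreover have "sgl h 1 \<odot>\<^bsub>M\<^esub> p' = p'" if "h \<in> S" for h
    proof -
      have h: "h \<in> carrier G" using insert that by auto
      have "sgl h 1 \<odot>\<^bsub>M\<^esub> p' = (a [^]\<^bsub>A\<^esub> j \<otimes>\<^bsub>A\<^esub> sgl h 1) \<odot>\<^bsub>M\<^esub> p"
        using a p h by (simp add: p'_def M.smult_assoc1[symmetric] A.m_comm)
      also have "\<dots> = p'" using a p h that by (simp add: p'_def M.smult_assoc1)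
      finally show ?thesis .
    qed
    ultimately show ?case using p' by blast
  qed
  from this[OF fin order_refl] that show thesis by blast
qed

subsection \<open>Linear functionals and free summands\<close>

text \<open>Zorn's lemma gives a maximal k-subspace C that avoids p. Then M is the sum of C and k p,
  and l v is the scalar c with v + c p in C; characteristic 2 removes the sign.\<close>

lemma ex_functional:
  assumes M: "left_module A M" and p: "p \<in> carrier M" "p \<noteq> \<zero>\<^bsub>M\<^esub>"
  obtains l :: "_ \<Rightarrow> 'k" where "l p = 1"
    "\<And>x y. x \<in> carrier M \<Longrightarrow> y \<in> carrier M \<Longrightarrow> l (x \<oplus>\<^bsub>M\<^esub> y) = l x + l y"
    "\<And>c x. x \<in> carrier M \<Longrightarrow> l (sgl \<one> c \<odot>\<^bsub>M\<^esub> x) = c * l x"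
proof -
  interpret M: left_module A M by fact
  let ?sc = "\<lambda>c x. sgl \<one> c \<odot>\<^bsub>M\<^esub> x"
  have sc1: "?sc 1 x = x" if "x \<in> carrier M" for x using that by (simp flip: sgl_one)
  have scm: "?sc (c * d) x = ?sc c (?sc d x)" if "x \<in> carrier M" for c d x
    using that by (simp add: M.smult_assoc1[symmetric] sgl_mult)
  have sca: "?sc (c + d) x = ?sc c x \<oplus>\<^bsub>M\<^esub> ?sc d x" if "x \<in> carrier M" for c d x
    using that by (simp add: sgl_add M.smult_l_distr)
  have sc0: "?sc 0 x = \<zero>\<^bsub>M\<^esub>" if "x \<in> carrier M" for x using that by (simp add: sgl_zero)
  define sub where "sub C \<longleftrightarrow> C \<subseteq> carrier M \<and> \<zero>\<^bsub>M\<^esub> \<in> C \<and> (\<forall>x\<in>C. \<forall>y\<in>C. x \<oplus>\<^bsub>M\<^esub> y \<in> C)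
    \<and> (\<forall>c. \<forall>x\<in>C. ?sc c x \<in> C)" for C
  let ?S = "{C. sub C \<and> p \<notin> C}"
  have "\<exists>C\<in>?S. \<forall>X\<in>?S. C \<subseteq> X \<longrightarrow> X = C"
  proof (rule subset_Zorn_nonempty)
    have "sub {\<zero>\<^bsub>M\<^esub>}" by (auto simp: sub_def)
    then show "?S \<noteq> {}" using p by blast
    fix C assume C: "C \<noteq> {}" "subset.chain ?S C"
    have ch: "X \<subseteq> Y \<or> Y \<subseteq> X" if "X \<in> C" "Y \<in> C" for X Y
      using C(2) that by (auto simp: subset_chain_def)
    have s: "sub X" "p \<notin> X" if "X \<in> C" for X using C(2) that by (auto simp: subset_chain_def)
    have "x \<oplus>\<^bsub>M\<^esub> y \<in> \<Union>C" if xy: "x \<in> \<Union>C" "y \<in> \<Union>C" for x y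
    proof -
      obtain X Y where X: "X \<in> C" "Y \<in> C" "x \<in> X" "y \<in> Y" using xy by blast
      then have "\<exists>Z\<in>C. x \<in> Z \<and> y \<in> Z" using ch[OF X(1,2)] by blast
      then show ?thesis using s unfolding sub_def by blast
    qed
    moreover have "\<Union>C \<subseteq> carrier M" "\<zero>\<^bsub>M\<^esub> \<in> \<Union>C" "\<forall>c. \<forall>x\<in>\<Union>C. ?sc c x \<in> \<Union>C"
      using s C(1) unfolding sub_def by blast+
    ultimately show "\<Union>C \<in> ?S" using s unfolding sub_def by blast
  qed
  then obtain C where C: "sub C" "p \<notin> C" and max: "\<And>X. sub X \<Longrightarrow> p \<notin> X \<Longrightarrow> C \<subseteq> X \<Longrightarrow> X = C" by blast
  have Cm: "x \<in> carrier M" if "x \<in> C" for x using C(1) that by (auto simp: sub_def)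
  have Ca: "x \<oplus>\<^bsub>M\<^esub> y \<in> C" if "x \<in> C" "y \<in> C" for x y using C(1) that by (auto simp: sub_def)
  have Cs: "?sc c x \<in> C" if "x \<in> C" for c x using C(1) that by (auto simp: sub_def)
  have cancel: "x \<oplus>\<^bsub>M\<^esub> (x \<oplus>\<^bsub>M\<^esub> y) = y" if "x \<in> carrier M" "y \<in> carrier M" for x y
    using that mod_two_zero[OF M, of x] by (simp add: M.M.a_assoc[symmetric])
  have ex: "\<exists>c. v \<oplus>\<^bsub>M\<^esub> ?sc c p \<in> C" if v: "v \<in> carrier M" for v
  proof (cases "v \<in> C")
    case True
    then show ?thesis using v by (intro exI[of _ 0]) (simp add: sc0[OF p(1)])
  next
    case False
    let ?X = "{m \<oplus>\<^bsub>M\<^esub> ?sc c v | m c. m \<in> C}"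
    have X: "sub ?X"
      unfolding sub_def
    proof (intro conjI ballI allI)
      show "?X \<subseteq> carrier M" using Cm v by auto
      show "\<zero>\<^bsub>M\<^esub> \<in> ?X" using C(1) sc0[OF v] by (auto simp: sub_def intro!: exI[of _ "\<zero>\<^bsub>M\<^esub>"] exI[of _ 0])
      show "x \<oplus>\<^bsub>M\<^esub> y \<in> ?X" if xy: "x \<in> ?X" "y \<in> ?X" for x y
      proof -
        obtain m c m' c' where x: "m \<in> C" "x = m \<oplus>\<^bsub>M\<^esub> ?sc c v" and y: "m' \<in> C" "y = m' \<oplus>\<^bsub>M\<^esub> ?sc c' v" using xy by blast
        have "x \<oplus>\<^bsub>M\<^esub> y = (m \<oplus>\<^bsub>M\<^esub> m') \<oplus>\<^bsub>M\<^esub> ?sc (c + c') v"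
          using Cm[OF x(1)] Cm[OF y(1)] v by (simp add: x y sca M.M.a_ac)
        then show ?thesis using Ca[OF x(1) y(1)] by blast
      qed
      show "?sc c x \<in> ?X" if x: "x \<in> ?X" for c x
      proof -
        obtain m c' where x: "m \<in> C" "x = m \<oplus>\<^bsub>M\<^esub> ?sc c' v" using x by blast
        have "?sc c x = ?sc c m \<oplus>\<^bsub>M\<^esub> ?sc (c * c') v"
          using Cm[OF x(1)] v by (simp add: x M.smult_r_distr scm)
        then show ?thesis using Cs[OF x(1)] by blast
      qed
    qed
    have CX: "C \<subseteq> ?X"
    proof
      fix m assume m: "m \<in> C"
      then have "m = m \<oplus>\<^bsub>M\<^esub> ?sc 0 v" using Cm v by (simp add: sc0)
      then show "m \<in> ?X" using m by blast
    qed
    have "v = \<zero>\<^bsub>M\<^esub> \<oplus>\<^bsub>M\<^esub> ?sc 1 v" using v by (simp add: sc1)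
    then have "v \<in> ?X" using C(1) unfolding sub_def by blast
    \<comment> \<open>C + k v is strictly larger than C, so by maximality it contains p; solving for
      v gives the required scalar.\<close>
    then have "p \<in> ?X" using max[OF X _ CX] False by blast
    then obtain m c where m: "m \<in> C" "p = m \<oplus>\<^bsub>M\<^esub> ?sc c v" by blast
    have "c \<noteq> 0"
    proof
      assume "c = 0" then have "p = m" using m Cm v by (simp add: sc0)
      then show False using m C(2) by simp
    qed
    then have "v = ?sc (inverse c) (?sc c v)" using v by (simp flip: scm add: sc1)
    also have "?sc c v = m \<oplus>\<^bsub>M\<^esub> p" using m Cm v by (simp add: cancel)
    finally have "v = ?sc (inverse c) m \<oplus>\<^bsub>M\<^esub> ?sc (inverse c) p" using m Cm p by (simp add: M.smult_r_distr)
    then have "v \<oplus>\<^bsub>M\<^esub> ?sc (inverse c) p = ?sc (inverse c) m"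
      using Cm[OF m(1)] p mod_two_zero[OF M, of "?sc (inverse c) p"] by (simp add: M.M.a_assoc)
    then show ?thesis using Cs[OF m(1)] by metis
  qed
  have uniq: "c = c'" if "v \<in> carrier M" "v \<oplus>\<^bsub>M\<^esub> ?sc c p \<in> C" "v \<oplus>\<^bsub>M\<^esub> ?sc c' p \<in> C" for v c c'
  proof (rule ccontr)
    assume "c \<noteq> c'"
    then have nz: "c + c' \<noteq> 0" using two_zero[of c'] by (metis add_right_cancel)
    have "(v \<oplus>\<^bsub>M\<^esub> ?sc c p) \<oplus>\<^bsub>M\<^esub> (v \<oplus>\<^bsub>M\<^esub> ?sc c' p) = v \<oplus>\<^bsub>M\<^esub> (v \<oplus>\<^bsub>M\<^esub> ?sc (c + c') p)"
      using that(1) p by (simp add: sca M.M.a_ac)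
    then have "?sc (c + c') p \<in> C" using Ca[OF that(2,3)] that(1) p by (simp add: cancel)
    from Cs[OF this, of "inverse (c + c')"] have "p \<in> C"
      using nz p by (simp flip: scm add: sc1)
    then show False using C(2) by simp
  qed
  define l where "l v = (THE c. v \<oplus>\<^bsub>M\<^esub> ?sc c p \<in> C)" for v
  have l: "v \<oplus>\<^bsub>M\<^esub> ?sc (l v) p \<in> C" if "v \<in> carrier M" for v
  proof -
    have "\<exists>!c. v \<oplus>\<^bsub>M\<^esub> ?sc c p \<in> C" using ex[OF that] uniq[OF that] by blast
    then show ?thesis unfolding l_def by (rule theI')
  qed
  have leq: "l v = c" if "v \<in> carrier M" "v \<oplus>\<^bsub>M\<^esub> ?sc c p \<in> C" for v c
    using uniq[OF that(1) l[OF that(1)] that(2)] .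
  show thesis
  proof
    show "l p = 1"
      using C(1) p mod_two_zero[OF M p(1)] by (intro leq) (auto simp: sc1 sub_def)
    show "l (x \<oplus>\<^bsub>M\<^esub> y) = l x + l y" if xy: "x \<in> carrier M" "y \<in> carrier M" for x y
    proof (rule leq)
      have "x \<oplus>\<^bsub>M\<^esub> y \<oplus>\<^bsub>M\<^esub> ?sc (l x + l y) p = (x \<oplus>\<^bsub>M\<^esub> ?sc (l x) p) \<oplus>\<^bsub>M\<^esub> (y \<oplus>\<^bsub>M\<^esub> ?sc (l y) p)"
        using xy p by (simp add: sca M.M.a_ac)
      then show "x \<oplus>\<^bsub>M\<^esub> y \<oplus>\<^bsub>M\<^esub> ?sc (l x + l y) p \<in> C" using Ca[OF l[OF xy(1)] l[OF xy(2)]] by simp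
    qed (use xy in simp)
    show "l (?sc c x) = c * l x" if x: "x \<in> carrier M" for c x
    proof (rule leq)
      have "?sc c x \<oplus>\<^bsub>M\<^esub> ?sc (c * l x) p = ?sc c (x \<oplus>\<^bsub>M\<^esub> ?sc (l x) p)"
        using x p by (simp add: scm M.smult_r_distr)
      then show "?sc c x \<oplus>\<^bsub>M\<^esub> ?sc (c * l x) p \<in> C" using Cs[OF l[OF x]] by simp
    qed (use x in simp)
  qed
qed

end

section \<open>The regular module as the only indecomposable projective or injective module\<close>

context two_group_algebra
begin

lemma set_add_iff: "x \<in> U <+>\<^bsub>M\<^esub> V \<longleftrightarrow> (\<exists>u\<in>U. \<exists>v\<in>V. x = u \<oplus>\<^bsub>M\<^esub> v)"
  by (auto simp: set_add_def set_mult_def)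

lemma A_zero_apply: "\<zero>\<^bsub>A\<^esub> g = 0"
  by (simp add: A_ops(2))

lemma A_one_neq_zero: "\<one>\<^bsub>A\<^esub> \<noteq> \<zero>\<^bsub>A\<^esub>"
proof
  assume "\<one>\<^bsub>A\<^esub> = \<zero>\<^bsub>A\<^esub>"
  then have "\<one>\<^bsub>A\<^esub> \<one> = \<zero>\<^bsub>A\<^esub> \<one>" by (rule fun_cong)
  then show False by (simp add: A_ops(3) A_zero_apply)
qed

lemma hom_criterion:
  assumes M: "left_module A M" and N: "left_module A N"
    and c: "\<And>x. x \<in> carrier M \<Longrightarrow> f x \<in> carrier N"
    and a: "\<And>x y. x \<in> carrier M \<Longrightarrow> y \<in> carrier M \<Longrightarrow> f (x \<oplus>\<^bsub>M\<^esub> y) = f x \<oplus>\<^bsub>N\<^esub> f y"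
    and s: "\<And>g c x. g \<in> carrier G \<Longrightarrow> x \<in> carrier M \<Longrightarrow> f (sgl g c \<odot>\<^bsub>M\<^esub> x) = sgl g c \<odot>\<^bsub>N\<^esub> f x"
  shows "f \<in> module_homs A M N"
proof (rule module_homsI)
  interpret M: left_module A M by fact
  interpret N: left_module A N by fact
  fix b x assume "b \<in> carrier A" and x: "x \<in> carrier M"
  then show "f (b \<odot>\<^bsub>M\<^esub> x) = b \<odot>\<^bsub>N\<^esub> f x"
  proof (induct b rule: A_induct)
    case zero
    show ?case using s[of \<one> x 0] x c by (simp add: sgl_zero)
  next
    case (add b g d)
    then show ?case using x c by (simp add: M.smult_l_distr N.smult_l_distr a s)
  qed
qed (use c a in auto)

lemma smult_expand:
  assumes M: "left_module A M" and v: "v \<in> carrier M" and a: "a \<in> carrier A"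
  shows "a \<odot>\<^bsub>M\<^esub> v = (\<Oplus>\<^bsub>M\<^esub>g\<in>carrier G. sgl g (a g) \<odot>\<^bsub>M\<^esub> v)"
proof -
  interpret M: left_module A M by fact
  show ?thesis using a
  proof (induct a rule: A_induct)
    case zero
    have "(\<Oplus>\<^bsub>M\<^esub>g\<in>carrier G. sgl g (\<zero>\<^bsub>A\<^esub> g) \<odot>\<^bsub>M\<^esub> v) = (\<Oplus>\<^bsub>M\<^esub>g\<in>carrier G. \<zero>\<^bsub>M\<^esub>)"
      using v by (intro M.M.finsum_cong') (auto simp: A_zero_apply sgl_zero)
    then show ?case using v by simp
  next
    case (add b h c)
    have "(\<Oplus>\<^bsub>M\<^esub>g\<in>carrier G. sgl g ((b \<oplus>\<^bsub>A\<^esub> sgl h c) g) \<odot>\<^bsub>M\<^esub> v)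
      = (\<Oplus>\<^bsub>M\<^esub>g\<in>carrier G. sgl g (b g) \<odot>\<^bsub>M\<^esub> v \<oplus>\<^bsub>M\<^esub> (if h = g then sgl g c \<odot>\<^bsub>M\<^esub> v else \<zero>\<^bsub>M\<^esub>))"
    proof (rule M.M.finsum_cong'[OF refl])
      fix g assume g: "g \<in> carrier G"
      have "sgl g (sgl h c g) \<odot>\<^bsub>M\<^esub> v = (if h = g then sgl g c \<odot>\<^bsub>M\<^esub> v else \<zero>\<^bsub>M\<^esub>)"
        using v by (auto simp: sgl_def[of h] sgl_zero)
      then show "sgl g ((b \<oplus>\<^bsub>A\<^esub> sgl h c) g) \<odot>\<^bsub>M\<^esub> v
        = sgl g (b g) \<odot>\<^bsub>M\<^esub> v \<oplus>\<^bsub>M\<^esub> (if h = g then sgl g c \<odot>\<^bsub>M\<^esub> v else \<zero>\<^bsub>M\<^esub>)"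
        using g v by (simp add: A_ops(1) sgl_add M.smult_l_distr)
    qed (use v in auto)
    also have "\<dots> = (\<Oplus>\<^bsub>M\<^esub>g\<in>carrier G. sgl g (b g) \<odot>\<^bsub>M\<^esub> v)
      \<oplus>\<^bsub>M\<^esub> (\<Oplus>\<^bsub>M\<^esub>g\<in>carrier G. if h = g then sgl g c \<odot>\<^bsub>M\<^esub> v else \<zero>\<^bsub>M\<^esub>)"
      using v by (intro M.M.finsum_addf) auto
    also have "(\<Oplus>\<^bsub>M\<^esub>g\<in>carrier G. if h = g then sgl g c \<odot>\<^bsub>M\<^esub> v else \<zero>\<^bsub>M\<^esub>) = sgl h c \<odot>\<^bsub>M\<^esub> v"
      using add(2) v fin by (intro M.M.finsum_singleton) auto
    finally show ?case using add v by (simp add: M.smult_l_distr)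
  qed
qed

definition reg :: "('g \<Rightarrow> 'k, 'g \<Rightarrow> 'k) module"
  where "reg = \<lparr>carrier = carrier A, monoid.mult = monoid.mult A, one = \<one>\<^bsub>A\<^esub>, zero = \<zero>\<^bsub>A\<^esub>,
    add = add A, smult = monoid.mult A\<rparr>"

lemma reg_simps [simp]: "carrier reg = carrier A" "\<zero>\<^bsub>reg\<^esub> = \<zero>\<^bsub>A\<^esub>" "x \<oplus>\<^bsub>reg\<^esub> y = x \<oplus>\<^bsub>A\<^esub> y"
  "x \<odot>\<^bsub>reg\<^esub> y = x \<otimes>\<^bsub>A\<^esub> y"
  by (simp_all add: reg_def)

lemma reg_module: "left_module A reg"
proof (rule left_moduleI)
  show "\<exists>y\<in>carrier reg. y \<oplus>\<^bsub>reg\<^esub> f = \<zero>\<^bsub>reg\<^esub>" if "f \<in> carrier reg" for f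
    using that by (intro bexI[of _ f]) (auto simp: A_two_zero)
qed (auto simp: A.ring_axioms A.l_distr A.r_distr A.m_assoc A.a_ac)

text \<open>For a functional l with value 1 at \<open>norm_elt\<close> times z, the map sending v to
  the sum of l(g^(-1) v) g is A-linear. At z its augmentation is the sum of all l(g z), which is 1,
  so its value at z is a unit and can be divided out.\<close>

lemma free_retract:
  assumes M: "left_module A M" and z: "z \<in> carrier M" and nz: "norm_elt \<odot>\<^bsub>M\<^esub> z \<noteq> \<zero>\<^bsub>M\<^esub>"
  obtains \<alpha> where "\<alpha> \<in> module_homs A M reg" "\<alpha> z = \<one>\<^bsub>A\<^esub>"
proof -
  interpret M: left_module A M by fact
  have pz: "norm_elt \<odot>\<^bsub>M\<^esub> z \<in> carrier M" using z by simp
  obtain l :: "_ \<Rightarrow> 'k" where l1: "l (norm_elt \<odot>\<^bsub>M\<^esub> z) = 1"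
    and la: "\<And>x y. x \<in> carrier M \<Longrightarrow> y \<in> carrier M \<Longrightarrow> l (x \<oplus>\<^bsub>M\<^esub> y) = l x + l y"
    and ls: "\<And>c x. x \<in> carrier M \<Longrightarrow> l (sgl \<one> c \<odot>\<^bsub>M\<^esub> x) = c * l x"
    using ex_functional[OF M pz nz] by blast
  have lg: "l (sgl g c \<odot>\<^bsub>M\<^esub> x) = c * l (sgl g 1 \<odot>\<^bsub>M\<^esub> x)" if "x \<in> carrier M" "g \<in> carrier G" for g c x
    using ls[of "sgl g 1 \<odot>\<^bsub>M\<^esub> x" c] that by (simp add: M.smult_assoc1[symmetric] sgl_mult)
  have l0: "l \<zero>\<^bsub>M\<^esub> = 0" using ls[of "\<zero>\<^bsub>M\<^esub>" 0] by simp
  define \<phi> where "\<phi> v = (\<lambda>g. if g \<in> carrier G then l (sgl (inv g) 1 \<odot>\<^bsub>M\<^esub> v) else 0)" for v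
  have \<phi>: "\<phi> \<in> module_homs A M reg"
  proof (rule hom_criterion[OF M reg_module])
    show "\<phi> x \<in> carrier reg" for x by (simp add: \<phi>_def A_carrier)
    show "\<phi> (x \<oplus>\<^bsub>M\<^esub> y) = \<phi> x \<oplus>\<^bsub>reg\<^esub> \<phi> y" if "x \<in> carrier M" "y \<in> carrier M" for x y
      using that by (auto simp: \<phi>_def A_ops fun_eq_iff M.smult_r_distr la)
    show "\<phi> (sgl h c \<odot>\<^bsub>M\<^esub> x) = sgl h c \<odot>\<^bsub>reg\<^esub> \<phi> x" if h: "h \<in> carrier G" and x: "x \<in> carrier M" for h c x
    proof
      fix g
      show "\<phi> (sgl h c \<odot>\<^bsub>M\<^esub> x) g = (sgl h c \<odot>\<^bsub>reg\<^esub> \<phi> x) g"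
      proof (cases "g \<in> carrier G")
        case True
        have "inv (inv h \<otimes> g) = inv g \<otimes> h" using True h by (simp add: G.inv_mult_group)
        then show ?thesis
          using True h x lg[of x "inv g \<otimes> h" c]
          by (simp add: \<phi>_def sgl_mult_apply M.smult_assoc1[symmetric] sgl_mult)
      qed (simp add: \<phi>_def A_ops)
    qed
  qed
  have exp: "l (a \<odot>\<^bsub>M\<^esub> z) = (\<Sum>g\<in>carrier G. a g * l (sgl g 1 \<odot>\<^bsub>M\<^esub> z))" if "a \<in> carrier A" for a
    using that
  proof (induct a rule: A_induct)
    case zero
    then show ?case using z by (simp add: l0) (simp add: A_ops)
  next
    case (add a h c)
    have "(\<Sum>g\<in>carrier G. sgl h c g * l (sgl g 1 \<odot>\<^bsub>M\<^esub> z)) = (\<Sum>g\<in>carrier G. if g = h then c * l (sgl h 1 \<odot>\<^bsub>M\<^esub> z) else 0)"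
      by (rule sum.cong) (auto simp: sgl_def)
    then have "(\<Sum>g\<in>carrier G. (a \<oplus>\<^bsub>A\<^esub> sgl h c) g * l (sgl g 1 \<odot>\<^bsub>M\<^esub> z))
        = l (a \<odot>\<^bsub>M\<^esub> z) + c * l (sgl h 1 \<odot>\<^bsub>M\<^esub> z)"
      using add fin by (simp add: A_ops(1) distrib_right sum.distrib)
    moreover have "l ((a \<oplus>\<^bsub>A\<^esub> sgl h c) \<odot>\<^bsub>M\<^esub> z) = l (a \<odot>\<^bsub>M\<^esub> z) + c * l (sgl h 1 \<odot>\<^bsub>M\<^esub> z)"
      using add z lg[OF z add(2), of c] by (simp add: M.smult_l_distr la)
    ultimately show ?case by simp
  qed
  have "aug (\<phi> z) = (\<Sum>g\<in>carrier G. l (sgl (inv g) 1 \<odot>\<^bsub>M\<^esub> z))"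
    unfolding aug_def by (rule sum.cong) (auto simp: \<phi>_def)
  also have "\<dots> = (\<Sum>g\<in>carrier G. l (sgl g 1 \<odot>\<^bsub>M\<^esub> z))" by (rule sum_inv)
  also have "\<dots> = 1" using exp[OF norm_closed] l1 by (simp add: norm_elt_def)
  finally have "aug (\<phi> z) \<noteq> 0" by simp
  moreover have \<phi>z: "\<phi> z \<in> carrier A" using hom_closed[OF \<phi> z] by simp
  ultimately obtain u where u: "u \<in> carrier A" "u \<otimes>\<^bsub>A\<^esub> \<phi> z = \<one>\<^bsub>A\<^esub>" using aug_unit by blast
  have "(\<lambda>v. \<phi> v \<otimes>\<^bsub>A\<^esub> u) \<in> module_homs A M reg"
    using hom_closed[OF \<phi>] u(1) by (intro module_homsI) (auto simp: hom_add[OF \<phi>] hom_smult[OF \<phi>] A.l_distr A.m_assoc)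
  moreover have "\<phi> z \<otimes>\<^bsub>A\<^esub> u = \<one>\<^bsub>A\<^esub>" using u \<phi>z by (simp add: A.m_comm)
  ultimately show thesis by (rule that)
qed

theorem free_summand:
  assumes M: "left_module A M" and z: "z \<in> carrier M" and nz: "norm_elt \<odot>\<^bsub>M\<^esub> z \<noteq> \<zero>\<^bsub>M\<^esub>"
  shows "\<exists>U V. is_direct_sum A M U V \<and> module_iso A reg (M\<lparr>carrier := U\<rparr>)"
proof -
  interpret M: left_module A M by fact
  obtain \<phi> where \<phi>: "\<phi> \<in> module_homs A M reg" "\<phi> z = \<one>\<^bsub>A\<^esub>" by (rule free_retract[OF M z nz])
  have inj: "\<phi> (a \<odot>\<^bsub>M\<^esub> z) = a" if "a \<in> carrier A" for a
    using hom_smult[OF \<phi>(1) that z] \<phi>(2) that by simp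
  let ?f = "\<lambda>a. a \<odot>\<^bsub>M\<^esub> z"
  have f: "?f \<in> module_homs A reg M"
    using z by (intro module_homsI) (auto simp: M.smult_l_distr M.smult_assoc1)
  let ?U = "?f ` carrier reg" and ?V = "{v \<in> carrier M. \<phi> v = \<zero>\<^bsub>reg\<^esub>}"
  have U: "submodule ?U A M" by (rule submodule_image[OF reg_module M f])
  have V: "submodule ?V A M" by (rule submodule_kernel[OF M reg_module \<phi>(1)])
  have UV: "?U \<inter> ?V = {\<zero>\<^bsub>M\<^esub>}"
  proof
    show "?U \<inter> ?V \<subseteq> {\<zero>\<^bsub>M\<^esub>}"
    proof
      fix v assume "v \<in> ?U \<inter> ?V"
      then obtain a where a: "a \<in> carrier A" "v = a \<odot>\<^bsub>M\<^esub> z" "\<phi> v = \<zero>\<^bsub>A\<^esub>" by auto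
      then have "a = \<zero>\<^bsub>A\<^esub>" using inj[OF a(1)] by simp
      then show "v \<in> {\<zero>\<^bsub>M\<^esub>}" using a(2) z by simp
    qed
    show "{\<zero>\<^bsub>M\<^esub>} \<subseteq> ?U \<inter> ?V" using M.submoduleD(2)[OF U] M.submoduleD(2)[OF V] by blast
  qed
  have sum: "?U <+>\<^bsub>M\<^esub> ?V = carrier M"
  proof
    show "?U <+>\<^bsub>M\<^esub> ?V \<subseteq> carrier M"
      using M.submoduleD(1)[OF U] M.submoduleD(1)[OF V] by (auto simp: set_add_def set_mult_def)
    show "carrier M \<subseteq> ?U <+>\<^bsub>M\<^esub> ?V"
    proof
      fix v assume v: "v \<in> carrier M"
      define a where "a = \<phi> v"
      have a: "a \<in> carrier A" using hom_closed[OF \<phi>(1) v] by (simp add: a_def)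
      \<comment> \<open>In characteristic 2 this is v - a z, the component of v in the kernel of
        \<open>\<phi>\<close>.\<close>
      define w where "w = a \<odot>\<^bsub>M\<^esub> z \<oplus>\<^bsub>M\<^esub> v"
      have w: "w \<in> carrier M" using a z v by (simp add: w_def)
      have "\<phi> w = a \<oplus>\<^bsub>A\<^esub> a"
        using hom_add[OF \<phi>(1), of "a \<odot>\<^bsub>M\<^esub> z" v] a z v by (simp add: w_def inj) (simp add: a_def)
      then have "w \<in> ?V" using w by (simp add: A_two_zero)
      moreover have "v = a \<odot>\<^bsub>M\<^esub> z \<oplus>\<^bsub>M\<^esub> w"
        using a z v mod_two_zero[OF M, of "a \<odot>\<^bsub>M\<^esub> z"] by (simp add: w_def M.M.a_assoc[symmetric])
      moreover have "a \<odot>\<^bsub>M\<^esub> z \<in> ?U" using a by simp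
      ultimately show "v \<in> ?U <+>\<^bsub>M\<^esub> ?V" unfolding set_add_iff by blast
    qed
  qed
  have "inj_on ?f (carrier reg)"
    by (rule inj_on_inverseI[of _ \<phi>]) (simp add: inj)
  then have "bij_betw ?f (carrier reg) (carrier (M\<lparr>carrier := ?U\<rparr>))" by (simp add: bij_betw_def)
  moreover have "?f \<in> module_homs A reg (M\<lparr>carrier := ?U\<rparr>)" by (rule hom_restrict_codomain[OF f]) simp
  ultimately have "module_iso A reg (M\<lparr>carrier := ?U\<rparr>)" unfolding module_iso_def by blast
  with U V UV sum show ?thesis unfolding is_direct_sum_def by blast
qed

lemma indecomposable_iso_reg:
  assumes M: "left_module A M" and ind: "indecomposable A M"
    and z: "z \<in> carrier M" and nz: "norm_elt \<odot>\<^bsub>M\<^esub> z \<noteq> \<zero>\<^bsub>M\<^esub>"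
  shows "module_iso A M reg"
proof -
  interpret M: left_module A M by fact
  obtain U V where UV: "is_direct_sum A M U V" and iso: "module_iso A reg (M\<lparr>carrier := U\<rparr>)"
    using free_summand[OF M z nz] by blast
  have sub: "submodule U A M" "submodule V A M" "U <+>\<^bsub>M\<^esub> V = carrier M" using UV by (auto simp: is_direct_sum_def)
  have "U \<noteq> {\<zero>\<^bsub>M\<^esub>}"
  proof
    assume "U = {\<zero>\<^bsub>M\<^esub>}"
    then obtain f where "bij_betw f (carrier A) {\<zero>\<^bsub>M\<^esub>}" using iso by (auto simp: module_iso_def)
    then have "\<one>\<^bsub>A\<^esub> = \<zero>\<^bsub>A\<^esub>" unfolding bij_betw_def inj_on_def by (metis A.one_closed A.zero_closed imageI singletonD)
    then show False using A_one_neq_zero by simp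
  qed
  then have V: "V = {\<zero>\<^bsub>M\<^esub>}" using ind UV by (auto simp: indecomposable_def)
  have "U = carrier M"
  proof
    show "U \<subseteq> carrier M" by (rule M.submoduleD(1)[OF sub(1)])
    show "carrier M \<subseteq> U"
    proof
      fix x assume "x \<in> carrier M"
      then obtain u where "u \<in> U" "x = u \<oplus>\<^bsub>M\<^esub> \<zero>\<^bsub>M\<^esub>"
        unfolding sub(3)[symmetric] V set_add_iff by blast
      then show "x \<in> U" using M.submoduleD(1)[OF sub(1)] by auto
    qed
  qed
  then have "module_iso A reg M" using iso by simp
  then show ?thesis by (rule module_iso_sym[OF reg_module])
qed

text \<open>Projective and injective modules are summands of coinduced modules, where every fixed vector
  is a multiple of the norm element.\<close>

definition coind :: "('g \<Rightarrow> 'k, 'b) module \<Rightarrow> ('g \<Rightarrow> 'k, ('g \<Rightarrow> 'k) \<Rightarrow> 'b) module"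
  where "coind M = \<lparr>carrier = {F \<in> extensional (carrier A). (\<forall>b\<in>carrier A. F b \<in> carrier M
      \<and> (\<forall>c. F (sgl \<one> c \<otimes>\<^bsub>A\<^esub> b) = sgl \<one> c \<odot>\<^bsub>M\<^esub> F b) \<and> (\<forall>b'\<in>carrier A. F (b \<oplus>\<^bsub>A\<^esub> b') = F b \<oplus>\<^bsub>M\<^esub> F b'))},
    monoid.mult = (\<lambda>F F'. F), one = (\<lambda>b\<in>carrier A. \<zero>\<^bsub>M\<^esub>), zero = (\<lambda>b\<in>carrier A. \<zero>\<^bsub>M\<^esub>),
    add = (\<lambda>F F'. \<lambda>b\<in>carrier A. F b \<oplus>\<^bsub>M\<^esub> F' b), smult = (\<lambda>a F. \<lambda>b\<in>carrier A. F (b \<otimes>\<^bsub>A\<^esub> a))\<rparr>"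

lemma coind_ops [simp]:
  "\<zero>\<^bsub>coind M\<^esub> = (\<lambda>b\<in>carrier A. \<zero>\<^bsub>M\<^esub>)" "F \<oplus>\<^bsub>coind M\<^esub> F' = (\<lambda>b\<in>carrier A. F b \<oplus>\<^bsub>M\<^esub> F' b)"
  "a \<odot>\<^bsub>coind M\<^esub> F = (\<lambda>b\<in>carrier A. F (b \<otimes>\<^bsub>A\<^esub> a))"
  by (simp_all add: coind_def)

lemma coindD:
  assumes "F \<in> carrier (coind M)"
  shows "F \<in> extensional (carrier A)" "b \<in> carrier A \<Longrightarrow> F b \<in> carrier M"
    "b \<in> carrier A \<Longrightarrow> F (sgl \<one> c \<otimes>\<^bsub>A\<^esub> b) = sgl \<one> c \<odot>\<^bsub>M\<^esub> F b"
    "b \<in> carrier A \<Longrightarrow> b' \<in> carrier A \<Longrightarrow> F (b \<oplus>\<^bsub>A\<^esub> b') = F b \<oplus>\<^bsub>M\<^esub> F b'"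
  using assms by (auto simp: coind_def)

lemma coindI:
  assumes "\<And>b. b \<in> carrier A \<Longrightarrow> F b \<in> carrier M"
    "\<And>b c. b \<in> carrier A \<Longrightarrow> F (sgl \<one> c \<otimes>\<^bsub>A\<^esub> b) = sgl \<one> c \<odot>\<^bsub>M\<^esub> F b"
    "\<And>b b'. b \<in> carrier A \<Longrightarrow> b' \<in> carrier A \<Longrightarrow> F (b \<oplus>\<^bsub>A\<^esub> b') = F b \<oplus>\<^bsub>M\<^esub> F b'"
  shows "(\<lambda>b\<in>carrier A. F b) \<in> carrier (coind M)"
  using assms by (simp add: coind_def)

lemma coind_ext:
  assumes "F \<in> carrier (coind M)" "F' \<in> carrier (coind M)" "\<And>b. b \<in> carrier A \<Longrightarrow> F b = F' b"
  shows "F = F'"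
  using extensionalityI[OF coindD(1)[OF assms(1)] coindD(1)[OF assms(2)]] assms(3) by blast

lemma coind_module:
  assumes M: "left_module A M"
  shows "left_module A (coind M)"
proof -
  interpret M: left_module A M by fact
  have add: "F \<oplus>\<^bsub>coind M\<^esub> F' \<in> carrier (coind M)" if F: "F \<in> carrier (coind M)" "F' \<in> carrier (coind M)" for F F'
    unfolding coind_ops using coindD[OF F(1)] coindD[OF F(2)]
    by (intro coindI) (auto simp: M.smult_r_distr M.M.a_ac)
  have zero: "\<zero>\<^bsub>coind M\<^esub> \<in> carrier (coind M)" unfolding coind_ops by (intro coindI) auto
  have smult: "a \<odot>\<^bsub>coind M\<^esub> F \<in> carrier (coind M)" if a: "a \<in> carrier A" and F: "F \<in> carrier (coind M)" for a F
    unfolding coind_ops using a coindD[OF F]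
    by (intro coindI) (auto simp: A.m_assoc A.l_distr)
  show ?thesis
  proof (rule left_moduleI)
    fix F assume F: "F \<in> carrier (coind M)"
    show "\<exists>F'\<in>carrier (coind M). F' \<oplus>\<^bsub>coind M\<^esub> F = \<zero>\<^bsub>coind M\<^esub>"
      using F coindD(2)[OF F] by (intro bexI[of _ F]) (auto simp: mod_two_zero[OF M] intro!: restrict_ext)
    show "\<zero>\<^bsub>coind M\<^esub> \<oplus>\<^bsub>coind M\<^esub> F = F"
      by (rule coind_ext[OF add[OF zero F] F]) (use coindD(2)[OF F] in auto)
    show "\<one>\<^bsub>A\<^esub> \<odot>\<^bsub>coind M\<^esub> F = F"
      by (rule coind_ext[OF smult[OF A.one_closed F] F]) auto
    show "(a \<oplus>\<^bsub>A\<^esub> b) \<odot>\<^bsub>coind M\<^esub> F = a \<odot>\<^bsub>coind M\<^esub> F \<oplus>\<^bsub>coind M\<^esub> b \<odot>\<^bsub>coind M\<^esub> F"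
      if "a \<in> carrier A" "b \<in> carrier A" for a b
      using that coindD(4)[OF F] by (auto simp: A.r_distr intro!: restrict_ext)
    show "(a \<otimes>\<^bsub>A\<^esub> b) \<odot>\<^bsub>coind M\<^esub> F = a \<odot>\<^bsub>coind M\<^esub> (b \<odot>\<^bsub>coind M\<^esub> F)"
      if "a \<in> carrier A" "b \<in> carrier A" for a b
      using that by (auto simp: A.m_assoc intro!: restrict_ext)
    show "a \<odot>\<^bsub>coind M\<^esub> (F \<oplus>\<^bsub>coind M\<^esub> F') = a \<odot>\<^bsub>coind M\<^esub> F \<oplus>\<^bsub>coind M\<^esub> a \<odot>\<^bsub>coind M\<^esub> F'"
      if "a \<in> carrier A" for a F'
      using that by (auto intro!: restrict_ext)
    fix F' assume F': "F' \<in> carrier (coind M)"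
    show "F \<oplus>\<^bsub>coind M\<^esub> F' = F' \<oplus>\<^bsub>coind M\<^esub> F"
      using coindD(2)[OF F] coindD(2)[OF F'] by (auto simp: M.M.a_comm intro!: restrict_ext)
    fix F'' assume F'': "F'' \<in> carrier (coind M)"
    show "F \<oplus>\<^bsub>coind M\<^esub> F' \<oplus>\<^bsub>coind M\<^esub> F'' = F \<oplus>\<^bsub>coind M\<^esub> (F' \<oplus>\<^bsub>coind M\<^esub> F'')"
      using coindD(2)[OF F] coindD(2)[OF F'] coindD(2)[OF F''] by (auto simp: M.M.a_assoc intro!: restrict_ext)
  qed (use A.ring_axioms add zero smult in auto)
qed

lemma coind_sgl:
  assumes "F \<in> carrier (coind M)" "g \<in> carrier G"
  shows "F (sgl g c) = sgl \<one> c \<odot>\<^bsub>M\<^esub> F (sgl g 1)"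
  using coindD(3)[OF assms(1), of "sgl g 1" c] assms(2) by (simp add: sgl_mult)

lemma coind_eqI:
  assumes M: "left_module A M" and F: "F \<in> carrier (coind M)" "F' \<in> carrier (coind M)"
    and eq: "\<And>g. g \<in> carrier G \<Longrightarrow> F (sgl g 1) = F' (sgl g 1)"
  shows "F = F'"
proof (rule coind_ext[OF F])
  interpret M: left_module A M by fact
  fix b assume "b \<in> carrier A"
  then show "F b = F' b"
  proof (induct b rule: A_induct)
    case zero
    have "F \<zero>\<^bsub>A\<^esub> = F (sgl \<one> 0)" "F' \<zero>\<^bsub>A\<^esub> = F' (sgl \<one> 0)" by (simp_all add: sgl_zero)
    then show ?case using coind_sgl[OF F(1), of \<one> 0] coind_sgl[OF F(2), of \<one> 0] eq[of \<one>] by simp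
  next
    case (add b g c)
    then show ?case
      using coindD(4)[OF F(1)] coindD(4)[OF F(2)] coind_sgl[OF F(1), of g c] coind_sgl[OF F(2), of g c] eq[of g]
      by simp
  qed
qed

lemma ex_inj_coind:
  assumes "infinite (UNIV :: 'm set)" and M: "left_module A (M :: ('g \<Rightarrow> 'k, 'm) module)"
  shows "\<exists>j :: _ \<Rightarrow> 'm. inj_on j (carrier (coind M))"
proof -
  obtain f :: "('g \<Rightarrow> 'm) \<Rightarrow> 'm" where f: "inj_on f (\<Pi>\<^sub>E g\<in>carrier G. carrier M)"
    using ex_inj_pi[OF assms(1) fin] by blast
  have "inj_on (\<lambda>F. f (\<lambda>g\<in>carrier G. F (sgl g 1))) (carrier (coind M))"
  proof (rule inj_onI)
    fix F F' assume F: "F \<in> carrier (coind M)" "F' \<in> carrier (coind M)"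
      and e: "f (\<lambda>g\<in>carrier G. F (sgl g 1)) = f (\<lambda>g\<in>carrier G. F' (sgl g 1))"
    have "(\<lambda>g\<in>carrier G. F (sgl g 1)) = (\<lambda>g\<in>carrier G. F' (sgl g 1))"
      using coindD(2)[OF F(1)] coindD(2)[OF F(2)] by (intro inj_onD[OF f, OF e]) auto
    then have "F (sgl g 1) = F' (sgl g 1)" if "g \<in> carrier G" for g
      using that by (metis restrict_apply')
    then show "F = F'" by (rule coind_eqI[OF M F])
  qed
  then show ?thesis by blast
qed

text \<open>The element of the coinduced module concentrated at the unit of G. Multiplied by the
  norm element it becomes b \<mapsto> aug b v, which for a fixed vector v is b \<mapsto> b
  v.\<close>

definition delta :: "('g \<Rightarrow> 'k, 'b) module \<Rightarrow> 'b \<Rightarrow> ('g \<Rightarrow> 'k) \<Rightarrow> 'b"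
  where "delta M v = (\<lambda>b\<in>carrier A. sgl \<one> (b \<one>) \<odot>\<^bsub>M\<^esub> v)"

lemma delta_coind:
  assumes M: "left_module A M" and v: "v \<in> carrier M"
  shows "delta M v \<in> carrier (coind M)"
  unfolding delta_def
proof (rule coindI)
  interpret M: left_module A M by fact
  fix b assume b: "b \<in> carrier A"
  show "sgl \<one> (b \<one>) \<odot>\<^bsub>M\<^esub> v \<in> carrier M" using v by simp
  show "sgl \<one> ((sgl \<one> c \<otimes>\<^bsub>A\<^esub> b) \<one>) \<odot>\<^bsub>M\<^esub> v = sgl \<one> c \<odot>\<^bsub>M\<^esub> (sgl \<one> (b \<one>) \<odot>\<^bsub>M\<^esub> v)" for c
    using v by (simp add: sgl_mult_apply M.smult_assoc1[symmetric] sgl_mult)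
  show "sgl \<one> ((b \<oplus>\<^bsub>A\<^esub> b') \<one>) \<odot>\<^bsub>M\<^esub> v = sgl \<one> (b \<one>) \<odot>\<^bsub>M\<^esub> v \<oplus>\<^bsub>M\<^esub> sgl \<one> (b' \<one>) \<odot>\<^bsub>M\<^esub> v" for b'
    using v by (simp add: A_ops(1) sgl_add M.smult_l_distr)
qed

text \<open>I embeds into its coinduced module by v \<mapsto> (b \<mapsto> b v), and injectivity
  provides a retraction r. A fixed vector v goes to the norm element times \<open>delta I v\<close>,
  so v is the norm element times the image of \<open>delta I v\<close> under r.\<close>

lemma injective_norm:
  fixes I :: "('g \<Rightarrow> 'k, 'm) module"
  assumes inf: "infinite (UNIV :: 'm set)" and I: "injective A I" and nz: "carrier I \<noteq> {\<zero>\<^bsub>I\<^esub>}"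
  obtains z where "z \<in> carrier I" "norm_elt \<odot>\<^bsub>I\<^esub> z \<noteq> \<zero>\<^bsub>I\<^esub>"
proof -
  have M: "left_module A I" using I by (simp add: injective_def)
  interpret M: left_module A I by fact
  obtain v where v: "v \<in> carrier I" "v \<noteq> \<zero>\<^bsub>I\<^esub>" and fx: "\<And>g. g \<in> carrier G \<Longrightarrow> sgl g 1 \<odot>\<^bsub>I\<^esub> v = v"
    using ex_fixed[OF M nz] by blast
  obtain j :: "_ \<Rightarrow> 'm" where j: "inj_on j (carrier (coind I))" using ex_inj_coind[OF inf M] by blast
  let ?N = "transport j (coind I)"
  note cM = coind_module[OF M]
  let ?i = "\<lambda>v. \<lambda>b\<in>carrier A. b \<odot>\<^bsub>I\<^esub> v"
  have i: "?i \<in> module_homs A I (coind I)"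
  proof (rule module_homsI)
    show "?i x \<in> carrier (coind I)" if "x \<in> carrier I" for x
      using that by (intro coindI) (auto simp: M.smult_assoc1 M.smult_l_distr)
    show "?i (x \<oplus>\<^bsub>I\<^esub> y) = ?i x \<oplus>\<^bsub>coind I\<^esub> ?i y" if "x \<in> carrier I" "y \<in> carrier I" for x y
      using that by (auto simp: M.smult_r_distr intro!: restrict_ext)
    show "?i (a \<odot>\<^bsub>I\<^esub> x) = a \<odot>\<^bsub>coind I\<^esub> ?i x" if "a \<in> carrier A" "x \<in> carrier I" for a x
      using that by (auto simp: M.smult_assoc1 intro!: restrict_ext)
  qed
  have h: "(\<lambda>x. j (?i x)) \<in> module_homs A I ?N" by (rule hom_comp[OF i transport_hom[OF j]])
  have "inj_on (\<lambda>x. j (?i x)) (carrier I)"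
  proof (rule inj_onI)
    fix x y assume xy: "x \<in> carrier I" "y \<in> carrier I" "j (?i x) = j (?i y)"
    then have "?i x = ?i y" using inj_onD[OF j, OF xy(3)] hom_closed[OF i] by blast
    then have "\<one>\<^bsub>A\<^esub> \<odot>\<^bsub>I\<^esub> x = \<one>\<^bsub>A\<^esub> \<odot>\<^bsub>I\<^esub> y" by (metis A.one_closed restrict_apply')
    then show "x = y" using xy by simp
  qed
  moreover have id: "(\<lambda>x. x) \<in> module_homs A I I" by (auto intro: module_homsI)
  ultimately have "\<exists>r\<in>module_homs A ?N I. \<forall>x\<in>carrier I. r (j (?i x)) = x"
    by (intro conjunct2[OF I[unfolded injective_def], rule_format, OF conjI, OF M left_module_transport[OF cM j] h id])
  then obtain r where r: "r \<in> module_homs A ?N I" "\<And>x. x \<in> carrier I \<Longrightarrow> r (j (?i x)) = x" by auto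
  have d: "delta I v \<in> carrier (coind I)" by (rule delta_coind[OF M v(1)])
  have "norm_elt \<odot>\<^bsub>coind I\<^esub> delta I v = ?i v"
  proof (rule coind_ext)
    show "norm_elt \<odot>\<^bsub>coind I\<^esub> delta I v \<in> carrier (coind I)"
      by (rule left_module.smult_closed[OF cM norm_closed d])
    show "?i v \<in> carrier (coind I)" by (rule hom_closed[OF i v(1)])
    fix b assume b: "b \<in> carrier A"
    have "(b \<otimes>\<^bsub>A\<^esub> norm_elt) \<one> = aug b"
      by (subst norm_mult) (simp add: sgl_mult_apply norm_elt_def)
    then show "(norm_elt \<odot>\<^bsub>coind I\<^esub> delta I v) b = ?i v b"
      using b fixed_by_sgl[OF M v(1) fx b] by (simp add: delta_def)
  qed
  then have "j (?i v) = norm_elt \<odot>\<^bsub>?N\<^esub> j (delta I v)"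
    using d by (simp add: transport_simps[OF j] del: coind_ops)
  moreover have jd: "j (delta I v) \<in> carrier ?N" using d by (simp add: transport_simps[OF j])
  ultimately have "v = norm_elt \<odot>\<^bsub>I\<^esub> r (j (delta I v))"
    using r(2)[OF v(1)] hom_smult[OF r(1) norm_closed jd] by simp
  then show thesis using that[of "r (j (delta I v))"] hom_closed[OF r(1) jd] v by simp
qed

text \<open>Dual to the injective case: the coinduced module maps onto P by F \<mapsto> sum of
  g^(-1) F(g), with \<open>delta P\<close> as a k-linear section, and projectivity provides an
  A-linear section. It takes a fixed vector v to a fixed F, for which the sum is the norm element
  times F(1).\<close>

lemma projective_norm:
  fixes P :: "('g \<Rightarrow> 'k, 'm) module"
  assumes inf: "infinite (UNIV :: 'm set)" and P: "projective A P" and nz: "carrier P \<noteq> {\<zero>\<^bsub>P\<^esub>}"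
  obtains z where "z \<in> carrier P" "norm_elt \<odot>\<^bsub>P\<^esub> z \<noteq> \<zero>\<^bsub>P\<^esub>"
proof -
  have M: "left_module A P" and lP: "lifting TYPE('m) A P" using P by (simp_all add: projective_iff_lifting)
  interpret M: left_module A P by fact
  obtain v where v: "v \<in> carrier P" "v \<noteq> \<zero>\<^bsub>P\<^esub>" and fx: "\<And>g. g \<in> carrier G \<Longrightarrow> sgl g 1 \<odot>\<^bsub>P\<^esub> v = v"
    using ex_fixed[OF M nz] by blast
  obtain j :: "_ \<Rightarrow> 'm" where j: "inj_on j (carrier (coind P))" using ex_inj_coind[OF inf M] by blast
  let ?N = "transport j (coind P)"
  let ?k = "the_inv_into (carrier (coind P)) j"
  note cM = coind_module[OF M]
  interpret C: left_module A "coind P" by (rule cM)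
  define \<pi> where "\<pi> F = (\<Oplus>\<^bsub>P\<^esub>g\<in>carrier G. sgl (inv g) 1 \<odot>\<^bsub>P\<^esub> F (sgl g 1))" for F
  have \<pi>: "\<pi> \<in> module_homs A (coind P) P"
  proof (rule hom_criterion[OF cM M])
    fix F assume F: "F \<in> carrier (coind P)"
    show "\<pi> F \<in> carrier P" unfolding \<pi>_def using coindD(2)[OF F] by (intro M.M.finsum_closed) auto
    show "\<pi> (F \<oplus>\<^bsub>coind P\<^esub> F') = \<pi> F \<oplus>\<^bsub>P\<^esub> \<pi> F'" if F': "F' \<in> carrier (coind P)" for F'
    proof -
      have "\<pi> (F \<oplus>\<^bsub>coind P\<^esub> F') = (\<Oplus>\<^bsub>P\<^esub>g\<in>carrier G. sgl (inv g) 1 \<odot>\<^bsub>P\<^esub> F (sgl g 1) \<oplus>\<^bsub>P\<^esub> sgl (inv g) 1 \<odot>\<^bsub>P\<^esub> F' (sgl g 1))"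
        unfolding \<pi>_def using coindD(2)[OF F] coindD(2)[OF F']
        by (intro M.M.finsum_cong') (auto simp: M.smult_r_distr)
      also have "\<dots> = \<pi> F \<oplus>\<^bsub>P\<^esub> \<pi> F'"
        unfolding \<pi>_def using coindD(2)[OF F] coindD(2)[OF F'] by (intro M.M.finsum_addf) auto
      finally show ?thesis .
    qed
    show "\<pi> (sgl h c \<odot>\<^bsub>coind P\<^esub> F) = sgl h c \<odot>\<^bsub>P\<^esub> \<pi> F" if h: "h \<in> carrier G" for h c
    proof -
      let ?t = "\<lambda>u. sgl h c \<odot>\<^bsub>P\<^esub> (sgl (inv u) 1 \<odot>\<^bsub>P\<^esub> F (sgl u 1))"
      have t: "?t \<in> carrier G \<rightarrow> carrier P" using coindD(2)[OF F] h by auto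
      have img: "(\<lambda>g. g \<otimes> h) ` carrier G = carrier G"
      proof
        show "(\<lambda>g. g \<otimes> h) ` carrier G \<subseteq> carrier G" using h by auto
        show "carrier G \<subseteq> (\<lambda>g. g \<otimes> h) ` carrier G"
        proof
          fix g assume "g \<in> carrier G"
          then show "g \<in> (\<lambda>g. g \<otimes> h) ` carrier G"
            using h by (intro image_eqI[of _ _ "g \<otimes> inv h"]) (auto simp: G.m_assoc)
        qed
      qed
      have "sgl h c \<odot>\<^bsub>P\<^esub> \<pi> F = (\<Oplus>\<^bsub>P\<^esub>u\<in>carrier G. ?t u)"
        unfolding \<pi>_def using coindD(2)[OF F] h by (intro M.lmod_finsum fin) auto
      also have "\<dots> = (\<Oplus>\<^bsub>P\<^esub>u\<in>(\<lambda>g. g \<otimes> h) ` carrier G. ?t u)" by (simp only: img)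
      also have "\<dots> = (\<Oplus>\<^bsub>P\<^esub>g\<in>carrier G. ?t (g \<otimes> h))"
        using t h by (intro M.M.finsum_reindex) (auto simp: inj_on_def)
      also have "\<dots> = \<pi> (sgl h c \<odot>\<^bsub>coind P\<^esub> F)"
        unfolding \<pi>_def
      proof (rule M.M.finsum_cong'[OF refl])
        fix g assume g: "g \<in> carrier G"
        have "sgl h c \<otimes>\<^bsub>A\<^esub> sgl (inv (g \<otimes> h)) 1 = sgl (inv g) 1 \<otimes>\<^bsub>A\<^esub> sgl \<one> c"
        proof -
          have "h \<otimes> inv (g \<otimes> h) = inv g"
            using g h by (simp add: G.inv_mult_group G.m_assoc[symmetric])
          then show ?thesis using g h by (simp add: sgl_mult)
        qed
        moreover have "F (sgl (g \<otimes> h) c) = sgl \<one> c \<odot>\<^bsub>P\<^esub> F (sgl (g \<otimes> h) 1)"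
          using coind_sgl[OF F, of "g \<otimes> h" c] g h by simp
        ultimately show "?t (g \<otimes> h) = sgl (inv g) 1 \<odot>\<^bsub>P\<^esub> (sgl h c \<odot>\<^bsub>coind P\<^esub> F) (sgl g 1)"
          using g h coindD(2)[OF F] by (simp add: sgl_mult M.smult_assoc1[symmetric])
      qed (use coindD(2)[OF F] h in auto)
      finally show ?thesis by simp
    qed
  qed
  have \<pi>d: "\<pi> (delta P x) = x" if x: "x \<in> carrier P" for x
  proof -
    have "\<pi> (delta P x) = (\<Oplus>\<^bsub>P\<^esub>g\<in>carrier G. if \<one> = g then x else \<zero>\<^bsub>P\<^esub>)"
      unfolding \<pi>_def
    proof (rule M.M.finsum_cong'[OF refl])
      fix g assume g: "g \<in> carrier G"
      have "delta P x (sgl g 1) = (if \<one> = g then x else \<zero>\<^bsub>P\<^esub>)"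
      proof -
        have "delta P x (sgl g 1) = sgl \<one> (sgl g 1 \<one>) \<odot>\<^bsub>P\<^esub> x" using g by (simp add: delta_def)
        moreover have "sgl g (1 :: 'k) \<one> = (if \<one> = g then 1 else 0)" by (simp add: sgl_def)
        ultimately have "delta P x (sgl g 1) = (if \<one> = g then sgl \<one> 1 \<odot>\<^bsub>P\<^esub> x else \<zero>\<^bsub>P\<^esub>)"
          using x by (simp add: sgl_zero)
        then show ?thesis unfolding sgl_one[symmetric] using x by simp
      qed
      then show "sgl (inv g) 1 \<odot>\<^bsub>P\<^esub> delta P x (sgl g 1) = (if \<one> = g then x else \<zero>\<^bsub>P\<^esub>)"
        using g x by (auto simp flip: sgl_one)
    qed (use x in auto)
    also have "\<dots> = x" using x fin by (intro M.M.finsum_singleton) auto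
    finally show ?thesis .
  qed
  have k: "?k \<in> module_homs A ?N (coind P)" by (rule transport_inv_hom[OF cM j])
  have g: "(\<lambda>y. \<pi> (?k y)) \<in> module_homs A ?N P" by (rule hom_comp[OF k \<pi>])
  have surj: "(\<lambda>y. \<pi> (?k y)) ` carrier ?N = carrier P"
  proof
    show "(\<lambda>y. \<pi> (?k y)) ` carrier ?N \<subseteq> carrier P" using hom_closed[OF g] by blast
    show "carrier P \<subseteq> (\<lambda>y. \<pi> (?k y)) ` carrier ?N"
    proof
      fix x assume x: "x \<in> carrier P"
      have "x = \<pi> (?k (j (delta P x)))" using \<pi>d[OF x] delta_coind[OF M x] by (simp add: the_inv_into_f_f[OF j])
      moreover have "j (delta P x) \<in> carrier ?N" using delta_coind[OF M x] by (simp add: transport_simps[OF j])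
      ultimately show "x \<in> (\<lambda>y. \<pi> (?k y)) ` carrier ?N" by blast
    qed
  qed
  have id: "(\<lambda>x. x) \<in> module_homs A P P" by (auto intro: module_homsI)
  obtain h where h: "h \<in> module_homs A P ?N" "\<forall>x\<in>carrier P. \<pi> (?k (h x)) = x"
    by (rule bexE[OF liftingD[OF lP left_module_transport[OF cM j] M g id surj]])
  define F where "F = ?k (h v)"
  have F: "F \<in> carrier (coind P)" unfolding F_def by (rule hom_closed[OF hom_comp[OF h(1) k] v(1)])
  \<comment> \<open>F is fixed by G in the coinduced module, so its values at all group elements
    agree.\<close>
  have Fg: "F (sgl g 1) = F \<one>\<^bsub>A\<^esub>" if g: "g \<in> carrier G" for g
  proof -
    have "sgl g 1 \<odot>\<^bsub>coind P\<^esub> F = F"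
      using hom_smult[OF hom_comp[OF h(1) k], of "sgl g 1" v] v fx[OF g] g by (simp add: F_def del: coind_ops)
    then have "F \<one>\<^bsub>A\<^esub> = (sgl g 1 \<odot>\<^bsub>coind P\<^esub> F) \<one>\<^bsub>A\<^esub>" by simp
    then show ?thesis using g by simp
  qed
  let ?f = "F \<one>\<^bsub>A\<^esub>"
  have f: "?f \<in> carrier P" by (rule coindD(2)[OF F A.one_closed])
  have inv_img: "m_inv G ` carrier G = carrier G"
    by (auto intro!: image_eqI[of _ _ "inv _"])
  have "v = \<pi> F" using h(2) v(1) by (simp add: F_def)
  also have "\<dots> = (\<Oplus>\<^bsub>P\<^esub>g\<in>carrier G. sgl (inv g) 1 \<odot>\<^bsub>P\<^esub> ?f)"
    unfolding \<pi>_def using f Fg by (intro M.M.finsum_cong') auto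
  also have "\<dots> = (\<Oplus>\<^bsub>P\<^esub>g\<in>m_inv G ` carrier G. sgl g 1 \<odot>\<^bsub>P\<^esub> ?f)"
    using f by (intro M.M.finsum_reindex[symmetric]) (auto intro: inj_on_inverseI[of _ "m_inv G"])
  also have "\<dots> = (\<Oplus>\<^bsub>P\<^esub>g\<in>carrier G. sgl g (norm_elt g) \<odot>\<^bsub>P\<^esub> ?f)"
    unfolding inv_img using f by (intro M.M.finsum_cong') (auto simp: norm_elt_def)
  also have "\<dots> = norm_elt \<odot>\<^bsub>P\<^esub> ?f" by (rule smult_expand[OF M f norm_closed, symmetric])
  finally show thesis using that[OF f] v(2) by simp
qed

lemma reg_lifting: "lifting TYPE('m) A reg"
proof (rule liftingI)
  fix N L :: "('g \<Rightarrow> 'k, 'm) module" and g f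
  assume N: "left_module A N" and L: "left_module A L" and g: "g \<in> module_homs A N L"
    and f: "f \<in> module_homs A reg L" and s: "g ` carrier N = carrier L"
  interpret N: left_module A N by fact
  have "f \<one>\<^bsub>A\<^esub> \<in> carrier L" by (rule hom_closed[OF f]) simp
  then obtain m where m: "m \<in> carrier N" "g m = f \<one>\<^bsub>A\<^esub>" using s by (metis imageE)
  have h: "(\<lambda>a. a \<odot>\<^bsub>N\<^esub> m) \<in> module_homs A reg N"
    using m by (intro module_homsI) (auto simp: N.smult_l_distr N.smult_assoc1)
  have "g (a \<odot>\<^bsub>N\<^esub> m) = f a" if "a \<in> carrier reg" for a
    using hom_smult[OF g, of a m] hom_smult[OF f, of a "\<one>\<^bsub>A\<^esub>"] m that by simp
  then show "\<exists>h\<in>module_homs A reg N. \<forall>x\<in>carrier reg. g (h x) = f x"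
    by (intro bexI[OF _ h] ballI)
qed

text \<open>If 1 = u + v, one of u and v has nonzero augmentation, hence is a unit and generates
  everything.\<close>

lemma reg_indecomposable: "indecomposable A reg"
  unfolding indecomposable_def
proof (intro conjI allI impI)
  interpret R: left_module A reg by (rule reg_module)
  show "carrier reg \<noteq> {\<zero>\<^bsub>reg\<^esub>}"
  proof
    assume "carrier reg = {\<zero>\<^bsub>reg\<^esub>}"
    then have "\<one>\<^bsub>A\<^esub> = \<zero>\<^bsub>A\<^esub>" using A.one_closed by auto
    then show False using A_one_neq_zero by simp
  qed
  fix U V assume UV: "is_direct_sum A reg U V"
  then have s: "submodule U A reg" "submodule V A reg" and i: "U \<inter> V = {\<zero>\<^bsub>reg\<^esub>}"
    and "U <+>\<^bsub>reg\<^esub> V = carrier reg" by (auto simp: is_direct_sum_def)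
  then have "\<one>\<^bsub>A\<^esub> \<in> U <+>\<^bsub>reg\<^esub> V" by simp
  then obtain u v where uv: "u \<in> U" "v \<in> V" "\<one>\<^bsub>A\<^esub> = u \<oplus>\<^bsub>A\<^esub> v" by (auto simp: set_add_iff)
  have "aug u + aug v = 1" using uv(3) aug_add[of u v] by (metis sgl_one aug_sgl G.one_closed)
  then have "aug u \<noteq> 0 \<or> aug v \<noteq> 0" by auto
  moreover have all: "W = carrier reg" if W: "submodule W A reg" and w: "w \<in> W" "aug w \<noteq> 0" for W w
  proof -
    have wA: "w \<in> carrier A" using R.submoduleD(1)[OF W] w by auto
    obtain t where t: "t \<in> carrier A" "t \<otimes>\<^bsub>A\<^esub> w = \<one>\<^bsub>A\<^esub>" by (rule aug_unit[OF wA w(2)])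
    have "a \<in> W" if "a \<in> carrier A" for a
    proof -
      have "(a \<otimes>\<^bsub>A\<^esub> t) \<odot>\<^bsub>reg\<^esub> w \<in> W" using R.submoduleD(4)[OF W, of "a \<otimes>\<^bsub>A\<^esub> t" w] w that t by simp
      then show ?thesis using that t wA by (simp add: A.m_assoc)
    qed
    then show ?thesis using R.submoduleD(1)[OF W] by auto
  qed
  ultimately have "U = carrier reg \<or> V = carrier reg" using s uv by blast
  then show "U = {\<zero>\<^bsub>reg\<^esub>} \<or> V = {\<zero>\<^bsub>reg\<^esub>}"
    using i R.submoduleD(1)[OF s(1)] R.submoduleD(1)[OF s(2)] by blast
qed

end

section \<open>Endomorphism rings, quotients and free modules\<close>

lemma End_ring_simps:
  "carrier (End_ring R M) = module_homs R M M \<inter> extensional (carrier M)"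
  "e \<otimes>\<^bsub>End_ring R M\<^esub> f = compose (carrier M) e f" "\<one>\<^bsub>End_ring R M\<^esub> = (\<lambda>x\<in>carrier M. x)"
  "\<zero>\<^bsub>End_ring R M\<^esub> = (\<lambda>x\<in>carrier M. \<zero>\<^bsub>M\<^esub>)" "e \<oplus>\<^bsub>End_ring R M\<^esub> f = (\<lambda>x\<in>carrier M. e x \<oplus>\<^bsub>M\<^esub> f x)"
  by (simp_all add: End_ring_def)

lemma End_ringI: "f \<in> module_homs R M M \<Longrightarrow> left_module R M \<Longrightarrow> restrict f (carrier M) \<in> carrier (End_ring R M)"
proof -
  assume f: "f \<in> module_homs R M M" and "left_module R M"
  then interpret M: left_module R M by simp
  have "restrict f (carrier M) \<in> module_homs R M M"
    using module_homsD[OF f] by (intro module_homsI) auto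
  then show ?thesis by (simp add: End_ring_simps)
qed

lemma End_ring_eqI:
  assumes "e \<in> carrier (End_ring R M)" "f \<in> carrier (End_ring R M)" "\<And>x. x \<in> carrier M \<Longrightarrow> e x = f x"
  shows "e = f"
  using assms by (auto simp: End_ring_simps intro: extensionalityI)

lemma End_ring_ring:
  assumes M: "left_module R M"
  shows "ring (End_ring R M)"
proof -
  interpret M: left_module R M by fact
  let ?E = "End_ring R M"
  have hom: "e \<in> module_homs R M M" if "e \<in> carrier ?E" for e using that by (simp add: End_ring_simps)
  have ec: "e x \<in> carrier M" if "e \<in> carrier ?E" "x \<in> carrier M" for e x
    using hom_closed[OF hom[OF that(1)] that(2)] .
  have add: "e \<oplus>\<^bsub>?E\<^esub> f \<in> carrier ?E" if "e \<in> carrier ?E" "f \<in> carrier ?E" for e f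
    unfolding End_ring_simps(5) by (rule End_ringI[OF hom_plus[OF M hom[OF that(1)] hom[OF that(2)]] M])
  have mult: "e \<otimes>\<^bsub>?E\<^esub> f \<in> carrier ?E" if "e \<in> carrier ?E" "f \<in> carrier ?E" for e f
    unfolding End_ring_simps(2) compose_def by (rule End_ringI[OF hom_comp[OF hom[OF that(2)] hom[OF that(1)]] M])
  have zero: "\<zero>\<^bsub>?E\<^esub> \<in> carrier ?E"
    unfolding End_ring_simps(4) by (rule End_ringI[OF module_homsI M]) auto
  have one: "\<one>\<^bsub>?E\<^esub> \<in> carrier ?E"
    unfolding End_ring_simps(3) by (rule End_ringI[OF module_homsI M]) auto
  show ?thesis
  proof (rule ringI)
    show "abelian_group ?E"
    proof (rule abelian_groupI)
      show "\<exists>f\<in>carrier ?E. f \<oplus>\<^bsub>?E\<^esub> e = \<zero>\<^bsub>?E\<^esub>" if e: "e \<in> carrier ?E" for e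
      proof (rule bexI[OF _ End_ringI[OF hom_uminus[OF M hom[OF e]] M]])
        show "restrict (\<lambda>x. \<ominus>\<^bsub>M\<^esub> e x) (carrier M) \<oplus>\<^bsub>?E\<^esub> e = \<zero>\<^bsub>?E\<^esub>"
          using ec[OF e] by (auto simp: End_ring_simps M.M.l_neg intro!: restrict_ext)
      qed
      show "\<zero>\<^bsub>?E\<^esub> \<oplus>\<^bsub>?E\<^esub> e = e" if e: "e \<in> carrier ?E" for e
        by (rule End_ring_eqI[OF add[OF zero e] e]) (use ec[OF e] in \<open>simp add: End_ring_simps\<close>)
      show "e \<oplus>\<^bsub>?E\<^esub> f = f \<oplus>\<^bsub>?E\<^esub> e" if "e \<in> carrier ?E" "f \<in> carrier ?E" for e f
        using ec[OF that(1)] ec[OF that(2)] by (auto simp: End_ring_simps M.M.a_comm intro!: restrict_ext)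
      show "e \<oplus>\<^bsub>?E\<^esub> f \<oplus>\<^bsub>?E\<^esub> g = e \<oplus>\<^bsub>?E\<^esub> (f \<oplus>\<^bsub>?E\<^esub> g)"
        if "e \<in> carrier ?E" "f \<in> carrier ?E" "g \<in> carrier ?E" for e f g
        using ec[OF that(1)] ec[OF that(2)] ec[OF that(3)]
        by (auto simp: End_ring_simps M.M.a_assoc intro!: restrict_ext)
    qed (use add zero in auto)
    show "monoid ?E"
    proof (rule monoidI)
      show "\<one>\<^bsub>?E\<^esub> \<otimes>\<^bsub>?E\<^esub> e = e" if e: "e \<in> carrier ?E" for e
        by (rule End_ring_eqI[OF mult[OF one e] e]) (use ec[OF e] in \<open>simp add: End_ring_simps compose_def\<close>)
      show "e \<otimes>\<^bsub>?E\<^esub> \<one>\<^bsub>?E\<^esub> = e" if e: "e \<in> carrier ?E" for e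
        by (rule End_ring_eqI[OF mult[OF e one] e]) (use ec[OF e] in \<open>simp add: End_ring_simps compose_def\<close>)
      show "e \<otimes>\<^bsub>?E\<^esub> f \<otimes>\<^bsub>?E\<^esub> g = e \<otimes>\<^bsub>?E\<^esub> (f \<otimes>\<^bsub>?E\<^esub> g)"
        if "e \<in> carrier ?E" "f \<in> carrier ?E" "g \<in> carrier ?E" for e f g
        using ec[OF that(3)] by (auto simp: End_ring_simps compose_def intro!: restrict_ext)
    qed (use mult one in auto)
    show "(e \<oplus>\<^bsub>?E\<^esub> f) \<otimes>\<^bsub>?E\<^esub> g = e \<otimes>\<^bsub>?E\<^esub> g \<oplus>\<^bsub>?E\<^esub> f \<otimes>\<^bsub>?E\<^esub> g"
      if "e \<in> carrier ?E" "f \<in> carrier ?E" "g \<in> carrier ?E" for e f g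
      using ec[OF that(3)] by (auto simp: End_ring_simps compose_def intro!: restrict_ext)
    show "g \<otimes>\<^bsub>?E\<^esub> (e \<oplus>\<^bsub>?E\<^esub> f) = g \<otimes>\<^bsub>?E\<^esub> e \<oplus>\<^bsub>?E\<^esub> g \<otimes>\<^bsub>?E\<^esub> f"
      if "e \<in> carrier ?E" "f \<in> carrier ?E" "g \<in> carrier ?E" for e f g
      using ec[OF that(1)] ec[OF that(2)]
      by (auto simp: End_ring_simps compose_def hom_add[OF hom[OF that(3)]] intro!: restrict_ext)
  qed
qed

definition End_module :: "('a, 'x) ring_scheme \<Rightarrow> ('a, 'b) module \<Rightarrow> ('b \<Rightarrow> 'b, 'b) module"
  where "End_module R M = \<lparr>carrier = carrier M, monoid.mult = monoid.mult M, one = \<one>\<^bsub>M\<^esub>, zero = \<zero>\<^bsub>M\<^esub>,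
    add = add M, smult = (\<lambda>e x. e x)\<rparr>"

lemma End_module_simps [simp]: "carrier (End_module R M) = carrier M" "\<zero>\<^bsub>End_module R M\<^esub> = \<zero>\<^bsub>M\<^esub>"
  "x \<oplus>\<^bsub>End_module R M\<^esub> y = x \<oplus>\<^bsub>M\<^esub> y" "e \<odot>\<^bsub>End_module R M\<^esub> x = e x"
  by (simp_all add: End_module_def)

lemma End_module_module:
  assumes M: "left_module R M"
  shows "left_module (End_ring R M) (End_module R M)"
proof -
  interpret M: left_module R M by fact
  show ?thesis
  proof (rule left_moduleI)
    show "\<exists>y\<in>carrier (End_module R M). y \<oplus>\<^bsub>End_module R M\<^esub> x = \<zero>\<^bsub>End_module R M\<^esub>"
      if "x \<in> carrier (End_module R M)" for x
      using that by (intro bexI[of _ "\<ominus>\<^bsub>M\<^esub> x"]) (auto simp: M.M.l_neg)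
  qed (use End_ring_ring[OF M] in \<open>auto simp: End_ring_simps M.M.a_assoc compose_def hom_closed hom_add intro: M.M.a_comm\<close>)
qed

text \<open>Cosets are replaced by chosen representatives, so that the quotient lives on the same
  type as M and therefore stays in the universe over which the global dimension is taken.\<close>

lemma ex_quotient:
  fixes M :: "('a, 'b) module"
  assumes M: "left_module R M" and S: "submodule S R M"
  obtains Q :: "('a, 'b) module" and \<rho> where "left_module R Q" "\<rho> \<in> module_homs R M Q"
    "\<rho> ` carrier M = carrier Q" "{x \<in> carrier M. \<rho> x = \<zero>\<^bsub>Q\<^esub>} = S"
proof -
  interpret M: left_module R M by fact
  note SD = M.submoduleD[OF S]
  have Sc: "x \<in> carrier M" if "x \<in> S" for x using SD(1) that by auto
  define eq where "eq x y \<longleftrightarrow> x \<in> carrier M \<and> y \<in> carrier M \<and> x \<ominus>\<^bsub>M\<^esub> y \<in> S" for x y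
  have eq_refl: "eq x x" if "x \<in> carrier M" for x
    using that SD(2) by (simp add: eq_def a_minus_def M.M.r_neg)
  have eq_sym: "eq y x" if "eq x y" for x y
  proof -
    have "\<ominus>\<^bsub>M\<^esub> (x \<ominus>\<^bsub>M\<^esub> y) = y \<ominus>\<^bsub>M\<^esub> x"
      using that by (simp add: eq_def a_minus_def M.M.minus_add M.M.a_comm)
    then show ?thesis using that SD(5)[of "x \<ominus>\<^bsub>M\<^esub> y"] by (auto simp: eq_def)
  qed
  have eq_add: "eq (x \<oplus>\<^bsub>M\<^esub> x') (y \<oplus>\<^bsub>M\<^esub> y')" if "eq x y" "eq x' y'" for x y x' y'
  proof -
    have "(x \<oplus>\<^bsub>M\<^esub> x') \<ominus>\<^bsub>M\<^esub> (y \<oplus>\<^bsub>M\<^esub> y') = (x \<ominus>\<^bsub>M\<^esub> y) \<oplus>\<^bsub>M\<^esub> (x' \<ominus>\<^bsub>M\<^esub> y')"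
      using that by (simp add: eq_def a_minus_def M.M.minus_add M.M.a_ac)
    then show ?thesis using that SD(3) by (auto simp: eq_def)
  qed
  have eq_smult: "eq (a \<odot>\<^bsub>M\<^esub> x) (a \<odot>\<^bsub>M\<^esub> y)" if "eq x y" "a \<in> carrier R" for x y a
  proof -
    have "a \<odot>\<^bsub>M\<^esub> x \<ominus>\<^bsub>M\<^esub> a \<odot>\<^bsub>M\<^esub> y = a \<odot>\<^bsub>M\<^esub> (x \<ominus>\<^bsub>M\<^esub> y)"
      using that by (simp add: eq_def a_minus_def M.smult_r_distr M.lmod_r_minus)
    then show ?thesis using that SD(4) by (auto simp: eq_def)
  qed
  have eq_trans: "eq x z" if "eq x y" "eq y z" for x y z
  proof -
    have c: "x \<in> carrier M" "y \<in> carrier M" "z \<in> carrier M" using that by (auto simp: eq_def)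
    have "x \<ominus>\<^bsub>M\<^esub> z = x \<oplus>\<^bsub>M\<^esub> ((\<ominus>\<^bsub>M\<^esub> y \<oplus>\<^bsub>M\<^esub> y) \<oplus>\<^bsub>M\<^esub> \<ominus>\<^bsub>M\<^esub> z)"
      using c by (simp add: a_minus_def M.M.l_neg)
    also have "\<dots> = (x \<ominus>\<^bsub>M\<^esub> y) \<oplus>\<^bsub>M\<^esub> (y \<ominus>\<^bsub>M\<^esub> z)"
      using c by (simp add: a_minus_def M.M.a_assoc)
    finally show ?thesis using that SD(3) by (auto simp: eq_def)
  qed
  define \<rho> where "\<rho> x = (SOME y. eq x y)" for x
  have \<rho>: "eq x (\<rho> x)" if "x \<in> carrier M" for x
    unfolding \<rho>_def using eq_refl[OF that] by (rule someI)
  have \<rho>c: "\<rho> x \<in> carrier M" if "x \<in> carrier M" for x using \<rho>[OF that] by (simp add: eq_def)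
  have \<rho>_eq: "\<rho> x = \<rho> y" if "eq x y" for x y
  proof -
    have "eq x = eq y" using that eq_sym eq_trans by blast
    then show ?thesis by (simp add: \<rho>_def)
  qed
  define Q :: "('a, 'b) module" where "Q = \<lparr>carrier = \<rho> ` carrier M, monoid.mult = (\<lambda>x y. x), one = \<rho> \<zero>\<^bsub>M\<^esub>, zero = \<rho> \<zero>\<^bsub>M\<^esub>,
    add = (\<lambda>x y. \<rho> (x \<oplus>\<^bsub>M\<^esub> y)), smult = (\<lambda>a x. \<rho> (a \<odot>\<^bsub>M\<^esub> x))\<rparr>"
  have Qs: "carrier Q = \<rho> ` carrier M" "\<zero>\<^bsub>Q\<^esub> = \<rho> \<zero>\<^bsub>M\<^esub>" by (simp_all add: Q_def)
  have Qa: "\<rho> x \<oplus>\<^bsub>Q\<^esub> \<rho> y = \<rho> (x \<oplus>\<^bsub>M\<^esub> y)" if "x \<in> carrier M" "y \<in> carrier M" for x y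
    using \<rho>_eq[OF eq_sym[OF eq_add[OF \<rho>[OF that(1)] \<rho>[OF that(2)]]]] by (simp add: Q_def)
  have Qm: "a \<odot>\<^bsub>Q\<^esub> \<rho> x = \<rho> (a \<odot>\<^bsub>M\<^esub> x)" if "a \<in> carrier R" "x \<in> carrier M" for a x
    using \<rho>_eq[OF eq_sym[OF eq_smult[OF \<rho>[OF that(2)] that(1)]]] by (simp add: Q_def)
  have Q: "left_module R Q"
  proof (rule left_moduleI)
    show "\<exists>y\<in>carrier Q. y \<oplus>\<^bsub>Q\<^esub> x = \<zero>\<^bsub>Q\<^esub>" if x: "x \<in> carrier Q" for x
    proof -
      obtain u where u: "u \<in> carrier M" "x = \<rho> u" using x by (auto simp: Qs)
      then show ?thesis
        by (intro bexI[of _ "\<rho> (\<ominus>\<^bsub>M\<^esub> u)"]) (auto simp: Qs Qa M.M.l_neg)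
    qed
  qed (auto simp: Qs Qa Qm M.R.ring_axioms M.smult_l_distr M.smult_r_distr M.smult_assoc1 M.M.a_ac)
  have mz: "x \<ominus>\<^bsub>M\<^esub> \<zero>\<^bsub>M\<^esub> = x" if "x \<in> carrier M" for x
  proof -
    have "\<ominus>\<^bsub>M\<^esub> \<zero>\<^bsub>M\<^esub> = \<zero>\<^bsub>M\<^esub>" by (rule M.M.minus_equality) simp_all
    then show ?thesis using that by (simp only: a_minus_def M.M.r_zero)
  qed
  have "\<rho> \<in> module_homs R M Q" by (intro module_homsI) (auto simp: Qs Qa Qm)
  moreover have "{x \<in> carrier M. \<rho> x = \<zero>\<^bsub>Q\<^esub>} = S"
  proof -
    have "\<rho> x = \<rho> \<zero>\<^bsub>M\<^esub> \<longleftrightarrow> x \<in> S" if x: "x \<in> carrier M" for x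
    proof
      assume "\<rho> x = \<rho> \<zero>\<^bsub>M\<^esub>"
      then have "eq x \<zero>\<^bsub>M\<^esub>" using \<rho>[OF x] eq_sym[OF \<rho>[of "\<zero>\<^bsub>M\<^esub>"]] eq_trans by auto
      then show "x \<in> S" using x mz[OF x] by (simp add: eq_def)
    next
      assume "x \<in> S"
      then have "eq x \<zero>\<^bsub>M\<^esub>" using x mz[OF x] by (simp add: eq_def)
      then show "\<rho> x = \<rho> \<zero>\<^bsub>M\<^esub>" by (rule \<rho>_eq)
    qed
    then show ?thesis using Sc by (auto simp: Qs)
  qed
  ultimately show thesis using that[OF Q] by (simp add: Qs)
qed

definition free_module :: "('a, 'x) ring_scheme \<Rightarrow> 'j set \<Rightarrow> ('a, 'j \<Rightarrow> 'a) module"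
  where "free_module R J = \<lparr>carrier = {r. (\<forall>j. r j \<in> carrier R) \<and> finite {j. r j \<noteq> \<zero>\<^bsub>R\<^esub>} \<and> {j. r j \<noteq> \<zero>\<^bsub>R\<^esub>} \<subseteq> J},
    monoid.mult = (\<lambda>r r'. r), one = (\<lambda>j. \<zero>\<^bsub>R\<^esub>), zero = (\<lambda>j. \<zero>\<^bsub>R\<^esub>), add = (\<lambda>r r' j. r j \<oplus>\<^bsub>R\<^esub> r' j),
    smult = (\<lambda>a r j. a \<otimes>\<^bsub>R\<^esub> r j)\<rparr>"

lemma free_module_simps [simp]:
  "\<zero>\<^bsub>free_module R J\<^esub> = (\<lambda>j. \<zero>\<^bsub>R\<^esub>)" "r \<oplus>\<^bsub>free_module R J\<^esub> r' = (\<lambda>j. r j \<oplus>\<^bsub>R\<^esub> r' j)"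
  "a \<odot>\<^bsub>free_module R J\<^esub> r = (\<lambda>j. a \<otimes>\<^bsub>R\<^esub> r j)"
  by (simp_all add: free_module_def)

lemma free_module_carrier:
  "r \<in> carrier (free_module R J) \<longleftrightarrow> (\<forall>j. r j \<in> carrier R) \<and> finite {j. r j \<noteq> \<zero>\<^bsub>R\<^esub>} \<and> {j. r j \<noteq> \<zero>\<^bsub>R\<^esub>} \<subseteq> J"
  by (simp add: free_module_def)

lemma free_module_module:
  assumes "ring R"
  shows "left_module R (free_module R J)"
proof -
  interpret R: ring R by fact
  have add: "(\<lambda>j. r j \<oplus>\<^bsub>R\<^esub> r' j) \<in> carrier (free_module R J)"
    if "r \<in> carrier (free_module R J)" "r' \<in> carrier (free_module R J)" for r r'
  proof -
    have "{j. r j \<oplus>\<^bsub>R\<^esub> r' j \<noteq> \<zero>\<^bsub>R\<^esub>} \<subseteq> {j. r j \<noteq> \<zero>\<^bsub>R\<^esub>} \<union> {j. r' j \<noteq> \<zero>\<^bsub>R\<^esub>}" by auto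
    then show ?thesis using that unfolding free_module_carrier
      by (meson R.a_closed Un_least finite_Un finite_subset subset_trans)
  qed
  have smult: "(\<lambda>j. a \<otimes>\<^bsub>R\<^esub> r j) \<in> carrier (free_module R J)"
    if "a \<in> carrier R" "r \<in> carrier (free_module R J)" for a r
  proof -
    have "{j. a \<otimes>\<^bsub>R\<^esub> r j \<noteq> \<zero>\<^bsub>R\<^esub>} \<subseteq> {j. r j \<noteq> \<zero>\<^bsub>R\<^esub>}" using that by auto
    then show ?thesis using that unfolding free_module_carrier
      by (meson R.m_closed finite_subset subset_trans)
  qed
  show ?thesis
  proof (rule left_moduleI)
    show "\<exists>y\<in>carrier (free_module R J). y \<oplus>\<^bsub>free_module R J\<^esub> r = \<zero>\<^bsub>free_module R J\<^esub>"
      if r: "r \<in> carrier (free_module R J)" for r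
    proof (rule bexI)
      show "(\<lambda>j. \<ominus>\<^bsub>R\<^esub> \<one>\<^bsub>R\<^esub> \<otimes>\<^bsub>R\<^esub> r j) \<in> carrier (free_module R J)" by (rule smult[OF _ r]) simp
      show "(\<lambda>j. \<ominus>\<^bsub>R\<^esub> \<one>\<^bsub>R\<^esub> \<otimes>\<^bsub>R\<^esub> r j) \<oplus>\<^bsub>free_module R J\<^esub> r = \<zero>\<^bsub>free_module R J\<^esub>"
        using r by (auto simp: free_module_carrier fun_eq_iff R.l_minus R.l_neg)
    qed
  qed (use add smult in \<open>auto simp: free_module_carrier R.ring_axioms R.l_distr R.r_distr R.m_assoc R.a_ac\<close>)
qed

definition free_eval :: "('a, 'x) ring_scheme \<Rightarrow> ('a, 'b) module \<Rightarrow> ('b \<Rightarrow> 'a) \<Rightarrow> 'b"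
  where "free_eval R N r = (\<Oplus>\<^bsub>N\<^esub>j\<in>{j. r j \<noteq> \<zero>\<^bsub>R\<^esub>}. r j \<odot>\<^bsub>N\<^esub> j)"

lemma free_eval_superset:
  assumes N: "left_module R N" and r: "r \<in> carrier (free_module R (carrier N))"
    and U: "finite U" "{j. r j \<noteq> \<zero>\<^bsub>R\<^esub>} \<subseteq> U" "U \<subseteq> carrier N"
  shows "free_eval R N r = (\<Oplus>\<^bsub>N\<^esub>j\<in>U. r j \<odot>\<^bsub>N\<^esub> j)"
proof -
  interpret N: left_module R N by fact
  have "r j \<in> carrier R" for j using r by (simp add: free_module_carrier)
  then show ?thesis
    unfolding free_eval_def using U by (intro N.M.add.finprod_mono_neutral_cong_left) auto
qed

lemma free_eval_hom:
  assumes N: "left_module R N"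
  shows "free_eval R N \<in> module_homs R (free_module R (carrier N)) N"
    and "free_eval R N ` carrier (free_module R (carrier N)) = carrier N"
proof -
  interpret N: left_module R N by fact
  let ?F = "free_module R (carrier N)"
  have rR: "r j \<in> carrier R" if "r \<in> carrier ?F" for r j using that by (simp add: free_module_carrier)
  have sup: "finite {j. r j \<noteq> \<zero>\<^bsub>R\<^esub>}" "{j. r j \<noteq> \<zero>\<^bsub>R\<^esub>} \<subseteq> carrier N" if "r \<in> carrier ?F" for r
    using that by (simp_all add: free_module_carrier)
  interpret F: left_module R ?F by (rule free_module_module[OF N.R.ring_axioms])
  show h: "free_eval R N \<in> module_homs R ?F N"
  proof (rule module_homsI)
    fix r assume r: "r \<in> carrier ?F"
    show "free_eval R N r \<in> carrier N"
      unfolding free_eval_def using rR[OF r] sup(2)[OF r] by (intro N.M.finsum_closed) auto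
    show "free_eval R N (r \<oplus>\<^bsub>?F\<^esub> r') = free_eval R N r \<oplus>\<^bsub>N\<^esub> free_eval R N r'" if r': "r' \<in> carrier ?F" for r'
    proof -
      let ?U = "{j. r j \<noteq> \<zero>\<^bsub>R\<^esub>} \<union> {j. r' j \<noteq> \<zero>\<^bsub>R\<^esub>}"
      have U: "finite ?U" "?U \<subseteq> carrier N" using sup[OF r] sup[OF r'] by auto
      have s: "{j. (r \<oplus>\<^bsub>?F\<^esub> r') j \<noteq> \<zero>\<^bsub>R\<^esub>} \<subseteq> ?U" "{j. r j \<noteq> \<zero>\<^bsub>R\<^esub>} \<subseteq> ?U" "{j. r' j \<noteq> \<zero>\<^bsub>R\<^esub>} \<subseteq> ?U" by auto
      have jc: "j \<in> carrier N" if "j \<in> ?U" for j using U(2) that by blast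
      have "free_eval R N (r \<oplus>\<^bsub>?F\<^esub> r') = (\<Oplus>\<^bsub>N\<^esub>j\<in>?U. r j \<odot>\<^bsub>N\<^esub> j \<oplus>\<^bsub>N\<^esub> r' j \<odot>\<^bsub>N\<^esub> j)"
        unfolding free_eval_superset[OF N F.M.a_closed[OF r r'] U(1) s(1) U(2)]
        using rR[OF r] rR[OF r'] jc by (intro N.M.finsum_cong') (auto simp: N.smult_l_distr)
      also have "\<dots> = free_eval R N r \<oplus>\<^bsub>N\<^esub> free_eval R N r'"
        unfolding free_eval_superset[OF N r U(1) s(2) U(2)] free_eval_superset[OF N r' U(1) s(3) U(2)]
        using rR[OF r] rR[OF r'] jc by (intro N.M.finsum_addf) auto
      finally show ?thesis .
    qed
    show "free_eval R N (a \<odot>\<^bsub>?F\<^esub> r) = a \<odot>\<^bsub>N\<^esub> free_eval R N r" if a: "a \<in> carrier R" for a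
    proof -
      have jc: "j \<in> carrier N" if "r j \<noteq> \<zero>\<^bsub>R\<^esub>" for j using sup(2)[OF r] that by blast
      have s: "{j. (a \<odot>\<^bsub>?F\<^esub> r) j \<noteq> \<zero>\<^bsub>R\<^esub>} \<subseteq> {j. r j \<noteq> \<zero>\<^bsub>R\<^esub>}" using a by auto
      have "free_eval R N (a \<odot>\<^bsub>?F\<^esub> r) = (\<Oplus>\<^bsub>N\<^esub>j\<in>{j. r j \<noteq> \<zero>\<^bsub>R\<^esub>}. a \<odot>\<^bsub>N\<^esub> (r j \<odot>\<^bsub>N\<^esub> j))"
        unfolding free_eval_superset[OF N F.smult_closed[OF a r] sup(1)[OF r] s sup(2)[OF r]]
        using rR[OF r] jc a by (intro N.M.finsum_cong') (auto simp: N.smult_assoc1)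
      also have "\<dots> = a \<odot>\<^bsub>N\<^esub> free_eval R N r"
        unfolding free_eval_def using rR[OF r] jc a sup(1)[OF r] by (intro N.lmod_finsum[symmetric]) auto
      finally show ?thesis .
    qed
  qed
  show "free_eval R N ` carrier ?F = carrier N"
  proof
    show "free_eval R N ` carrier ?F \<subseteq> carrier N" using hom_closed[OF h] by blast
    show "carrier N \<subseteq> free_eval R N ` carrier ?F"
    proof
      fix x assume x: "x \<in> carrier N"
      let ?r = "\<lambda>j. if j = x then \<one>\<^bsub>R\<^esub> else \<zero>\<^bsub>R\<^esub>"
      have s: "{j. ?r j \<noteq> \<zero>\<^bsub>R\<^esub>} \<subseteq> {x}" by auto
      then have r: "?r \<in> carrier ?F" using x finite_subset[OF s] by (auto simp: free_module_carrier)
      have "free_eval R N ?r = (\<Oplus>\<^bsub>N\<^esub>j\<in>{x}. ?r j \<odot>\<^bsub>N\<^esub> j)"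
        by (rule free_eval_superset[OF N r _ s]) (use x in auto)
      also have "\<dots> = x" using x by simp
      finally show "x \<in> free_eval R N ` carrier ?F" using r by (metis imageI)
    qed
  qed
qed

lemma ex_inj_free_module:
  assumes inf: "infinite (UNIV :: 'm set)" and c: "inj_on (c :: 'a \<Rightarrow> 'm) (carrier R)"
  shows "\<exists>f :: ('m \<Rightarrow> 'a) \<Rightarrow> 'm. inj_on f (carrier (free_module R J))"
proof -
  obtain pr :: "'m \<times> 'm \<Rightarrow> 'm" where pr: "inj pr" using ex_inj_prod[OF inf] by blast
  obtain f :: "('m \<Rightarrow> 'm) \<Rightarrow> 'm" where f: "inj_on f {g. finite {i. g i \<noteq> c \<zero>\<^bsub>R\<^esub>}}"
    using ex_inj_fin_supp[OF inf pr, of "c \<zero>\<^bsub>R\<^esub>"] by blast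
  have "inj_on (\<lambda>r. f (\<lambda>j. c (r j))) (carrier (free_module R J))"
  proof (rule inj_onI)
    fix r r' assume r: "r \<in> carrier (free_module R J)" "r' \<in> carrier (free_module R J)"
      and e: "f (\<lambda>j. c (r j)) = f (\<lambda>j. c (r' j))"
    have fin: "finite {j. c (r j) \<noteq> c \<zero>\<^bsub>R\<^esub>}" if "r \<in> carrier (free_module R J)" for r
    proof (rule finite_subset)
      show "{j. c (r j) \<noteq> c \<zero>\<^bsub>R\<^esub>} \<subseteq> {j. r j \<noteq> \<zero>\<^bsub>R\<^esub>}" by auto
      show "finite {j. r j \<noteq> \<zero>\<^bsub>R\<^esub>}" using that by (simp add: free_module_carrier)
    qed
    have eq: "(\<lambda>j. c (r j)) = (\<lambda>j. c (r' j))"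
      by (rule inj_onD[OF f, OF e]) (use fin r in auto)
    show "r = r'"
    proof
      fix j show "r j = r' j"
        using inj_onD[OF c fun_cong[OF eq, of j]] r by (simp add: free_module_carrier)
    qed
  qed
  then show ?thesis by blast
qed

section \<open>The lower bound\<close>

lemma indecomposable_iso:
  assumes M: "left_module R M" and N: "left_module R N"
    and f: "f \<in> module_homs R M N" "bij_betw f (carrier M) (carrier N)"
    and ind: "indecomposable R M"
  shows "indecomposable R N"
proof -
  interpret M: left_module R M by fact
  interpret N: left_module R N by fact
  note inj = bij_betw_imp_inj_on[OF f(2)] and img = bij_betw_imp_surj_on[OF f(2)]
  note f0 = hom_zero[OF M N f(1)]
  have z: "x = \<zero>\<^bsub>M\<^esub>" if "x \<in> carrier M" "f x = \<zero>\<^bsub>N\<^esub>" for x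
    using inj_onD[OF inj, of x "\<zero>\<^bsub>M\<^esub>"] that f0 by simp
  let ?p = "\<lambda>U. {m \<in> carrier M. f m \<in> U}"
  have pre: "submodule (?p U) R M" if U: "submodule U R N" for U
    by (rule M.submoduleI_lmod)
      (auto simp: f0 hom_add[OF f(1)] hom_smult[OF f(1)] intro: N.submoduleD[OF U])
  have zero: "U = {\<zero>\<^bsub>N\<^esub>}" if U: "submodule U R N" and e: "?p U = {\<zero>\<^bsub>M\<^esub>}" for U
  proof
    show "U \<subseteq> {\<zero>\<^bsub>N\<^esub>}"
    proof
      fix u assume u: "u \<in> U"
      then have "u \<in> f ` carrier M" using N.submoduleD(1)[OF U] img by auto
      then obtain m where m: "m \<in> carrier M" "u = f m" by blast
      then have "m = \<zero>\<^bsub>M\<^esub>" using e u by auto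
      then show "u \<in> {\<zero>\<^bsub>N\<^esub>}" using m f0 by simp
    qed
    show "{\<zero>\<^bsub>N\<^esub>} \<subseteq> U" using N.submoduleD(2)[OF U] by simp
  qed
  show ?thesis
    unfolding indecomposable_def
  proof (intro conjI allI impI)
    show "carrier N \<noteq> {\<zero>\<^bsub>N\<^esub>}"
    proof
      assume a: "carrier N = {\<zero>\<^bsub>N\<^esub>}"
      have "carrier M = {\<zero>\<^bsub>M\<^esub>}"
      proof
        show "carrier M \<subseteq> {\<zero>\<^bsub>M\<^esub>}" using z hom_closed[OF f(1)] a by auto
      qed simp
      then show False using ind by (simp add: indecomposable_def)
    qed
    fix U V assume "is_direct_sum R N U V"
    then have U: "submodule U R N" and V: "submodule V R N" and i: "U \<inter> V = {\<zero>\<^bsub>N\<^esub>}"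
      and s: "U <+>\<^bsub>N\<^esub> V = carrier N" by (auto simp: is_direct_sum_def)
    have "is_direct_sum R M (?p U) (?p V)"
      unfolding is_direct_sum_def
    proof (intro conjI pre U V)
      show "?p U \<inter> ?p V = {\<zero>\<^bsub>M\<^esub>}"
      proof
        show "?p U \<inter> ?p V \<subseteq> {\<zero>\<^bsub>M\<^esub>}"
        proof
          fix m assume "m \<in> ?p U \<inter> ?p V"
          then have "m \<in> carrier M" "f m \<in> U \<inter> V" by auto
          then show "m \<in> {\<zero>\<^bsub>M\<^esub>}" using z i by auto
        qed
        show "{\<zero>\<^bsub>M\<^esub>} \<subseteq> ?p U \<inter> ?p V" using f0 N.submoduleD(2)[OF U] N.submoduleD(2)[OF V] by simp
      qed
      show "?p U <+>\<^bsub>M\<^esub> ?p V = carrier M"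
      proof
        show "?p U <+>\<^bsub>M\<^esub> ?p V \<subseteq> carrier M" by (auto simp: set_add_def set_mult_def)
        show "carrier M \<subseteq> ?p U <+>\<^bsub>M\<^esub> ?p V"
        proof
          fix m assume m: "m \<in> carrier M"
          then have "f m \<in> U <+>\<^bsub>N\<^esub> V" using s hom_closed[OF f(1)] by simp
          then obtain u v where uv: "u \<in> U" "v \<in> V" "f m = u \<oplus>\<^bsub>N\<^esub> v" by (auto simp: set_add_def set_mult_def)
          have "u \<in> f ` carrier M" "v \<in> f ` carrier M"
            using uv N.submoduleD(1)[OF U] N.submoduleD(1)[OF V] img by auto
          then obtain a b where ab: "a \<in> carrier M" "u = f a" "b \<in> carrier M" "v = f b" by blast
          have "f m = f (a \<oplus>\<^bsub>M\<^esub> b)" using uv ab hom_add[OF f(1) ab(1,3)] by simp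
          then have "m = a \<oplus>\<^bsub>M\<^esub> b" using inj_onD[OF inj, of m "a \<oplus>\<^bsub>M\<^esub> b"] m ab by simp
          then show "m \<in> ?p U <+>\<^bsub>M\<^esub> ?p V" using ab uv by (auto simp: set_add_def set_mult_def)
        qed
      qed
    qed
    then have "?p U = {\<zero>\<^bsub>M\<^esub>} \<or> ?p V = {\<zero>\<^bsub>M\<^esub>}" using ind by (auto simp: indecomposable_def)
    then show "U = {\<zero>\<^bsub>N\<^esub>} \<or> V = {\<zero>\<^bsub>N\<^esub>}" using zero[OF U] zero[OF V] by blast
  qed
qed

text \<open>In \<open>k[x,y]/(x^2, y^q)\<close> take \<open>s = x\<close>, \<open>t = y\<close>, \<open>p = y^(q-1)\<close> and \<open>r = x y^(q-2)\<close>.\<close>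

locale klein_witness = two_group_algebra +
  fixes s t p r :: "'a \<Rightarrow> 'c"
  assumes elts [simp]: "s \<in> carrier A" "t \<in> carrier A" "p \<in> carrier A" "r \<in> carrier A"
    and s_s: "s \<otimes>\<^bsub>A\<^esub> s = \<zero>\<^bsub>A\<^esub>" and s_r: "s \<otimes>\<^bsub>A\<^esub> r = \<zero>\<^bsub>A\<^esub>" and t_p: "t \<otimes>\<^bsub>A\<^esub> p = \<zero>\<^bsub>A\<^esub>"
    and t_r: "t \<otimes>\<^bsub>A\<^esub> r = norm_elt" and s_p: "s \<otimes>\<^bsub>A\<^esub> p = norm_elt"
    and socle: "\<And>b. b \<in> carrier A \<Longrightarrow> s \<otimes>\<^bsub>A\<^esub> b = \<zero>\<^bsub>A\<^esub> \<Longrightarrow> t \<otimes>\<^bsub>A\<^esub> b = \<zero>\<^bsub>A\<^esub> \<Longrightarrow>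
      b = sgl \<one> (b \<one>) \<otimes>\<^bsub>A\<^esub> norm_elt"

text \<open>A module M with a chosen free summand: \<alpha> splits the map a \<mapsto> a z from A to
  M. The set S is a finite set of generators of M.\<close>

locale free_direction = klein_witness G n A s t p r
  for G :: "('g, 'x) monoid_scheme" (structure) and n and A :: "('g \<Rightarrow> 'k::field) ring" and s t p r +
  fixes M :: "('g \<Rightarrow> 'k, 'm) module" and z :: 'm and \<alpha> :: "'m \<Rightarrow> 'g \<Rightarrow> 'k" and S :: "'m set"
  assumes M: "left_module A M" and z [simp]: "z \<in> carrier M" and nz: "norm_elt \<odot>\<^bsub>M\<^esub> z \<noteq> \<zero>\<^bsub>M\<^esub>"
    and \<alpha>: "\<alpha> \<in> module_homs A M reg" and \<alpha>_z: "\<alpha> z = \<one>\<^bsub>A\<^esub>"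
    and S: "finite S" "S \<subseteq> carrier M" "\<And>H. submodule H A M \<Longrightarrow> S \<subseteq> H \<Longrightarrow> H = carrier M"
begin

abbreviation "E \<equiv> End_ring A M"
abbreviation "EM \<equiv> End_module A M"

lemmas E_ring = End_ring_ring[OF M]
lemmas EM_module = End_module_module[OF M]

lemma E_hom: "e \<in> carrier E \<Longrightarrow> e \<in> module_homs A M M"
  by (simp add: End_ring_simps)

lemma E_closed: "e \<in> carrier E \<Longrightarrow> v \<in> carrier M \<Longrightarrow> e v \<in> carrier M"
  by (rule hom_closed[OF E_hom])

lemma \<alpha>_closed [simp]: "v \<in> carrier M \<Longrightarrow> \<alpha> v \<in> carrier A"
  using hom_closed[OF \<alpha>] by simp

lemma \<alpha>_add: "u \<in> carrier M \<Longrightarrow> v \<in> carrier M \<Longrightarrow> \<alpha> (u \<oplus>\<^bsub>M\<^esub> v) = \<alpha> u \<oplus>\<^bsub>A\<^esub> \<alpha> v"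
  using hom_add[OF \<alpha>] by simp

lemma \<alpha>_smult: "c \<in> carrier A \<Longrightarrow> v \<in> carrier M \<Longrightarrow> \<alpha> (c \<odot>\<^bsub>M\<^esub> v) = c \<otimes>\<^bsub>A\<^esub> \<alpha> v"
  using hom_smult[OF \<alpha>] by simp

lemma \<alpha>_zero: "\<alpha> \<zero>\<^bsub>M\<^esub> = \<zero>\<^bsub>A\<^esub>"
  using hom_zero[OF M reg_module \<alpha>] by simp

definition \<theta> :: "'m \<Rightarrow> 'm \<Rightarrow> 'm" where "\<theta> m = (\<lambda>v\<in>carrier M. \<alpha> v \<odot>\<^bsub>M\<^esub> m)"

lemma \<theta>_E: "m \<in> carrier M \<Longrightarrow> \<theta> m \<in> carrier E"
proof -
  assume m: "m \<in> carrier M"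
  interpret M: left_module A M by (rule M)
  show ?thesis
    unfolding \<theta>_def by (rule End_ringI[OF module_homsI M])
      (use m in \<open>auto simp: \<alpha>_add \<alpha>_smult M.smult_l_distr M.smult_assoc1\<close>)
qed

lemma \<theta>_add: "m \<in> carrier M \<Longrightarrow> m' \<in> carrier M \<Longrightarrow> \<theta> (m \<oplus>\<^bsub>M\<^esub> m') = \<theta> m \<oplus>\<^bsub>E\<^esub> \<theta> m'"
  using left_module.smult_r_distr[OF M] by (auto simp: \<theta>_def End_ring_simps intro!: restrict_ext)

lemma \<theta>_comp: "e \<in> carrier E \<Longrightarrow> m \<in> carrier M \<Longrightarrow> \<theta> (e m) = e \<otimes>\<^bsub>E\<^esub> \<theta> m"
  by (auto simp: \<theta>_def End_ring_simps(2) compose_def hom_smult[OF E_hom] intro!: restrict_ext)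

lemma \<theta>_z: "m \<in> carrier M \<Longrightarrow> \<theta> m z = m"
  using left_module.smult_one[OF M] by (simp add: \<theta>_def \<alpha>_z)

text \<open>\<theta> is an E-linear map from M to E, and evaluation at z is a left inverse of it. So
  M is a direct summand of E as a left module over E.\<close>

lemma lifting_EM: "lifting TYPE('n) E EM"
proof (rule liftingI)
  fix N L :: "('m \<Rightarrow> 'm, 'n) module" and g f
  assume N: "left_module E N" and L: "left_module E L" and g: "g \<in> module_homs E N L"
    and f: "f \<in> module_homs E EM L" and su: "g ` carrier N = carrier L"
  interpret N: left_module E N by fact
  have "f z \<in> carrier L" using hom_closed[OF f, of z] by simp
  then obtain n where n: "n \<in> carrier N" "g n = f z" using su by (metis imageE)
  have h: "(\<lambda>m. \<theta> m \<odot>\<^bsub>N\<^esub> n) \<in> module_homs E EM N"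
    by (rule module_homsI) (use n \<theta>_E in \<open>auto simp: \<theta>_add \<theta>_comp N.smult_l_distr N.smult_assoc1\<close>)
  have "g (\<theta> m \<odot>\<^bsub>N\<^esub> n) = f m" if m: "m \<in> carrier EM" for m
    using hom_smult[OF g, of "\<theta> m" n] hom_smult[OF f, of "\<theta> m" z] m n \<theta>_E[of m] by (simp add: \<theta>_z)
  then show "\<exists>h\<in>module_homs E EM N. \<forall>x\<in>carrier EM. g (h x) = f x"
    by (intro bexI[OF _ h] ballI)
qed

definition act :: "('g \<Rightarrow> 'k) \<Rightarrow> 'm \<Rightarrow> 'm" where "act c = (\<lambda>v\<in>carrier M. c \<odot>\<^bsub>M\<^esub> v)"

lemma act_E: "c \<in> carrier A \<Longrightarrow> act c \<in> carrier E"
proof -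
  assume c: "c \<in> carrier A"
  interpret M: left_module A M by (rule M)
  show ?thesis
    unfolding act_def
  proof (rule End_ringI[OF module_homsI M])
    show "c \<odot>\<^bsub>M\<^esub> (a \<odot>\<^bsub>M\<^esub> x) = a \<odot>\<^bsub>M\<^esub> (c \<odot>\<^bsub>M\<^esub> x)" if "a \<in> carrier A" "x \<in> carrier M" for a x
      using that c by (simp add: M.smult_assoc1[symmetric] A.m_comm[of c a])
  qed (use c in \<open>auto simp: M.smult_r_distr\<close>)
qed

text \<open>The map v \<mapsto> (l 0 v, ..., l (N - 1) v) takes the \<kappa> i to nonzero multiples
  of the unit vectors of k^N, so it is onto. As S generates M, its image is spanned by the images of
  the g m with g in G and m in S.\<close>

lemma dimension_bound:
  fixes l :: "nat \<Rightarrow> 'm \<Rightarrow> 'k"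
  assumes la: "\<And>j u v. u \<in> carrier M \<Longrightarrow> v \<in> carrier M \<Longrightarrow> l j (u \<oplus>\<^bsub>M\<^esub> v) = l j u + l j v"
    and ls: "\<And>j c v. v \<in> carrier M \<Longrightarrow> l j (sgl \<one> c \<odot>\<^bsub>M\<^esub> v) = c * l j v"
    and \<kappa>: "\<And>i. i < N \<Longrightarrow> \<kappa> i \<in> carrier M"
    and l\<kappa>: "\<And>i j. i < N \<Longrightarrow> j < N \<Longrightarrow> l j (\<kappa> i) = (if i = j then d else 0)" and d: "d \<noteq> 0"
  shows "N \<le> card (carrier G) * card S"
proof -
  interpret M: left_module A M by (rule M)
  define \<Psi> where "\<Psi> v = (\<lambda>j. if j < N then l j v else 0)" for v
  have \<Psi>a: "\<Psi> (u \<oplus>\<^bsub>M\<^esub> v) = \<Psi> u + \<Psi> v" if "u \<in> carrier M" "v \<in> carrier M" for u v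
    using la that by (auto simp: \<Psi>_def fun_eq_iff)
  have \<Psi>s: "\<Psi> (sgl \<one> c \<odot>\<^bsub>M\<^esub> v) = fscale c (\<Psi> v)" if "v \<in> carrier M" for c v
    using ls that by (auto simp: \<Psi>_def fun_eq_iff fscale_def)
  define B where "B = (\<lambda>(g, m). \<Psi> (sgl g 1 \<odot>\<^bsub>M\<^esub> m)) ` (carrier G \<times> S)"
  have B: "finite B" "card B \<le> card (carrier G) * card S"
    using fin S(1) card_image_le[of "carrier G \<times> S"] by (simp_all add: B_def card_cartesian_product)
  \<comment> \<open>All translates of v are tested, so that H is a submodule; it contains S, hence
    is all of M.\<close>
  define H where "H = {v \<in> carrier M. \<forall>g\<in>carrier G. \<Psi> (sgl g 1 \<odot>\<^bsub>M\<^esub> v) \<in> fv.span B}"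
  have "submodule H A M"
  proof (rule M.submoduleI_lmod)
    have "\<Psi> \<zero>\<^bsub>M\<^esub> = 0" using \<Psi>s[of "\<zero>\<^bsub>M\<^esub>" 0] by (simp add: fscale_def fun_eq_iff)
    then show "\<zero>\<^bsub>M\<^esub> \<in> H" using fv.span_zero[of B] by (simp add: H_def)
    show add: "u \<oplus>\<^bsub>M\<^esub> v \<in> H" if "u \<in> H" "v \<in> H" for u v
      using that by (auto simp: H_def M.smult_r_distr \<Psi>a intro: fv.span_add)
    show "a \<odot>\<^bsub>M\<^esub> v \<in> H" if a: "a \<in> carrier A" and v: "v \<in> H" for a v
      using a
    proof (induct a rule: A_induct)
      case zero
      show ?case using \<open>\<zero>\<^bsub>M\<^esub> \<in> H\<close> v by (simp add: H_def)
    next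
      case (add f h c)
      have vM: "v \<in> carrier M" using v by (simp add: H_def)
      have "sgl h c \<odot>\<^bsub>M\<^esub> v \<in> H"
        unfolding H_def
      proof (intro CollectI conjI ballI)
        show "sgl h c \<odot>\<^bsub>M\<^esub> v \<in> carrier M" using add(2) vM by simp
        fix g assume g: "g \<in> carrier G"
        have "sgl g 1 \<odot>\<^bsub>M\<^esub> (sgl h c \<odot>\<^bsub>M\<^esub> v) = sgl \<one> c \<odot>\<^bsub>M\<^esub> (sgl (g \<otimes> h) 1 \<odot>\<^bsub>M\<^esub> v)"
          using g add(2) vM by (simp add: M.smult_assoc1[symmetric] sgl_mult)
        moreover have "\<Psi> (sgl (g \<otimes> h) 1 \<odot>\<^bsub>M\<^esub> v) \<in> fv.span B" using v g add(2) by (simp add: H_def)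
        ultimately show "\<Psi> (sgl g 1 \<odot>\<^bsub>M\<^esub> (sgl h c \<odot>\<^bsub>M\<^esub> v)) \<in> fv.span B"
          using g add(2) vM by (simp add: \<Psi>s fv.span_scale)
      qed
      then have "f \<odot>\<^bsub>M\<^esub> v \<oplus>\<^bsub>M\<^esub> sgl h c \<odot>\<^bsub>M\<^esub> v \<in> H"
        using add(3) \<open>\<And>u v. u \<in> H \<Longrightarrow> v \<in> H \<Longrightarrow> u \<oplus>\<^bsub>M\<^esub> v \<in> H\<close> by blast
      then show ?case using add(1,2) vM by (simp add: M.smult_l_distr)
    qed
  qed (auto simp: H_def)
  moreover have "S \<subseteq> H" using S(2) by (auto simp: H_def B_def intro!: fv.span_base)
  ultimately have H: "H = carrier M" by (rule S(3))
  have span: "\<Psi> v \<in> fv.span B" if "v \<in> carrier M" for v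
  proof -
    have "v \<in> H" using H that by simp
    then have "\<Psi> (sgl \<one> 1 \<odot>\<^bsub>M\<^esub> v) \<in> fv.span B" by (simp add: H_def)
    then show ?thesis using that by (simp flip: sgl_one)
  qed
  define u :: "nat \<Rightarrow> nat \<Rightarrow> 'k" where "u i = (\<lambda>j. if j = i then 1 else 0)" for i
  have inj: "inj_on u {..<N}"
  proof (rule inj_onI)
    fix i j assume "u i = u j"
    then have "u i i = u j i" by simp
    then show "i = j" by (auto simp: u_def split: if_splits)
  qed
  have "u i \<in> fv.span B" if i: "i < N" for i
  proof -
    have "u i = fscale (inverse d) (\<Psi> (\<kappa> i))"
      using i d l\<kappa> by (auto simp: u_def \<Psi>_def fscale_def fun_eq_iff)
    then show ?thesis using span[OF \<kappa>[OF i]] by (simp add: fv.span_scale)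
  qed
  then have sub: "u ` {..<N} \<subseteq> fv.span B" by auto
  have "fv.independent (u ` {..<N})"
  proof
    assume "fv.dependent (u ` {..<N})"
    then obtain w where w: "\<exists>v\<in>u ` {..<N}. w v \<noteq> 0" "(\<Sum>v\<in>u ` {..<N}. fscale (w v) v) = 0"
      by (auto simp: fv.dependent_finite)
    then obtain j where j: "j < N" "w (u j) \<noteq> 0" by auto
    have "(\<Sum>v\<in>u ` {..<N}. fscale (w v) v) = (\<Sum>i<N. fscale (w (u i)) (u i))"
      using inj by (rule sum.reindex_cong) auto
    then have "(\<Sum>i<N. fscale (w (u i)) (u i)) j = 0" using w(2) by simp
    moreover have "(\<Sum>i<N. fscale (w (u i)) (u i)) j = (\<Sum>i<N. if i = j then w (u j) else 0)"
      unfolding sum_fun_apply by (rule sum.cong) (auto simp: fscale_def u_def)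
    ultimately show False using j by simp
  qed
  then have "card (u ` {..<N}) \<le> card B" using fv.independent_span_bound[OF B(1) _ sub] by blast
  then show ?thesis using B(2) inj by (simp add: card_image)
qed

end

section \<open>A second syzygy that is not projective\<close>

context free_direction
begin

definition N :: nat where "N = Suc (card (carrier G) * card S)"

text \<open>\<open>K\<close> is the kernel of a map \<open>M\<^sup>N \<rightarrow> M\<^sup>N\<^sup>-\<^sup>1\<close> between projective \<open>E\<close>-modules, hence would be
  projective if the global dimension were at most 2.\<close>

definition K :: "(nat \<Rightarrow> 'm) set"
  where "K = {m \<in> \<Pi>\<^sub>E l\<in>{..<N}. carrier M. \<forall>l. Suc l < N \<longrightarrow> s \<odot>\<^bsub>M\<^esub> m (Suc l) = t \<odot>\<^bsub>M\<^esub> m l}"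

definition KM :: "('m \<Rightarrow> 'm, nat \<Rightarrow> 'm) module"
  where "KM = (pi_module {..<N} EM)\<lparr>carrier := K\<rparr>"

lemma KM_simps [simp]: "carrier KM = K" "\<zero>\<^bsub>KM\<^esub> = (\<lambda>l\<in>{..<N}. \<zero>\<^bsub>M\<^esub>)"
  "m \<oplus>\<^bsub>KM\<^esub> m' = (\<lambda>l\<in>{..<N}. m l \<oplus>\<^bsub>M\<^esub> m' l)" "e \<odot>\<^bsub>KM\<^esub> m = (\<lambda>l\<in>{..<N}. e (m l))"
  by (simp_all add: KM_def)

lemma K_closed: "m \<in> K \<Longrightarrow> l < N \<Longrightarrow> m l \<in> carrier M"
  by (auto simp: K_def)

lemma K_rel: "m \<in> K \<Longrightarrow> Suc l < N \<Longrightarrow> s \<odot>\<^bsub>M\<^esub> m (Suc l) = t \<odot>\<^bsub>M\<^esub> m l"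
  by (simp add: K_def)

lemma KM_module: "left_module E KM"
proof -
  interpret M: left_module A M by (rule M)
  interpret P: left_module E "pi_module {..<N} EM" by (rule left_module_pi[OF EM_module])
  have "submodule K E (pi_module {..<N} EM)"
  proof (rule P.submoduleI_lmod)
    show "e \<odot>\<^bsub>pi_module {..<N} EM\<^esub> m \<in> K" if e: "e \<in> carrier E" and m: "m \<in> K" for e m
    proof -
      have "s \<odot>\<^bsub>M\<^esub> e (m (Suc l)) = t \<odot>\<^bsub>M\<^esub> e (m l)" if l: "Suc l < N" for l
        using K_rel[OF m l] K_closed[OF m, of l] K_closed[OF m l] l
          hom_smult[OF E_hom[OF e] elts(1), of "m (Suc l)"] hom_smult[OF E_hom[OF e] elts(2), of "m l"] by simp
      then show ?thesis using E_closed[OF e] K_closed[OF m] by (auto simp: K_def)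
    qed
    show "m \<oplus>\<^bsub>pi_module {..<N} EM\<^esub> m' \<in> K" if m: "m \<in> K" "m' \<in> K" for m m'
    proof -
      have "s \<odot>\<^bsub>M\<^esub> (m (Suc l) \<oplus>\<^bsub>M\<^esub> m' (Suc l)) = t \<odot>\<^bsub>M\<^esub> (m l \<oplus>\<^bsub>M\<^esub> m' l)" if l: "Suc l < N" for l
        using K_rel[OF m(1) l] K_rel[OF m(2) l] K_closed[OF m(1), of l] K_closed[OF m(2), of l]
          K_closed[OF m(1) l] K_closed[OF m(2) l] l by (simp add: M.smult_r_distr)
      then show ?thesis using K_closed[OF m(1)] K_closed[OF m(2)] by (auto simp: K_def)
    qed
  qed (auto simp: K_def)
  then show ?thesis unfolding KM_def by (rule P.left_module_submodule)
qed

text \<open>p z in position j and r z in position j - 1. It lies in K because s p = t r is the norm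
  element, while s r = t p = 0. The same identities give the chain \<open>f_rel\<close>. At j = N
  only r z at the last position is left, so s annihilates \<open>f N\<close>.\<close>

definition f :: "nat \<Rightarrow> nat \<Rightarrow> 'm"
  where "f j = (\<lambda>l\<in>{..<N}. if l = j then p \<odot>\<^bsub>M\<^esub> z else if Suc l = j then r \<odot>\<^bsub>M\<^esub> z else \<zero>\<^bsub>M\<^esub>)"

lemma z_simps:
  "s \<odot>\<^bsub>M\<^esub> (p \<odot>\<^bsub>M\<^esub> z) = norm_elt \<odot>\<^bsub>M\<^esub> z" "t \<odot>\<^bsub>M\<^esub> (r \<odot>\<^bsub>M\<^esub> z) = norm_elt \<odot>\<^bsub>M\<^esub> z"
  "s \<odot>\<^bsub>M\<^esub> (r \<odot>\<^bsub>M\<^esub> z) = \<zero>\<^bsub>M\<^esub>" "t \<odot>\<^bsub>M\<^esub> (p \<odot>\<^bsub>M\<^esub> z) = \<zero>\<^bsub>M\<^esub>"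
proof -
  interpret M: left_module A M by (rule M)
  show "s \<odot>\<^bsub>M\<^esub> (p \<odot>\<^bsub>M\<^esub> z) = norm_elt \<odot>\<^bsub>M\<^esub> z" "t \<odot>\<^bsub>M\<^esub> (r \<odot>\<^bsub>M\<^esub> z) = norm_elt \<odot>\<^bsub>M\<^esub> z"
    "s \<odot>\<^bsub>M\<^esub> (r \<odot>\<^bsub>M\<^esub> z) = \<zero>\<^bsub>M\<^esub>" "t \<odot>\<^bsub>M\<^esub> (p \<odot>\<^bsub>M\<^esub> z) = \<zero>\<^bsub>M\<^esub>"
    by (simp_all add: M.smult_assoc1[symmetric] s_p t_r s_r t_p)
qed

lemma f_K: "f j \<in> K"
proof -
  interpret M: left_module A M by (rule M)
  show ?thesis unfolding K_def by (auto simp: f_def z_simps)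
qed

lemma f_rel: "act s \<odot>\<^bsub>KM\<^esub> f j = act t \<odot>\<^bsub>KM\<^esub> f (Suc j)"
proof -
  interpret M: left_module A M by (rule M)
  show ?thesis by (auto simp: f_def act_def z_simps intro!: restrict_ext)
qed

lemma f_first: "act t \<odot>\<^bsub>KM\<^esub> f 0 = \<zero>\<^bsub>KM\<^esub>"
proof -
  interpret M: left_module A M by (rule M)
  show ?thesis by (auto simp: f_def act_def z_simps intro!: restrict_ext)
qed

lemma f_last: "act s \<odot>\<^bsub>KM\<^esub> f N = \<zero>\<^bsub>KM\<^esub>"
proof -
  interpret M: left_module A M by (rule M)
  show ?thesis by (auto simp: f_def act_def z_simps intro!: restrict_ext)
qed

text \<open>\<open>\<theta> z\<close> is the projection of M onto A z. Through this identity the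
  coordinates of \<open>f j\<close> are endomorphisms with values in A z.\<close>

lemma f_\<theta>: "\<theta> z \<odot>\<^bsub>KM\<^esub> f j = f j"
proof -
  interpret M: left_module A M by (rule M)
  show ?thesis by (auto simp: f_def \<theta>_def \<alpha>_smult \<alpha>_z \<alpha>_zero intro!: restrict_ext)
qed

text \<open>\<open>s \<sigma>\<^sub>j\<close> takes values in the socle of \<open>A z\<close>, hence is given by the functional
  \<open>c j\<close>. The relations force \<open>c j (\<kappa> l)\<close> to be \<open>c 0 (\<kappa> 0)\<close> times the Kronecker delta,
  and \<open>N\<close> exceeds the dimension of \<open>M\<close>.\<close>

lemma split_coordinate_zero:
  assumes \<sigma>: "\<And>j. \<sigma> j \<in> carrier E"
    and rel: "\<And>j v. v \<in> carrier M \<Longrightarrow> s \<odot>\<^bsub>M\<^esub> \<sigma> j v = t \<odot>\<^bsub>M\<^esub> \<sigma> (Suc j) v"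
    and first: "\<And>v. v \<in> carrier M \<Longrightarrow> t \<odot>\<^bsub>M\<^esub> \<sigma> 0 v = \<zero>\<^bsub>M\<^esub>"
    and last: "\<And>v. v \<in> carrier M \<Longrightarrow> s \<odot>\<^bsub>M\<^esub> \<sigma> N v = \<zero>\<^bsub>M\<^esub>"
    and img: "\<And>v. v \<in> carrier M \<Longrightarrow> \<sigma> 0 v = \<alpha> (\<sigma> 0 v) \<odot>\<^bsub>M\<^esub> z"
    and \<kappa>: "\<kappa> \<in> K"
  shows "s \<odot>\<^bsub>M\<^esub> \<sigma> 0 (\<kappa> 0) = \<zero>\<^bsub>M\<^esub>"
proof -
  interpret M: left_module A M by (rule M)
  define c where "c j v = \<alpha> (s \<odot>\<^bsub>M\<^esub> \<sigma> j v) \<one>" for j v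
  note \<sigma>c [simp] = E_closed[OF \<sigma>]
  have step: "c j (\<kappa> (Suc l)) = \<alpha> (t \<odot>\<^bsub>M\<^esub> \<sigma> j (\<kappa> l)) \<one>" if l: "Suc l < N" for j l
    using K_rel[OF \<kappa> l] K_closed[OF \<kappa> l] K_closed[OF \<kappa>, of l] l
      hom_smult[OF E_hom[OF \<sigma>[of j]] elts(1), of "\<kappa> (Suc l)"]
      hom_smult[OF E_hom[OF \<sigma>[of j]] elts(2), of "\<kappa> l"] by (simp add: c_def)
  have c_Suc: "c (Suc j) (\<kappa> (Suc l)) = c j (\<kappa> l)" if l: "Suc l < N" for j l
    using step[OF l, of "Suc j"] rel[of "\<kappa> l" j] K_closed[OF \<kappa>, of l] l by (simp add: c_def)
  have c_first: "c 0 (\<kappa> (Suc l)) = 0" if l: "Suc l < N" for l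
    using step[OF l, of 0] first[of "\<kappa> l"] K_closed[OF \<kappa>, of l] l by (simp add: \<alpha>_zero A_zero_apply)
  have c_last: "c N (\<kappa> l) = 0" if l: "l < N" for l
    using last[of "\<kappa> l"] K_closed[OF \<kappa> l] by (simp add: c_def \<alpha>_zero A_zero_apply)
  have shift: "c (j + i) (\<kappa> (l + i)) = c j (\<kappa> l)" if "l + i < N" for i j l
    using that by (induct i) (auto simp: c_Suc)
  \<comment> \<open>By \<open>c_Suc\<close> the value is constant along diagonals. A diagonal with j
    < l comes down to j = 0 while l is still positive, where \<open>c_first\<close> applies; one
    with l < j goes up to j = N while l is still below N, where \<open>c_last\<close>
    applies.\<close>
  have c_delta: "c j (\<kappa> l) = (if l = j then c 0 (\<kappa> 0) else 0)" if "l < N" "j < N" for j l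
  proof -
    consider "l = j" | "j < l" | "l < j" by linarith
    then show ?thesis
    proof cases
      case 1
      then show ?thesis using shift[of 0 j 0] that by simp
    next
      case 2
      then obtain i where i: "l = Suc i + j" by (metis add.commute add_Suc_right less_imp_Suc_add)
      have "c j (\<kappa> l) = c 0 (\<kappa> (Suc i))" using shift[of "Suc i" j 0] that i by simp
      also have "\<dots> = 0" by (rule c_first) (use that i in simp)
      finally show ?thesis using 2 by simp
    next
      case 3
      have "c j (\<kappa> l) = c N (\<kappa> (l + (N - j)))" using shift[of l "N - j" j] that 3 by simp
      also have "\<dots> = 0" by (rule c_last) (use that 3 in simp)
      finally show ?thesis using 3 by simp
    qed
  qed
  have "c 0 (\<kappa> 0) = 0"
  proof (rule ccontr)
    assume d: "c 0 (\<kappa> 0) \<noteq> 0"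
    have "N \<le> card (carrier G) * card S"
    proof (rule dimension_bound[of c N \<kappa>, OF _ _ K_closed[OF \<kappa>] c_delta d])
      show "c j (u \<oplus>\<^bsub>M\<^esub> v) = c j u + c j v" if "u \<in> carrier M" "v \<in> carrier M" for j u v
        using that hom_add[OF E_hom[OF \<sigma>[of j]]] by (simp add: c_def M.smult_r_distr \<alpha>_add A_ops(1))
      show "c j (sgl \<one> a \<odot>\<^bsub>M\<^esub> v) = a * c j v" if v: "v \<in> carrier M" for j a v
      proof -
        have "s \<odot>\<^bsub>M\<^esub> (sgl \<one> a \<odot>\<^bsub>M\<^esub> \<sigma> j v) = sgl \<one> a \<odot>\<^bsub>M\<^esub> (s \<odot>\<^bsub>M\<^esub> \<sigma> j v)"
          using v by (simp add: M.smult_assoc1[symmetric] A.m_comm[of s])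
        then show ?thesis
          using v hom_smult[OF E_hom[OF \<sigma>[of j]], of "sgl \<one> a" v]
          by (simp add: c_def \<alpha>_smult[of "sgl \<one> a"] sgl_mult_apply)
      qed
    qed
    then show False by (simp add: N_def)
  qed
  \<comment> \<open>b is annihilated by s and, because t annihilates the values of
    \<open>\<sigma> 0\<close>, also by t. So it lies in the socle and is determined by its
    coefficient at the unit of G, which has just been shown to vanish.\<close>
  moreover define b where "b = s \<otimes>\<^bsub>A\<^esub> \<alpha> (\<sigma> 0 (\<kappa> 0))"
  have N0: "0 < N" by (simp add: N_def)
  note k0 = K_closed[OF \<kappa> N0]
  have "b \<one> = c 0 (\<kappa> 0)" using k0 by (simp add: b_def c_def \<alpha>_smult)
  moreover have "b = sgl \<one> (b \<one>) \<otimes>\<^bsub>A\<^esub> norm_elt"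
  proof (rule socle)
    show "b \<in> carrier A" using k0 by (simp add: b_def)
    show "s \<otimes>\<^bsub>A\<^esub> b = \<zero>\<^bsub>A\<^esub>" using k0 by (simp add: b_def A.m_assoc[symmetric] s_s)
    have "t \<otimes>\<^bsub>A\<^esub> b = s \<otimes>\<^bsub>A\<^esub> \<alpha> (t \<odot>\<^bsub>M\<^esub> \<sigma> 0 (\<kappa> 0))"
      using k0 by (simp add: b_def \<alpha>_smult A.m_assoc[symmetric] A.m_comm[of t s])
    then show "t \<otimes>\<^bsub>A\<^esub> b = \<zero>\<^bsub>A\<^esub>" using first[OF k0] by (simp add: \<alpha>_zero)
  qed
  ultimately have "b = \<zero>\<^bsub>A\<^esub>" by (simp add: sgl_zero)
  moreover have "s \<odot>\<^bsub>M\<^esub> (\<alpha> (\<sigma> 0 (\<kappa> 0)) \<odot>\<^bsub>M\<^esub> z) = b \<odot>\<^bsub>M\<^esub> z"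
    using k0 by (simp add: b_def M.smult_assoc1)
  ultimately show ?thesis using img[OF k0] by simp
qed

text \<open>In the application T is a copy of \<open>KM\<close> in the universe and k the
  isomorphism. A section h of the free cover of T gives a dual basis: \<open>f 0\<close> is the sum
  of the \<open>h (f 0) u\<close> applied to \<open>k u\<close>. The map m \<mapsto> s (m 0)
  annihilates every summand by \<open>split_coordinate_zero\<close>, but takes \<open>f 0\<close> to
  the norm element times z.\<close>

lemma KM_not_split:
  assumes T: "left_module E T" and k: "k \<in> module_homs E T KM"
    and h: "h \<in> module_homs E KM (free_module E (carrier T))"
    and split: "\<And>m. m \<in> K \<Longrightarrow> k (free_eval E T (h m)) = m"
  shows False
proof -
  interpret M: left_module A M by (rule M)
  interpret T: left_module E T by (rule T)
  note FM = free_module_module[OF E_ring, of "carrier T"]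
  have hE: "h m u \<in> carrier E" if "m \<in> K" for m u
    using hom_closed[OF h, of m] that by (simp add: free_module_carrier)
  have hs: "h (e \<odot>\<^bsub>KM\<^esub> m) u v = e (h m u v)" if "e \<in> carrier E" "m \<in> K" "v \<in> carrier M" for e m u v
    using fun_cong[OF hom_smult[OF h that(1), of m], of u] that by (simp add: End_ring_simps(2) compose_def del: KM_simps(4))
  have ha: "h (act a \<odot>\<^bsub>KM\<^esub> m) u v = a \<odot>\<^bsub>M\<^esub> h m u v" if "a \<in> carrier A" "m \<in> K" "v \<in> carrier M" for a m u v
    using hs[OF act_E[OF that(1)] that(2,3)] E_closed[OF hE[OF that(2)] that(3)] by (simp add: act_def del: KM_simps(4))
  have h0: "h \<zero>\<^bsub>KM\<^esub> u v = \<zero>\<^bsub>M\<^esub>" if "v \<in> carrier M" for u v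
    using hom_zero[OF KM_module FM h] that by (simp add: End_ring_simps(4) del: KM_simps(2))
  define \<phi> where "\<phi> m = s \<odot>\<^bsub>M\<^esub> m 0" for m :: "nat \<Rightarrow> 'm"
  have N0: "0 < N" by (simp add: N_def)
  have \<phi>: "\<phi> \<in> module_homs E KM EM"
  proof (rule module_homsI)
    show "\<phi> (e \<odot>\<^bsub>KM\<^esub> m) = e \<odot>\<^bsub>EM\<^esub> \<phi> m" if "e \<in> carrier E" "m \<in> carrier KM" for e m
      using that N0 K_closed[of m 0] hom_smult[OF E_hom[OF that(1)] elts(1), of "m 0"] by (simp add: \<phi>_def)
  qed (use N0 K_closed in \<open>auto simp: \<phi>_def M.smult_r_distr\<close>)
  let ?f = "f 0" and ?U = "{u. h (f 0) u \<noteq> \<zero>\<^bsub>E\<^esub>}"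
  have F: "h ?f \<in> carrier (free_module E (carrier T))" using hom_closed[OF h, of ?f] f_K by simp
  have U: "finite ?U" "?U \<subseteq> carrier T" using F by (simp_all add: free_module_carrier)
  have zero: "\<phi> (k (h ?f u \<odot>\<^bsub>T\<^esub> u)) = \<zero>\<^bsub>M\<^esub>" if u: "u \<in> carrier T" for u
  proof -
    have ku: "k u \<in> K" using hom_closed[OF k u] by simp
    have "s \<odot>\<^bsub>M\<^esub> h (f 0) u (k u 0) = \<zero>\<^bsub>M\<^esub>"
    proof (rule split_coordinate_zero[of "\<lambda>j. h (f j) u"])
      fix v assume v: "v \<in> carrier M"
      show "s \<odot>\<^bsub>M\<^esub> h (f j) u v = t \<odot>\<^bsub>M\<^esub> h (f (Suc j)) u v" for j
        using f_rel[of j] by (simp only: ha[OF _ f_K v, symmetric] elts)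
      show "t \<odot>\<^bsub>M\<^esub> h (f 0) u v = \<zero>\<^bsub>M\<^esub>"
        using f_first h0[OF v] by (simp only: ha[OF _ f_K v, symmetric] elts)
      show "s \<odot>\<^bsub>M\<^esub> h (f N) u v = \<zero>\<^bsub>M\<^esub>"
        using f_last h0[OF v] by (simp only: ha[OF _ f_K v, symmetric] elts)
      have "h (f 0) u v = \<theta> z (h (f 0) u v)"
        using hs[OF \<theta>_E[OF z] f_K v, of 0 u] f_\<theta>[of 0] by simp
      also have "\<dots> = \<alpha> (h (f 0) u v) \<odot>\<^bsub>M\<^esub> z" using E_closed[OF hE[OF f_K] v] by (simp add: \<theta>_def)
      finally show "h (f 0) u v = \<alpha> (h (f 0) u v) \<odot>\<^bsub>M\<^esub> z" .
    qed (use hE f_K ku in auto)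
    then show ?thesis using hom_smult[OF k hE[OF f_K] u] N0 by (simp add: \<phi>_def)
  qed
  have \<phi>k: "(\<lambda>u. \<phi> (k u)) \<in> module_homs E T EM" by (rule hom_comp[OF k \<phi>])
  have "norm_elt \<odot>\<^bsub>M\<^esub> z = \<phi> ?f" using N0 by (simp add: \<phi>_def f_def z_simps)
  also have "\<dots> = \<phi> (k (\<Oplus>\<^bsub>T\<^esub>u\<in>?U. h ?f u \<odot>\<^bsub>T\<^esub> u))"
    using split[OF f_K, of 0] by (simp add: free_eval_def)
  also have "\<dots> = (\<Oplus>\<^bsub>EM\<^esub>u\<in>?U. \<phi> (k (h ?f u \<odot>\<^bsub>T\<^esub> u)))"
    by (rule hom_finsum[OF T EM_module \<phi>k U(1)]) (use U(2) hE f_K in auto)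
  also have "\<dots> = (\<Oplus>\<^bsub>EM\<^esub>u\<in>?U. \<zero>\<^bsub>EM\<^esub>)"
  proof -
    interpret EM: left_module E EM by (rule EM_module)
    show ?thesis by (rule EM.M.finsum_cong') (use zero U(2) in auto)
  qed
  also have "\<dots> = \<zero>\<^bsub>M\<^esub>"
  proof -
    interpret EM: left_module E EM by (rule EM_module)
    show ?thesis using EM.M.finsum_zero by simp
  qed
  finally show False using nz by simp
qed

end

section \<open>Global dimension greater than 2\<close>

context free_direction
begin

text \<open>An endomorphism is determined by its values on the finite generating set S. This makes
  free E-modules on subsets of \<open>'m\<close> available as test modules.\<close>

lemma ex_inj_E:
  assumes inf: "infinite (UNIV :: 'm set)"
  shows "\<exists>c :: ('m \<Rightarrow> 'm) \<Rightarrow> 'm. inj_on c (carrier E)"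
proof -
  interpret M: left_module A M by (rule M)
  obtain J :: "('m \<Rightarrow> 'm) \<Rightarrow> 'm" where J: "inj_on J (\<Pi>\<^sub>E v\<in>S. UNIV)" using ex_inj_pi[OF inf S(1)] by blast
  have "inj_on (\<lambda>e. J (restrict e S)) (carrier E)"
  proof (rule inj_onI)
    fix e e' assume e: "e \<in> carrier E" "e' \<in> carrier E" and "J (restrict e S) = J (restrict e' S)"
    then have eq: "restrict e S = restrict e' S" using inj_onD[OF J, of "restrict e S" "restrict e' S"] by simp
    define H where "H = {v \<in> carrier M. e v = e' v}"
    have "submodule H A M"
      by (rule M.submoduleI_lmod)
        (auto simp: H_def hom_add[OF E_hom[OF e(1)]] hom_add[OF E_hom[OF e(2)]] hom_smult[OF E_hom[OF e(1)]]
          hom_smult[OF E_hom[OF e(2)]] hom_zero[OF M M E_hom[OF e(1)]] hom_zero[OF M M E_hom[OF e(2)]])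
    moreover have "S \<subseteq> H"
    proof
      fix v assume "v \<in> S"
      then show "v \<in> H" using fun_cong[OF eq, of v] S(2) by (auto simp: H_def)
    qed
    ultimately have "H = carrier M" by (rule S(3))
    then show "e = e'" by (intro End_ring_eqI[OF e]) (auto simp: H_def)
  qed
  then show ?thesis by blast
qed

theorem gl_dim_End_gt_2:
  assumes inf: "infinite (UNIV :: 'm set)"
  shows "\<not> gl_dim TYPE('m) E \<le> 2"
proof
  assume gd: "gl_dim TYPE('m) E \<le> 2"
  interpret M: left_module A M by (rule M)
  let ?I = "{..<N}" and ?L = "{..<N - 1}"
  let ?P1 = "pi_module ?I EM" and ?P0 = "pi_module ?L EM"
  note P1 = left_module_pi[OF EM_module, of ?I] and P0 = left_module_pi[OF EM_module, of ?L]
  obtain j1 :: "(nat \<Rightarrow> 'm) \<Rightarrow> 'm" where j1: "inj_on j1 (carrier ?P1)"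
    using ex_inj_pi[OF inf finite_lessThan] by auto
  obtain j0 :: "(nat \<Rightarrow> 'm) \<Rightarrow> 'm" where j0: "inj_on j0 (carrier ?P0)"
    using ex_inj_pi[OF inf finite_lessThan] by auto
  let ?T1 = "transport j1 ?P1" and ?T0 = "transport j0 ?P0"
  have T1: "projective E ?T1" "left_module E ?T1"
    using projective_transport[OF P1 lifting_pi[OF EM_module lifting_EM finite_lessThan] j1]
      left_module_transport[OF P1 j1] .
  have T0: "projective E ?T0" "left_module E ?T0"
    using projective_transport[OF P0 lifting_pi[OF EM_module lifting_EM finite_lessThan] j0]
      left_module_transport[OF P0 j0] .
  let ?k = "the_inv_into (carrier ?P1) j1"
  note k = transport_inv_hom[OF P1 j1]
  \<comment> \<open>In characteristic 2 the sum is the difference, so the kernel is K.\<close>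
  define D where "D m = (\<lambda>l\<in>?L. s \<odot>\<^bsub>M\<^esub> m (Suc l) \<oplus>\<^bsub>M\<^esub> t \<odot>\<^bsub>M\<^esub> m l)" for m :: "nat \<Rightarrow> 'm"
  have mc: "m l \<in> carrier M" if "m \<in> carrier ?P1" "l < N" for m l using that by auto
  have D: "D \<in> module_homs E ?P1 ?P0"
  proof (rule module_homsI)
    show "D m \<in> carrier ?P0" if "m \<in> carrier ?P1" for m
      using mc[OF that] by (auto simp: D_def)
    show "D (m \<oplus>\<^bsub>?P1\<^esub> m') = D m \<oplus>\<^bsub>?P0\<^esub> D m'" if m: "m \<in> carrier ?P1" "m' \<in> carrier ?P1" for m m'
      using mc[OF m(1)] mc[OF m(2)] by (auto simp: D_def M.smult_r_distr M.M.a_ac intro!: restrict_ext)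
    show "D (e \<odot>\<^bsub>?P1\<^esub> m) = e \<odot>\<^bsub>?P0\<^esub> D m" if e: "e \<in> carrier E" and m: "m \<in> carrier ?P1" for e m
      using mc[OF m] by (auto simp: D_def hom_add[OF E_hom[OF e]] hom_smult[OF E_hom[OF e]] intro!: restrict_ext)
  qed
  have D_zero: "D m = \<zero>\<^bsub>?P0\<^esub> \<longleftrightarrow> m \<in> K" if m: "m \<in> carrier ?P1" for m
  proof -
    have eq: "u \<oplus>\<^bsub>M\<^esub> v = \<zero>\<^bsub>M\<^esub> \<longleftrightarrow> u = v" if "u \<in> carrier M" "v \<in> carrier M" for u v
    proof
      assume "u \<oplus>\<^bsub>M\<^esub> v = \<zero>\<^bsub>M\<^esub>"
      then have "(u \<oplus>\<^bsub>M\<^esub> v) \<oplus>\<^bsub>M\<^esub> v = v" using that by simp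
      then show "u = v" using that by (simp add: M.M.a_assoc mod_two_zero[OF M])
    qed (use that mod_two_zero[OF M] in simp)
    have "D m = \<zero>\<^bsub>?P0\<^esub> \<longleftrightarrow> (\<forall>l<N - 1. s \<odot>\<^bsub>M\<^esub> m (Suc l) \<oplus>\<^bsub>M\<^esub> t \<odot>\<^bsub>M\<^esub> m l = \<zero>\<^bsub>M\<^esub>)"
      by (auto simp: D_def fun_eq_iff restrict_def)
    also have "\<dots> \<longleftrightarrow> (\<forall>l<N - 1. s \<odot>\<^bsub>M\<^esub> m (Suc l) = t \<odot>\<^bsub>M\<^esub> m l)"
      using mc[OF m] by (auto simp: eq)
    also have "\<dots> \<longleftrightarrow> m \<in> K" using m by (auto simp: K_def less_diff_conv)
    finally show ?thesis .
  qed
  let ?d = "\<lambda>u. j0 (D (?k u))"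
  have d: "?d \<in> module_homs E ?T1 ?T0" by (rule hom_comp[OF hom_comp[OF k D] transport_hom[OF j0]])
  \<comment> \<open>C is the cokernel of the map D, so the kernel of D is its second syzygy.\<close>
  obtain C :: "('m \<Rightarrow> 'm, 'm) module" and \<rho> where C: "left_module E C" "\<rho> \<in> module_homs E ?T0 C"
    "\<rho> ` carrier ?T0 = carrier C" "{x \<in> carrier ?T0. \<rho> x = \<zero>\<^bsub>C\<^esub>} = ?d ` carrier ?T1"
    by (rule ex_quotient[OF T0(2) submodule_image[OF T1(2) T0(2) d]])
  have "proj_dim E C \<le> gl_dim TYPE('m) E"
    unfolding gl_dim_def using C(1) by (intro Sup_upper) blast
  then have pd: "proj_dim E C \<le> 2" using gd by (rule order_trans)
  let ?Ker = "{u \<in> carrier ?T1. ?d u = \<zero>\<^bsub>?T0\<^esub>}"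
  let ?Q = "?T1\<lparr>carrier := ?Ker\<rparr>"
  have lT: "lifting TYPE('m) E ?Q" by (rule syzygy_lifting[OF pd C(1) T0(1) T1(1) d C(2-4)])
  have T: "left_module E ?Q"
    by (rule left_module.left_module_submodule[OF T1(2) submodule_kernel[OF T1(2) T0(2) d]])
  have kK: "?k u \<in> K" if u: "u \<in> ?Ker" for u
  proof -
    have ku: "?k u \<in> carrier ?P1" using hom_closed[OF k] u by blast
    have "j0 (D (?k u)) = j0 \<zero>\<^bsub>?P0\<^esub>" using u unfolding transport_simps(2)[OF j0] by blast
    moreover have "D (?k u) \<in> carrier ?P0" "\<zero>\<^bsub>?P0\<^esub> \<in> carrier ?P0" using hom_closed[OF D ku] by auto
    ultimately have "D (?k u) = \<zero>\<^bsub>?P0\<^esub>" using inj_onD[OF j0] by blast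
    then show ?thesis using D_zero[OF ku] by blast
  qed
  have kT: "?k \<in> module_homs E ?Q KM"
    unfolding KM_def by (rule hom_restrict_codomain[OF hom_restrict_domain[OF k]]) (use kK in auto)
  have KP: "m \<in> carrier ?P1" if "m \<in> K" for m using that by (auto simp: K_def)
  have jk: "?k (j1 m) = m" if "m \<in> carrier ?P1" for m by (rule the_inv_into_f_f[OF j1 that])
  have jT: "j1 \<in> module_homs E KM ?Q"
    unfolding KM_def
  proof (rule hom_restrict_codomain[OF hom_restrict_domain[OF transport_hom[OF j1]]])
    show "K \<subseteq> carrier ?P1" using KP by blast
    have "j1 m \<in> ?Ker" if m: "m \<in> K" for m
    proof -
      have "D m = \<zero>\<^bsub>?P0\<^esub>" using D_zero[OF KP[OF m]] m by blast
      then have "?d (j1 m) = \<zero>\<^bsub>?T0\<^esub>" by (simp only: jk[OF KP[OF m]] transport_simps(2)[OF j0])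
      moreover have "j1 m \<in> carrier ?T1" using KP[OF m] by (simp only: transport_simps(1)[OF j1] imageI)
      ultimately show ?thesis by blast
    qed
    then show "j1 ` carrier (?P1\<lparr>carrier := K\<rparr>) \<subseteq> ?Ker" by auto
  qed
  let ?F = "free_module E (carrier ?Q)"
  note F = free_module_module[OF E_ring, of "carrier ?Q"]
  \<comment> \<open>The free cover of the kernel is encoded in \<open>'m\<close>, so that the
    lifting property of the kernel can be applied to it.\<close>
  obtain c :: "('m \<Rightarrow> 'm) \<Rightarrow> 'm" where c: "inj_on c (carrier E)" using ex_inj_E[OF inf] by blast
  obtain jF :: "('m \<Rightarrow> 'm \<Rightarrow> 'm) \<Rightarrow> 'm" where jF: "inj_on jF (carrier ?F)"
    using ex_inj_free_module[OF inf c] by blast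
  let ?kF = "the_inv_into (carrier ?F) jF" and ?F' = "transport jF ?F"
  note kF = transport_inv_hom[OF F jF] and F' = left_module_transport[OF F jF]
  have g: "(\<lambda>u. free_eval E ?Q (?kF u)) \<in> module_homs E ?F' ?Q"
    by (rule hom_comp[OF kF free_eval_hom(1)[OF T]])
  have "(\<lambda>u. free_eval E ?Q (?kF u)) ` carrier ?F' = free_eval E ?Q ` (?kF ` carrier ?F')"
    by (simp only: image_image)
  also have "?kF ` carrier ?F' = carrier ?F"
    using bij_betw_imp_surj_on[OF bij_betw_the_inv_into[OF transport_bij[OF jF]]] .
  also have "free_eval E ?Q ` carrier ?F = carrier ?Q" by (rule free_eval_hom(2)[OF T])
  finally have surj: "(\<lambda>u. free_eval E ?Q (?kF u)) ` carrier ?F' = carrier ?Q" .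
  have id: "(\<lambda>x. x) \<in> module_homs E ?Q ?Q" by (rule module_homsI) auto
  obtain h where h: "h \<in> module_homs E ?Q ?F'" "\<forall>u\<in>carrier ?Q. free_eval E ?Q (?kF (h u)) = u"
    by (rule bexE[OF liftingD[OF lT F' T g id surj]])
  show False
  proof (rule KM_not_split[OF T kT hom_comp[OF jT hom_comp[OF h(1) kF]]])
    fix m assume m: "m \<in> K"
    have "j1 m \<in> carrier ?Q" by (rule hom_closed[OF jT]) (use m in simp)
    then have "free_eval E ?Q (?kF (h (j1 m))) = j1 m" by (rule bspec[OF h(2)])
    then show "?k (free_eval E ?Q (?kF (h (j1 m)))) = m" by (simp only: jk[OF KP[OF m]])
  qed
qed

end

text \<open>The copy of the regular module in \<open>'m\<close> is projective and indecomposable, so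
  it occurs in M. The image of 1 serves as z, and \<open>free_retract\<close> gives
  \<alpha>.\<close>

theorem (in klein_witness) gl_dim_End_generator_cogenerator:
  fixes M :: "('a \<Rightarrow> 'c, 'm) module"
  assumes inf: "infinite (UNIV :: 'm set)" and \<iota>: "inj (\<iota> :: 'c \<Rightarrow> 'm)"
    and gc: "generator_cogenerator A M"
  shows "\<not> gl_dim TYPE('m) (End_ring A M) \<le> 2"
proof -
  have M: "left_module A M" using gc by (simp add: generator_cogenerator_def)
  interpret M: left_module A M by (rule M)
  obtain J :: "('a \<Rightarrow> 'm) \<Rightarrow> 'm" where J: "inj_on J (\<Pi>\<^sub>E g\<in>carrier G. UNIV)" using ex_inj_pi[OF inf fin] by blast
  define j where "j a = J (\<lambda>g\<in>carrier G. \<iota> (a g))" for a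
  have j: "inj_on j (carrier reg)"
  proof (rule inj_onI)
    fix a b assume ab: "a \<in> carrier reg" "b \<in> carrier reg" "j a = j b"
    then have eq: "(\<lambda>g\<in>carrier G. \<iota> (a g)) = (\<lambda>g\<in>carrier G. \<iota> (b g))"
      unfolding j_def by (intro inj_onD[OF J]) auto
    show "a = b"
    proof
      fix g show "a g = b g"
      proof (cases "g \<in> carrier G")
        case True
        then show ?thesis using fun_cong[OF eq, of g] injD[OF \<iota>] by simp
      next
        case False
        then show ?thesis using ab(1,2) by (simp add: A_carrier)
      qed
    qed
  qed
  let ?R = "transport j reg"
  have "projective A ?R" by (rule projective_transport[OF reg_module reg_lifting j])
  moreover have "indecomposable A ?R"
    by (rule indecomposable_iso[OF reg_module left_module_transport[OF reg_module j] transport_hom[OF j]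
          transport_bij[OF j] reg_indecomposable])
  ultimately have "occurs_as_summand A ?R M" using gc by (simp add: generator_cogenerator_def)
  then obtain U V where UV: "is_direct_sum A M U V" and iso: "module_iso A ?R (M\<lparr>carrier := U\<rparr>)"
    by (auto simp: occurs_as_summand_def)
  have U: "submodule U A M" using UV by (simp add: is_direct_sum_def)
  obtain f where f: "f \<in> module_homs A ?R (M\<lparr>carrier := U\<rparr>)" "bij_betw f (carrier ?R) U"
    using iso by (auto simp: module_iso_def)
  have fj: "(\<lambda>a. f (j a)) \<in> module_homs A reg M"
    by (rule hom_extend_codomain[OF hom_comp[OF transport_hom[OF j] f(1)] M.submoduleD(1)[OF U]])
  have inj: "inj_on (\<lambda>a. f (j a)) (carrier reg)"
    using comp_inj_on[OF j, of f] bij_betw_imp_inj_on[OF f(2)] by (simp add: transport_simps(1)[OF j] comp_def)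
  let ?z = "f (j \<one>\<^bsub>A\<^esub>)"
  have z: "?z \<in> carrier M" using hom_closed[OF fj, of "\<one>\<^bsub>A\<^esub>"] by simp
  have nz: "norm_elt \<odot>\<^bsub>M\<^esub> ?z \<noteq> \<zero>\<^bsub>M\<^esub>"
  proof
    assume "norm_elt \<odot>\<^bsub>M\<^esub> ?z = \<zero>\<^bsub>M\<^esub>"
    then have "f (j norm_elt) = f (j \<zero>\<^bsub>A\<^esub>)"
      using hom_smult[OF fj norm_closed, of "\<one>\<^bsub>A\<^esub>"] hom_zero[OF reg_module M fj] by simp
    then have "norm_elt = \<zero>\<^bsub>A\<^esub>" using inj_onD[OF inj, of norm_elt "\<zero>\<^bsub>A\<^esub>"] by simp
    then have "norm_elt \<one> = \<zero>\<^bsub>A\<^esub> \<one>" by simp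
    then show False by (simp add: norm_elt_def A_zero_apply)
  qed
  obtain \<alpha> where \<alpha>: "\<alpha> \<in> module_homs A M reg" "\<alpha> ?z = \<one>\<^bsub>A\<^esub>" by (rule free_retract[OF M z nz])
  obtain S where S: "finite S" "S \<subseteq> carrier M" "\<forall>H. submodule H A M \<and> S \<subseteq> H \<longrightarrow> H = carrier M"
    using gc by (auto simp: generator_cogenerator_def fin_gen_def)
  interpret free_direction G n A s t p r M ?z \<alpha> S
    by unfold_locales (use M z nz \<alpha> S in auto)
  show ?thesis by (rule gl_dim_End_gt_2[OF inf])
qed

section \<open>The group \<open>C\<^sub>2 \<times> C\<^sub>q\<close> with \<open>q = 2 ^ n\<close>\<close>

locale klein_cyclic =
  fixes n :: nat and G :: "(int \<times> int) monoid" and A :: "(int \<times> int \<Rightarrow> 'k::field) ring"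
  assumes n_pos: "1 \<le> n" and char_2: "CHAR('k) = 2"
    and G_eq: "G = integer_mod_group 2 \<times>\<times> integer_mod_group (2 ^ n)" and A_eq: "A = group_algebra G"
begin

abbreviation q :: nat where "q \<equiv> 2 ^ n"

lemma G_ops:
  "carrier G = {0..<2} \<times> {0..<int q}" "\<one>\<^bsub>G\<^esub> = (0, 0)"
  "(a, b) \<otimes>\<^bsub>G\<^esub> (c, d) = ((a + c) mod 2, (b + d) mod int q)"
  by (simp_all add: G_eq carrier_integer_mod_group)

lemma G_pow: "(a, b) [^]\<^bsub>G\<^esub> (m :: nat) = (a [^]\<^bsub>integer_mod_group 2\<^esub> m, b [^]\<^bsub>integer_mod_group q\<^esub> m)"
  by (induct m) (simp_all add: G_eq nat_pow_def)

lemma G_comm: "comm_group G"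
proof -
  interpret H: group G unfolding G_eq by (intro DirProd_group) simp_all
  show ?thesis by (rule H.group_comm_groupI) (auto simp: G_ops add.commute)
qed

sublocale two_group_algebra G n A
proof (rule two_group_algebra.intro[OF G_comm], unfold_locales)
  show "finite (carrier G)" by (simp add: G_ops)
  show "g [^]\<^bsub>G\<^esub> q = \<one>\<^bsub>G\<^esub>" if g: "g \<in> carrier G" for g
  proof -
    obtain m where "n = Suc m" using n_pos by (cases n) auto
    then show ?thesis by (cases g) (simp add: G_pow G_ops)
  qed
qed (fact char_2 A_eq)+

sublocale strings q by unfold_locales simp

lemma G_inv: "(a, b) \<in> carrier G \<Longrightarrow> inv\<^bsub>G\<^esub> (a, b) = (- a mod 2, - b mod int q)"
  by (rule G.inv_equality) (auto simp: G_ops mod_add_left_eq)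

text \<open>With generators g and h of the two factors, s = 1 + g is x and t = 1 + h is y. The sum p
  of all powers of h is (1 + h)^(q-1), that is y^(q-1). The sum w of the odd powers is h y^(q-2); it
  satisfies y w = y^(q-1) just as y^(q-2) does, and x w serves as the fourth witness.\<close>

definition s_elt :: "int \<times> int \<Rightarrow> 'k" where "s_elt = \<one>\<^bsub>A\<^esub> \<oplus>\<^bsub>A\<^esub> sgl (1, 0) 1"
definition t_elt :: "int \<times> int \<Rightarrow> 'k" where "t_elt = \<one>\<^bsub>A\<^esub> \<oplus>\<^bsub>A\<^esub> sgl (0, 1) 1"
definition p_elt :: "int \<times> int \<Rightarrow> 'k" where "p_elt = (\<lambda>g. if g \<in> carrier G \<and> fst g = 0 then 1 else 0)"
definition w_elt :: "int \<times> int \<Rightarrow> 'k" where "w_elt = (\<lambda>g. if g \<in> carrier G \<and> fst g = 0 \<and> odd (snd g) then 1 else 0)"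

lemma q_ge_2: "2 \<le> q" using n_pos power_increasing[of 1 n "2 :: nat"] by simp

lemma q_even: "even (int q)" using n_pos by simp

lemma gens: "(1, 0) \<in> carrier G" "(0, 1) \<in> carrier G"
proof -
  have "1 < int q" using q_ge_2 by linarith
  then show "(1, 0) \<in> carrier G" "(0, 1) \<in> carrier G" by (simp_all add: G_ops)
qed

lemma elts_A: "s_elt \<in> carrier A" "t_elt \<in> carrier A" "p_elt \<in> carrier A" "w_elt \<in> carrier A"
  using gens by (auto simp: s_elt_def t_elt_def p_elt_def w_elt_def A_carrier[of "\<lambda>g. if _ g then _ else _"])

lemma s_mult:
  assumes "f \<in> carrier A" "(a, b) \<in> carrier G"
  shows "(s_elt \<otimes>\<^bsub>A\<^esub> f) (a, b) = f (a, b) + f ((a + 1) mod 2, b)"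
proof -
  have "(- 1 mod 2 + a) mod 2 = (a + 1) mod (2 :: int)" by presburger
  then show ?thesis
    using assms gens sgl_mult_apply[OF gens(1) assms(2), of 1 f]
    by (simp add: s_elt_def A.l_distr A_ops(1) G_inv G_ops)
qed

lemma t_mult:
  assumes "f \<in> carrier A" "(a, b) \<in> carrier G"
  shows "(t_elt \<otimes>\<^bsub>A\<^esub> f) (a, b) = f (a, b) + f (a, (b - 1) mod int q)"
proof -
  have "(- 1 mod int q + b) mod int q = (b - 1) mod int q" by (simp add: mod_add_left_eq)
  then show ?thesis
    using assms gens sgl_mult_apply[OF gens(2) assms(2), of 1 f]
    by (simp add: t_elt_def A.l_distr A_ops(1) G_inv G_ops)
qed

lemma A_eqI:
  assumes "f \<in> carrier A" "f' \<in> carrier A" "\<And>a b. (a, b) \<in> carrier G \<Longrightarrow> f (a, b) = f' (a, b)"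
  shows "f = f'"
proof
  fix g show "f g = f' g" using assms by (cases g, cases "g \<in> carrier G") (auto simp: A_carrier)
qed

lemma eq_if_add_zero: "u + v = 0 \<Longrightarrow> u = (v :: 'k)"
  using two_zero[of v] by (metis add_right_cancel)

lemma pw_apply: "(a, b) \<in> carrier G \<Longrightarrow> p_elt (a, b) = (if a = 0 then 1 else 0)"
  "(a, b) \<in> carrier G \<Longrightarrow> w_elt (a, b) = (if a = 0 \<and> odd b then 1 else 0)"
  by (auto simp: p_elt_def w_elt_def)

lemma t_p_elt: "t_elt \<otimes>\<^bsub>A\<^esub> p_elt = \<zero>\<^bsub>A\<^esub>"
proof (rule A_eqI)
  fix a b assume ab: "(a, b) \<in> carrier G"
  have "(a, (b - 1) mod int q) \<in> carrier G" using ab by (simp add: G_ops)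
  then show "(t_elt \<otimes>\<^bsub>A\<^esub> p_elt) (a, b) = \<zero>\<^bsub>A\<^esub> (a, b)"
    using ab by (simp add: t_mult elts_A pw_apply A_zero_apply two_zero)
qed (simp_all add: elts_A)

lemma s_p_elt: "s_elt \<otimes>\<^bsub>A\<^esub> p_elt = norm_elt"
proof (rule A_eqI)
  fix a b assume ab: "(a, b) \<in> carrier G"
  then have "a = 0 \<or> a = 1" "((a + 1) mod 2, b) \<in> carrier G" by (auto simp: G_ops)
  then show "(s_elt \<otimes>\<^bsub>A\<^esub> p_elt) (a, b) = norm_elt (a, b)"
    using ab by (auto simp: s_mult elts_A pw_apply norm_elt_def)
qed (simp_all add: elts_A)

lemma t_w_elt: "t_elt \<otimes>\<^bsub>A\<^esub> w_elt = p_elt"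
proof (rule A_eqI)
  fix a b assume ab: "(a, b) \<in> carrier G"
  have "odd ((b - 1) mod int q) \<longleftrightarrow> even b" using q_even by (simp add: dvd_mod_iff)
  moreover have "(a, (b - 1) mod int q) \<in> carrier G" using ab by (simp add: G_ops)
  ultimately show "(t_elt \<otimes>\<^bsub>A\<^esub> w_elt) (a, b) = p_elt (a, b)"
    using ab by (auto simp: t_mult elts_A pw_apply)
qed (simp_all add: elts_A)

lemma s_s_elt: "s_elt \<otimes>\<^bsub>A\<^esub> s_elt = \<zero>\<^bsub>A\<^esub>"
proof -
  have "s_elt \<otimes>\<^bsub>A\<^esub> s_elt = s_elt \<oplus>\<^bsub>A\<^esub> (sgl (1, 0) 1 \<oplus>\<^bsub>A\<^esub> sgl (1, 0) 1 \<otimes>\<^bsub>A\<^esub> sgl (1, 0) 1)"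
    using gens unfolding s_elt_def by (simp add: A.l_distr A.r_distr)
  also have "sgl (1, 0) 1 \<otimes>\<^bsub>A\<^esub> sgl (1, 0) 1 = \<one>\<^bsub>A\<^esub>"
    using gens by (simp add: sgl_mult sgl_one G_ops)
  finally show ?thesis using gens by (simp add: s_elt_def A.a_comm A_two_zero)
qed

sublocale klein_witness G n A s_elt t_elt p_elt "s_elt \<otimes>\<^bsub>A\<^esub> w_elt"
proof
  show "s_elt \<otimes>\<^bsub>A\<^esub> (s_elt \<otimes>\<^bsub>A\<^esub> w_elt) = \<zero>\<^bsub>A\<^esub>" by (simp add: A.m_assoc[symmetric] s_s_elt elts_A)
  show "t_elt \<otimes>\<^bsub>A\<^esub> (s_elt \<otimes>\<^bsub>A\<^esub> w_elt) = norm_elt"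
    using A.m_lcomm[OF elts_A(2,1,4)] by (simp only: t_w_elt s_p_elt)
next
  fix b assume b: "b \<in> carrier A" and s: "s_elt \<otimes>\<^bsub>A\<^esub> b = \<zero>\<^bsub>A\<^esub>" and t: "t_elt \<otimes>\<^bsub>A\<^esub> b = \<zero>\<^bsub>A\<^esub>"
  \<comment> \<open>s b = 0 says that b is invariant under g, and t b = 0 that it is invariant under
    h. So b is constant on the group, a multiple of the norm element.\<close>
  have s1: "b (u, v) = b ((u + 1) mod 2, v)" if "(u, v) \<in> carrier G" for u v
    by (rule eq_if_add_zero) (use s_mult[OF b that] s in \<open>simp add: A_zero_apply\<close>)
  have t1: "b (u, v) = b (u, (v - 1) mod int q)" if "(u, v) \<in> carrier G" for u v
    by (rule eq_if_add_zero) (use t_mult[OF b that] t in \<open>simp add: A_zero_apply\<close>)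
  have z: "b (0, int j) = b (0, 0)" if "j < q" for j
    using that
  proof (induct j)
    case (Suc j)
    have "int (Suc j) < int q" using Suc(2) by (simp only: of_nat_less_iff)
    moreover from this have "(int (Suc j) - 1) mod int q = int j" by (subst mod_pos_pos_trivial) linarith+
    ultimately have "(0, int (Suc j)) \<in> carrier G" "(int (Suc j) - 1) mod int q = int j" by (simp_all add: G_ops)
    then show ?case using t1[of 0 "int (Suc j)"] Suc by simp
  qed simp
  have const: "b (u, v) = b (0, 0)" if uv: "(u, v) \<in> carrier G" for u v
  proof -
    have v: "b (0, v) = b (0, 0)" using z[of "nat v"] uv by (auto simp: G_ops nat_less_iff)
    have "u = 0 \<or> u = 1" using uv by (auto simp: G_ops)
    then show ?thesis using s1[OF uv] v by auto
  qed
  show "b = sgl \<one>\<^bsub>G\<^esub> (b \<one>\<^bsub>G\<^esub>) \<otimes>\<^bsub>A\<^esub> norm_elt"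
  proof (rule A_eqI)
    fix u v assume uv: "(u, v) \<in> carrier G"
    then show "b (u, v) = (sgl \<one>\<^bsub>G\<^esub> (b \<one>\<^bsub>G\<^esub>) \<otimes>\<^bsub>A\<^esub> norm_elt) (u, v)"
      using const[OF uv] sgl_mult_apply[OF G.one_closed uv, of "b \<one>\<^bsub>G\<^esub>" norm_elt]
      by (simp add: norm_elt_def) (simp add: G_ops)
  qed (use b in simp_all)
qed (simp_all add: elts_A s_p_elt s_s_elt t_p_elt)

end

section \<open>A module whose endomorphism ring has global dimension at most 3\<close>

lemma funpow_commute: "(\<And>m. F (K m) = K (F m)) \<Longrightarrow> (F ^^ a) ((K ^^ b) m) = (K ^^ b) ((F ^^ a) m)"
proof -
  assume c: "\<And>m. F (K m) = K (F m)"
  have *: "F ((K ^^ b) m) = (K ^^ b) (F m)" for m by (induct b) (simp_all add: c)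
  show ?thesis by (induct a) (simp_all add: *)
qed

context klein_cyclic
begin

text \<open>\<open>V\<close> is the dual of the sum of ideals with basis \<open>T\<close>, so \<open>x\<close> and \<open>y\<close> lower the index.\<close>

definition V :: "(idx \<Rightarrow> 'k) set" where "V = {m. \<forall>t. t \<notin> T \<longrightarrow> m t = 0}"

definition colY :: "(idx \<Rightarrow> 'k) \<Rightarrow> idx \<Rightarrow> 'k"
  where "colY m = (\<lambda>(c, i, j). if (c, i, j) \<in> T \<and> Suc j < q then m (c, i, Suc j) else 0)"

definition colX :: "(idx \<Rightarrow> 'k) \<Rightarrow> idx \<Rightarrow> 'k"
  where "colX m = (\<lambda>(c, i, j). if (c, i, j) \<in> T \<and> c = KU then m (KV, i, j) else 0)"

lemma colY_simp: "colY m (c, i, j) = (if (c, i, j) \<in> T \<and> Suc j < q then m (c, i, Suc j) else 0)"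
  by (simp add: colY_def)

lemma colX_simp: "colX m (c, i, j) = (if (c, i, j) \<in> T \<and> c = KU then m (KV, i, j) else 0)"
  by (simp add: colX_def)

lemma colY_eta: "m \<in> V \<Longrightarrow> t \<in> T \<Longrightarrow> colY m t = m (eta t)"
  by (cases t) (auto simp: colY_simp V_def)

lemma colX_xi: "m \<in> V \<Longrightarrow> t \<in> T \<Longrightarrow> colX m t = m (xi t)"
  by (cases t) (auto simp: colX_simp V_def)

definition lin_op :: "((idx \<Rightarrow> 'k) \<Rightarrow> idx \<Rightarrow> 'k) \<Rightarrow> bool"
  where "lin_op F \<longleftrightarrow> (\<forall>m\<in>V. F m \<in> V \<and> (\<forall>m'\<in>V. F (m + m') = F m + F m') \<and> (\<forall>c. F (fscale c m) = fscale c (F m)))"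

lemma V_add: "m \<in> V \<Longrightarrow> m' \<in> V \<Longrightarrow> m + m' \<in> V" and V_scale: "m \<in> V \<Longrightarrow> fscale c m \<in> V" and V_zero: "0 \<in> V"
  by (auto simp: V_def fscale_def)

lemma lin_opD:
  assumes "lin_op F" "m \<in> V"
  shows "F m \<in> V" "m' \<in> V \<Longrightarrow> F (m + m') = F m + F m'" "F (fscale c m) = fscale c (F m)"
  using assms by (auto simp: lin_op_def)

lemma lin_op_comp: "lin_op F \<Longrightarrow> lin_op K \<Longrightarrow> lin_op (\<lambda>m. F (K m))"
  by (simp add: lin_op_def)

lemma lin_op_pow: "lin_op F \<Longrightarrow> lin_op (F ^^ a)"
  by (induct a) (simp_all add: lin_op_def)

text \<open>\<open>gX\<close> and \<open>gY\<close> are the actions 1 + x and 1 + y of the two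
  generators of the group.\<close>

definition gX :: "(idx \<Rightarrow> 'k) \<Rightarrow> idx \<Rightarrow> 'k" where "gX m = m + colX m"
definition gY :: "(idx \<Rightarrow> 'k) \<Rightarrow> idx \<Rightarrow> 'k" where "gY m = m + colY m"

lemma lin_op_gX: "lin_op gX"
  by (auto simp: lin_op_def gX_def V_def colX_def fscale_def fun_eq_iff algebra_simps)

lemma lin_op_gY: "lin_op gY"
  by (auto simp: lin_op_def gY_def V_def colY_def fscale_def fun_eq_iff algebra_simps)

lemma add_self: "m + m = (0 :: idx \<Rightarrow> 'k)" by (rule ext) (simp only: plus_fun_apply zero_fun_apply two_zero)

lemma gX_gX: "gX (gX m) = m"
proof -
  have "colX (m + colX m) = colX m" by (auto simp: colX_def fun_eq_iff)
  then show ?thesis by (simp add: gX_def add.assoc add_self)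
qed

lemma gX_gY: "gX (gY m) = gY (gX m)"
proof -
  have "colX (m + colY m) = colX m + colX (colY m)" "colY (m + colX m) = colY m + colY (colX m)"
    by (auto simp: colX_def colY_def fun_eq_iff)
  moreover have "colX (colY m) = colY (colX m)" by (auto simp: colX_def colY_def fun_eq_iff)
  ultimately show ?thesis by (simp add: gX_def gY_def ac_simps)
qed

lemma colY_pow: "(colY ^^ Suc l) m (c, i, j) = (if (c, i, j) \<in> T \<and> j + Suc l < q then m (c, i, j + Suc l) else 0)"
proof (induct l arbitrary: j)
  case (Suc l)
  show ?case unfolding funpow.simps(2)[of "Suc l"] o_apply colY_simp Suc by (cases c) auto
qed (auto simp: colY_simp)

lemma gY_pow: "(gY ^^ (2 ^ k)) m = m + (colY ^^ (2 ^ k)) m"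
proof (induct k arbitrary: m)
  case (Suc k)
  have add: "(colY ^^ l) (m + m') = (colY ^^ l) m + (colY ^^ l) m'" for l m m'
  proof (induct l)
    case (Suc l)
    have "colY (u + v) = colY u + colY v" for u v by (auto simp: colY_def fun_eq_iff)
    then show ?case by (simp only: funpow.simps o_apply Suc)
  qed simp
  let ?Y = "colY ^^ (2 ^ k)"
  have "(gY ^^ (2 ^ Suc k)) m = (m + ?Y m) + ?Y (m + ?Y m)"
    by (simp only: power_Suc mult_2 funpow_add o_apply Suc)
  also have "\<dots> = m + (?Y m + ?Y m) + ?Y (?Y m)" unfolding add by (simp only: add.assoc)
  also have "\<dots> = m + (colY ^^ (2 ^ Suc k)) m" by (simp only: power_Suc mult_2 funpow_add o_apply add_self add_0_right)
  finally show ?case .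
qed (simp add: gY_def)

lemma gY_q: "(gY ^^ q) m = m"
proof -
  obtain l where "q = Suc l" using q_pos by (metis gr0_implies_Suc)
  then have "(colY ^^ q) m = 0"
    using colY_pow[of l m] by (auto simp only: fun_eq_iff zero_fun_apply split_paired_all) simp
  then show ?thesis by (simp add: gY_pow)
qed

definition act :: "int \<times> int \<Rightarrow> (idx \<Rightarrow> 'k) \<Rightarrow> idx \<Rightarrow> 'k"
  where "act g m = (gX ^^ nat (fst g)) ((gY ^^ nat (snd g)) m)"

lemma lin_op_act: "lin_op (act g)"
  unfolding act_def[abs_def] by (rule lin_op_comp[OF lin_op_pow[OF lin_op_gX] lin_op_pow[OF lin_op_gY]])

text \<open>The generators commute, and reducing exponents modulo 2 and modulo q is harmless by
  \<open>gX_gX\<close> and \<open>gY_q\<close>.\<close>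

lemma act_mult:
  assumes "g \<in> carrier G" "h \<in> carrier G"
  shows "act (g \<otimes>\<^bsub>G\<^esub> h) m = act g (act h m)"
proof -
  obtain a b c d where gh: "g = (a, b)" "h = (c, d)" by (metis prod.exhaust)
  then have nn: "0 \<le> a" "0 \<le> b" "0 \<le> c" "0 \<le> d" using assms by (auto simp: G_ops)
  have X: "(gX ^^ (k mod 2)) u = (gX ^^ k) u" for k u
    by (rule funpow_mod_eq) (simp add: numeral_2_eq_2 gX_gX)
  have Y: "(gY ^^ (k mod q)) u = (gY ^^ k) u" for k u by (rule funpow_mod_eq) (rule gY_q)
  have "nat ((a + c) mod 2) = (nat a + nat c) mod 2" "nat ((b + d) mod int q) = (nat b + nat d) mod q"
    using nn by (simp_all add: nat_mod_distrib nat_add_distrib nat_power_eq)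
  then have "act (g \<otimes>\<^bsub>G\<^esub> h) m = (gX ^^ (nat a + nat c)) ((gY ^^ (nat b + nat d)) m)"
    unfolding act_def gh G_ops fst_conv snd_conv by (simp only: X Y)
  also have "\<dots> = (gX ^^ nat a) ((gX ^^ nat c) ((gY ^^ nat b) ((gY ^^ nat d) m)))"
    by (simp add: funpow_add)
  also have "\<dots> = act g (act h m)"
    unfolding act_def gh fst_conv snd_conv by (simp only: funpow_commute[of gX gY, OF gX_gY])
  finally show ?thesis .
qed

section \<open>The dual of D as a module over the group algebra\<close>

definition VM :: "(int \<times> int \<Rightarrow> 'k, idx \<Rightarrow> 'k) module"
  where "VM = \<lparr>carrier = V, monoid.mult = (+), one = 0, zero = 0, add = (+),
    smult = (\<lambda>a m t. \<Sum>g\<in>carrier G. a g * act g m t)\<rparr>"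

lemma VM_simps [simp]: "carrier VM = V" "\<zero>\<^bsub>VM\<^esub> = 0" "m \<oplus>\<^bsub>VM\<^esub> m' = m + m'"
  by (simp_all add: VM_def)

lemma VM_smult: "(a \<odot>\<^bsub>VM\<^esub> m) t = (\<Sum>g\<in>carrier G. a g * act g m t)"
  by (simp add: VM_def)

lemma VM_sgl: "h \<in> carrier G \<Longrightarrow> sgl h c \<odot>\<^bsub>VM\<^esub> m = fscale c (act h m)"
proof
  fix t assume h: "h \<in> carrier G"
  have "(\<Sum>g\<in>carrier G. sgl h c g * act g m t) = (\<Sum>g\<in>carrier G. if g = h then c * act h m t else 0)"
    by (rule sum.cong) (auto simp: sgl_def)
  then show "(sgl h c \<odot>\<^bsub>VM\<^esub> m) t = fscale c (act h m) t" using h fin by (simp add: VM_smult fscale_def)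
qed

lemma VM_module: "left_module A VM"
proof -
  have cl: "a \<odot>\<^bsub>VM\<^esub> m \<in> V" if "m \<in> V" for a m
    using lin_opD(1)[OF lin_op_act that] by (auto simp: V_def VM_smult)
  have la: "(a \<oplus>\<^bsub>A\<^esub> b) \<odot>\<^bsub>VM\<^esub> m = a \<odot>\<^bsub>VM\<^esub> m + b \<odot>\<^bsub>VM\<^esub> m" for a b m
    by (auto simp: VM_smult A_ops(1) distrib_right sum.distrib fun_eq_iff)
  have ra: "a \<odot>\<^bsub>VM\<^esub> (m + m') = a \<odot>\<^bsub>VM\<^esub> m + a \<odot>\<^bsub>VM\<^esub> m'" if "m \<in> V" "m' \<in> V" for a m m'
    by (auto simp: VM_smult lin_opD(2)[OF lin_op_act that] distrib_left sum.distrib fun_eq_iff)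
  have z: "\<zero>\<^bsub>A\<^esub> \<odot>\<^bsub>VM\<^esub> m = 0" for m by (auto simp: VM_smult A_zero_apply fun_eq_iff)
  have ss: "sgl h c \<otimes>\<^bsub>A\<^esub> b \<odot>\<^bsub>VM\<^esub> m = sgl h c \<odot>\<^bsub>VM\<^esub> (b \<odot>\<^bsub>VM\<^esub> m)"
    if h: "h \<in> carrier G" and b: "b \<in> carrier A" and m: "m \<in> V" for h c b m
    using b
  proof (induct b rule: A_induct)
    case zero
    have "act h 0 = 0" using lin_opD(3)[OF lin_op_act V_zero, of h 0] by (simp add: fscale_def zero_fun_def)
    then show ?case using h by (simp add: z VM_sgl fscale_def zero_fun_def)
  next
    case (add f u d)
    have "sgl h c \<otimes>\<^bsub>A\<^esub> sgl u d \<odot>\<^bsub>VM\<^esub> m = sgl h c \<odot>\<^bsub>VM\<^esub> (sgl u d \<odot>\<^bsub>VM\<^esub> m)"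
      using h add(2) lin_opD(3)[OF lin_op_act lin_opD(1)[OF lin_op_act m], of h d u]
      by (simp add: sgl_mult VM_sgl act_mult)
    moreover have "sgl h c \<otimes>\<^bsub>A\<^esub> (f \<oplus>\<^bsub>A\<^esub> sgl u d) = sgl h c \<otimes>\<^bsub>A\<^esub> f \<oplus>\<^bsub>A\<^esub> sgl h c \<otimes>\<^bsub>A\<^esub> sgl u d"
      using h add(1,2) by (simp add: A.r_distr)
    ultimately show ?case using add(3) by (simp only: la ra[OF cl[OF m] cl[OF m]])
  qed
  show ?thesis
  proof (rule left_moduleI)
    show "\<exists>m'\<in>carrier VM. m' \<oplus>\<^bsub>VM\<^esub> m = \<zero>\<^bsub>VM\<^esub>" if "m \<in> carrier VM" for m
      using that by (intro bexI[of _ m]) (auto simp: add_self)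
    show "a \<otimes>\<^bsub>A\<^esub> b \<odot>\<^bsub>VM\<^esub> m = a \<odot>\<^bsub>VM\<^esub> (b \<odot>\<^bsub>VM\<^esub> m)"
      if a: "a \<in> carrier A" and b: "b \<in> carrier A" and m: "m \<in> carrier VM" for a b m
      using a
    proof (induct a rule: A_induct)
      case zero
      show ?case using b by (simp add: z)
    next
      case (add f h c)
      then show ?case using b m by (simp add: A.l_distr la ss)
    qed
    show "\<one>\<^bsub>A\<^esub> \<odot>\<^bsub>VM\<^esub> m = m" for m
      unfolding sgl_one by (simp add: VM_sgl) (simp add: act_def G_ops fscale_def)
  qed (auto simp: A.ring_axioms cl la ra V_add V_zero ac_simps)
qed

text \<open>A linear map that commutes with x and y commutes with the generators 1 + x and 1 + y of
  the group, hence with the whole action.\<close>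

lemma VM_homI:
  assumes F: "lin_op F" and X: "\<And>m. m \<in> V \<Longrightarrow> F (colX m) = colX (F m)" and Y: "\<And>m. m \<in> V \<Longrightarrow> F (colY m) = colY (F m)"
  shows "F \<in> module_homs A VM VM"
proof (rule hom_criterion[OF VM_module VM_module])
  have cX: "colX m \<in> V" and cY: "colY m \<in> V" for m by (auto simp: V_def colX_def colY_def)
  have gX: "F (gX m) = gX (F m)" "gX m \<in> V" and gY: "F (gY m) = gY (F m)" "gY m \<in> V" if "m \<in> V" for m
    using that lin_opD(2)[OF F that] X[OF that] Y[OF that] V_add[OF that] by (simp_all add: gX_def gY_def cX cY)
  have pX: "F ((gX ^^ a) m) = (gX ^^ a) (F m) \<and> (gX ^^ a) m \<in> V" if "m \<in> V" for a m
    using that by (induct a) (simp_all add: gX)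
  have pY: "F ((gY ^^ a) m) = (gY ^^ a) (F m) \<and> (gY ^^ a) m \<in> V" if "m \<in> V" for a m
    using that by (induct a) (simp_all add: gY)
  show "F (sgl g c \<odot>\<^bsub>VM\<^esub> m) = sgl g c \<odot>\<^bsub>VM\<^esub> F m" if "g \<in> carrier G" "m \<in> carrier VM" for g c m
    using that pX pY lin_opD(3)[OF F lin_opD(1)[OF lin_op_act]] by (simp add: VM_sgl) (simp add: act_def)
qed (use lin_opD[OF F] in auto)

lemma VM_homD:
  assumes F: "F \<in> module_homs A VM VM"
  shows "lin_op F" "m \<in> V \<Longrightarrow> F (colX m) = colX (F m)" "m \<in> V \<Longrightarrow> F (colY m) = colY (F m)"
proof -
  have FV: "F m \<in> V" if "m \<in> V" for m using hom_closed[OF F, of m] that by simp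
  have Fa: "F (m + m') = F m + F m'" if "m \<in> V" "m' \<in> V" for m m' using hom_add[OF F, of m m'] that by simp
  have Fs: "F (fscale c (act g m)) = fscale c (act g (F m))" if "g \<in> carrier G" "m \<in> V" for g c m
    using hom_smult[OF F, of "sgl g c" m] that by (simp add: VM_sgl)
  have a0: "act (0, 0) m = m" and aX: "act (1, 0) m = gX m" and aY: "act (0, 1) m = gY m" for m by (simp_all add: act_def)
  have "(0, 0) \<in> carrier G" by (simp add: G_ops)
  then show "lin_op F" using FV Fa Fs[of "(0, 0)"] by (simp add: lin_op_def a0)
  have f1: "fscale 1 m = m" for m :: "idx \<Rightarrow> 'k" by (simp add: fscale_def)
  have cX: "colX m \<in> V" and cY: "colY m \<in> V" for m by (auto simp: V_def colX_def colY_def)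
  show "F (colX m) = colX (F m)" if "m \<in> V"
    using Fs[OF gens(1) that, of 1] Fa[OF that cX] by (simp add: f1 aX) (simp add: gX_def)
  show "F (colY m) = colY (F m)" if "m \<in> V"
    using Fs[OF gens(2) that, of 1] Fa[OF that cY] by (simp add: f1 aY) (simp add: gY_def)
qed

end

context klein_cyclic
begin

definition \<delta> :: "idx \<Rightarrow> idx \<Rightarrow> 'k" where "\<delta> t = (\<lambda>t'. if t' = t then 1 else 0)"

lemma \<delta>_V: "t \<in> T \<Longrightarrow> \<delta> t \<in> V"
  by (auto simp: \<delta>_def V_def)

lemma V_induct [consumes 1, case_names zero add]:
  assumes m: "m \<in> V" and z: "P 0"
    and a: "\<And>m' t. m' \<in> V \<Longrightarrow> t \<in> T \<Longrightarrow> P m' \<Longrightarrow> P (m' + fscale (m t) (\<delta> t))"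
  shows "P m"
proof -
  have "P (\<lambda>t. if t \<in> U then m t else 0)" if "finite U" "U \<subseteq> T" for U
    using that
  proof (induct U)
    case empty
    then show ?case using z by (simp add: zero_fun_def)
  next
    case (insert u U)
    have "(\<lambda>t. if t \<in> insert u U then m t else 0) = (\<lambda>t. if t \<in> U then m t else 0) + fscale (m u) (\<delta> u)"
      using insert(2) by (auto simp: fun_eq_iff fscale_def \<delta>_def)
    moreover have "(\<lambda>t. if t \<in> U then m t else 0) \<in> V" using m by (simp add: V_def)
    ultimately show ?case using a insert by simp
  qed
  from this[OF finite_T order_refl] have "P (\<lambda>t. if t \<in> T then m t else 0)" .
  moreover have "(\<lambda>t. if t \<in> T then m t else 0) = m" using m by (auto simp: V_def)
  ultimately show ?thesis by simp
qed

lemma lin_op_expand: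
  assumes F: "lin_op F" and m: "m \<in> V"
  shows "F m t = (\<Sum>t'\<in>T. F (\<delta> t') t * m t')"
  using m
proof (induct rule: V_induct)
  case zero
  have "F 0 = 0" using lin_opD(3)[OF F V_zero, of 0] by (simp add: fscale_def zero_fun_def)
  then have "F 0 t = (\<Sum>t'\<in>T. F (\<delta> t') t * 0 t')" by simp
  then show ?case .
next
  case (add m' u)
  have "F (m' + fscale (m u) (\<delta> u)) t = F m' t + m u * F (\<delta> u) t"
    using lin_opD(2)[OF F add(1) V_scale[OF \<delta>_V[OF add(2)]]] lin_opD(3)[OF F \<delta>_V[OF add(2)]]
    by (simp add: fscale_def)
  moreover have "(\<Sum>t'\<in>T. F (\<delta> t') t * (m' + fscale (m u) (\<delta> u)) t')
    = (\<Sum>t'\<in>T. F (\<delta> t') t * m' t') + (\<Sum>t'\<in>T. if t' = u then m u * F (\<delta> u) t else 0)"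
    unfolding sum.distrib[symmetric] by (rule sum.cong) (auto simp: fscale_def \<delta>_def distrib_left)
  ultimately have "F (m' + fscale (m u) (\<delta> u)) t = (\<Sum>t'\<in>T. F (\<delta> t') t * (m' + fscale (m u) (\<delta> u)) t')"
    using add by simp
  then show ?case .
qed

text \<open>The norm element is x y^(q-1), and this vector is dual to the basis element x y^(q-1) of
  the ideal with i = 0, which is A itself. By \<open>free_summand\<close> a nonzero value shows that
  A is a summand of the module.\<close>

lemma norm_\<delta>: "(norm_elt \<odot>\<^bsub>VM\<^esub> \<delta> (KV, 0, q - 1)) (KU, 0, 0) = 1"
proof -
  let ?m = "\<delta> (KV, 0, q - 1)"
  \<comment> \<open>A factor 1 + y lowers the index by at most one, so b factors reach at most b
    steps below q - 1, and the coefficient at the extreme is 1.\<close>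
  have low: "(gY ^^ b) ?m (KV, 0, l) = (if l + b = q - 1 then 1 else 0)" if "l + b \<le> q - 1" for b l
    using that
  proof (induct b arbitrary: l)
    case (Suc b)
    have "Suc l < q" using Suc(2) q_pos by linarith
    then have "(gY ^^ Suc b) ?m (KV, 0, l) = (gY ^^ b) ?m (KV, 0, l) + (gY ^^ b) ?m (KV, 0, Suc l)"
      by (simp add: gY_def colY_simp)
    then show ?case using Suc(1)[of l] Suc(1)[of "Suc l"] Suc(2) by simp
  qed (simp add: \<delta>_def)
  define F where "F b = (gY ^^ nat b) ?m" for b :: int
  have "(norm_elt \<odot>\<^bsub>VM\<^esub> ?m) (KU, 0, 0) = (\<Sum>g\<in>carrier G. act g ?m (KU, 0, 0))"
    unfolding VM_smult by (rule sum.cong) (auto simp: norm_elt_def)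
  also have "\<dots> = (\<Sum>a\<in>{0..<2::int}. \<Sum>b\<in>{0..<int q}. act (a, b) ?m (KU, 0, 0))"
    unfolding G_ops(1) by (simp only: sum.cartesian_product split_def prod.collapse)
  \<comment> \<open>For a = 1 the factor 1 + x adds the \<open>KV\<close> coefficient to the
    \<open>KU\<close> coefficient. The two \<open>KU\<close> sums then cancel in characteristic
    2.\<close>
  also have "\<dots> = (\<Sum>b\<in>{0..<int q}. F b (KU, 0, 0)) + (\<Sum>b\<in>{0..<int q}. F b (KU, 0, 0) + F b (KV, 0, 0))"
  proof -
    have "{0..<2::int} = {0, 1}" by auto
    then show ?thesis by (simp add: act_def F_def gX_def colX_simp)
  qed
  also have "\<dots> = (\<Sum>b\<in>{0..<int q}. F b (KV, 0, 0))"
    unfolding sum.distrib add.assoc[symmetric] two_zero by simp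
  also have "\<dots> = (\<Sum>b\<in>{0..<int q}. if b = int q - 1 then 1 else 0)"
  proof (rule sum.cong[OF refl])
    fix b assume b: "b \<in> {0..<int q}"
    then obtain j where j: "b = int j" "j < q" by (metis atLeastLessThan_iff of_nat_less_iff zero_le_imp_eq_int)
    then have "F b (KV, 0, 0) = (if j = q - 1 then 1 else 0)" using low[of 0 j] by (simp add: F_def)
    moreover have "b = int q - 1 \<longleftrightarrow> j = q - 1" using j by linarith
    ultimately show "F b (KV, 0, 0) = (if b = int q - 1 then 1 else 0)" by simp
  qed
  also have "\<dots> = 1" using q_pos by (subst sum.delta) auto
  finally show ?thesis .
qed

end

section \<open>The dual of D inside the universe, and matrices of its endomorphisms\<close>

locale string_module = klein_cyclic n G A
  for n :: nat and G :: "(int \<times> int) monoid" and A :: "(int \<times> int \<Rightarrow> 'k::field) ring" +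
  fixes enc :: "(idx \<Rightarrow> 'k) \<Rightarrow> 'm"
  assumes enc: "inj_on enc V"
begin

definition MM :: "(int \<times> int \<Rightarrow> 'k, 'm) module" where "MM = transport enc VM"

definition dec :: "'m \<Rightarrow> idx \<Rightarrow> 'k" where "dec = the_inv_into (carrier VM) enc"

abbreviation "E \<equiv> End_ring A MM"

lemma enc': "inj_on enc (carrier VM)" using enc by simp

lemma dec_enc [simp]: "m \<in> V \<Longrightarrow> dec (enc m) = m"
  using the_inv_into_f_f[OF enc'] by (simp add: dec_def)

lemma MM_module: "left_module A MM"
  unfolding MM_def by (rule left_module_transport[OF VM_module enc'])

lemma MM_carrier: "carrier MM = enc ` V"
  by (simp add: MM_def transport_simps(1)[OF enc'])

lemma enc_hom: "enc \<in> module_homs A VM MM"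
  unfolding MM_def by (rule transport_hom[OF enc'])

lemma dec_hom: "dec \<in> module_homs A MM VM"
  unfolding MM_def dec_def by (rule transport_inv_hom[OF VM_module enc'])

definition hat :: "('m \<Rightarrow> 'm) \<Rightarrow> (idx \<Rightarrow> 'k) \<Rightarrow> idx \<Rightarrow> 'k" where "hat e m = dec (e (enc m))"

lemma hat_hom:
  assumes "e \<in> carrier E"
  shows "hat e \<in> module_homs A VM VM"
proof -
  have "e \<in> module_homs A MM MM" using assms by (simp add: End_ring_simps)
  then show ?thesis unfolding hat_def[abs_def] by (intro hom_comp[OF hom_comp[OF enc_hom] dec_hom])
qed

lemma enc_hat: "e \<in> carrier E \<Longrightarrow> m \<in> V \<Longrightarrow> e (enc m) = enc (hat e m)"
proof -
  assume e: "e \<in> carrier E" and m: "m \<in> V"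
  have "e (enc m) \<in> carrier MM"
    by (rule hom_closed[of _ A MM]) (use e m in \<open>auto simp: End_ring_simps MM_carrier\<close>)
  then show ?thesis by (auto simp: MM_carrier hat_def)
qed

definition \<mu> :: "('m \<Rightarrow> 'm) \<Rightarrow> idx \<Rightarrow> idx \<Rightarrow> 'k"
  where "\<mu> e t t' = (if t' \<in> T then hat e (\<delta> t') t else 0)"

lemma hat_\<mu>: "e \<in> carrier E \<Longrightarrow> m \<in> V \<Longrightarrow> hat e m t = (\<Sum>t'\<in>T. \<mu> e t t' * m t')"
  by (subst lin_op_expand[OF VM_homD(1)[OF hat_hom]]) (simp_all add: \<mu>_def)

lemma col_\<delta>:
  assumes "(c, i, l) \<in> T"
  shows "colY (\<delta> (c, i, l)) = (case l of 0 \<Rightarrow> 0 | Suc l' \<Rightarrow> if (c, i, l') \<in> T then \<delta> (c, i, l') else 0)"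
    and "colX (\<delta> (c, i, l)) = (if c = KV \<and> (KU, i, l) \<in> T then \<delta> (KU, i, l) else 0)"
proof -
  show "colY (\<delta> (c, i, l)) = (case l of 0 \<Rightarrow> 0 | Suc l' \<Rightarrow> if (c, i, l') \<in> T then \<delta> (c, i, l') else 0)"
  proof
    fix t :: idx
    obtain d a b where t: "t = (d, a, b)" by (metis prod.exhaust)
    show "colY (\<delta> (c, i, l)) t = (case l of 0 \<Rightarrow> 0 | Suc l' \<Rightarrow> if (c, i, l') \<in> T then \<delta> (c, i, l') else 0) t"
      using assms unfolding t colY_simp by (cases l) (auto simp: \<delta>_def)
  qed
  show "colX (\<delta> (c, i, l)) = (if c = KV \<and> (KU, i, l) \<in> T then \<delta> (KU, i, l) else 0)"
  proof
    fix t :: idx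
    obtain d a b where t: "t = (d, a, b)" by (metis prod.exhaust)
    show "colX (\<delta> (c, i, l)) t = (if c = KV \<and> (KU, i, l) \<in> T then \<delta> (KU, i, l) else 0) t"
      using assms unfolding t colX_simp by (auto simp: \<delta>_def)
  qed
qed

abbreviation "rows \<equiv> {a :: idx \<Rightarrow> idx \<Rightarrow> 'k. (\<forall>t. t \<notin> T \<longrightarrow> a t = 0) \<and> (\<forall>t t'. t' \<notin> T \<longrightarrow> a t t' = 0) \<and>
      (\<forall>t\<in>T. rowY (a t) = a (eta t) \<and> rowX (a t) = a (xi t))}"

text \<open>Entry s of row \<open>eta t\<close> is the value at t of y applied to the image of
  \<open>\<delta> s\<close>. Moving y inside, it is the value at t of the image of \<delta> at the
  predecessor of s, and this is the entry that \<open>rowY\<close> reads off. The argument for x and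
  \<open>xi\<close> is the same.\<close>

lemma \<mu>_rows:
  assumes e: "e \<in> carrier E"
  shows "\<mu> e \<in> rows"
proof -
  note h = hat_hom[OF e]
  note L = VM_homD[OF h]
  have 1: "\<mu> e t t' = 0" if "t' \<notin> T \<or> t \<notin> T" for t t'
    using that lin_opD(1)[OF L(1) \<delta>_V, of t'] by (auto simp: \<mu>_def V_def)
  have h0: "hat e 0 = 0" using hom_zero[OF VM_module VM_module h] by simp
  have Y: "rowY (\<mu> e t) s = \<mu> e (eta t) s" if t: "t \<in> T" for t s
  proof (cases "s \<in> T")
    case True
    obtain c i l where s: "s = (c, i, l)" by (metis prod.exhaust)
    have "\<mu> e (eta t) s = colY (hat e (\<delta> s)) t"
      using True colY_eta[OF lin_opD(1)[OF L(1) \<delta>_V[OF True]] t] by (simp add: \<mu>_def)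
    also have "\<dots> = hat e (colY (\<delta> s)) t" using L(3)[OF \<delta>_V[OF True]] by simp
    also have "\<dots> = rowY (\<mu> e t) s"
    proof (cases l)
      case 0
      then have "colY (\<delta> s) = 0" using col_\<delta>(1)[OF True[unfolded s]] by (simp add: s)
      then show ?thesis by (simp add: s 0 h0)
    next
      case (Suc l')
      have sT: "Suc l' < q" using True s Suc by simp
      show ?thesis
      proof (cases "(c, i, l') \<in> T")
        case in_T: True
        then have "colY (\<delta> s) = \<delta> (c, i, l')" using col_\<delta>(1)[OF True[unfolded s]] by (simp add: s Suc del: T_iff)
        then show ?thesis using in_T sT by (simp add: s Suc \<mu>_def)
      next
        case False
        then have "colY (\<delta> s) = 0" using col_\<delta>(1)[OF True[unfolded s]] by (simp add: s Suc del: T_iff)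
        then show ?thesis using 1[of "(c, i, l')" t] False sT by (simp add: s Suc h0)
      qed
    qed
    finally show ?thesis by simp
  next
    case False
    obtain c i l where s: "s = (c, i, l)" by (metis prod.exhaust)
    have "rowY (\<mu> e t) s = 0"
    proof (cases l)
      case (Suc l')
      then have "(c, i, l') \<notin> T \<or> \<not> Suc l' < q" using False by (auto simp: s)
      then show ?thesis using 1[of "(c, i, l')" t] by (auto simp: s Suc)
    qed (simp add: s)
    then show ?thesis using 1[of s "eta t"] False by simp
  qed
  have X: "rowX (\<mu> e t) s = \<mu> e (xi t) s" if t: "t \<in> T" for t s
  proof (cases "s \<in> T")
    case True
    obtain c i l where s: "s = (c, i, l)" by (metis prod.exhaust)
    have "\<mu> e (xi t) s = colX (hat e (\<delta> s)) t"
      using True colX_xi[OF lin_opD(1)[OF L(1) \<delta>_V[OF True]] t] by (simp add: \<mu>_def)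
    also have "\<dots> = hat e (colX (\<delta> s)) t" using L(2)[OF \<delta>_V[OF True]] by simp
    also have "\<dots> = rowX (\<mu> e t) s"
    proof (cases "c = KV \<and> (KU, i, l) \<in> T")
      case in_T: True
      then have "colX (\<delta> s) = \<delta> (KU, i, l)" using col_\<delta>(2)[OF True[unfolded s]] by (simp add: s del: T_iff)
      then show ?thesis using in_T by (simp add: s \<mu>_def)
    next
      case False
      then have "colX (\<delta> s) = 0" using col_\<delta>(2)[OF True[unfolded s]] unfolding s if_not_P[OF False] by simp
      then show ?thesis using 1[of "(KU, i, l)" t] False by (auto simp: s h0)
    qed
    finally show ?thesis by simp
  next
    case False
    obtain c i l where s: "s = (c, i, l)" by (metis prod.exhaust)
    have "rowX (\<mu> e t) s = 0" using 1[of "(KU, i, l)" t] False by (auto simp: s)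
    then show ?thesis using 1[of s "xi t"] False by simp
  qed
  have "\<mu> e t = 0" if "t \<notin> T" for t using 1 that by (simp add: fun_eq_iff)
  moreover have "rowY (\<mu> e t) = \<mu> e (eta t)" "rowX (\<mu> e t) = \<mu> e (xi t)" if "t \<in> T" for t
    using X[OF that] Y[OF that] by (rule_tac [!] ext) simp_all
  ultimately show ?thesis using 1 by simp
qed

lemma rows_\<mu>:
  assumes a: "a \<in> rows"
  obtains e where "e \<in> carrier E" "\<mu> e = a"
proof
  note a1 = a[simplified]
  define F where "F m = (\<lambda>t. \<Sum>t'\<in>T. a t t' * m t')" for m
  have FV: "F m \<in> V" for m using a1 by (simp add: F_def V_def)
  have "lin_op F"
    unfolding lin_op_def
  proof (intro ballI conjI allI)
    fix m m' :: "idx \<Rightarrow> 'k" and c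
    show "F m \<in> V" by (rule FV)
    show "F (m + m') = F m + F m'" by (simp add: F_def fun_eq_iff distrib_left sum.distrib)
    show "F (fscale c m) = fscale c (F m)" by (simp add: F_def fun_eq_iff fscale_def sum_distrib_left ac_simps)
  qed
  moreover have "F (colY m) = colY (F m)" if m: "m \<in> V" for m
  proof
    fix t
    show "F (colY m) t = colY (F m) t"
    proof (cases "t \<in> T")
      case True
      have "F (colY m) t = (\<Sum>t'\<in>T. a t t' * m (eta t'))"
        unfolding F_def by (rule sum.cong) (simp_all add: colY_eta[OF m])
      also have "\<dots> = (\<Sum>t'\<in>T. rowY (a t) t' * m t')"
        by (rule sum_rowY[symmetric]) (use a1 m in \<open>auto simp: V_def\<close>)
      also have "\<dots> = colY (F m) t" using a1 True by (simp add: colY_eta[OF FV True]) (simp add: F_def)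
      finally show ?thesis .
    next
      case False
      then have "F (colY m) t = 0" "colY (F m) t = 0" using a1 by (simp_all add: F_def) (cases t, simp add: colY_simp del: T_iff)
      then show ?thesis by simp
    qed
  qed
  moreover have "F (colX m) = colX (F m)" if m: "m \<in> V" for m
  proof
    fix t
    show "F (colX m) t = colX (F m) t"
    proof (cases "t \<in> T")
      case True
      have "F (colX m) t = (\<Sum>t'\<in>T. a t t' * m (xi t'))"
        unfolding F_def by (rule sum.cong) (simp_all add: colX_xi[OF m])
      also have "\<dots> = (\<Sum>t'\<in>T. rowX (a t) t' * m t')"
        by (rule sum_rowX[symmetric]) (use a1 m in \<open>auto simp: V_def\<close>)
      also have "\<dots> = colX (F m) t" using a1 True by (simp add: colX_xi[OF FV True]) (simp add: F_def)
      finally show ?thesis .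
    next
      case False
      then have "F (colX m) t = 0" "colX (F m) t = 0" using a1 by (simp_all add: F_def) (cases t, simp add: colX_simp del: T_iff)
      then show ?thesis by simp
    qed
  qed
  ultimately have F: "F \<in> module_homs A VM VM" by (intro VM_homI)
  let ?e = "restrict (\<lambda>u. enc (F (dec u))) (carrier MM)"
  show "?e \<in> carrier E" by (rule End_ringI[OF hom_comp[OF hom_comp[OF dec_hom F] enc_hom] MM_module])
  have "hat ?e m = F m" if "m \<in> V" for m using that FV by (simp add: hat_def MM_carrier)
  then have "\<mu> ?e t t' = a t t'" for t t'
  proof -
    have "F (\<delta> t') t = (\<Sum>s\<in>T. if s = t' then a t t' else 0)"
      unfolding F_def by (rule sum.cong) (auto simp: \<delta>_def)
    then show ?thesis using \<open>\<And>m. m \<in> V \<Longrightarrow> hat ?e m = F m\<close>[OF \<delta>_V] a1 by (simp add: \<mu>_def)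
  qed
  then show "\<mu> ?e = a" by (simp add: fun_eq_iff)
qed

text \<open>An endomorphism of the dual of D is the transpose of an endomorphism of D: the columns
  of the matrix are images in the dual, its rows are images in D.\<close>

sublocale mat: mat_ring q E \<mu>
proof (rule mat_ring.intro[OF strings_axioms End_ring_ring[OF MM_module]], rule mat_ring_axioms.intro)
  have eE: "e \<oplus>\<^bsub>E\<^esub> f \<in> carrier E" "e \<otimes>\<^bsub>E\<^esub> f \<in> carrier E" if "e \<in> carrier E" "f \<in> carrier E" for e f
    using ring.ring_simprules(1,5)[OF End_ring_ring[OF MM_module]] that by blast+
  have cM: "enc m \<in> carrier MM" if "m \<in> V" for m using that by (simp add: MM_carrier)
  show "bij_betw \<mu> (carrier E) rows"
    unfolding bij_betw_def
  proof
    show "inj_on \<mu> (carrier E)"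
    proof (rule inj_onI)
      fix e f assume ef: "e \<in> carrier E" "f \<in> carrier E" "\<mu> e = \<mu> f"
      show "e = f"
      proof (rule End_ring_eqI[OF ef(1,2)])
        fix u assume "u \<in> carrier MM"
        then obtain m where m: "m \<in> V" "u = enc m" by (auto simp: MM_carrier)
        have "hat e m = hat f m"
          by (rule ext) (simp add: hat_\<mu>[OF ef(1) m(1)] hat_\<mu>[OF ef(2) m(1)] ef(3))
        then show "e u = f u" using enc_hat[OF ef(1) m(1)] enc_hat[OF ef(2) m(1)] m(2) by simp
      qed
    qed
    show "\<mu> ` carrier E = rows"
    proof
      show "\<mu> ` carrier E \<subseteq> rows" using \<mu>_rows by blast
      show "rows \<subseteq> \<mu> ` carrier E"
      proof
        fix a assume "a \<in> rows"
        then obtain e where "e \<in> carrier E" "\<mu> e = a" by (rule rows_\<mu>)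
        then show "a \<in> \<mu> ` carrier E" by blast
      qed
    qed
  qed
  fix e f t t' assume e: "e \<in> carrier E" and f: "f \<in> carrier E"
  note hV = lin_opD(1)[OF VM_homD(1)[OF hat_hom]]
  have "hat (e \<oplus>\<^bsub>E\<^esub> f) (\<delta> t') = hat e (\<delta> t') + hat f (\<delta> t')" if t': "t' \<in> T"
  proof -
    have "(e \<oplus>\<^bsub>E\<^esub> f) (enc (\<delta> t')) = enc (hat e (\<delta> t')) \<oplus>\<^bsub>MM\<^esub> enc (hat f (\<delta> t'))"
      using cM[OF \<delta>_V[OF t']] enc_hat[OF e \<delta>_V[OF t']] enc_hat[OF f \<delta>_V[OF t']] by (simp add: End_ring_simps(5))
    also have "\<dots> = enc (hat e (\<delta> t') + hat f (\<delta> t'))"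
      using hom_add[OF enc_hom, of "hat e (\<delta> t')" "hat f (\<delta> t')"] hV[OF e \<delta>_V[OF t']] hV[OF f \<delta>_V[OF t']] by simp
    finally show ?thesis
      using V_add[OF hV[OF e \<delta>_V[OF t']] hV[OF f \<delta>_V[OF t']]] by (simp only: hat_def dec_enc)
  qed
  then show "\<mu> (e \<oplus>\<^bsub>E\<^esub> f) t t' = \<mu> e t t' + \<mu> f t t'" by (simp add: \<mu>_def)
  have "hat (e \<otimes>\<^bsub>E\<^esub> f) (\<delta> t') = hat e (hat f (\<delta> t'))" if t': "t' \<in> T"
    using cM[OF \<delta>_V[OF t']] enc_hat[OF f \<delta>_V[OF t']] by (simp add: hat_def End_ring_simps(2) compose_def)
  then show "\<mu> (e \<otimes>\<^bsub>E\<^esub> f) t t' = (\<Sum>s\<in>T. \<mu> e t s * \<mu> f s t')"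
    using hat_\<mu>[OF e hV[OF f \<delta>_V], of t' t] by (simp add: \<mu>_def[of _ _ t'])
next
  fix t t'
  have "hat \<one>\<^bsub>E\<^esub> (\<delta> t') = \<delta> t'" if t': "t' \<in> T"
    using \<delta>_V[OF t'] by (simp add: hat_def End_ring_simps(3) MM_carrier)
  then show "\<mu> \<one>\<^bsub>E\<^esub> t t' = (if t = t' \<and> t \<in> T then 1 else 0)" by (auto simp: \<mu>_def \<delta>_def)
qed

lemma MM_fin_gen: "fin_gen A MM"
  unfolding fin_gen_def
proof (intro exI conjI allI impI)
  interpret M: left_module A MM by (rule MM_module)
  show "finite ((\<lambda>t. enc (\<delta> t)) ` T)" by simp
  show "(\<lambda>t. enc (\<delta> t)) ` T \<subseteq> carrier MM" using \<delta>_V by (auto simp: MM_carrier)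
  fix H assume "submodule H A MM \<and> (\<lambda>t. enc (\<delta> t)) ` T \<subseteq> H"
  then have H: "submodule H A MM" and t: "\<And>t. t \<in> T \<Longrightarrow> enc (\<delta> t) \<in> H" by auto
  have "enc m \<in> H" if "m \<in> V" for m
    using that
  proof (induct rule: V_induct)
    case zero
    have "enc 0 \<in> H" using hom_zero[OF VM_module MM_module enc_hom] M.submoduleD(2)[OF H] by simp
    then show ?case .
  next
    case (add m' t)
    have 1: "\<one>\<^bsub>G\<^esub> \<in> carrier G" by simp
    have "act \<one>\<^bsub>G\<^esub> (\<delta> t) = \<delta> t" by (simp add: act_def G_ops)
    then have "enc (fscale (m t) (\<delta> t)) = sgl \<one>\<^bsub>G\<^esub> (m t) \<odot>\<^bsub>MM\<^esub> enc (\<delta> t)"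
      using hom_smult[OF enc_hom sgl_closed[OF 1], of "\<delta> t" "m t"] \<delta>_V[OF add(2)] by (simp add: VM_sgl[OF 1])
    then have "enc (fscale (m t) (\<delta> t)) \<in> H"
      using M.submoduleD(4)[OF H sgl_closed[OF 1] t[OF add(2)], of "m t"] by simp
    then have "enc m' \<oplus>\<^bsub>MM\<^esub> enc (fscale (m t) (\<delta> t)) \<in> H" using M.submoduleD(3)[OF H add(3)] by simp
    then have "enc (m' + fscale (m t) (\<delta> t)) \<in> H"
      using hom_add[OF enc_hom, of m' "fscale (m t) (\<delta> t)"] add(1) V_scale[OF \<delta>_V[OF add(2)]] by simp
    then show ?case .
  qed
  then show "H = carrier MM" using M.submoduleD(1)[OF H] by (auto simp: MM_carrier)
qed

text \<open>P is isomorphic to the regular module by \<open>indecomposable_iso_reg\<close>, and by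
  \<open>norm_\<delta>\<close> the regular module is a summand of \<open>MM\<close>.\<close>

lemma MM_summand:
  assumes P: "left_module A P" and ind: "indecomposable A P"
    and z: "z \<in> carrier P" "norm_elt \<odot>\<^bsub>P\<^esub> z \<noteq> \<zero>\<^bsub>P\<^esub>"
  shows "occurs_as_summand A P MM"
proof -
  let ?d = "\<delta> (KV, 0, q - 1)"
  have d: "?d \<in> V" using q_pos by (intro \<delta>_V) simp
  have "norm_elt \<odot>\<^bsub>MM\<^esub> enc ?d \<noteq> \<zero>\<^bsub>MM\<^esub>"
  proof
    assume "norm_elt \<odot>\<^bsub>MM\<^esub> enc ?d = \<zero>\<^bsub>MM\<^esub>"
    then have "dec (norm_elt \<odot>\<^bsub>MM\<^esub> enc ?d) = 0" using hom_zero[OF MM_module VM_module dec_hom] by simp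
    then have "norm_elt \<odot>\<^bsub>VM\<^esub> ?d = 0" using hom_smult[OF dec_hom norm_closed, of "enc ?d"] d by (simp add: MM_carrier)
    then have "(norm_elt \<odot>\<^bsub>VM\<^esub> ?d) (KU, 0, 0) = 0" by simp
    then show False unfolding norm_\<delta> by simp
  qed
  moreover have "enc ?d \<in> carrier MM" using d by (simp add: MM_carrier)
  ultimately obtain U W where "is_direct_sum A MM U W" "module_iso A reg (MM\<lparr>carrier := U\<rparr>)"
    using free_summand[OF MM_module] by blast
  then show ?thesis
    unfolding occurs_as_summand_def using module_iso_trans[OF indecomposable_iso_reg[OF P ind z]] by blast
qed

lemma MM_generator_cogenerator:
  assumes inf: "infinite (UNIV :: 'm set)"
  shows "generator_cogenerator A MM"
  unfolding generator_cogenerator_def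
proof (intro conjI allI impI MM_module MM_fin_gen)
  fix P :: "(int \<times> int \<Rightarrow> 'k, 'm) module"
  assume P: "projective A P \<and> indecomposable A P"
  then have m: "left_module A P" and nz: "carrier P \<noteq> {\<zero>\<^bsub>P\<^esub>}" by (simp_all add: projective_def indecomposable_def)
  obtain z where "z \<in> carrier P" "norm_elt \<odot>\<^bsub>P\<^esub> z \<noteq> \<zero>\<^bsub>P\<^esub>"
    using projective_norm[OF inf conjunct1[OF P] nz] by blast
  then show "occurs_as_summand A P MM" by (rule MM_summand[OF m conjunct2[OF P]])
next
  fix P :: "(int \<times> int \<Rightarrow> 'k, 'm) module"
  assume P: "injective A P \<and> indecomposable A P"
  then have m: "left_module A P" and nz: "carrier P \<noteq> {\<zero>\<^bsub>P\<^esub>}" by (simp_all add: injective_def indecomposable_def)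
  obtain z where "z \<in> carrier P" "norm_elt \<odot>\<^bsub>P\<^esub> z \<noteq> \<zero>\<^bsub>P\<^esub>"
    using injective_norm[OF inf conjunct1[OF P] nz] by blast
  then show "occurs_as_summand A P MM" by (rule MM_summand[OF m conjunct2[OF P]])
qed

end

lemma ex_inj_idx: "\<exists>f :: idx \<Rightarrow> nat. inj f"
proof -
  have "inj (\<lambda>(c, i, j). prod_encode ((case c of KR \<Rightarrow> 0 | KU \<Rightarrow> 1 | KV \<Rightarrow> 2), prod_encode (i, j)))"
    by (rule injI) (auto split: knd.splits)
  then show ?thesis by blast
qed

theorem corollary1p2:
  fixes \<iota> :: "nat \<times> 'k::field \<Rightarrow> 'm"
    and n :: nat
  assumes "inj \<iota>"
    and "CHAR('k) = 2"
    and "n \<ge> 1"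
  shows "repdim TYPE('m)
    (group_algebra (integer_mod_group 2 \<times>\<times> integer_mod_group (2 ^ n)) :: (int \<times> int \<Rightarrow> 'k) ring) = 3"
proof -
  define G where "G = integer_mod_group 2 \<times>\<times> integer_mod_group (2 ^ n)"
  define A where "A = (group_algebra G :: (int \<times> int \<Rightarrow> 'k) ring)"
  interpret klein_cyclic n G A by unfold_locales (use assms(2,3) in \<open>simp_all add: G_def A_def\<close>)
  have "inj (\<lambda>i. \<iota> (i, 0))" by (rule injI) (simp add: inj_eq[OF assms(1)])
  then have inf: "infinite (UNIV :: 'm set)" by (rule infinite_super[OF subset_UNIV range_inj_infinite])
  have \<iota>: "inj (\<lambda>x. \<iota> (0, x))" by (rule injI) (simp add: inj_eq[OF assms(1)])
  obtain pr :: "'m \<times> 'm \<Rightarrow> 'm" where pr: "inj pr" using ex_inj_prod[OF inf] by blast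
  obtain i :: "idx \<Rightarrow> nat" where i: "inj i" using ex_inj_idx by blast
  have "inj (\<lambda>(t, x). \<iota> (i t, x))"
    by (rule injI) (auto simp: inj_eq[OF assms(1)] inj_eq[OF i])
  then obtain enc :: "(idx \<Rightarrow> 'k) \<Rightarrow> 'm" where "inj_on enc {f. finite {i. f i \<noteq> 0}}"
    using ex_inj_fin_supp[OF inf, of "\<lambda>(t, x). \<iota> (i t, x)" 0] by blast
  moreover have "V \<subseteq> {f. finite {i. f i \<noteq> 0}}"
  proof
    fix m assume "m \<in> V"
    then have "{i. m i \<noteq> 0} \<subseteq> T" by (auto simp: V_def)
    then show "m \<in> {f. finite {i. f i \<noteq> 0}}" using finite_subset[OF _ finite_T] by simp
  qed
  ultimately have "inj_on enc V" by (rule inj_on_subset)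
  then interpret string_module n G A enc by unfold_locales
  have c: "inj (\<lambda>((t, m, s), x). pr (pr (\<iota> (i t, 0), m), pr (\<iota> (i s, 0), \<iota> (0, x))))"
    by (rule injI) (auto simp: inj_eq[OF assms(1)] inj_eq[OF i] inj_eq[OF pr])
  let ?S = "{gl_dim TYPE('m) (End_ring A M) | M :: (int \<times> int \<Rightarrow> 'k, 'm) module. generator_cogenerator A M}"
  have "gl_dim TYPE('m) (End_ring A MM) \<in> ?S" using MM_generator_cogenerator[OF inf] by blast
  then have "Inf ?S \<le> gl_dim TYPE('m) (End_ring A MM)" by (rule Inf_lower)
  also have "\<dots> \<le> 3" by (rule mat.gl_dim_le_3[OF inf c])
  finally have "Inf ?S \<le> 3" .
  moreover have "3 \<le> Inf ?S"
  proof (rule Inf_greatest)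
    fix d assume "d \<in> ?S"
    then obtain M :: "(int \<times> int \<Rightarrow> 'k, 'm) module"
      where d: "d = gl_dim TYPE('m) (End_ring A M)" and M: "generator_cogenerator A M" by blast
    have "2 < d" using gl_dim_End_generator_cogenerator[OF inf \<iota> M] unfolding d by (simp only: not_le)
    then show "3 \<le> d" using ileI1[of 2 d] by (simp add: eSuc_numeral)
  qed
  ultimately show ?thesis unfolding repdim_def G_def[symmetric] A_def[symmetric] by (rule antisym)
qed

end
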